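(* Let $\mathbb{k}$ be an algebraically closed field of characteristic zero. If $A=\mathbb{k}[x_1][x_2;\delta_2]\cdots[x_n;\delta_n]$ is an iterated Ore extension of derivation type over $\mathbb{k}$, then $A$ is congenial (with respect to the filtration $\mathcal F$ described in the context).
   Context: For an algebra $R$ and a derivation $\delta$ of $R$ (so $\delta(rs)=r\delta(s)+\delta(r)s$ for all $r,s\in R$), $R[x;\delta]$ is the overring of $R$ generated by $R$ and $x$ with the rule $xr=rx+\delta(r)$ for $r\in R$; it is called a differential operator ring over $R$ (an Ore extension of derivation type). Here each $\delta_k$ is a derivation of $\mathbb{k}[x_1][x_2;\delta_2]\cdots[x_{k-1};\delta_{k-1}]$. The filtration $\mathcal F$ on $A$ is defined by setting $\deg(x_1)=1$ and $\deg(x_k)=\max\{\deg(\delta_k(x_j)):j<k\}$ for $k>1$. An $\mathbb{N}$-filtration $\mathcal{F}$ on an algebra $A$ over a commutative ring $R$ is an increasing chain of $R$-submodules $F_0\subseteq F_1\subseteq\cdots$ with $1\in F_0$, $F_iF_j\subseteq F_{i+j}$, $\bigcup F_i=A$; it is locally finite if each $F_i$ is a finitely generated $R$-module (likewise for graded algebras). $\mathrm{gr}_{\mathcal F}A=\bigoplus_i F_i/F_{i-1}$. An $R$-algebra $A$ is strongly noetherian if $A\otimes_RC$ is noetherian for every commutative noetherian $R$-algebra $C$. Let $D$ be a $\mathbb{Z}$-affine (finitely generated) subring of $\mathbb{k}$. A $D$-subalgebra $A_D$ of a $\mathbb{k}$-algebra $A$ is an order of $A$ if $A_D$ is free over $D$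 and $A_D\otimes_D\mathbb{k}=A$. A $\mathbb{k}$-algebra $A$ is congenial (with respect to $\mathcal F$) if: (1) $A$ is a locally finite filtered algebra with an $\mathbb{N}$-filtration $\mathcal F$; (2) $A$ has an order $A_D$, where $D$ is a $\mathbb{Z}$-affine subalgebra of $\mathbb{k}$, such that $A_D$ is a locally finite filtered algebra over $D$ with the induced filtration, still denoted $\mathcal F$; (3) $\mathrm{gr}_{\mathcal F}A_D$ is an order of $\mathrm{gr}_{\mathcal F}A$; (4) $\mathrm{gr}_{\mathcal F}A_D$ is a strongly noetherian locally finite graded algebra over $D$; (5) if $F$ is a factor ring of $D$ and is a finite field, then $A_D\otimes_DF$ is an affine noetherian PI algebra over $F$.
   Formalization: Each deg(x_k) is taken to be at least 1; otherwise the Weyl algebra has deg(x_2)=0 and F_0 is infinite-dimensional. Test algebras C for strong noetherianity live in one arbitrary type fixed before D and A_D; a countable elementary subring of C recovers all C. *)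

theory Defs
  imports "HOL-Algebra.Algebra"
begin

text \<open>The library locale \<^locale>\<open>algebra\<close> requires a commutative algebra; this is the same notion
  without commutativity.\<close>

locale noncomm_algebra = module + ring M +
  assumes smult_mult_left:
      "\<lbrakk> a \<in> carrier R; x \<in> carrier M; y \<in> carrier M \<rbrakk> \<Longrightarrow>
      (a \<odot>\<^bsub>M\<^esub> x) \<otimes>\<^bsub>M\<^esub> y = a \<odot>\<^bsub>M\<^esub> (x \<otimes>\<^bsub>M\<^esub> y)"
    and smult_mult_right:
      "\<lbrakk> a \<in> carrier R; x \<in> carrier M; y \<in> carrier M \<rbrakk> \<Longrightarrow>
      x \<otimes>\<^bsub>M\<^esub> (a \<odot>\<^bsub>M\<^esub> y) = a \<odot>\<^bsub>M\<^esub> (x \<otimes>\<^bsub>M\<^esub> y)"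

definition unital_subalgebra ::
    "('r, 'm) ring_scheme \<Rightarrow> 'a set \<Rightarrow> ('r, 'a, 'n) module_scheme \<Rightarrow> bool" where
  "unital_subalgebra R B A \<longleftrightarrow>
     subring B A \<and> (\<forall>r\<in>carrier R. \<forall>b\<in>B. r \<odot>\<^bsub>A\<^esub> b \<in> B)"

definition adjoin ::
    "('r, 'm) ring_scheme \<Rightarrow> ('r, 'a, 'n) module_scheme \<Rightarrow> 'a set \<Rightarrow> 'a set" where
  "adjoin R A S = (\<lambda>B. unital_subalgebra R B A) hull S"

definition affine_algebra ::
    "('r, 'm) ring_scheme \<Rightarrow> ('r, 'a, 'n) module_scheme \<Rightarrow> bool" where
  "affine_algebra R A \<longleftrightarrow>
     noncomm_algebra R A \<and> (\<exists>S. finite S \<and> S \<subseteq> carrier A \<and> adjoin R A S = carrier A)"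

definition int_affine_subring :: "'r set \<Rightarrow> ('r, 'm) ring_scheme \<Rightarrow> bool" where
  "int_affine_subring D K \<longleftrightarrow>
     subring D K \<and> (\<exists>S. finite S \<and> S \<subseteq> carrier K \<and> generate_ring K S = D)"

definition fin_gen_submodule ::
    "'a set \<Rightarrow> ('r, 'm) ring_scheme \<Rightarrow> ('r, 'a, 'n) module_scheme \<Rightarrow> bool" where
  "fin_gen_submodule N R M \<longleftrightarrow>
     submodule N R M \<and> (\<exists>S. finite S \<and> S \<subseteq> N \<and> (\<lambda>L. submodule L R M) hull S = N)"

text \<open>Neither \<open>R\<close> need be commutative here nor \<open>M\<close> satisfy \<^locale>\<open>module\<close>: the notion is also used
  for left modules over noncommutative rings.\<close>

definition module_basis ::
    "('r, 'm) ring_scheme \<Rightarrow> ('r, 'a, 'n) module_scheme \<Rightarrow> ('i \<Rightarrow> 'a) \<Rightarrow> 'i set \<Rightarrow> bool" where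
  "module_basis R M b I \<longleftrightarrow> b \<in> I \<rightarrow> carrier M \<and>
     (\<forall>v\<in>carrier M. \<exists>!c. range c \<subseteq> carrier R \<and> (\<forall>i. i \<notin> I \<longrightarrow> c i = \<zero>\<^bsub>R\<^esub>) \<and>
        finite {i. c i \<noteq> \<zero>\<^bsub>R\<^esub>} \<and> v = (\<Oplus>\<^bsub>M\<^esub>i\<in>{i. c i \<noteq> \<zero>\<^bsub>R\<^esub>}. c i \<odot>\<^bsub>M\<^esub> b i))"

definition free_module ::
    "('r, 'm) ring_scheme \<Rightarrow> ('r, 'a, 'n) module_scheme \<Rightarrow> bool" where
  "free_module R M \<longleftrightarrow> module R M \<and> (\<exists>B. module_basis R M (\<lambda>v. v) B)"

text \<open>The library locale \<^locale>\<open>noetherian_ring\<close> speaks about two-sided ideals, which is the right notion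
  only for commutative rings.\<close>

definition left_ideal :: "'a set \<Rightarrow> ('a, 'm) ring_scheme \<Rightarrow> bool" where
  "left_ideal I R \<longleftrightarrow>
     subgroup I (add_monoid R) \<and> (\<forall>r\<in>carrier R. \<forall>a\<in>I. r \<otimes>\<^bsub>R\<^esub> a \<in> I)"

definition right_ideal :: "'a set \<Rightarrow> ('a, 'm) ring_scheme \<Rightarrow> bool" where
  "right_ideal I R \<longleftrightarrow>
     subgroup I (add_monoid R) \<and> (\<forall>r\<in>carrier R. \<forall>a\<in>I. a \<otimes>\<^bsub>R\<^esub> r \<in> I)"

definition noetherian :: "('a, 'm) ring_scheme \<Rightarrow> bool" where
  "noetherian R \<longleftrightarrow> ring R \<and>
     (\<forall>I. left_ideal I R \<longrightarrow>
        (\<exists>S. finite S \<and> S \<subseteq> I \<and> (\<lambda>J. left_ideal J R) hull S = I)) \<and>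
     (\<forall>I. right_ideal I R \<longrightarrow>
        (\<exists>S. finite S \<and> S \<subseteq> I \<and> (\<lambda>J. right_ideal J R) hull S = I))"

definition word_eval :: "('a, 'm) ring_scheme \<Rightarrow> (nat \<Rightarrow> 'a) \<Rightarrow> nat list \<Rightarrow> 'a" where
  "word_eval A x w = foldr (\<lambda>i a. x i \<otimes>\<^bsub>A\<^esub> a) w \<one>\<^bsub>A\<^esub>"

text \<open>\<open>f\<close> is the coefficient function of a nonzero element of the free algebra over \<open>F\<close> on countably
  many variables, whose monomials are the words in \<^typ>\<open>nat list\<close>. Intended for a field \<open>F\<close>; over a
  general base ring one asks for a coefficient \<open>1\<close>.\<close>

definition PI_algebra ::
    "('r, 'm) ring_scheme \<Rightarrow> ('r, 'a, 'n) module_scheme \<Rightarrow> bool" where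
  "PI_algebra F A \<longleftrightarrow>
     (\<exists>f :: nat list \<Rightarrow> 'r. range f \<subseteq> carrier F \<and>
        finite {w. f w \<noteq> \<zero>\<^bsub>F\<^esub>} \<and> {w. f w \<noteq> \<zero>\<^bsub>F\<^esub>} \<noteq> {} \<and>
        (\<forall>a. range a \<subseteq> carrier A \<longrightarrow>
          (\<Oplus>\<^bsub>A\<^esub>w\<in>{w. f w \<noteq> \<zero>\<^bsub>F\<^esub>}. f w \<odot>\<^bsub>A\<^esub> word_eval A a w) = \<zero>\<^bsub>A\<^esub>))"

text \<open>The integral monoid ring of the multiplicative monoid \<open>B \<times> C\<close>.\<close>

definition pair_ring ::
    "('b, 'm) ring_scheme \<Rightarrow> ('c, 'n) ring_scheme \<Rightarrow> ('b \<times> 'c \<Rightarrow>\<^sub>0 int) ring" where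
  "pair_ring B C =
     \<lparr> carrier = {f. Poly_Mapping.keys f \<subseteq> carrier B \<times> carrier C},
       monoid.mult = (\<lambda>f g. frag_extend (\<lambda>p. frag_extend
                 (\<lambda>q. frag_of (fst p \<otimes>\<^bsub>B\<^esub> fst q, snd p \<otimes>\<^bsub>C\<^esub> snd q)) g) f),
       one = frag_of (\<one>\<^bsub>B\<^esub>, \<one>\<^bsub>C\<^esub>),
       ring.zero = 0,
       ring.add = (+) \<rparr>"

text \<open>The additive group of \<^const>\<open>pair_ring\<close> is free abelian on \<open>B \<times> C\<close>. The subgroup generated by the
  bilinearity and balancing relations below is stable under multiplication by pairs, hence it equals
  the ideal generated by them, and the quotient is the usual tensor product over \<open>D\<close>.\<close>

definition tensor_ideal ::
    "('r, 'l) ring_scheme \<Rightarrow> ('r, 'b, 'm) module_scheme \<Rightarrow> ('r, 'c, 'n) module_scheme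
      \<Rightarrow> ('b \<times> 'c \<Rightarrow>\<^sub>0 int) set" where
  "tensor_ideal D B C = Idl\<^bsub>pair_ring B C\<^esub>
     ({frag_of (b \<oplus>\<^bsub>B\<^esub> b', c) - frag_of (b, c) - frag_of (b', c) | b b' c.
         b \<in> carrier B \<and> b' \<in> carrier B \<and> c \<in> carrier C} \<union>
      {frag_of (b, c \<oplus>\<^bsub>C\<^esub> c') - frag_of (b, c) - frag_of (b, c') | b c c'.
         b \<in> carrier B \<and> c \<in> carrier C \<and> c' \<in> carrier C} \<union>
      {frag_of (d \<odot>\<^bsub>B\<^esub> b, c) - frag_of (b, d \<odot>\<^bsub>C\<^esub> c) | d b c.
         d \<in> carrier D \<and> b \<in> carrier B \<and> c \<in> carrier C})"

definition pure_tensor ::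
    "('r, 'l) ring_scheme \<Rightarrow> ('r, 'b, 'm) module_scheme \<Rightarrow> ('r, 'c, 'n) module_scheme
      \<Rightarrow> 'b \<Rightarrow> 'c \<Rightarrow> ('b \<times> 'c \<Rightarrow>\<^sub>0 int) set" where
  "pure_tensor D B C b c = tensor_ideal D B C +>\<^bsub>pair_ring B C\<^esub> frag_of (b, c)"

text \<open>\<open>B \<otimes>\<^sub>D C\<close> as an algebra over its second factor.\<close>

definition base_change ::
    "('r, 'l) ring_scheme \<Rightarrow> ('r, 'b, 'm) module_scheme \<Rightarrow> ('r, 'c, 'n) module_scheme
      \<Rightarrow> ('c, ('b \<times> 'c \<Rightarrow>\<^sub>0 int) set) module" where
  "base_change D B C =
     (let T = pair_ring B C Quot tensor_ideal D B C in
      \<lparr> carrier = carrier T, monoid.mult = monoid.mult T, one = one T, ring.zero = ring.zero T, ring.add = ring.add T,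
        smult = (\<lambda>c t. pure_tensor D B C \<one>\<^bsub>B\<^esub> c \<otimes>\<^bsub>T\<^esub> t) \<rparr>)"

text \<open>The ring \<open>S\<close> with scalars acting by left multiplication through \<open>\<phi>\<close>.\<close>

definition scalars_via :: "('r \<Rightarrow> 's) \<Rightarrow> ('s, 'm) ring_scheme \<Rightarrow> ('r, 's) module" where
  "scalars_via \<phi> S =
     \<lparr> carrier = carrier S, monoid.mult = monoid.mult S, one = one S, ring.zero = ring.zero S, ring.add = ring.add S,
       smult = (\<lambda>r s. \<phi> r \<otimes>\<^bsub>S\<^esub> s) \<rparr>"

text \<open>HOL cannot quantify over types inside a definition, so the type \<open>'c\<close> hosting the carriers of the
  test algebras is an explicit parameter, playing the role of a universe; theorems keep it arbitrary.\<close>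

definition strongly_noetherian ::
    "'c itself \<Rightarrow> ('r, 'm) ring_scheme \<Rightarrow> ('r, 'a, 'n) module_scheme \<Rightarrow> bool" where
  "strongly_noetherian _ R A \<longleftrightarrow>
     (\<forall>C :: ('r, 'c) module. algebra R C \<and> noetherian_ring C \<longrightarrow> noetherian (base_change R A C))"

definition nat_filtration ::
    "('r, 'm) ring_scheme \<Rightarrow> ('r, 'a, 'n) module_scheme \<Rightarrow> (nat \<Rightarrow> 'a set) \<Rightarrow> bool" where
  "nat_filtration R A F \<longleftrightarrow>
     (\<forall>i. submodule (F i) R A) \<and> (\<forall>i. F i \<subseteq> F (Suc i)) \<and> \<one>\<^bsub>A\<^esub> \<in> F 0 \<and>
     (\<forall>i j. \<forall>a\<in>F i. \<forall>b\<in>F j. a \<otimes>\<^bsub>A\<^esub> b \<in> F (i + j)) \<and> (\<Union>i. F i) = carrier A"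

definition loc_finite_filtered ::
    "('r, 'm) ring_scheme \<Rightarrow> ('r, 'a, 'n) module_scheme \<Rightarrow> (nat \<Rightarrow> 'a set) \<Rightarrow> bool" where
  "loc_finite_filtered R A F \<longleftrightarrow>
     noncomm_algebra R A \<and> nat_filtration R A F \<and> (\<forall>i. fin_gen_submodule (F i) R A)"

text \<open>\<open>F\<^bsub>i-1\<^esub>\<close>, with \<open>F\<^bsub>-1\<^esub> = 0\<close>.\<close>

definition filt_pred :: "('a, 'm) ring_scheme \<Rightarrow> (nat \<Rightarrow> 'a set) \<Rightarrow> nat \<Rightarrow> 'a set" where
  "filt_pred A F i = (case i of 0 \<Rightarrow> {\<zero>\<^bsub>A\<^esub>} | Suc j \<Rightarrow> F j)"

text \<open>An element of \<open>\<Oplus>\<^sub>i F\<^sub>i / F\<^bsub>i-1\<^esub>\<close> is the finitely supported family of its components, which are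
  cosets. As for \<^const>\<open>rcoset_mult\<close>, operations are carried out on all representatives at once.\<close>

definition assoc_graded ::
    "('r, 'a, 'n) module_scheme \<Rightarrow> (nat \<Rightarrow> 'a set) \<Rightarrow> ('r, nat \<Rightarrow> 'a set) module" where
  "assoc_graded A F =
     \<lparr> carrier = {f. (\<forall>i. f i \<in> (\<lambda>a. filt_pred A F i +>\<^bsub>A\<^esub> a) ` F i) \<and>
                     finite {i. f i \<noteq> filt_pred A F i}},
       monoid.mult = (\<lambda>f g n. \<Union>a\<in>{a. \<forall>i. a i \<in> f i}. \<Union>b\<in>{b. \<forall>i. b i \<in> g i}.
                 filt_pred A F n +>\<^bsub>A\<^esub> (\<Oplus>\<^bsub>A\<^esub>i\<in>{..n}. a i \<otimes>\<^bsub>A\<^esub> b (n - i))),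
       one = (\<lambda>i. if i = 0 then filt_pred A F 0 +>\<^bsub>A\<^esub> \<one>\<^bsub>A\<^esub> else filt_pred A F i),
       ring.zero = filt_pred A F,
       ring.add = (\<lambda>f g i. f i <+>\<^bsub>A\<^esub> g i),
       smult = (\<lambda>r f i. \<Union>a\<in>f i. filt_pred A F i +>\<^bsub>A\<^esub> (r \<odot>\<^bsub>A\<^esub> a)) \<rparr>"

definition graded_component :: "('r, nat \<Rightarrow> 'a set) module \<Rightarrow> nat \<Rightarrow> (nat \<Rightarrow> 'a set) set" where
  "graded_component G i = {f \<in> carrier G. \<forall>j. j \<noteq> i \<longrightarrow> f j = \<zero>\<^bsub>G\<^esub> j}"

text \<open>The natural map from the associated graded of a subring with the induced filtration to that of
  \<open>A\<close>; it sends each coset to the larger coset containing it, and it is injective.\<close>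

definition graded_incl ::
    "('a, 'm) ring_scheme \<Rightarrow> (nat \<Rightarrow> 'a set) \<Rightarrow> (nat \<Rightarrow> 'a set) \<Rightarrow> nat \<Rightarrow> 'a set" where
  "graded_incl A F f = (\<lambda>i. \<Union>a\<in>f i. filt_pred A F i +>\<^bsub>A\<^esub> a)"

text \<open>\<open>A\<^sub>D \<otimes>\<^sub>D K = A\<close> means that the natural map \<open>b \<otimes> c \<mapsto> c b\<close> is an isomorphism.\<close>

definition is_order ::
    "('k, 'm) ring_scheme \<Rightarrow> ('k, 'a, 'n) module_scheme \<Rightarrow> 'k set \<Rightarrow> 'a set \<Rightarrow> bool" where
  "is_order K A D AD \<longleftrightarrow>
     (let R = K\<lparr>carrier := D\<rparr>; B = A\<lparr>carrier := AD\<rparr>; C = scalars_via (\<lambda>d. d) K in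
      subring D K \<and> unital_subalgebra R AD A \<and> free_module R B \<and>
      (\<exists>h. h \<in> ring_iso (base_change R B C) A \<and>
         (\<forall>b\<in>AD. \<forall>c\<in>carrier K. h (pure_tensor R B C b c) = c \<odot>\<^bsub>A\<^esub> b)))"

definition congenial ::
    "'c itself \<Rightarrow> ('k, 'm) ring_scheme \<Rightarrow> ('k, 'a, 'n) module_scheme \<Rightarrow> (nat \<Rightarrow> 'a set) \<Rightarrow> bool" where
  "congenial U K A F \<longleftrightarrow>
     loc_finite_filtered K A F \<and>
     (\<exists>D AD.
        let R = K\<lparr>carrier := D\<rparr>; B = A\<lparr>carrier := AD\<rparr>; FD = (\<lambda>i. F i \<inter> AD);
            G = assoc_graded B FD
        in int_affine_subring D K \<and>
           is_order K A D AD \<and>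
           loc_finite_filtered R B FD \<and>
           is_order K (assoc_graded A F) D (graded_incl A F ` carrier G) \<and>
           strongly_noetherian U R G \<and>
           (\<forall>i. fin_gen_submodule (graded_component G i) R G) \<and>
           (\<forall>I. ideal I R \<and> field (R Quot I) \<and> finite (carrier (R Quot I)) \<longrightarrow>
              (let Q = R Quot I; T = base_change R B (scalars_via (\<lambda>d. I +>\<^bsub>R\<^esub> d) Q)
               in affine_algebra Q T \<and> noetherian T \<and> PI_algebra Q T)))"

definition derivation ::
    "('k, 'm) ring_scheme \<Rightarrow> ('k, 'a, 'n) module_scheme \<Rightarrow> ('a \<Rightarrow> 'a) \<Rightarrow> bool" where
  "derivation K A \<delta> \<longleftrightarrow> \<delta> \<in> carrier A \<rightarrow> carrier A \<and>
     (\<forall>r\<in>carrier A. \<forall>s\<in>carrier A. \<delta> (r \<oplus>\<^bsub>A\<^esub> s) = \<delta> r \<oplus>\<^bsub>A\<^esub> \<delta> s) \<and>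
     (\<forall>c\<in>carrier K. \<forall>r\<in>carrier A. \<delta> (c \<odot>\<^bsub>A\<^esub> r) = c \<odot>\<^bsub>A\<^esub> \<delta> r) \<and>
     (\<forall>r\<in>carrier A. \<forall>s\<in>carrier A. \<delta> (r \<otimes>\<^bsub>A\<^esub> s) = r \<otimes>\<^bsub>A\<^esub> \<delta> s \<oplus>\<^bsub>A\<^esub> \<delta> r \<otimes>\<^bsub>A\<^esub> s)"

text \<open>\<open>S = R[x;\<delta>]\<close> for subalgebras \<open>R \<subseteq> S\<close> of \<open>A\<close>: that the rule \<open>x r = r x + \<delta>(r)\<close> is the only
  relation means that \<open>S\<close> is a free left \<open>R\<close>-module on the powers of \<open>x\<close>.\<close>

definition ore_extension ::
    "('k, 'm) ring_scheme \<Rightarrow> ('k, 'a, 'n) module_scheme \<Rightarrow> 'a set \<Rightarrow> 'a set \<Rightarrow> 'a \<Rightarrow> ('a \<Rightarrow> 'a)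
      \<Rightarrow> bool" where
  "ore_extension K A R S x \<delta> \<longleftrightarrow>
     unital_subalgebra K R A \<and> unital_subalgebra K S A \<and> R \<subseteq> S \<and> x \<in> S \<and>
     derivation K (A\<lparr>carrier := R\<rparr>) \<delta> \<and>
     (\<forall>r\<in>R. x \<otimes>\<^bsub>A\<^esub> r = r \<otimes>\<^bsub>A\<^esub> x \<oplus>\<^bsub>A\<^esub> \<delta> r) \<and>
     module_basis (A\<lparr>carrier := R\<rparr>) (scalars_via (\<lambda>r. r) (A\<lparr>carrier := S\<rparr>))
       (\<lambda>i::nat. x [^]\<^bsub>A\<^esub> i) UNIV"

text \<open>\<open>A = K[x\<^sub>1][x\<^sub>2;\<delta>\<^sub>2]\<dots>[x\<^sub>n;\<delta>\<^sub>n]\<close>, the base field being identified with the multiples of \<open>1\<close>. The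
  \<open>K\<close>-linear derivation \<open>\<delta>\<^sub>1\<close> of \<open>K\<close> is necessarily \<open>0\<close>, so the first step is the polynomial ring
  \<open>K[x\<^sub>1]\<close>.\<close>

definition iterated_ore ::
    "('k, 'm) ring_scheme \<Rightarrow> ('k, 'a, 'n) module_scheme \<Rightarrow> nat \<Rightarrow> (nat \<Rightarrow> 'a) \<Rightarrow> (nat \<Rightarrow> 'a \<Rightarrow> 'a)
      \<Rightarrow> bool" where
  "iterated_ore K A n x \<delta> \<longleftrightarrow>
     noncomm_algebra K A \<and> inj_on (\<lambda>c. c \<odot>\<^bsub>A\<^esub> \<one>\<^bsub>A\<^esub>) (carrier K) \<and>
     (\<forall>k\<in>{1..n}. ore_extension K A (adjoin K A (x ` {1..<k})) (adjoin K A (x ` {1..k})) (x k) (\<delta> k)) \<and>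
     adjoin K A (x ` {1..n}) = carrier A"

text \<open>The filtration determined by giving each generator \<open>x\<^sub>j\<close>, \<open>j \<in> J\<close>, the degree \<open>d j\<close>: its \<open>i\<close>-th
  term is spanned by the monomials in these generators of total degree at most \<open>i\<close>.\<close>

definition word_filtration ::
    "('k, 'm) ring_scheme \<Rightarrow> ('k, 'a, 'n) module_scheme \<Rightarrow> (nat \<Rightarrow> 'a) \<Rightarrow> (nat \<Rightarrow> nat) \<Rightarrow> nat set
      \<Rightarrow> nat \<Rightarrow> 'a set" where
  "word_filtration K A x d J i =
     (\<lambda>N. submodule N K A) hull
       {word_eval A x w | w. set w \<subseteq> J \<and> sum_list (map d w) \<le> i}"

definition filtration_degree :: "(nat \<Rightarrow> 'a set) \<Rightarrow> 'a \<Rightarrow> nat" where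
  "filtration_degree F r = (LEAST i. r \<in> F i)"

text \<open>Degrees of the generators: \<open>deg x\<^sub>k\<close> is the largest of the \<open>deg (\<delta>\<^sub>k x\<^sub>j)\<close> with \<open>j < k\<close>, computed in
  the filtration already defined on \<open>K[x\<^sub>1]\<dots>[x\<^bsub>k-1\<^esub>;\<delta>\<^bsub>k-1\<^esub>]\<close>, but at least \<open>1\<close>. The lower bound only
  matters if every \<open>\<delta>\<^sub>k x\<^sub>j\<close> is a scalar, as for the Weyl algebra; without it, \<open>F\<^sub>0\<close> would then contain
  all powers of \<open>x\<^sub>k\<close> and not be finite-dimensional. It also gives \<open>deg x\<^sub>1 = 1\<close>.\<close>

primrec ore_degrees ::
    "('k, 'm) ring_scheme \<Rightarrow> ('k, 'a, 'n) module_scheme \<Rightarrow> (nat \<Rightarrow> 'a) \<Rightarrow> (nat \<Rightarrow> 'a \<Rightarrow> 'a)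
      \<Rightarrow> nat \<Rightarrow> nat \<Rightarrow> nat" where
  "ore_degrees K A x \<delta> 0 = (\<lambda>_. 0)"
| "ore_degrees K A x \<delta> (Suc m) = (ore_degrees K A x \<delta> m)(Suc m :=
     Max (insert 1 ((\<lambda>j. filtration_degree
       (word_filtration K A x (ore_degrees K A x \<delta> m) {1..m}) (\<delta> (Suc m) (x j))) ` {1..m})))"

definition ore_filtration ::
    "('k, 'm) ring_scheme \<Rightarrow> ('k, 'a, 'n) module_scheme \<Rightarrow> nat \<Rightarrow> (nat \<Rightarrow> 'a) \<Rightarrow> (nat \<Rightarrow> 'a \<Rightarrow> 'a)
      \<Rightarrow> nat \<Rightarrow> 'a set" where
  "ore_filtration K A n x \<delta> = word_filtration K A x (ore_degrees K A x \<delta> n) {1..n}"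

end

theory Submission
  imports Defs "HOL-Combinatorics.Permutations"
begin

text \<open>Commuting a generator past an earlier one produces only earlier generators of no larger total
  degree, so the ordered monomials form a basis adapted to the filtration, and the symbols of the
  generators commute. The finitely many coefficients of these commutation relations generate \<open>D\<close>;
  over \<open>D\<close> the ordered monomials span the order \<open>A\<^sub>D\<close>, and their symbols span an order of the
  associated graded ring. Base changes of the latter are generated by finitely many commuting elements
  over a commutative noetherian ring, hence noetherian by Hilbert's basis theorem.

  Over a field of characteristic \<open>p\<close> one has \<open>ad (y\<^sup>p) = (ad y)\<^sup>p\<close>. If the subring generated by the
  first \<open>k\<close> generators is finite over its centre, noetherianity bounds the orbit of the next
  derivation, and suitable combinations of the iterated \<open>p\<close>-th powers of the next generator become
  central. By induction the fibre is finite over a noetherian central subring, so it is noetherian and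
  satisfies a standard identity.\<close>

section \<open>Spans and noetherian modules\<close>

text \<open>The symbols commute because of a strict inequality: the commutator of x_k and x_j has
  degree at most d_k, and d_j >= 1, so it lies strictly below the degree d_k + d_j of the product.
  The same lower bound leaves only finitely many monomials below any degree. Both orders, that of
  the algebra and that of its graded ring, come from one criterion: if the D-span of a K-basis is a
  subring, it is an order. Independence inside a tensor product never has to be shown directly,
  since the natural map sends the evident spanning set of the base change to the given basis. The
  obstacle in characteristic p is that the next generator x need not commute with the central
  elements found so far. It does commute with their p-th powers, because [x, z^p] = p z^(p-1) [x, z]
  as soon as z commutes with [x, z], and the ring built so far remains finite over the subring that
  these powers generate. Over that subring one can speak of monic polynomials in x, and a monic
  polynomial that has become central bounds the powers of x needed to span the larger ring.\<close>

inductive_set lin_span ::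
    "('r, 'm) ring_scheme \<Rightarrow> ('r, 'a, 'n) module_scheme \<Rightarrow> 'a set \<Rightarrow> 'a set"
  for R M S where
    zero: "\<zero>\<^bsub>M\<^esub> \<in> lin_span R M S"
  | step: "\<lbrakk>r \<in> carrier R; s \<in> S; v \<in> lin_span R M S\<rbrakk> \<Longrightarrow> r \<odot>\<^bsub>M\<^esub> s \<oplus>\<^bsub>M\<^esub> v \<in> lin_span R M S"

lemma lin_span_mono: "S \<subseteq> S' \<Longrightarrow> carrier R \<subseteq> carrier R' \<Longrightarrow> lin_span R M S \<subseteq> lin_span R' M S'"
proof
  fix v assume "S \<subseteq> S'" "carrier R \<subseteq> carrier R'" "v \<in> lin_span R M S"
  from this(3,1,2) show "v \<in> lin_span R' M S'"
    by induction (auto intro: lin_span.intros)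
qed

context module
begin

lemma lin_span_closed:
  assumes "S \<subseteq> carrier M" shows "lin_span R M S \<subseteq> carrier M"
proof
  fix v assume "v \<in> lin_span R M S"
  then show "v \<in> carrier M" by induction (use assms in auto)
qed

lemma lin_span_incl:
  assumes "S \<subseteq> carrier M" "s \<in> S" shows "s \<in> lin_span R M S"
  using lin_span.step[OF R.one_closed assms(2) lin_span.zero, of M] assms by auto

lemma lin_span_submodule:
  assumes S: "S \<subseteq> carrier M" shows "submodule (lin_span R M S) R M"
proof (rule submoduleI)
  show sub: "lin_span R M S \<subseteq> carrier M" by (rule lin_span_closed[OF S])
  show "\<zero>\<^bsub>M\<^esub> \<in> lin_span R M S" by (rule lin_span.zero)
  show add: "a \<oplus>\<^bsub>M\<^esub> b \<in> lin_span R M S" if "a \<in> lin_span R M S" "b \<in> lin_span R M S" for a b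
    using that
  proof induction
    case zero
    then show ?case using sub by auto
  next
    case (step r s v)
    then have "r \<odot>\<^bsub>M\<^esub> s \<oplus>\<^bsub>M\<^esub> v \<oplus>\<^bsub>M\<^esub> b = r \<odot>\<^bsub>M\<^esub> s \<oplus>\<^bsub>M\<^esub> (v \<oplus>\<^bsub>M\<^esub> b)"
      using sub S by (subst M.a_assoc) auto
    with step show ?case by (auto intro: lin_span.step)
  qed
  show sm: "a \<odot>\<^bsub>M\<^esub> v \<in> lin_span R M S" if "a \<in> carrier R" "v \<in> lin_span R M S" for a v
    using that(2)
  proof induction
    case zero
    then show ?case using that by (simp add: lin_span.zero)
  next
    case (step r s v)
    have "a \<odot>\<^bsub>M\<^esub> (r \<odot>\<^bsub>M\<^esub> s \<oplus>\<^bsub>M\<^esub> v) = (a \<otimes> r) \<odot>\<^bsub>M\<^esub> s \<oplus>\<^bsub>M\<^esub> a \<odot>\<^bsub>M\<^esub> v"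
      using step sub S that by (auto simp: smult_r_distr smult_assoc1 subset_eq)
    with step that show ?case by (auto intro: lin_span.step)
  qed
  show "\<ominus>\<^bsub>M\<^esub> a \<in> lin_span R M S" if "a \<in> lin_span R M S" for a
  proof -
    have "\<ominus>\<^bsub>M\<^esub> a = (\<ominus> \<one>) \<odot>\<^bsub>M\<^esub> a" using that sub by (simp add: smult_l_minus subset_eq)
    then show ?thesis using sm[OF _ that] by simp
  qed
qed

lemma lin_span_minimal:
  assumes "submodule N R M" "S \<subseteq> N" shows "lin_span R M S \<subseteq> N"
proof
  fix v assume "v \<in> lin_span R M S"
  then show "v \<in> N"
  proof induction
    case zero
    then show ?case
      using submoduleE[OF assms(1)] by (metis M.add.r_inv ex_in_conv M.r_neg subsetD)
  next
    case (step r s v)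
    then show ?case using submoduleE[OF assms(1)] assms(2) by auto
  qed
qed

text \<open>Finite generation is defined by hulls of submodules, while spans are handled by rule
  induction, one summand at a time; this equation converts one into the other.\<close>

lemma lin_span_eq_hull:
  assumes "S \<subseteq> carrier M" shows "(\<lambda>N. submodule N R M) hull S = lin_span R M S"
  by (rule hull_unique) (use assms lin_span_incl lin_span_submodule lin_span_minimal in auto)

lemma submodule_zero: "submodule N R M \<Longrightarrow> \<zero>\<^bsub>M\<^esub> \<in> N"
  using lin_span_minimal[of N "{}"] lin_span.zero[of M R "{}"] by auto

lemma submodule_Int:
  assumes "submodule N R M" "submodule L R M" shows "submodule (N \<inter> L) R M"
  using submoduleE[OF assms(1)] submoduleE[OF assms(2)] submodule_zero[OF assms(1)]
    submodule_zero[OF assms(2)] by (intro submoduleI) auto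

end

text \<open>Noetherianity of \<open>N\<close> is expressed through submodules of the ambient
  \<open>M\<close> that lie in \<open>N\<close>, so that carriers never have to be changed.\<close>

definition noeth_in ::
    "('r, 'm) ring_scheme \<Rightarrow> ('r, 'a, 'n) module_scheme \<Rightarrow> 'a set \<Rightarrow> bool" where
  "noeth_in R M N \<longleftrightarrow> (\<forall>L. submodule L R M \<and> L \<subseteq> N \<longrightarrow>
     (\<exists>S. finite S \<and> S \<subseteq> L \<and> L = lin_span R M S))"

lemma (in module) lin_span_insertD:
  assumes S: "S \<subseteq> carrier M" and b: "b \<in> carrier M" and "v \<in> lin_span R M (insert b S)"
  shows "\<exists>r\<in>carrier R. \<exists>m\<in>lin_span R M S. v = r \<odot>\<^bsub>M\<^esub> b \<oplus>\<^bsub>M\<^esub> m" (is "\<exists>r\<in>_. \<exists>m\<in>?V. _")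
  using assms(3)
proof induction
  case zero
  show ?case by (rule bexI[of _ \<zero>], rule bexI[of _ "\<zero>\<^bsub>M\<^esub>"]) (use b lin_span.zero in auto)
next
  case (step r s v)
  then obtain r' m where rm: "r' \<in> carrier R" "m \<in> ?V" "v = r' \<odot>\<^bsub>M\<^esub> b \<oplus>\<^bsub>M\<^esub> m" by blast
  note VE = submoduleE[OF lin_span_submodule[OF S]]
  show ?case
  proof (cases "s = b")
    case True
    have "r \<odot>\<^bsub>M\<^esub> s \<oplus>\<^bsub>M\<^esub> v = (r \<oplus> r') \<odot>\<^bsub>M\<^esub> b \<oplus>\<^bsub>M\<^esub> m"
      using True rm step(1) b VE(1) by (auto simp: smult_l_distr M.a_assoc subset_eq)
    with rm step(1) show ?thesis by blast
  next
    case False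
    then have s: "s \<in> ?V" using step lin_span_incl[OF S] by auto
    have "r \<odot>\<^bsub>M\<^esub> s \<oplus>\<^bsub>M\<^esub> v = r' \<odot>\<^bsub>M\<^esub> b \<oplus>\<^bsub>M\<^esub> (r \<odot>\<^bsub>M\<^esub> s \<oplus>\<^bsub>M\<^esub> m)"
      using s rm step(1) b VE(1) by (auto simp: M.a_lcomm subset_eq)
    with rm s step(1) VE show ?thesis by blast
  qed
qed

text \<open>These are the leading coefficients at \<open>b\<close> of elements of \<open>L\<close>,
  everything in \<open>V\<close> counting as lower terms. The same ideal serves for adding one
  generator to a noetherian module and, with \<open>b\<close> a power of an adjoined element and
  \<open>V\<close> the span of the lower powers, for Hilbert's basis theorem.\<close>

lemma (in module) conductor_ideal:
  assumes L: "submodule L R M" and V: "submodule V R M" and b: "b \<in> carrier M"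
  shows "ideal {r \<in> carrier R. \<exists>m\<in>V. r \<odot>\<^bsub>M\<^esub> b \<oplus>\<^bsub>M\<^esub> m \<in> L} R" (is "ideal ?I R")
proof (rule idealI)
  note VE = submoduleE[OF V] and LE = submoduleE[OF L]
  show "ring R" by (rule R.ring_axioms)
  show "subgroup ?I (add_monoid R)"
  proof (rule R.add.subgroupI)
    show "?I \<subseteq> carrier R" by auto
    have "\<zero> \<in> ?I" using b submodule_zero[OF L] submodule_zero[OF V]
      by (auto intro!: bexI[of _ "\<zero>\<^bsub>M\<^esub>"])
    then show "?I \<noteq> {}" by auto
    fix r assume "r \<in> ?I"
    then obtain m where r: "r \<in> carrier R" "m \<in> V" "r \<odot>\<^bsub>M\<^esub> b \<oplus>\<^bsub>M\<^esub> m \<in> L" by auto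
    have "(\<ominus> r) \<odot>\<^bsub>M\<^esub> b \<oplus>\<^bsub>M\<^esub> (\<ominus>\<^bsub>M\<^esub> m) = \<ominus>\<^bsub>M\<^esub> (r \<odot>\<^bsub>M\<^esub> b \<oplus>\<^bsub>M\<^esub> m)"
      using r b VE(1) by (auto simp: smult_l_minus M.minus_add subset_eq)
    then have "(\<ominus> r) \<odot>\<^bsub>M\<^esub> b \<oplus>\<^bsub>M\<^esub> (\<ominus>\<^bsub>M\<^esub> m) \<in> L" using LE(3)[OF r(3)] by metis
    then show "\<ominus> r \<in> ?I" using r VE(3)[OF r(2)] by blast
    fix r' assume "r' \<in> ?I"
    then obtain m' where r': "r' \<in> carrier R" "m' \<in> V" "r' \<odot>\<^bsub>M\<^esub> b \<oplus>\<^bsub>M\<^esub> m' \<in> L" by auto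
    have "(r \<oplus> r') \<odot>\<^bsub>M\<^esub> b \<oplus>\<^bsub>M\<^esub> (m \<oplus>\<^bsub>M\<^esub> m') = (r \<odot>\<^bsub>M\<^esub> b \<oplus>\<^bsub>M\<^esub> m) \<oplus>\<^bsub>M\<^esub> (r' \<odot>\<^bsub>M\<^esub> b \<oplus>\<^bsub>M\<^esub> m')"
      using r r' b VE(1) by (auto simp: smult_l_distr M.a_ac subset_eq)
    then have "(r \<oplus> r') \<odot>\<^bsub>M\<^esub> b \<oplus>\<^bsub>M\<^esub> (m \<oplus>\<^bsub>M\<^esub> m') \<in> L" using LE(5)[OF r(3) r'(3)] by metis
    then show "r \<oplus> r' \<in> ?I" using r r' VE(5)[OF r(2) r'(2)] by blast
  qed
  fix r a assume "r \<in> ?I" and a: "a \<in> carrier R"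
  then obtain m where r: "r \<in> carrier R" "m \<in> V" "r \<odot>\<^bsub>M\<^esub> b \<oplus>\<^bsub>M\<^esub> m \<in> L" by auto
  have "(a \<otimes> r) \<odot>\<^bsub>M\<^esub> b \<oplus>\<^bsub>M\<^esub> a \<odot>\<^bsub>M\<^esub> m = a \<odot>\<^bsub>M\<^esub> (r \<odot>\<^bsub>M\<^esub> b \<oplus>\<^bsub>M\<^esub> m)"
    using r b a VE(1) by (auto simp: smult_r_distr smult_assoc1 subset_eq)
  then have "(a \<otimes> r) \<odot>\<^bsub>M\<^esub> b \<oplus>\<^bsub>M\<^esub> a \<odot>\<^bsub>M\<^esub> m \<in> L" using LE(4)[OF a r(3)] by metis
  then show "a \<otimes> r \<in> ?I" using r a VE(4)[OF a r(2)] by blast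
  then show "r \<otimes> a \<in> ?I" using r a by (simp add: R.m_comm)
qed

text \<open>A submodule \<open>L\<close> is controlled by two finitely generated pieces: the ideal
  of its leading coefficients at \<open>b\<close>, and its intersection with the span of
  \<open>S\<close>. Elements of \<open>L\<close> that realise generators of the ideal, together with
  generators of the intersection, generate \<open>L\<close>.\<close>

lemma (in module) noeth_in_insert:
  assumes noeth: "noetherian_ring R" and S: "S \<subseteq> carrier M" and b: "b \<in> carrier M"
    and N: "noeth_in R M (lin_span R M S)"
  shows "noeth_in R M (lin_span R M (insert b S))"
  unfolding noeth_in_def
proof (intro allI impI, elim conjE)
  let ?V = "lin_span R M S"
  fix L assume L: "submodule L R M" and sub: "L \<subseteq> lin_span R M (insert b S)"
  note V = lin_span_submodule[OF S] and VE = submoduleE[OF lin_span_submodule[OF S]]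
    and LE = submoduleE[OF L]
  note dec = lin_span_insertD[OF S b]
  define I where "I = {r \<in> carrier R. \<exists>m\<in>?V. r \<odot>\<^bsub>M\<^esub> b \<oplus>\<^bsub>M\<^esub> m \<in> L}"
  have I: "ideal I R" unfolding I_def by (rule conductor_ideal[OF L V b])
  obtain A where A: "A \<subseteq> carrier R" "finite A" "I = Idl A"
    using noetherian_ring.finetely_gen[OF noeth I] by blast
  have "\<forall>a\<in>A. \<exists>m\<in>?V. a \<odot>\<^bsub>M\<^esub> b \<oplus>\<^bsub>M\<^esub> m \<in> L"
    using R.genideal_self[OF A(1)] A(3) by (auto simp: I_def)
  then obtain m where m: "\<And>a. a \<in> A \<Longrightarrow> m a \<in> ?V" "\<And>a. a \<in> A \<Longrightarrow> a \<odot>\<^bsub>M\<^esub> b \<oplus>\<^bsub>M\<^esub> m a \<in> L"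
    by metis
  define G where "G = (\<lambda>a. a \<odot>\<^bsub>M\<^esub> b \<oplus>\<^bsub>M\<^esub> m a) ` A"
  have GL: "G \<subseteq> L" using m by (auto simp: G_def)
  have Gc: "G \<subseteq> carrier M" using GL LE(1) by blast
  note GE = submoduleE[OF lin_span_submodule[OF Gc]]
  obtain H where H: "finite H" "H \<subseteq> L \<inter> ?V" "L \<inter> ?V = lin_span R M H"
    using N[unfolded noeth_in_def, rule_format, of "L \<inter> ?V"] submodule_Int[OF L V] by auto
  have GHc: "G \<union> H \<subseteq> carrier M" using Gc H LE(1) by blast
  note GHE = submoduleE[OF lin_span_submodule[OF GHc]]
  \<comment> \<open>The coefficients realised inside the span of \<open>G\<close> again form a
    conductor ideal; it contains \<open>A\<close>, hence all of \<open>I\<close>.\<close>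
  have J: "\<exists>g\<in>lin_span R M G. \<exists>m\<in>?V. g = r \<odot>\<^bsub>M\<^esub> b \<oplus>\<^bsub>M\<^esub> m" if "r \<in> I" for r
  proof -
    let ?J = "{r \<in> carrier R. \<exists>m\<in>?V. r \<odot>\<^bsub>M\<^esub> b \<oplus>\<^bsub>M\<^esub> m \<in> lin_span R M G}"
    have "ideal ?J R" by (rule conductor_ideal[OF lin_span_submodule[OF Gc] V b])
    moreover have "A \<subseteq> ?J"
      using A(1) m(1) lin_span_incl[OF Gc] unfolding G_def by fastforce
    ultimately have "Idl A \<subseteq> ?J" by (rule R.genideal_minimal)
    then show ?thesis using that A(3) by blast
  qed
  have "v \<in> lin_span R M (G \<union> H)" if v: "v \<in> L" for v
  proof -
    obtain r w where r: "r \<in> carrier R" "w \<in> ?V" "v = r \<odot>\<^bsub>M\<^esub> b \<oplus>\<^bsub>M\<^esub> w" using dec v sub by blast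
    then have "r \<in> I" using v by (auto simp: I_def)
    then obtain g w' where g: "g \<in> lin_span R M G" "w' \<in> ?V" "g = r \<odot>\<^bsub>M\<^esub> b \<oplus>\<^bsub>M\<^esub> w'" using J by blast
    have gL: "g \<in> L" using g lin_span_minimal[OF L GL] by blast
    have wc: "w \<in> carrier M" "w' \<in> carrier M" "g \<in> carrier M" "v \<in> carrier M" "r \<odot>\<^bsub>M\<^esub> b \<in> carrier M"
      using r g VE(1) gL v LE(1) b by auto
    \<comment> \<open>\<open>v\<close> and \<open>g\<close> have the same coefficient at
      \<open>b\<close>, so their difference has no \<open>b\<close>-term and falls into the part of
      \<open>L\<close> generated by \<open>H\<close>.\<close>
    have eq: "v \<oplus>\<^bsub>M\<^esub> (\<ominus>\<^bsub>M\<^esub> g) = w \<oplus>\<^bsub>M\<^esub> (\<ominus>\<^bsub>M\<^esub> w')"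
      unfolding r(3) g(3) using wc by (simp add: M.minus_add M.a_ac M.r_neg1 M.r_neg2 M.r_neg)
    have "v \<oplus>\<^bsub>M\<^esub> (\<ominus>\<^bsub>M\<^esub> g) \<in> L \<inter> ?V"
      using LE(5)[OF v LE(3)[OF gL]] VE(5)[OF r(2) VE(3)[OF g(2)]] eq by simp
    then have "v \<oplus>\<^bsub>M\<^esub> (\<ominus>\<^bsub>M\<^esub> g) \<in> lin_span R M H" using H(3) by simp
    then have "v \<oplus>\<^bsub>M\<^esub> (\<ominus>\<^bsub>M\<^esub> g) \<in> lin_span R M (G \<union> H)"
      using lin_span_mono[of H "G \<union> H" R R M] by blast
    moreover have "g \<in> lin_span R M (G \<union> H)" using lin_span_mono[of G "G \<union> H" R R M] g(1) by blast
    moreover have "v = v \<oplus>\<^bsub>M\<^esub> (\<ominus>\<^bsub>M\<^esub> g) \<oplus>\<^bsub>M\<^esub> g" using wc by (simp add: M.a_assoc M.l_neg)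
    ultimately show ?thesis using GHE(5) by metis
  qed
  moreover have "lin_span R M (G \<union> H) \<subseteq> L" using lin_span_minimal[OF L] GL H(2) by blast
  ultimately show "\<exists>S. finite S \<and> S \<subseteq> L \<and> L = lin_span R M S"
    using GL H A(2) by (intro exI[of _ "G \<union> H"]) (auto simp: G_def)
qed

lemma (in module) noeth_in_lin_span:
  assumes noeth: "noetherian_ring R" and "finite S" "S \<subseteq> carrier M"
  shows "noeth_in R M (lin_span R M S)"
  using assms(2,3)
proof induction
  case empty
  have e: "lin_span R M {} = {\<zero>\<^bsub>M\<^esub>}"
    by (auto elim: lin_span.cases intro: lin_span.zero)
  show ?case unfolding noeth_in_def e
    using submodule_zero e by (intro allI impI exI[of _ "{}"]) auto
next
  case (insert b S)
  then show ?case using noeth_in_insert[OF noeth, of S b] by auto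
qed

section \<open>Modules over a commutative subring\<close>

lemma scalars_via_simps [simp]:
  "carrier (scalars_via \<phi> S) = carrier S" "monoid.mult (scalars_via \<phi> S) = monoid.mult S"
  "one (scalars_via \<phi> S) = one S" "ring.zero (scalars_via \<phi> S) = ring.zero S"
  "ring.add (scalars_via \<phi> S) = ring.add S"
  "r \<odot>\<^bsub>scalars_via \<phi> S\<^esub> s = \<phi> r \<otimes>\<^bsub>S\<^esub> s"
  "\<ominus>\<^bsub>scalars_via \<phi> S\<^esub> s = \<ominus>\<^bsub>S\<^esub> s"
  by (simp_all add: scalars_via_def a_inv_def m_inv_def)

lemma scalars_via_module:
  assumes "cring R" "ring S" "\<phi> \<in> ring_hom R S"
  shows "module R (scalars_via \<phi> S)"
proof -
  interpret S: ring S by fact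
  have "abelian_group (scalars_via \<phi> S)"
  proof (rule abelian_groupI)
    show "\<exists>y\<in>carrier (scalars_via \<phi> S). y \<oplus>\<^bsub>scalars_via \<phi> S\<^esub> x = \<zero>\<^bsub>scalars_via \<phi> S\<^esub>"
      if "x \<in> carrier (scalars_via \<phi> S)" for x
      using that S.l_neg by auto
  qed (auto simp: S.add.m_assoc, metis S.a_comm)
  then show ?thesis
    using ring_hom_closed[OF assms(3)] ring_hom_add[OF assms(3)] ring_hom_mult[OF assms(3)]
      ring_hom_one[OF assms(3)] assms(1)
    by (intro moduleI) (auto simp: S.l_distr S.r_distr S.m_assoc)
qed

abbreviation left_module :: "('a, 'm) ring_scheme \<Rightarrow> ('a, 'a) module" where
  "left_module T \<equiv> scalars_via (\<lambda>z. z) T"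

context ring
begin

lemma subcring_module:
  assumes "subcring Z R" shows "module (R\<lparr>carrier := Z\<rparr>) (left_module R)"
proof -
  have "cring (R\<lparr>carrier := Z\<rparr>)" using assms subcring_iff[of Z] subcringE(1)[OF assms] by simp
  then show ?thesis
    using subcringE(1)[OF assms]
    by (intro scalars_via_module) (auto intro!: ring_hom_memI simp: ring_axioms)
qed

abbreviation zspan :: "'a set \<Rightarrow> 'a set \<Rightarrow> 'a set" where
  "zspan Z S \<equiv> lin_span (R\<lparr>carrier := Z\<rparr>) (left_module R) S"

abbreviation zsub :: "'a set \<Rightarrow> 'a set \<Rightarrow> bool" where
  "zsub Z N \<equiv> submodule N (R\<lparr>carrier := Z\<rparr>) (left_module R)"

lemma zspan_step: "\<lbrakk>z \<in> Z; s \<in> S; v \<in> zspan Z S\<rbrakk> \<Longrightarrow> z \<otimes> s \<oplus> v \<in> zspan Z S"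
  using lin_span.step[of z "R\<lparr>carrier := Z\<rparr>" s S v "left_module R"] by simp

lemma zspan_zero: "\<zero> \<in> zspan Z S"
  using lin_span.zero[of "left_module R"] by simp

lemma zspan_induct [consumes 1, case_names zero step]:
  assumes "v \<in> zspan Z S" "P \<zero>"
    "\<And>z s v. \<lbrakk>z \<in> Z; s \<in> S; v \<in> zspan Z S; P v\<rbrakk> \<Longrightarrow> P (z \<otimes> s \<oplus> v)"
  shows "P v"
  using assms(1)
proof induction
  case zero
  then show ?case using assms(2) by simp
next
  case (step r s v)
  then show ?case using assms(3)[of r s v] by simp
qed

lemma zsubI:
  assumes Z: "subcring Z R"
    and N: "N \<subseteq> carrier R" "\<zero> \<in> N" "\<And>a b. a \<in> N \<Longrightarrow> b \<in> N \<Longrightarrow> a \<oplus> b \<in> N"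
      "\<And>z a. z \<in> Z \<Longrightarrow> a \<in> N \<Longrightarrow> z \<otimes> a \<in> N"
  shows "zsub Z N"
proof -
  interpret M: module "R\<lparr>carrier := Z\<rparr>" "left_module R" by (rule subcring_module[OF Z])
  \<comment> \<open>Negatives come from multiplication by the additive inverse of the unit, which
    lies in \<open>Z\<close>.\<close>
  have "\<ominus> a \<in> N" if "a \<in> N" for a
    using N(4)[OF subcringE(5)[OF Z subcringE(3)[OF Z]] that] that N(1) by (auto simp: l_minus subset_eq)
  then show ?thesis using N(1-4) by (intro M.submoduleI) simp_all
qed

lemma zsubD:
  assumes Z: "subcring Z R" and N: "zsub Z N"
  shows "N \<subseteq> carrier R" "\<zero> \<in> N" "\<And>a b. a \<in> N \<Longrightarrow> b \<in> N \<Longrightarrow> a \<oplus> b \<in> N"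
      "\<And>z a. z \<in> Z \<Longrightarrow> a \<in> N \<Longrightarrow> z \<otimes> a \<in> N" "\<And>a. a \<in> N \<Longrightarrow> \<ominus> a \<in> N"
proof -
  interpret M: module "R\<lparr>carrier := Z\<rparr>" "left_module R" by (rule subcring_module[OF Z])
  note E = M.submoduleE[OF N]
  show "N \<subseteq> carrier R" using E(1) by simp
  show "\<zero> \<in> N" using M.submodule_zero[OF N] by simp
  show "a \<oplus> b \<in> N" if "a \<in> N" "b \<in> N" for a b using E(5)[OF that] by simp
  show "z \<otimes> a \<in> N" if "z \<in> Z" "a \<in> N" for z a using E(4)[of z a] that by simp
  show "\<ominus> a \<in> N" if "a \<in> N" for a using E(3)[OF that] by simp
qed

lemma zspan_zsub: "subcring Z R \<Longrightarrow> S \<subseteq> carrier R \<Longrightarrow> zsub Z (zspan Z S)"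
  by (rule module.lin_span_submodule[OF subcring_module]) auto

lemma zspan_incl: "subcring Z R \<Longrightarrow> S \<subseteq> carrier R \<Longrightarrow> s \<in> S \<Longrightarrow> s \<in> zspan Z S"
  by (rule module.lin_span_incl[OF subcring_module]) auto

lemma zspan_minimal: "subcring Z R \<Longrightarrow> zsub Z N \<Longrightarrow> S \<subseteq> N \<Longrightarrow> zspan Z S \<subseteq> N"
  by (rule module.lin_span_minimal[OF subcring_module])

lemma zspan_mult_incl: "subcring Z R \<Longrightarrow> S \<subseteq> carrier R \<Longrightarrow> s \<in> S \<Longrightarrow> z \<in> Z \<Longrightarrow> z \<otimes> s \<in> zspan Z S"
  using zsubD(4)[OF _ zspan_zsub] zspan_incl by auto

lemma ideal_zsub:
  assumes Z: "subcring Z R" and E: "subring E R" "Z \<subseteq> E" and N: "ideal N (R\<lparr>carrier := E\<rparr>)"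
  shows "zsub Z N"
proof -
  have N': "additive_subgroup N (R\<lparr>carrier := E\<rparr>)" using N by (rule ideal.axioms)
  show ?thesis
  proof (rule zsubI[OF Z])
    show "N \<subseteq> carrier R" using additive_subgroup.a_subset[OF N'] subringE(1)[OF E(1)] by auto
    show "\<zero> \<in> N" using additive_subgroup.zero_closed[OF N'] by simp
    show "a \<oplus> b \<in> N" if "a \<in> N" "b \<in> N" for a b
      using additive_subgroup.a_closed[OF N' that] by simp
    show "z \<otimes> a \<in> N" if "z \<in> Z" "a \<in> N" for z a
      using ideal.I_l_closed[OF N that(2), of z] that(1) E(2) by auto
  qed
qed

lemma generate_ring_commutes:
  assumes "H \<subseteq> carrier R" "a \<in> carrier R" "\<And>h. h \<in> H \<Longrightarrow> a \<otimes> h = h \<otimes> a" "g \<in> generate_ring R H"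
  shows "a \<otimes> g = g \<otimes> a"
  using assms(4)
proof induction
  case (a_inv h)
  then show ?case using generate_ring_in_carrier[OF assms(1)] assms(2) by (simp add: l_minus r_minus)
next
  case (eng_add h1 h2)
  then show ?case using generate_ring_in_carrier[OF assms(1)] assms(2) by (simp add: l_distr r_distr)
next
  case (eng_mult h1 h2)
  then show ?case
    using generate_ring_in_carrier[OF assms(1)] assms(2) by (metis m_assoc)
next
  case (incl h)
  then show ?case by (rule assms(3))
qed (use assms(2) in simp)

lemma generate_ring_subcring:
  assumes H: "H \<subseteq> carrier R" and comm: "\<And>h k. h \<in> H \<Longrightarrow> k \<in> H \<Longrightarrow> h \<otimes> k = k \<otimes> h"
  shows "subcring (generate_ring R H) R"
proof (rule subcringI[OF generate_ring_is_subring[OF H]])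
  fix g k assume g: "g \<in> generate_ring R H" and k: "k \<in> generate_ring R H"
  have hk: "h \<otimes> k = k \<otimes> h" if h: "h \<in> H" for h
    by (rule generate_ring_commutes[OF H subsetD[OF H h] comm[OF h] k])
  have "k \<otimes> g = g \<otimes> k"
    by (rule generate_ring_commutes[OF H generate_ring_in_carrier[OF H k] _ g]) (rule hk[symmetric])
  then show "g \<otimes> k = k \<otimes> g" by (rule sym)
qed

end

section \<open>Hilbert's basis theorem inside an ambient ring\<close>

context ring
begin

text \<open>Polynomials of degree below \<open>n\<close> in \<open>w\<close>, taken as elements of
  the ambient ring and not as formal objects: \<open>w\<close> may be algebraic over
  \<open>Z\<close>, so a degree is only an upper bound.\<close>

abbreviation pspan :: "'a set \<Rightarrow> 'a \<Rightarrow> nat \<Rightarrow> 'a set" where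
  "pspan Z w n \<equiv> zspan Z ((\<lambda>i. w [^] i) ` {..<n})"

context
  fixes Z w
  assumes Z: "subcring Z R" and w: "w \<in> carrier R" and comm: "\<forall>z\<in>Z. w \<otimes> z = z \<otimes> w"
begin

lemma powers_closed: "(\<lambda>i. w [^] i) ` A \<subseteq> carrier R" for A :: "nat set"
  using w by auto

lemma pspan_zsub: "zsub Z (pspan Z w n)"
  by (rule zspan_zsub[OF Z powers_closed])

lemmas pspanE = zsubD[OF Z pspan_zsub]

lemma pspan_mono: "n \<le> m \<Longrightarrow> pspan Z w n \<subseteq> pspan Z w m"
  by (rule lin_span_mono) auto

lemma pow_commutes: "z \<in> Z \<Longrightarrow> w [^] (k::nat) \<otimes> z = z \<otimes> w [^] k"
proof (induction k)
  case 0
  then show ?case using subcringE(1)[OF Z] by auto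
next
  case (Suc k)
  have c: "z \<in> carrier R" using subcringE(1)[OF Z] Suc by auto
  have "w [^] Suc k \<otimes> z = w [^] k \<otimes> (w \<otimes> z)" using c w by (simp add: m_assoc)
  also have "\<dots> = (w [^] k \<otimes> z) \<otimes> w" unfolding bspec[OF comm Suc(2)] using c w by (simp add: m_assoc)
  also have "\<dots> = z \<otimes> w [^] Suc k" unfolding Suc(1)[OF Suc(2)] using c w by (simp add: m_assoc)
  finally show ?case .
qed

lemma pspan_monomial: "z \<in> Z \<Longrightarrow> i < n \<Longrightarrow> z \<otimes> w [^] i \<in> pspan Z w n"
  by (intro zspan_mult_incl[OF Z powers_closed]) auto

lemma pspan_pow: "i < n \<Longrightarrow> w [^] i \<in> pspan Z w n"
  by (intro zspan_incl[OF Z powers_closed]) auto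

lemma pspan_shift:
  assumes "v \<in> pspan Z w n" shows "w [^] k \<otimes> v \<in> pspan Z w (k + n)"
  using assms
proof (induction rule: zspan_induct)
  case zero then show ?case using pspanE(2) w by simp
next
  case (step z s v)
  then obtain i where i: "i < n" "s = w [^] i" by auto
  have "w [^] k \<otimes> (z \<otimes> s \<oplus> v) = z \<otimes> w [^] (k + i) \<oplus> w [^] k \<otimes> v"
    using step i subcringE(1)[OF Z] w pspanE(1)[of n] pow_commutes[OF step(1), of k]
    by (auto simp: r_distr subset_eq m_assoc[symmetric] nat_pow_mult[symmetric])
  with step i pspan_monomial pspanE(3) show ?case by auto
qed

lemma pspan_mult:
  assumes "u \<in> pspan Z w m" "v \<in> pspan Z w n" shows "u \<otimes> v \<in> pspan Z w (m + n)"
  using assms(1)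
proof (induction rule: zspan_induct)
  case zero then show ?case using pspanE(1)[of n] pspanE(2) assms(2) by (simp add: subset_eq)
next
  case (step z s u)
  then obtain i where i: "i < m" "s = w [^] i" by auto
  have "(z \<otimes> s \<oplus> u) \<otimes> v = z \<otimes> (s \<otimes> v) \<oplus> u \<otimes> v"
    using step i subcringE(1)[OF Z] w pspanE(1)[of n] pspanE(1)[of m] assms(2)
    by (auto simp: l_distr subset_eq m_assoc)
  moreover have "s \<otimes> v \<in> pspan Z w (m + n)"
    using pspan_shift[OF assms(2), of i] pspan_mono[of "i + n" "m + n"] i by auto
  ultimately show ?case using step pspanE(3,4) by simp
qed

end

text \<open>Hilbert's basis theorem for an element \<open>w\<close> that may be algebraic over
  \<open>Z\<close>, in a ring that may be noncommutative. Degrees are then not well defined, but the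
  argument compares upper bounds only, and the ideals of leading coefficients still increase because
  multiplication by \<open>w\<close> raises the bound by one.\<close>

theorem noetherian_generate_insert:
  assumes Z: "subcring Z R" and noeth: "noetherian_ring (R\<lparr>carrier := Z\<rparr>)"
    and w: "w \<in> carrier R" and comm: "\<And>z. z \<in> Z \<Longrightarrow> w \<otimes> z = z \<otimes> w"
  shows "noetherian_ring (R\<lparr>carrier := generate_ring R (insert w Z)\<rparr>)"
proof -
  define E where "E = generate_ring R (insert w Z)"
  define P where "P n = pspan Z w n" for n
  note ZE = subcringE[OF Z]
  interpret M: module "R\<lparr>carrier := Z\<rparr>" "left_module R" by (rule subcring_module[OF Z])
  have E: "subcring E R" unfolding E_def
    using comm w ZE(1,8) by (intro generate_ring_subcring) auto
  note EE = subcringE[OF E]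
  have ZsubE: "Z \<subseteq> E" and wE: "w \<in> E" by (auto simp: E_def intro: generate_ring.incl)
  have wkE: "w [^] (k::nat) \<in> E" for k
    by (induction k) (use EE(3,6) wE in auto)
  have comm': "\<forall>z\<in>Z. w \<otimes> z = z \<otimes> w" using comm by blast
  note PE = pspanE[OF Z w comm', folded P_def]
    and Pmono = pspan_mono[OF Z w comm', folded P_def]
    and wkz = pow_commutes[OF Z w comm']
    and zwP = pspan_monomial[OF Z w comm', folded P_def]
    and wP = pspan_shift[OF Z w comm', folded P_def]
    and PP = pspan_mult[OF Z w comm', folded P_def]
  have Psub: "zsub Z (P n)" for n unfolding P_def by (rule pspan_zsub[OF Z w comm'])
  have EP: "\<exists>n. e \<in> P n" if "e \<in> E" for e
    using that unfolding E_def
  proof induction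
    case one show ?case using zwP[OF ZE(3), of 0 1] by auto
  next
    case (incl h) then show ?case using zwP[OF ZE(3), of 1 2] zwP[of h 0 1] w ZE(1)
      by (auto simp: subset_eq)
  next
    case (a_inv h) then show ?case using PE(5) by blast
  next
    case (eng_add h1 h2)
    then obtain n m where "h1 \<in> P n" "h2 \<in> P m" by blast
    then show ?case using PE(3)[of h1 "max n m" h2] Pmono[of n "max n m"] Pmono[of m "max n m"] by auto
  next
    case (eng_mult h1 h2) then show ?case using PP by blast
  qed
  interpret E: ring "R\<lparr>carrier := E\<rparr>" by (rule subring_is_ring[OF subcring.axioms(1)[OF E]])
  have "\<exists>A\<subseteq>carrier (R\<lparr>carrier := E\<rparr>). finite A \<and> N = Idl\<^bsub>R\<lparr>carrier := E\<rparr>\<^esub> A"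
    if N: "ideal N (R\<lparr>carrier := E\<rparr>)" for N
  proof -
    have NZ: "zsub Z N" by (rule ideal_zsub[OF Z subcring.axioms(1)[OF E] ZsubE N])
    note NE = zsubD[OF Z NZ]
    have NsubE: "N \<subseteq> E" using additive_subgroup.a_subset[OF ideal.axioms(1)[OF N]] by simp
    define L where "L k = {z \<in> Z. \<exists>u\<in>P k. z \<otimes> w [^] k \<oplus> u \<in> N}" for k
    have Lid: "ideal (L k) (R\<lparr>carrier := Z\<rparr>)" for k
      using M.conductor_ideal[OF NZ Psub, of "w [^] k"] w by (simp add: L_def)
    have Lmono: "L k \<subseteq> L (Suc k)" for k
    proof
      fix z assume "z \<in> L k"
      then obtain u where u: "z \<in> Z" "u \<in> P k" "z \<otimes> w [^] k \<oplus> u \<in> N" by (auto simp: L_def)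
      have "w \<otimes> (z \<otimes> w [^] k \<oplus> u) \<in> N" using ideal.I_l_closed[OF N u(3), of w] wE by simp
      moreover have "w \<otimes> (z \<otimes> w [^] k \<oplus> u) = z \<otimes> w [^] Suc k \<oplus> w \<otimes> u"
        using u ZE(1) PE(1)[of k] w comm[OF u(1)]
        by (auto simp: r_distr m_assoc[symmetric] nat_pow_Suc2 subset_eq simp del: nat_pow_Suc)
          (simp add: m_assoc nat_pow_Suc2[symmetric])
      moreover have "w \<otimes> u \<in> P (Suc k)" using wP[OF u(2), of 1] w by simp
      ultimately show "z \<in> L (Suc k)" using u(1) by (auto simp: L_def)
    qed
    have "L i \<subseteq> L j \<or> L j \<subseteq> L i" for i j
      using lift_Suc_mono_le[of L, OF Lmono] by (metis nat_le_linear)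
    \<comment> \<open>The ideals of leading coefficients form a chain, so by noetherianity their
      union is one of them, \<open>L m\<close>: no bound yields a leading coefficient outside
      \<open>L m\<close>.\<close>
    then have "subset.chain {I. ideal I (R\<lparr>carrier := Z\<rparr>)} (range L)"
      unfolding subset_chain_def using Lid by fast
    then have "\<Union> (range L) \<in> range L"
      using noetherian_ring.ideal_chain_is_trivial[OF noeth] by blast
    then obtain m where m: "\<And>k. L k \<subseteq> L m" by blast
    obtain S where S: "S \<subseteq> Z" "finite S" "L m = Idl\<^bsub>R\<lparr>carrier := Z\<rparr>\<^esub> S"
      using noetherian_ring.finetely_gen[OF noeth Lid[of m]] by auto
    have "\<forall>s\<in>S. \<exists>u\<in>P m. s \<otimes> w [^] m \<oplus> u \<in> N"
      using M.R.genideal_self[of S] S by (auto simp: L_def)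
    then obtain u where u: "\<And>s. s \<in> S \<Longrightarrow> u s \<in> P m" "\<And>s. s \<in> S \<Longrightarrow> s \<otimes> w [^] m \<oplus> u s \<in> N"
      by metis
    define G where "G = (\<lambda>s. s \<otimes> w [^] m \<oplus> u s) ` S"
    \<comment> \<open>Below \<open>m\<close> the ideal \<open>L m\<close> gives no control; there
      \<open>N\<close> is finitely generated already as a module over \<open>Z\<close>, because
      finitely many powers of \<open>w\<close> span \<open>P m\<close>.\<close>
    have "noeth_in (R\<lparr>carrier := Z\<rparr>) (left_module R) (P m)"
      unfolding P_def using w by (intro M.noeth_in_lin_span[OF noeth]) auto
    then obtain H where H: "finite H" "H \<subseteq> N \<inter> P m" "N \<inter> P m = zspan Z H"
      unfolding noeth_in_def using M.submodule_Int[OF NZ Psub[of m]] by (metis inf_le2)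
    define J where "J = Idl\<^bsub>R\<lparr>carrier := E\<rparr>\<^esub> (G \<union> H)"
    have GHN: "G \<union> H \<subseteq> N" using H u(2) by (auto simp: G_def)
    then have GHE: "G \<union> H \<subseteq> carrier (R\<lparr>carrier := E\<rparr>)" using NsubE by auto
    have J: "ideal J (R\<lparr>carrier := E\<rparr>)" and GHJ: "G \<union> H \<subseteq> J"
      unfolding J_def by (rule E.genideal_ideal[OF GHE], rule E.genideal_self[OF GHE])
    have JN: "J \<subseteq> N" unfolding J_def by (rule E.genideal_minimal[OF N GHN])
    have JZ: "zsub Z J" by (rule ideal_zsub[OF Z subcring.axioms(1)[OF E] ZsubE J])
    note JE = zsubD[OF Z JZ]
    have LJ: "\<exists>v\<in>P m. z \<otimes> w [^] m \<oplus> v \<in> J" if "z \<in> L m" for z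
    proof -
      let ?C = "{z \<in> Z. \<exists>v\<in>P m. z \<otimes> w [^] m \<oplus> v \<in> J}"
      have "ideal ?C (R\<lparr>carrier := Z\<rparr>)"
        using M.conductor_ideal[OF JZ Psub, of "w [^] m"] w by simp
      moreover have "S \<subseteq> ?C" using S(1) u(1) GHJ unfolding G_def by blast
      ultimately have "Idl\<^bsub>R\<lparr>carrier := Z\<rparr>\<^esub> S \<subseteq> ?C" by (rule M.R.genideal_minimal)
      then show ?thesis using that S(3) by blast
    qed
    have NJ: "N \<inter> P k \<subseteq> J" for k
    proof (induction k)
      case 0
      have "P 0 \<subseteq> P m" by (rule Pmono) simp
      then show ?case using H(3) zspan_minimal[OF Z JZ, of H] GHJ by auto
    next
      case (Suc k)
      show ?case
      proof (cases "Suc k \<le> m")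
        case True
        then show ?thesis using Pmono[OF True] H(3) zspan_minimal[OF Z JZ, of H] GHJ by auto
      next
        case False
        show ?thesis
        proof
          fix f assume f: "f \<in> N \<inter> P (Suc k)"
          have "f \<in> lin_span (R\<lparr>carrier := Z\<rparr>) (left_module R) (insert (w [^] k) ((\<lambda>i. w [^] i) ` {..<k}))"
            using f by (simp add: P_def lessThan_Suc)
          from M.lin_span_insertD[OF _ _ this] obtain z v where
            zv: "z \<in> Z" "v \<in> P k" "f = z \<otimes> w [^] k \<oplus> v"
            using w by (auto simp: P_def)
          then have "z \<in> L k" using f by (auto simp: L_def)
          then obtain v' where v': "v' \<in> P m" "z \<otimes> w [^] m \<oplus> v' \<in> J" using m LJ by blast
          \<comment> \<open>An element of \<open>J\<close> with the same top term as
            \<open>f\<close>, obtained by shifting one of bound \<open>m\<close> upwards by a power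
            of \<open>w\<close>. Subtracting it lowers the bound from \<open>Suc k\<close> to
            \<open>k\<close>.\<close>
          let ?g = "w [^] (k - m) \<otimes> (z \<otimes> w [^] m \<oplus> v')"
          have gJ: "?g \<in> J" using ideal.I_l_closed[OF J v'(2)] wkE by simp
          have c: "z \<in> carrier R" "v \<in> carrier R" "v' \<in> carrier R" "w [^] k \<in> carrier R"
            "w [^] (k - m) \<otimes> v' \<in> carrier R"
            using zv v' ZE(1) PE(1) w by auto
          have "w [^] (k - m) \<otimes> (z \<otimes> w [^] m) = z \<otimes> w [^] k"
            using False w c wkz[OF zv(1), of "k - m"]
            by (simp add: m_assoc[symmetric]) (simp add: m_assoc nat_pow_mult)
          then have g: "?g = z \<otimes> w [^] k \<oplus> w [^] (k - m) \<otimes> v'"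
            using c w by (simp add: r_distr)
          have "w [^] (k - m) \<otimes> v' \<in> P k" using wP[OF v'(1), of "k - m"] False by simp
          then have "f \<oplus> \<ominus> ?g \<in> P k"
            unfolding g zv(3) using c zv(2) PE(3)[OF _ PE(5)]
            by (simp add: minus_add a_ac r_neg1 r_neg2 r_neg)
          moreover have "f \<oplus> \<ominus> ?g \<in> N" using NE(3)[OF _ NE(5)] f gJ JN by auto
          ultimately have "f \<oplus> \<ominus> ?g \<in> J" using Suc by auto
          then have "f \<oplus> \<ominus> ?g \<oplus> ?g \<in> J" using JE(3) gJ by blast
          moreover have "f \<oplus> \<ominus> ?g \<oplus> ?g = f" using f gJ JE(1) NE(1) by (auto simp: a_assoc l_neg subset_eq)
          ultimately show "f \<in> J" by simp
        qed
      qed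
    qed
    have "N \<subseteq> J"
    proof
      fix f assume "f \<in> N"
      then show "f \<in> J" using EP[of f] NsubE NJ by blast
    qed
    with JN show ?thesis using GHE H(1) S(2) unfolding J_def G_def
      by (intro exI[of _ "G \<union> H"]) (auto simp: G_def)
  qed
  then show ?thesis
    unfolding E_def[symmetric] by (intro noetherian_ring.intro E.ring_axioms noetherian_ring_axioms.intro)
qed

lemma generate_ring_mono: "H \<subseteq> H' \<Longrightarrow> generate_ring R H \<subseteq> generate_ring R H'"
proof
  fix g assume "H \<subseteq> H'" "g \<in> generate_ring R H"
  from this(2,1) show "g \<in> generate_ring R H'"
    by induction (auto intro: generate_ring.intros)
qed

lemma generate_ring_hull:
  assumes "H \<subseteq> carrier R" "H' \<subseteq> carrier R"
  shows "generate_ring R (H' \<union> generate_ring R H) = generate_ring R (H' \<union> H)"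
proof
  show "generate_ring R (H' \<union> generate_ring R H) \<subseteq> generate_ring R (H' \<union> H)"
    using assms generate_ring_mono[of H "H' \<union> H"] generate_ring_incl[OF assms(1)]
    by (intro generate_ring_min_subring1 generate_ring_is_subring) (auto intro: generate_ring.incl)
  show "generate_ring R (H' \<union> H) \<subseteq> generate_ring R (H' \<union> generate_ring R H)"
    by (rule generate_ring_mono) (auto intro: generate_ring.incl)
qed

text \<open>By induction every \<open>g\<close> of the generated ring maps \<open>W\<close> into
  itself, and applying it to the unit gives \<open>g\<close> itself. A candidate span thus exhausts
  the ring as soon as it is stable under left multiplication by the generators.\<close>

lemma generate_ring_subset_left:
  assumes H: "H \<subseteq> carrier R" and W: "W \<subseteq> carrier R" "\<one> \<in> W" "\<And>v. v \<in> W \<Longrightarrow> \<ominus> v \<in> W"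
    "\<And>u v. u \<in> W \<Longrightarrow> v \<in> W \<Longrightarrow> u \<oplus> v \<in> W"
    and left: "\<And>h v. h \<in> H \<Longrightarrow> v \<in> W \<Longrightarrow> h \<otimes> v \<in> W"
  shows "generate_ring R H \<subseteq> W"
proof
  fix g assume g: "g \<in> generate_ring R H"
  then have "g \<otimes> v \<in> W" if "v \<in> W" for v
    using that
  proof (induction arbitrary: v)
    case one then show ?case using W(1) by auto
  next
    case (incl h) then show ?case by (rule left)
  next
    case (a_inv h)
    then show ?case using W(1,3) generate_ring_in_carrier[OF H] by (simp add: l_minus subset_eq)
  next
    case (eng_add h1 h2)
    then show ?case using W(1,4) generate_ring_in_carrier[OF H] by (simp add: l_distr subset_eq)
  next
    case (eng_mult h1 h2)
    then show ?case using W(1) generate_ring_in_carrier[OF H] by (simp add: m_assoc subset_eq)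
  qed
  from this[OF W(2)] show "g \<in> W" using generate_ring_in_carrier[OF H g] by simp
qed

lemma noetherian_generate_finite:
  assumes Z: "subcring Z R" and noeth: "noetherian_ring (R\<lparr>carrier := Z\<rparr>)"
    and "finite E" "E \<subseteq> carrier R" "\<And>e h. e \<in> E \<Longrightarrow> h \<in> Z \<union> E \<Longrightarrow> e \<otimes> h = h \<otimes> e"
  shows "subcring (generate_ring R (Z \<union> E)) R \<and> noetherian_ring (R\<lparr>carrier := generate_ring R (Z \<union> E)\<rparr>)"
  using assms(3-5)
proof (induction E)
  case empty
  have "generate_ring R Z = Z"
    using generate_ring_min_subring1[OF subcringE(1)[OF Z] subcring.axioms(1)[OF Z]]
    by (auto intro: generate_ring.incl)
  then show ?case using Z noeth by simp
next
  case (insert w E)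
  have IH: "subcring (generate_ring R (Z \<union> E)) R"
    "noetherian_ring (R\<lparr>carrier := generate_ring R (Z \<union> E)\<rparr>)"
    using insert.IH insert.prems by blast+
  have ZE: "Z \<union> E \<subseteq> carrier R" using subcringE(1)[OF Z] insert.prems by auto
  have w: "w \<in> carrier R" using insert.prems by auto
  have eq: "generate_ring R (insert w (generate_ring R (Z \<union> E))) = generate_ring R (Z \<union> insert w E)"
    using generate_ring_hull[OF ZE, of "{w}"] w by (simp add: insert_is_Un[symmetric])
  have comm: "w \<otimes> z = z \<otimes> w" if "z \<in> generate_ring R (Z \<union> E)" for z
    by (rule generate_ring_commutes[OF ZE w _ that]) (use insert.prems(2)[of w] in blast)
  have wcomm: "h \<otimes> k = k \<otimes> h" if "h \<in> insert w (generate_ring R (Z \<union> E))"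
    "k \<in> insert w (generate_ring R (Z \<union> E))" for h k
    using that comm[of h] comm[of k] subcringE(8)[OF IH(1), of h k] by (elim insertE) simp_all
  have "subcring (generate_ring R (insert w (generate_ring R (Z \<union> E)))) R"
    by (rule generate_ring_subcring[OF _ wcomm]) (use w subcringE(1)[OF IH(1)] in auto)
  then show ?case using noetherian_generate_insert[OF IH w comm] unfolding eq by blast
qed

lemma zspan_image_mult:
  assumes Z: "subcring Z R" and S: "S \<subseteq> carrier R" and c: "c \<in> carrier R"
    and v: "v \<in> zspan Z S" and T: "T \<subseteq> carrier R" "(\<lambda>s. s \<otimes> c) ` S \<subseteq> zspan Z T"
  shows "v \<otimes> c \<in> zspan Z T"
  using v
proof (induction rule: zspan_induct)
  case zero then show ?case using c zspan_zero by simp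
next
  case (step z s v)
  note E = zsubD[OF Z zspan_zsub[OF Z T(1)]]
  have "v \<in> carrier R" using step(3) zsubD(1)[OF Z zspan_zsub[OF Z S]] by auto
  then have "(z \<otimes> s \<oplus> v) \<otimes> c = z \<otimes> (s \<otimes> c) \<oplus> v \<otimes> c"
    using step S c subcringE(1)[OF Z] by (auto simp: l_distr m_assoc subset_eq)
  moreover have "s \<otimes> c \<in> zspan Z T" using step T by auto
  ultimately show ?case using step E by simp
qed

text \<open>Transitivity of finiteness: products of generators of the two layers generate.\<close>

lemma zspan_trans:
  assumes Z: "subcring Z R" and Z': "subcring Z' R" and C: "C \<subseteq> carrier R" "Z' \<subseteq> zspan Z C"
    and B: "B \<subseteq> carrier R"
  shows "zspan Z' B \<subseteq> zspan Z ((\<lambda>(c, b). c \<otimes> b) ` (C \<times> B))"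
proof
  let ?T = "(\<lambda>(c, b). c \<otimes> b) ` (C \<times> B)"
  have T: "?T \<subseteq> carrier R" using C B by auto
  note E = zsubD[OF Z zspan_zsub[OF Z T]]
  fix v assume "v \<in> zspan Z' B"
  then show "v \<in> zspan Z ?T"
  proof (induction rule: zspan_induct)
    case zero show ?case by (rule E(2))
  next
    case (step z b v)
    have "(\<lambda>c. c \<otimes> b) ` C \<subseteq> ?T" using step(2) by force
    then have "(\<lambda>c. c \<otimes> b) ` C \<subseteq> zspan Z ?T" using zspan_incl[OF Z T] by blast
    then have "z \<otimes> b \<in> zspan Z ?T"
      using step B C by (intro zspan_image_mult[OF Z C(1) _ _ T]) auto
    then show ?case using step E(3) by blast
  qed
qed

text \<open>An ideal of the image is generated by the images of generators of its preimage. Applied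
  to the map from the coefficient ring into a base change, this supplies the central noetherian
  subring over which everything else is generated.\<close>

lemma noetherian_image:
  assumes "ring_hom_ring C R \<phi>" and C: "noetherian_ring C" "cring C"
  shows "subcring (\<phi> ` carrier C) R" "noetherian_ring (R\<lparr>carrier := \<phi> ` carrier C\<rparr>)"
proof -
  interpret h: ring_hom_ring C R \<phi> by fact
  let ?Z = "\<phi> ` carrier C"
  interpret Zr: ring "R\<lparr>carrier := ?Z\<rparr>" by (rule h.img_is_ring)
  have sub: "?Z \<subseteq> carrier R" by auto
  show "subcring ?Z R"
  proof (rule subcringI[OF ring_incl_imp_subring[OF sub h.img_is_ring]])
    fix h1 h2 assume "h1 \<in> ?Z" "h2 \<in> ?Z"
    then obtain a b where ab: "a \<in> carrier C" "b \<in> carrier C" "h1 = \<phi> a" "h2 = \<phi> b" by auto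
    then have "\<phi> (a \<otimes>\<^bsub>C\<^esub> b) = \<phi> (b \<otimes>\<^bsub>C\<^esub> a)" using cring.cring_simprules(14)[OF C(2)] by simp
    then show "h1 \<otimes> h2 = h2 \<otimes> h1" using ab by simp
  qed
  have hZ: "ring_hom_ring C (R\<lparr>carrier := ?Z\<rparr>) \<phi>"
    by (rule ring_hom_ringI) (auto simp: h.R.ring_axioms Zr.ring_axioms)
  interpret hZ: ring_hom_ring C "R\<lparr>carrier := ?Z\<rparr>" \<phi> by (rule hZ)
  show "noetherian_ring (R\<lparr>carrier := ?Z\<rparr>)"
  proof (intro noetherian_ring.intro noetherian_ring_axioms.intro Zr.ring_axioms)
    fix I assume I: "ideal I (R\<lparr>carrier := ?Z\<rparr>)"
    have Isub: "I \<subseteq> ?Z" using additive_subgroup.a_subset[OF ideal.axioms(1)[OF I]] by simp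
    obtain A where A: "A \<subseteq> carrier C" "finite A" "{r \<in> carrier C. \<phi> r \<in> I} = Idl\<^bsub>C\<^esub> A"
      using noetherian_ring.finetely_gen[OF C(1) hZ.ideal_vimage[OF I]] by blast
    have AI: "\<phi> ` A \<subseteq> I" using h.R.genideal_self[OF A(1)] A(3) by auto
    have c: "\<phi> ` A \<subseteq> carrier (R\<lparr>carrier := ?Z\<rparr>)" using A(1) by auto
    have "Idl\<^bsub>C\<^esub> A \<subseteq> {r \<in> carrier C. \<phi> r \<in> Idl\<^bsub>R\<lparr>carrier := ?Z\<rparr>\<^esub> (\<phi> ` A)}"
      using A(1) Zr.genideal_self[OF c]
      by (intro h.R.genideal_minimal hZ.ideal_vimage Zr.genideal_ideal[OF c]) auto
    then have "I \<subseteq> Idl\<^bsub>R\<lparr>carrier := ?Z\<rparr>\<^esub> (\<phi> ` A)" using A(3) Isub by blast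
    moreover have "Idl\<^bsub>R\<lparr>carrier := ?Z\<rparr>\<^esub> (\<phi> ` A) \<subseteq> I" by (rule Zr.genideal_minimal[OF I AI])
    ultimately show "\<exists>A\<subseteq>carrier (R\<lparr>carrier := ?Z\<rparr>). finite A \<and> I = Idl\<^bsub>R\<lparr>carrier := ?Z\<rparr>\<^esub> A"
      using c A(2) by blast
  qed
qed

text \<open>Centrality of \<open>Z\<close> makes right ideals as well as left ideals submodules over
  \<open>Z\<close>, and the whole ring is a noetherian module over \<open>Z\<close>. Generators over
  \<open>Z\<close> generate the ideal a fortiori.\<close>

lemma noetherian_finite_over_center:
  assumes Z: "subcring Z R" and noeth: "noetherian_ring (R\<lparr>carrier := Z\<rparr>)"
    and central: "\<And>z a. z \<in> Z \<Longrightarrow> a \<in> carrier R \<Longrightarrow> z \<otimes> a = a \<otimes> z"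
    and B: "finite B" "B \<subseteq> carrier R" "carrier R = zspan Z B"
  shows "noetherian R"
proof -
  interpret M: module "R\<lparr>carrier := Z\<rparr>" "left_module R" by (rule subcring_module[OF Z])
  have fg: "\<exists>S. finite S \<and> S \<subseteq> I \<and> I = zspan Z S" if "zsub Z I" for I
    using M.noeth_in_lin_span[OF noeth B(1)] B zsubD(1)[OF Z that] that
    by (auto simp: noeth_in_def)
  have neg: "additive_subgroup I R" if "subgroup I (add_monoid R)" for I
    using that by (rule additive_subgroup.intro)
  have left: "zsub Z I" if I: "left_ideal I R" for I
    using I subcringE(1)[OF Z] additive_subgroup.a_subset[OF neg] additive_subgroup.a_closed[OF neg]
      additive_subgroup.zero_closed[OF neg]
    by (intro zsubI[OF Z]) (auto simp: left_ideal_def)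
  have right: "zsub Z I" if I: "right_ideal I R" for I
  proof (rule zsubI[OF Z])
    have I': "additive_subgroup I R" using I neg by (simp add: right_ideal_def)
    show IR: "I \<subseteq> carrier R" by (rule additive_subgroup.a_subset[OF I'])
    show "\<zero> \<in> I" by (rule additive_subgroup.zero_closed[OF I'])
    show "a \<oplus> b \<in> I" if "a \<in> I" "b \<in> I" for a b by (rule additive_subgroup.a_closed[OF I' that])
    show "z \<otimes> a \<in> I" if "z \<in> Z" "a \<in> I" for z a
    proof -
      have "a \<otimes> z \<in> I" using I that subcringE(1)[OF Z] by (auto simp: right_ideal_def)
      then show ?thesis using central[OF that(1)] that(2) IR by auto
    qed
  qed
  show ?thesis
    unfolding noetherian_def
  proof (intro conjI allI impI ring_axioms)
    fix I assume I: "left_ideal I R"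
    obtain S where S: "finite S" "S \<subseteq> I" "I = zspan Z S" using fg[OF left[OF I]] by blast
    have "(\<lambda>J. left_ideal J R) hull S = I"
      by (rule hull_unique) (use S I zspan_minimal[OF Z left] in auto)
    then show "\<exists>S. finite S \<and> S \<subseteq> I \<and> (\<lambda>J. left_ideal J R) hull S = I" using S by blast
  next
    fix I assume I: "right_ideal I R"
    obtain S where S: "finite S" "S \<subseteq> I" "I = zspan Z S" using fg[OF right[OF I]] by blast
    have "(\<lambda>J. right_ideal J R) hull S = I"
      by (rule hull_unique) (use S I zspan_minimal[OF Z right] in auto)
    then show "\<exists>S. finite S \<and> S \<subseteq> I \<and> (\<lambda>J. right_ideal J R) hull S = I" using S by blast
  qed
qed

end

section \<open>The standard identity\<close>

lemma word_eval_Nil [simp]: "word_eval A x [] = \<one>\<^bsub>A\<^esub>"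
  and word_eval_Cons [simp]: "word_eval A x (i # w) = x i \<otimes>\<^bsub>A\<^esub> word_eval A x w"
  by (simp_all add: word_eval_def)

lemma word_eval_map: "word_eval A x (map f w) = word_eval A (x \<circ> f) w"
  by (induction w) auto

context ring
begin

lemma word_eval_closed [simp]: "x ` set w \<subseteq> carrier R \<Longrightarrow> word_eval R x w \<in> carrier R"
  by (induction w) auto

lemma word_eval_append:
  "x ` set u \<subseteq> carrier R \<Longrightarrow> x ` set v \<subseteq> carrier R \<Longrightarrow>
   word_eval R x (u @ v) = word_eval R x u \<otimes> word_eval R x v"
  by (induction u) (auto simp: m_assoc)

lemma word_eval_upd_notin: "j \<notin> set w \<Longrightarrow> word_eval R (x(j := a)) w = word_eval R x w"
  by (induction w) auto

text \<open>The letter \<open>j\<close> occurs exactly once, so the product depends linearly on its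
  value; centrality lets the scalar travel to the front.\<close>

lemma word_eval_linear:
  assumes "distinct w" "j \<in> set w" "range x \<subseteq> carrier R" and z: "z \<in> carrier R"
    "\<And>a. a \<in> carrier R \<Longrightarrow> z \<otimes> a = a \<otimes> z" and bv: "b \<in> carrier R" "v \<in> carrier R"
  shows "word_eval R (x(j := z \<otimes> b \<oplus> v)) w
    = z \<otimes> word_eval R (x(j := b)) w \<oplus> word_eval R (x(j := v)) w"
  using assms(1,2)
proof (induction w)
  case (Cons i w)
  have c: "word_eval R (x(j := u)) w \<in> carrier R" if "u \<in> carrier R" for u
    using that assms(3) by (intro word_eval_closed) auto
  show ?case
  proof (cases "i = j")
    case True
    then have "j \<notin> set w" using Cons by auto
    moreover have "word_eval R x w \<in> carrier R" using assms(3) by (intro word_eval_closed) auto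
    ultimately show ?thesis
      using True bv z(1) assms(3) word_eval_closed[of x w]
      by (simp add: word_eval_upd_notin l_distr m_assoc del: fun_upd_apply) (simp add: l_distr m_assoc)
  next
    case False
    then have "distinct w" "j \<in> set w" using Cons.prems by auto
    note IH = Cons.IH[OF this]
    have xi: "x i \<in> carrier R" using assms(3) by auto
    have "x i \<otimes> (z \<otimes> word_eval R (x(j := b)) w) = z \<otimes> (x i \<otimes> word_eval R (x(j := b)) w)"
      using xi c[OF bv(1)] z(1) z(2)[OF xi] by (metis m_assoc)
    moreover have "word_eval R (x(j := u)) (i # w) = x i \<otimes> word_eval R (x(j := u)) w" for u
      using False by simp
    ultimately show ?thesis using IH xi c bv z(1) by (simp only: r_distr m_closed)
  qed
qed simp

end

text \<open>The standard polynomial of degree exceeding the number of generators is multilinear over the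
  centre and alternating, so it vanishes on generators by the pigeonhole principle.\<close>

lemma PI_finite_over_center:
  fixes F :: "('f, 'm) ring_scheme" and T :: "('f, 't, 'n) module_scheme"
  assumes alg: "noncomm_algebra F T" and F1: "\<one>\<^bsub>F\<^esub> \<noteq> \<zero>\<^bsub>F\<^esub>"
    and Z: "subcring Z T"
    and central: "\<And>z a. z \<in> Z \<Longrightarrow> a \<in> carrier T \<Longrightarrow> z \<otimes>\<^bsub>T\<^esub> a = a \<otimes>\<^bsub>T\<^esub> z"
    and B: "finite B" "B \<subseteq> carrier T" "carrier T = lin_span (T\<lparr>carrier := Z\<rparr>) (left_module T) B"
  shows "PI_algebra F T"
proof -
  interpret T: ring T using alg by (rule noncomm_algebra.axioms)
  interpret A: noncomm_algebra F T by fact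
  \<comment> \<open>One more argument than generators, so that any assignment of generators to the
    arguments repeats a value.\<close>
  define N where "N = Suc (card B)"
  define Pm where "Pm = {\<pi>. \<pi> permutes {..<N}}"
  define W where "W \<pi> = map \<pi> [0..<N]" for \<pi> :: "nat \<Rightarrow> nat"
  define sg where "sg \<pi> = (if evenperm \<pi> then \<one>\<^bsub>F\<^esub> else \<ominus>\<^bsub>F\<^esub> \<one>\<^bsub>F\<^esub>)" for \<pi> :: "nat \<Rightarrow> nat"
  \<comment> \<open>The coefficients of the standard polynomial: the word that lists the values of a
    permutation gets the sign of the permutation, every other word gets zero.\<close>
  define f where "f w = (if w \<in> W ` Pm then sg (inv_into Pm W w) else \<zero>\<^bsub>F\<^esub>)" for w
  have finP: "finite Pm" unfolding Pm_def by (rule finite_permutations) simp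
  have sgc: "sg \<pi> \<in> carrier F" for \<pi> by (simp add: sg_def)
  have "\<ominus>\<^bsub>F\<^esub> \<one>\<^bsub>F\<^esub> \<noteq> \<zero>\<^bsub>F\<^esub>" using F1 A.R.add.inv_eq_1_iff by blast
  then have sg0: "sg \<pi> \<noteq> \<zero>\<^bsub>F\<^esub>" for \<pi> using F1 by (simp add: sg_def)
  have injW: "inj_on W Pm"
  proof (rule inj_onI)
    fix \<pi> \<rho> assume p: "\<pi> \<in> Pm" "\<rho> \<in> Pm" and eq: "W \<pi> = W \<rho>"
    show "\<pi> = \<rho>"
    proof
      fix i show "\<pi> i = \<rho> i"
      proof (cases "i < N")
        case True
        then show ?thesis using eq unfolding W_def map_eq_conv by simp
      next
        case False
        then show ?thesis using p by (simp add: Pm_def permutes_def)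
      qed
    qed
  qed
  have fW: "f (W \<pi>) = sg \<pi>" if "\<pi> \<in> Pm" for \<pi>
    using that injW by (simp add: f_def)
  have supp: "{w. f w \<noteq> \<zero>\<^bsub>F\<^esub>} = W ` Pm" using sg0 by (auto simp: f_def)
  define S where "S a = (\<Oplus>\<^bsub>T\<^esub>\<pi>\<in>Pm. sg \<pi> \<odot>\<^bsub>T\<^esub> word_eval T a (W \<pi>))" for a
  have wc: "word_eval T a w \<in> carrier T" if "range a \<subseteq> carrier T" for a w
    using that by (intro T.word_eval_closed) auto
  have W: "distinct (W \<pi>)" "set (W \<pi>) = {..<N}" if "\<pi> \<in> Pm" for \<pi>
    using that permutes_inj_on[of \<pi> "{..<N}" "{0..<N}"] permutes_image[of \<pi> "{..<N}"]
    by (auto simp: Pm_def W_def distinct_map atLeast0LessThan)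
  have lin: "S (a(j := z \<otimes>\<^bsub>T\<^esub> b \<oplus>\<^bsub>T\<^esub> v)) = z \<otimes>\<^bsub>T\<^esub> S (a(j := b)) \<oplus>\<^bsub>T\<^esub> S (a(j := v))"
    if j: "j < N" and a: "range a \<subseteq> carrier T" and z: "z \<in> Z" and b: "b \<in> carrier T" and v: "v \<in> carrier T"
    for a j z b v
  proof -
    have zc: "z \<in> carrier T" using z subcringE(1)[OF Z] by auto
    have wb: "word_eval T (a(j := u)) w \<in> carrier T" if "u \<in> carrier T" for u w
      using that a by (intro wc) auto
    have "S (a(j := z \<otimes>\<^bsub>T\<^esub> b \<oplus>\<^bsub>T\<^esub> v)) =
      (\<Oplus>\<^bsub>T\<^esub>\<pi>\<in>Pm. z \<otimes>\<^bsub>T\<^esub> (sg \<pi> \<odot>\<^bsub>T\<^esub> word_eval T (a(j := b)) (W \<pi>)) \<oplus>\<^bsub>T\<^esub> sg \<pi> \<odot>\<^bsub>T\<^esub> word_eval T (a(j := v)) (W \<pi>))"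
      unfolding S_def
    proof (rule T.add.finprod_cong')
      fix \<pi> assume p: "\<pi> \<in> Pm"
      have "word_eval T (a(j := z \<otimes>\<^bsub>T\<^esub> b \<oplus>\<^bsub>T\<^esub> v)) (W \<pi>) =
         z \<otimes>\<^bsub>T\<^esub> word_eval T (a(j := b)) (W \<pi>) \<oplus>\<^bsub>T\<^esub> word_eval T (a(j := v)) (W \<pi>)"
        using W[OF p] j a zc central[OF z] b v by (intro T.word_eval_linear) auto
      then show "sg \<pi> \<odot>\<^bsub>T\<^esub> word_eval T (a(j := z \<otimes>\<^bsub>T\<^esub> b \<oplus>\<^bsub>T\<^esub> v)) (W \<pi>) =
         z \<otimes>\<^bsub>T\<^esub> (sg \<pi> \<odot>\<^bsub>T\<^esub> word_eval T (a(j := b)) (W \<pi>)) \<oplus>\<^bsub>T\<^esub> sg \<pi> \<odot>\<^bsub>T\<^esub> word_eval T (a(j := v)) (W \<pi>)"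
        using wb[OF b] wb[OF v] zc sgc by (simp add: A.smult_r_distr A.smult_mult_right)
    qed (use wb[OF b] wb[OF v] zc sgc in auto)
    also have "\<dots> = z \<otimes>\<^bsub>T\<^esub> S (a(j := b)) \<oplus>\<^bsub>T\<^esub> S (a(j := v))"
      unfolding S_def using wb[OF b] wb[OF v] zc sgc finP
      by (subst T.finsum_addf) (auto simp: T.finsum_rdistr)
    finally show ?thesis .
  qed
  \<comment> \<open>Composition with the transposition of two equal arguments pairs even with odd
    permutations and leaves the product of the values unchanged, so the terms cancel in pairs. In
    contrast to an argument by change of sign this involves no division by 2 and covers
    characteristic 2.\<close>
  have alt: "S a = \<zero>\<^bsub>T\<^esub>"
    if a: "range a \<subseteq> carrier T" and ij: "i < N" "j < N" "i \<noteq> j" "a i = a j" for a i j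
  proof -
    define \<tau> where "\<tau> = transpose i j"
    define Ev where "Ev = {\<pi> \<in> Pm. evenperm \<pi>}"
    have tau: "\<tau> permutes {..<N}" unfolding \<tau>_def using ij by (intro permutes_swap_id) auto
    have odd: "\<not> evenperm \<tau>" unfolding \<tau>_def using ij by (simp add: evenperm_swap)
    have perm: "permutation \<pi>" if "\<pi> \<in> Pm" for \<pi>
      using that permutation_permutes[of \<pi>] by (auto simp: Pm_def)
    have tc: "\<tau> \<circ> \<pi> \<in> Pm" if "\<pi> \<in> Pm" for \<pi> using that tau permutes_compose by (auto simp: Pm_def)
    have tt: "\<tau> \<circ> (\<tau> \<circ> \<pi>) = \<pi>" for \<pi> by (simp add: \<tau>_def fun_eq_iff)
    have evt: "evenperm (\<tau> \<circ> \<pi>) \<longleftrightarrow> \<not> evenperm \<pi>" if "\<pi> \<in> Pm" for \<pi>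
      using evenperm_comp[of \<tau> \<pi>] perm[OF that] tau odd permutation_permutes[of \<tau>] by auto
    have Pm: "Pm = Ev \<union> (\<circ>) \<tau> ` Ev"
    proof
      show "Pm \<subseteq> Ev \<union> (\<circ>) \<tau> ` Ev"
      proof
        fix \<pi> assume p: "\<pi> \<in> Pm"
        show "\<pi> \<in> Ev \<union> (\<circ>) \<tau> ` Ev"
        proof (cases "evenperm \<pi>")
          case False
          then have "\<tau> \<circ> \<pi> \<in> Ev" using p evt tc by (auto simp: Ev_def)
          then have "\<tau> \<circ> (\<tau> \<circ> \<pi>) \<in> (\<circ>) \<tau> ` Ev" by (rule imageI)
          then show ?thesis unfolding tt by simp
        qed (use p in \<open>auto simp: Ev_def\<close>)
      qed
    qed (use tc in \<open>auto simp: Ev_def\<close>)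
    have disj: "Ev \<inter> (\<circ>) \<tau> ` Ev = {}" using evt by (auto simp: Ev_def)
    have inj: "inj_on ((\<circ>) \<tau>) Ev" by (rule inj_onI) (metis tt)
    have at: "a \<circ> \<tau> = a" using ij(4) by (auto simp: \<tau>_def fun_eq_iff transpose_def)
    have wt: "word_eval T a (W (\<tau> \<circ> \<pi>)) = word_eval T a (W \<pi>)" for \<pi>
      unfolding W_def by (simp add: word_eval_map o_assoc at)
    define g where "g = (\<lambda>\<pi>. sg \<pi> \<odot>\<^bsub>T\<^esub> word_eval T a (W \<pi>))"
    have gc: "g \<in> Y \<rightarrow> carrier T" for Y unfolding g_def using wc[OF a] sgc by auto
    have finE: "finite Ev" using finP by (simp add: Ev_def)
    have "S a = finsum T g Ev \<oplus>\<^bsub>T\<^esub> finsum T g ((\<circ>) \<tau> ` Ev)"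
      unfolding S_def g_def[symmetric] Pm by (rule T.finsum_Un_disjoint) (use finE disj gc in auto)
    also have "finsum T g ((\<circ>) \<tau> ` Ev) = (\<Oplus>\<^bsub>T\<^esub>\<pi>\<in>Ev. g (\<tau> \<circ> \<pi>))"
      by (rule T.finsum_reindex[OF gc inj])
    also have "finsum T g Ev \<oplus>\<^bsub>T\<^esub> (\<Oplus>\<^bsub>T\<^esub>\<pi>\<in>Ev. g (\<tau> \<circ> \<pi>)) = (\<Oplus>\<^bsub>T\<^esub>\<pi>\<in>Ev. g \<pi> \<oplus>\<^bsub>T\<^esub> g (\<tau> \<circ> \<pi>))"
      by (rule T.finsum_addf[symmetric]) (use gc in auto)
    also have "\<dots> = \<zero>\<^bsub>T\<^esub>"
    proof (rule T.add.finprod_one_eqI)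
      fix \<pi> assume "\<pi> \<in> Ev"
      then have "sg \<pi> = \<one>\<^bsub>F\<^esub>" "sg (\<tau> \<circ> \<pi>) = \<ominus>\<^bsub>F\<^esub> \<one>\<^bsub>F\<^esub>" using evt by (auto simp: Ev_def sg_def)
      then show "g \<pi> \<oplus>\<^bsub>T\<^esub> g (\<tau> \<circ> \<pi>) = \<zero>\<^bsub>T\<^esub>"
        using wc[OF a] by (simp add: g_def wt A.smult_l_minus T.r_neg)
    qed
    finally show ?thesis .
  qed
  \<comment> \<open>Induction on the number of leading arguments that are not yet generators:
    multilinearity expands argument \<open>j\<close> over \<open>B\<close>, and once all arguments
    are generators two of them coincide.\<close>
  have van: "S a = \<zero>\<^bsub>T\<^esub>"
    if "range a \<subseteq> carrier T" "j \<le> N" "\<And>i. j \<le> i \<Longrightarrow> i < N \<Longrightarrow> a i \<in> B" for a j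
    using that
  proof (induction j arbitrary: a)
    case 0
    have "\<not> inj_on a {..<N}"
    proof
      assume "inj_on a {..<N}"
      then have "card {..<N} \<le> card B" using 0 B(1) by (intro card_inj_on_le[of a]) auto
      then show False by (simp add: N_def)
    qed
    then obtain i j where "i < N" "j < N" "i \<noteq> j" "a i = a j" by (auto simp: inj_on_def)
    then show ?case by (intro alt[OF 0(1)])
  next
    case (Suc j)
    have jN: "j < N" using Suc.prems by auto
    have aj: "a j \<in> T.zspan Z B" using Suc.prems(1) B(3) by auto
    have "S (a(j := u)) = \<zero>\<^bsub>T\<^esub>" if "u \<in> T.zspan Z B" for u
      using that
    proof (induction rule: T.zspan_induct)
      case zero
      have Sb: "S (a(j := \<zero>\<^bsub>T\<^esub>)) \<in> carrier T"
        unfolding S_def using Suc.prems(1) sgc by (intro T.finsum_closed) (auto intro!: A.smult_closed wc)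
      have "S (a(j := \<one>\<^bsub>T\<^esub> \<otimes>\<^bsub>T\<^esub> \<zero>\<^bsub>T\<^esub> \<oplus>\<^bsub>T\<^esub> \<zero>\<^bsub>T\<^esub>)) = \<one>\<^bsub>T\<^esub> \<otimes>\<^bsub>T\<^esub> S (a(j := \<zero>\<^bsub>T\<^esub>)) \<oplus>\<^bsub>T\<^esub> S (a(j := \<zero>\<^bsub>T\<^esub>))"
        by (rule lin[OF jN Suc.prems(1)]) (use subcringE(3)[OF Z] in auto)
      then have "S (a(j := \<zero>\<^bsub>T\<^esub>)) = S (a(j := \<zero>\<^bsub>T\<^esub>)) \<oplus>\<^bsub>T\<^esub> S (a(j := \<zero>\<^bsub>T\<^esub>))" using Sb by simp
      then show ?case using T.add.r_cancel_one'[OF Sb Sb] by blast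
    next
      case (step z b v)
      have "S (a(j := b)) = \<zero>\<^bsub>T\<^esub>"
      proof (rule Suc.IH)
        show "range (a(j := b)) \<subseteq> carrier T" using Suc.prems(1) step(2) B(2) by auto
        show "(a(j := b)) i \<in> B" if "j \<le> i" "i < N" for i
          using Suc.prems(3)[of i] that step(2) by (cases "i = j") auto
      qed (use jN in simp)
      moreover have "S (a(j := z \<otimes>\<^bsub>T\<^esub> b \<oplus>\<^bsub>T\<^esub> v)) = z \<otimes>\<^bsub>T\<^esub> S (a(j := b)) \<oplus>\<^bsub>T\<^esub> S (a(j := v))"
        using step B(2,3) by (intro lin[OF jN Suc.prems(1)]) auto
      moreover have "z \<in> carrier T" using step(1) subcringE(1)[OF Z] by auto
      ultimately show ?case using step(4) by (simp add: fun_upd_def)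
    qed
    from this[OF aj] show ?case by simp
  qed
  show ?thesis
    unfolding PI_algebra_def
  proof (intro exI[of _ f] conjI allI impI)
    show "range f \<subseteq> carrier F" using sgc by (auto simp: f_def)
    show "finite {w. f w \<noteq> \<zero>\<^bsub>F\<^esub>}" unfolding supp using finP by simp
    have "id \<in> Pm" by (simp add: Pm_def permutes_id)
    then show "{w. f w \<noteq> \<zero>\<^bsub>F\<^esub>} \<noteq> {}" unfolding supp by auto
    fix a :: "nat \<Rightarrow> 't" assume a: "range a \<subseteq> carrier T"
    have "(\<Oplus>\<^bsub>T\<^esub>w\<in>W ` Pm. f w \<odot>\<^bsub>T\<^esub> word_eval T a w) = (\<Oplus>\<^bsub>T\<^esub>\<pi>\<in>Pm. f (W \<pi>) \<odot>\<^bsub>T\<^esub> word_eval T a (W \<pi>))"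
      by (rule T.finsum_reindex[OF _ injW]) (use wc[OF a] sgc in \<open>auto simp: f_def\<close>)
    also have "\<dots> = S a"
      unfolding S_def by (rule T.add.finprod_cong') (use wc[OF a] sgc fW in auto)
    also have "\<dots> = \<zero>\<^bsub>T\<^esub>" by (rule van[of a N]) (use a in auto)
    finally show "(\<Oplus>\<^bsub>T\<^esub>w\<in>{w. f w \<noteq> \<zero>\<^bsub>F\<^esub>}. f w \<odot>\<^bsub>T\<^esub> word_eval T a w) = \<zero>\<^bsub>T\<^esub>"
      unfolding supp .
  qed
qed

section \<open>Inner derivations in prime characteristic\<close>

context ring
begin

definition ad :: "'a \<Rightarrow> 'a \<Rightarrow> 'a" where
  "ad y b = y \<otimes> b \<ominus> b \<otimes> y"

lemma ad_closed [simp]: "y \<in> carrier R \<Longrightarrow> b \<in> carrier R \<Longrightarrow> ad y b \<in> carrier R"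
  by (simp add: ad_def)

lemma ad_pow_closed [simp]: "y \<in> carrier R \<Longrightarrow> b \<in> carrier R \<Longrightarrow> (ad y ^^ n) b \<in> carrier R"
  by (induction n) auto

lemma ad_eq: "y \<in> carrier R \<Longrightarrow> b \<in> carrier R \<Longrightarrow> y \<otimes> b = b \<otimes> y \<oplus> ad y b"
  using a_lcomm[of "b \<otimes> y" "y \<otimes> b" "\<ominus> (b \<otimes> y)"] by (simp add: ad_def minus_eq r_neg)

lemma ad_eqI: "y \<in> carrier R \<Longrightarrow> b \<in> carrier R \<Longrightarrow> d \<in> carrier R \<Longrightarrow> y \<otimes> b = b \<otimes> y \<oplus> d \<Longrightarrow> ad y b = d"
  using a_comm[of "b \<otimes> y" d] by (simp add: ad_def minus_eq r_neg a_assoc)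

lemma ad_eq_zero_iff: "y \<in> carrier R \<Longrightarrow> b \<in> carrier R \<Longrightarrow> ad y b = \<zero> \<longleftrightarrow> y \<otimes> b = b \<otimes> y"
  by (simp add: ad_def)

lemma ad_add: "y \<in> carrier R \<Longrightarrow> b \<in> carrier R \<Longrightarrow> c \<in> carrier R \<Longrightarrow> ad y (b \<oplus> c) = ad y b \<oplus> ad y c"
  by (simp add: ad_def minus_eq r_distr l_distr minus_add a_ac)

lemma ad_add_left: "y \<in> carrier R \<Longrightarrow> z \<in> carrier R \<Longrightarrow> c \<in> carrier R \<Longrightarrow> ad (y \<oplus> z) c = ad y c \<oplus> ad z c"
  by (simp add: ad_def minus_eq r_distr l_distr minus_add a_ac)

lemma ad_minus: "y \<in> carrier R \<Longrightarrow> b \<in> carrier R \<Longrightarrow> ad y (\<ominus> b) = \<ominus> ad y b"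
  by (simp add: ad_def minus_eq r_minus l_minus minus_add a_ac)

lemma ad_minus_left: "y \<in> carrier R \<Longrightarrow> b \<in> carrier R \<Longrightarrow> ad (\<ominus> y) b = \<ominus> ad y b"
  by (simp add: ad_def minus_eq r_minus l_minus minus_add a_ac)

lemma ad_mult:
  assumes c: "y \<in> carrier R" "b \<in> carrier R" "c \<in> carrier R"
  shows "ad y (b \<otimes> c) = ad y b \<otimes> c \<oplus> b \<otimes> ad y c"
proof (rule ad_eqI)
  have "y \<otimes> (b \<otimes> c) = (b \<otimes> y \<oplus> ad y b) \<otimes> c"
    using c ad_eq[of y b] by (simp add: m_assoc[symmetric])
  also have "\<dots> = b \<otimes> (c \<otimes> y \<oplus> ad y c) \<oplus> ad y b \<otimes> c"
    using c ad_eq[of y c] by (simp add: l_distr m_assoc)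
  also have "\<dots> = b \<otimes> c \<otimes> y \<oplus> (ad y b \<otimes> c \<oplus> b \<otimes> ad y c)"
    using c by (simp add: r_distr m_assoc a_ac)
  finally show "y \<otimes> (b \<otimes> c) = b \<otimes> c \<otimes> y \<oplus> (ad y b \<otimes> c \<oplus> b \<otimes> ad y c)" .
qed (use c in auto)

lemma ad_mult_left:
  assumes c: "y \<in> carrier R" "z \<in> carrier R" "b \<in> carrier R" and "z \<otimes> b = b \<otimes> z"
  shows "ad (z \<otimes> y) b = z \<otimes> ad y b"
proof (rule ad_eqI)
  have "z \<otimes> y \<otimes> b = z \<otimes> (b \<otimes> y \<oplus> ad y b)"
    using c ad_eq[of y b] by (simp add: m_assoc)
  also have "\<dots> = (z \<otimes> b) \<otimes> y \<oplus> z \<otimes> ad y b" using c by (simp add: r_distr m_assoc)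
  also have "\<dots> = b \<otimes> (z \<otimes> y) \<oplus> z \<otimes> ad y b" unfolding assms(4) using c by (simp add: m_assoc)
  finally show "z \<otimes> y \<otimes> b = b \<otimes> (z \<otimes> y) \<oplus> z \<otimes> ad y b" .
qed (use c in auto)

lemma ad_generate_ring:
  assumes H: "H \<subseteq> carrier R" and y: "y \<in> carrier R"
    and "\<And>h. h \<in> H \<Longrightarrow> ad y h \<in> generate_ring R H"
    and g: "g \<in> generate_ring R H"
  shows "ad y g \<in> generate_ring R H"
  using g
proof induction
  case one
  have "ad y \<one> = \<zero>" using y by (simp add: ad_eq_zero_iff)
  then show ?case by (simp add: zero_in_generate)
next
  case (a_inv h)
  then show ?case using generate_ring_in_carrier[OF H] y by (simp add: ad_minus generate_ring.a_inv)
next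
  case (eng_add h1 h2)
  then show ?case using generate_ring_in_carrier[OF H] y by (simp add: ad_add generate_ring.eng_add)
next
  case (eng_mult h1 h2)
  then show ?case using generate_ring_in_carrier[OF H] y
    by (simp add: ad_mult generate_ring.eng_add generate_ring.eng_mult)
qed (rule assms(3))

text \<open>Left multiplication by \<open>y\<close> is the sum of right multiplication by
  \<open>y\<close> and \<open>ad y\<close>, and these two operators commute; the identity is their
  binomial theorem applied to \<open>b\<close>.\<close>

lemma pow_mult_ad:
  assumes y: "y \<in> carrier R" and b: "b \<in> carrier R"
  shows "y [^] n \<otimes> b = (\<Oplus>i\<in>{..n}. [(n choose i)] \<cdot> ((ad y ^^ i) b \<otimes> y [^] (n - i)))"
proof (induction n)
  case 0
  then show ?case using y b by simp
next
  case (Suc n)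
  let ?D = "\<lambda>i. (ad y ^^ i) b"
  have Dc: "?D i \<in> carrier R" for i using y b by simp
  have "y [^] Suc n \<otimes> b = y \<otimes> (y [^] n \<otimes> b)"
    using y b nat_pow_Suc2[OF y, of n] by (simp add: m_assoc del: nat_pow_Suc)
  also have "\<dots> = (\<Oplus>i\<in>{..n}. y \<otimes> ([(n choose i)] \<cdot> (?D i \<otimes> y [^] (n - i))))"
    unfolding Suc using y Dc by (intro finsum_rdistr) auto
  also have "\<dots> = (\<Oplus>i\<in>{..n}. [(n choose i)] \<cdot> (?D (Suc i) \<otimes> y [^] (n - i)) \<oplus>
      [(n choose i)] \<cdot> (?D i \<otimes> y [^] (Suc n - i)))"
  proof (rule add.finprod_cong')
    fix i assume i: "i \<in> {..n}"
    have "y \<otimes> (?D i \<otimes> y [^] (n - i)) = (?D i \<otimes> y \<oplus> ?D (Suc i)) \<otimes> y [^] (n - i)"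
      using y Dc[of i] ad_eq[OF y Dc[of i]] by (simp add: m_assoc[symmetric])
    also have "\<dots> = ?D (Suc i) \<otimes> y [^] (n - i) \<oplus> ?D i \<otimes> y [^] (Suc n - i)"
      using y Dc[of i] Dc[of "Suc i"] i nat_pow_Suc2[OF y, of "n - i"]
      by (simp add: l_distr m_assoc Suc_diff_le a_comm del: nat_pow_Suc funpow.simps)
    finally show "y \<otimes> ([(n choose i)] \<cdot> (?D i \<otimes> y [^] (n - i))) =
      [(n choose i)] \<cdot> (?D (Suc i) \<otimes> y [^] (n - i)) \<oplus> [(n choose i)] \<cdot> (?D i \<otimes> y [^] (Suc n - i))"
      using y Dc[of i] Dc[of "Suc i"]
      by (simp add: add_pow_rdistr add.nat_pow_distrib del: funpow.simps)
  qed (use y Dc in auto)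
  also have "\<dots> = (\<Oplus>i\<in>{..n}. [(n choose i)] \<cdot> (?D (Suc i) \<otimes> y [^] (n - i))) \<oplus>
      (\<Oplus>i\<in>{..n}. [(n choose i)] \<cdot> (?D i \<otimes> y [^] (Suc n - i)))"
    using y Dc by (intro finsum_addf) (auto simp del: funpow.simps)
  \<comment> \<open>The new summand at \<open>Suc n\<close> is zero together with its binomial
    coefficient. It is added so that splitting off index \<open>0\<close> leaves both sums with the
    same range, ready for Pascal's rule.\<close>
  also have "(\<Oplus>i\<in>{..n}. [(n choose i)] \<cdot> (?D i \<otimes> y [^] (Suc n - i))) =
      (\<Oplus>i\<in>{..Suc n}. [(n choose i)] \<cdot> (?D i \<otimes> y [^] (Suc n - i)))"
    using y Dc by (subst finsum_Suc) (auto simp: binomial_eq_0 simp del: funpow.simps)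
  also have "\<dots> = (\<Oplus>i\<in>{..n}. [(n choose Suc i)] \<cdot> (?D (Suc i) \<otimes> y [^] (n - i))) \<oplus>
      b \<otimes> y [^] Suc n"
    using y b Dc by (subst finsum_Suc2) (auto simp del: funpow.simps)
  also have "(\<Oplus>i\<in>{..n}. [(n choose i)] \<cdot> (?D (Suc i) \<otimes> y [^] (n - i))) \<oplus>
      ((\<Oplus>i\<in>{..n}. [(n choose Suc i)] \<cdot> (?D (Suc i) \<otimes> y [^] (n - i))) \<oplus> b \<otimes> y [^] Suc n) =
      (\<Oplus>i\<in>{..n}. [(n choose i)] \<cdot> (?D (Suc i) \<otimes> y [^] (n - i)) \<oplus>
        [(n choose Suc i)] \<cdot> (?D (Suc i) \<otimes> y [^] (n - i))) \<oplus> b \<otimes> y [^] Suc n"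
    using y Dc b by (subst finsum_addf) (auto simp: a_assoc simp del: funpow.simps)
  also have "(\<Oplus>i\<in>{..n}. [(n choose i)] \<cdot> (?D (Suc i) \<otimes> y [^] (n - i)) \<oplus>
        [(n choose Suc i)] \<cdot> (?D (Suc i) \<otimes> y [^] (n - i))) =
      (\<Oplus>i\<in>{..n}. [(Suc n choose Suc i)] \<cdot> (?D (Suc i) \<otimes> y [^] (Suc n - Suc i)))"
    using y Dc by (intro add.finprod_cong') (auto simp: add.nat_pow_mult simp del: funpow.simps)
  also have "\<dots> \<oplus> b \<otimes> y [^] Suc n =
      (\<Oplus>i\<in>{..Suc n}. [(Suc n choose i)] \<cdot> (?D i \<otimes> y [^] (Suc n - i)))"
    using y b Dc by (subst finsum_Suc2) (auto simp del: funpow.simps)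
  finally show ?case .
qed

lemma char_mult_zero:
  assumes "[p] \<cdot> \<one> = \<zero>" "p dvd k" "a \<in> carrier R" shows "[(k::nat)] \<cdot> a = \<zero>"
proof -
  obtain m where m: "k = p * m" using assms(2) by auto
  have "[p] \<cdot> a = [p] \<cdot> \<one> \<otimes> a" using assms(3) by (simp add: add_pow_ldistr)
  then have "[p] \<cdot> a = \<zero>" using assms by simp
  then have "[m] \<cdot> ([p] \<cdot> a) = \<zero>" by simp
  then show ?thesis unfolding m using assms(3) by (simp add: add.nat_pow_pow)
qed

lemma commutes_pow:
  "y \<in> carrier R \<Longrightarrow> c \<in> carrier R \<Longrightarrow> y \<otimes> c = c \<otimes> y \<Longrightarrow> y [^] n \<otimes> c = c \<otimes> y [^] (n::nat)"
  by (induction n) (simp, metis m_assoc nat_pow_Suc nat_pow_closed)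

context
  fixes p :: nat
  assumes p: "Factorial_Ring.prime p" and char: "[p] \<cdot> \<one> = \<zero>"
begin

text \<open>In the binomial expansion all inner coefficients are divisible by \<open>p\<close>, so
  only the terms for \<open>0\<close> and \<open>p\<close> survive.\<close>

lemma ad_pow_prime:
  assumes y: "y \<in> carrier R" and b: "b \<in> carrier R"
  shows "ad (y [^] p) b = (ad y ^^ p) b"
proof (rule ad_eqI)
  let ?t = "\<lambda>i. [(p choose i)] \<cdot> ((ad y ^^ i) b \<otimes> y [^] (p - i))"
  have tc: "?t i \<in> carrier R" for i using y b by simp
  have t0: "?t i = \<zero>" if "i \<in> {0<..<p}" for i
    using that y b by (intro char_mult_zero[OF char]) (auto intro!: dvd_choose_prime p)
  have p0: "0 < p" using p by (simp add: prime_gt_0_nat)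
  have "y [^] p \<otimes> b = finsum R ?t {..p}" by (rule pow_mult_ad[OF y b])
  also have "\<dots> = finsum R ?t {0, p}"
    using t0 tc by (intro add.finprod_mono_neutral_cong_right) auto
  also have "\<dots> = b \<otimes> y [^] p \<oplus> (ad y ^^ p) b"
    using p0 y b tc by (subst finsum_insert) (auto)
  finally show "y [^] p \<otimes> b = b \<otimes> y [^] p \<oplus> (ad y ^^ p) b" .
qed (use y b in auto)

text \<open>In general \<open>ad\<close> of a power is not an iterate of \<open>ad\<close>, but for
  powers of \<open>p\<close> it is; hence stability of the mere set \<open>S\<close> under
  \<open>ad y\<close> is enough.\<close>

lemma ad_pow_prime_power_stable:
  assumes y: "y \<in> carrier R" and S: "S \<subseteq> carrier R" "\<And>t. t \<in> S \<Longrightarrow> ad y t \<in> S" and t: "t \<in> S"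
  shows "ad (y [^] (p ^ i)) t \<in> S"
  using t
proof (induction i arbitrary: t)
  case 0
  then show ?case using y S(2) by simp
next
  case (Suc i)
  have "(ad (y [^] (p ^ i)) ^^ k) t \<in> S" for k
    using Suc by (induction k) auto
  moreover have "ad (y [^] (p ^ Suc i)) t = (ad (y [^] (p ^ i)) ^^ p) t"
    using ad_pow_prime[of "y [^] (p ^ i)" t] y Suc.prems S(1)
    by (auto simp: nat_pow_pow mult.commute)
  ultimately show ?case by simp
qed

text \<open>As \<open>z\<close> commutes with \<open>ad y z\<close>, the derivation obeys the
  commutative power rule on powers of \<open>z\<close>, and the factor \<open>p\<close> annihilates
  the result.\<close>

lemma frobenius_commutes:
  assumes y: "y \<in> carrier R" and z: "z \<in> carrier R" and c: "z \<otimes> ad y z = ad y z \<otimes> z"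
  shows "y \<otimes> z [^] p = z [^] p \<otimes> y"
proof -
  \<comment> \<open>At \<open>m = 0\<close> the truncated exponent \<open>m - 1\<close> is harmless,
    since the right-hand side is a zero multiple.\<close>
  have "ad y (z [^] m) = [m] \<cdot> (z [^] (m - 1) \<otimes> ad y z)" for m :: nat
  proof (induction m)
    case 0
    then show ?case using y by (simp add: ad_eq_zero_iff)
  next
    case (Suc m)
    have "ad y (z [^] Suc m) = [m] \<cdot> (z [^] (m - 1) \<otimes> ad y z) \<otimes> z \<oplus> z [^] m \<otimes> ad y z"
      using y z Suc by (simp add: ad_mult)
    also have "[m] \<cdot> (z [^] (m - 1) \<otimes> ad y z) \<otimes> z = [m] \<cdot> (z [^] m \<otimes> ad y z)"
    proof (cases m)
      case (Suc k)
      have "z [^] k \<otimes> ad y z \<otimes> z = z [^] k \<otimes> (z \<otimes> ad y z)"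
        unfolding c using y z by (simp add: m_assoc)
      also have "\<dots> = z [^] m \<otimes> ad y z" using y z Suc by (simp add: m_assoc)
      finally have e: "z [^] k \<otimes> ad y z \<otimes> z = z [^] m \<otimes> ad y z" .
      have km: "m - 1 = k" using Suc by simp
      show ?thesis unfolding km using add_pow_ldistr[of "z [^] k \<otimes> ad y z" z m] e y z by simp
    qed (use y z in simp)
    finally show ?case using y z by (simp add: add.nat_pow_Suc)
  qed
  from this[of p] have "ad y (z [^] p) = \<zero>" using char_mult_zero[OF char dvd_refl] y z by simp
  then show ?thesis using y z by (simp add: ad_eq_zero_iff)
qed

end

end

text \<open>The span of the whole sequence has finitely many generators, which together involve
  finitely many terms; any later term is a combination of these. The outcome is a linear relation
  with leading coefficient one, which later makes a polynomial monic.\<close>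

lemma (in module) noeth_in_sequence:
  assumes N: "noeth_in R M N" "submodule N R M" and v: "range v \<subseteq> N"
  shows "\<exists>m::nat. v m \<in> lin_span R M (v ` {..<m})"
proof -
  have vc: "v ` A \<subseteq> carrier M" for A using v submoduleE(1)[OF N(2)] by auto
  obtain S where S: "finite S" "S \<subseteq> lin_span R M (range v)" "lin_span R M (range v) = lin_span R M S"
    using N(1) lin_span_submodule[OF vc] lin_span_minimal[OF N(2) v] unfolding noeth_in_def by metis
  have "\<exists>m. u \<in> lin_span R M (v ` {..<m})" if "u \<in> lin_span R M (range v)" for u
    using that
  proof induction
    case zero
    show ?case by (auto intro: lin_span.zero)
  next
    case (step r s u)
    then obtain m i where m: "u \<in> lin_span R M (v ` {..<m})" "s = v i" by auto
    have "u \<in> lin_span R M (v ` {..<max m (Suc i)})"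
      using m(1) lin_span_mono[of "v ` {..<m}" "v ` {..<max m (Suc i)}" R R M] by (auto simp: image_mono)
    moreover have "s \<in> v ` {..<max m (Suc i)}" using m(2) by auto
    ultimately show ?case by (intro exI[of _ "max m (Suc i)"] lin_span.step[OF step(1)])
  qed
  then have "\<forall>s\<in>S. \<exists>m. s \<in> lin_span R M (v ` {..<m})" using S(2) by auto
  then obtain f where f: "\<And>s. s \<in> S \<Longrightarrow> s \<in> lin_span R M (v ` {..<f s})" by metis
  obtain m where m: "\<And>s. s \<in> S \<Longrightarrow> f s \<le> m"
    using S(1) by (metis finite_imageI finite_nat_set_iff_bounded_le imageI)
  have "S \<subseteq> lin_span R M (v ` {..<m})"
  proof
    fix s assume s: "s \<in> S"
    have "v ` {..<f s} \<subseteq> v ` {..<m}" using m[OF s] by auto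
    then show "s \<in> lin_span R M (v ` {..<m})" using f[OF s] lin_span_mono[of _ _ R R M] by blast
  qed
  then have "lin_span R M S \<subseteq> lin_span R M (v ` {..<m})"
    by (rule lin_span_minimal[OF lin_span_submodule[OF vc]])
  moreover have "v m \<in> lin_span R M (range v)" using lin_span_incl[OF vc] by auto
  ultimately show ?thesis using S(3) by blast
qed

section \<open>Finiteness over central subrings in prime characteristic\<close>

context ring
begin

lemma zspan_left_closed:
  assumes Z: "subcring Z R" and S: "S \<subseteq> carrier R" and h: "h \<in> carrier R"
    and comm: "\<And>z. z \<in> Z \<Longrightarrow> h \<otimes> z = z \<otimes> h"
    and hS: "\<And>s. s \<in> S \<Longrightarrow> h \<otimes> s \<in> zspan Z S" and v: "v \<in> zspan Z S"
  shows "h \<otimes> v \<in> zspan Z S"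
  using v
proof (induction rule: zspan_induct)
  case zero
  then show ?case using h zspan_zero by simp
next
  case (step z s v)
  note E = zsubD[OF Z zspan_zsub[OF Z S]]
  have c: "z \<in> carrier R" "s \<in> carrier R" "v \<in> carrier R" using step S E(1) subcringE(1)[OF Z] by auto
  have "h \<otimes> (z \<otimes> s \<oplus> v) = (h \<otimes> z) \<otimes> s \<oplus> h \<otimes> v" using c h by (simp add: r_distr m_assoc)
  also have "\<dots> = z \<otimes> (h \<otimes> s) \<oplus> h \<otimes> v" unfolding comm[OF step(1)] using c h by (simp add: m_assoc)
  finally show ?case using step hS E(3,4) by simp
qed

text \<open>Every adjoined \<open>e\<close> is integral over \<open>Z\<close> through its
  \<open>p\<close>-th power, so at each step of the induction its powers below \<open>p\<close>
  suffice.\<close>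

lemma generate_ring_finite_module:
  assumes Z: "subcring Z R" and p: "(p::nat) > 0" and fin: "finite E" and E: "E \<subseteq> carrier R"
    and comm: "\<And>e h. e \<in> E \<Longrightarrow> h \<in> Z \<union> E \<Longrightarrow> e \<otimes> h = h \<otimes> e"
    and pow: "\<And>e. e \<in> E \<Longrightarrow> e [^] p \<in> Z"
  shows "\<exists>C. finite C \<and> C \<subseteq> generate_ring R (Z \<union> E) \<and> generate_ring R (Z \<union> E) \<subseteq> zspan Z C"
  using fin E comm pow
proof (induction E)
  case empty
  have "generate_ring R Z \<subseteq> Z"
    using generate_ring_min_subring1[OF subcringE(1)[OF Z] subcring.axioms(1)[OF Z]] by simp
  moreover have "z \<in> zspan Z {\<one>}" if "z \<in> Z" for z
    using zspan_mult_incl[OF Z _ _ that, of "{\<one>}" \<one>] that subcringE(1)[OF Z] by auto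
  ultimately show ?case by (intro exI[of _ "{\<one>}"]) (auto intro: generate_ring.one)
next
  case (insert e E)
  let ?G = "generate_ring R (Z \<union> E)" and ?G' = "generate_ring R (Z \<union> insert e E)"
  have ZE: "Z \<union> E \<subseteq> carrier R" and ZE': "Z \<union> insert e E \<subseteq> carrier R" and e: "e \<in> carrier R"
    using subcringE(1)[OF Z] insert.prems by auto
  obtain C where C: "finite C" "C \<subseteq> ?G" "?G \<subseteq> zspan Z C"
    using insert.IH insert.prems by auto
  have GG': "?G \<subseteq> ?G'" by (rule generate_ring_mono) auto
  have eG': "e [^] (i::nat) \<in> ?G'" for i
    by (induction i) (auto intro: generate_ring.one generate_ring.incl generate_ring.eng_mult)
  have Gc: "?G \<subseteq> carrier R" by (rule generate_ring_incl[OF ZE])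
  have comme: "e \<otimes> g = g \<otimes> e" if "g \<in> ?G" for g
    by (rule generate_ring_commutes[OF ZE e _ that]) (use insert.prems(2)[of e] in blast)
  define T where "T = (\<lambda>(c, i). c \<otimes> e [^] i) ` (C \<times> {..<p})"
  have T: "T \<subseteq> carrier R" using C(2) Gc e by (auto simp: T_def)
  note WE = zsubD[OF Z zspan_zsub[OF Z T]]
  have gT: "g \<otimes> e [^] i \<in> zspan Z T" if "g \<in> ?G" "i < p" for g i
  proof (rule zspan_image_mult[OF Z _ _ _ T])
    show "(\<lambda>s. s \<otimes> e [^] i) ` C \<subseteq> zspan Z T"
      using zspan_incl[OF Z T] that(2) by (auto simp: T_def)
  qed (use C Gc e that in auto)
  have "?G' \<subseteq> zspan Z T"
  proof (rule generate_ring_subset_left[OF ZE' WE(1) _ WE(5) WE(3)])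
    show "\<one> \<in> zspan Z T" using gT[OF generate_ring.one p] by simp
    fix h v assume h: "h \<in> Z \<union> insert e E" and v: "v \<in> zspan Z T"
    show "h \<otimes> v \<in> zspan Z T"
    proof (rule zspan_left_closed[OF Z T _ _ _ v])
      show "h \<in> carrier R" using h ZE' by auto
      show "h \<otimes> z = z \<otimes> h" if "z \<in> Z" for z
        using h that insert.prems(2) subcringE(8)[OF Z] by auto
      fix s assume "s \<in> T"
      then obtain c i where ci: "c \<in> C" "i < p" "s = c \<otimes> e [^] i" by (auto simp: T_def)
      then have cG: "c \<in> ?G" "c \<in> carrier R" using C(2) Gc by auto
      show "h \<otimes> s \<in> zspan Z T"
      proof (cases "h = e")
        case False
        then have hG: "h \<in> ?G" using h by (auto intro: generate_ring.incl)
        then have "h \<otimes> s = (h \<otimes> c) \<otimes> e [^] i" using ci cG Gc e by (auto simp: m_assoc)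
        then show ?thesis using gT[OF generate_ring.eng_mult[OF hG cG(1)] ci(2)] by simp
      next
        case True
        have "e \<otimes> s = (e \<otimes> c) \<otimes> e [^] i" using ci cG e by (simp add: m_assoc)
        also have "\<dots> = c \<otimes> e [^] Suc i"
          unfolding comme[OF cG(1)] using cG e nat_pow_Suc2[OF e, of i] by (simp add: m_assoc del: nat_pow_Suc)
        finally have es: "e \<otimes> s = c \<otimes> e [^] Suc i" .
        show ?thesis
        proof (cases "Suc i < p")
          case True
          then show ?thesis using gT[OF cG(1) True] es \<open>h = e\<close> by simp
        next
          case False
          \<comment> \<open>The exponent overflows: \<open>e [^] p\<close> belongs to
            \<open>Z\<close> and joins the coefficient \<open>c\<close>, and the exponent starts
            again at \<open>0\<close>.\<close>
          then have "Suc i = p" using ci by simp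
          then have "c \<otimes> e [^] Suc i = (c \<otimes> e [^] p) \<otimes> e [^] (0::nat)" using cG e by simp
          moreover have "e [^] p \<in> ?G" using insert.prems(3) by (auto intro: generate_ring.incl)
          ultimately show ?thesis
            using gT[OF generate_ring.eng_mult[OF cG(1)] p] es \<open>h = e\<close> by simp
        qed
      qed
    qed
  qed
  moreover have "T \<subseteq> ?G'"
    using C(2) GG' eG' by (auto simp: T_def intro: generate_ring.eng_mult)
  moreover have "finite T" using C(1) by (simp add: T_def)
  ultimately show ?case by blast
qed

text \<open>The elements of \<open>E\<close> have to commute with \<open>T\<close> only, because in
  a tower the next generator need not commute with them. Adjoining finitely many elements, instead
  of taking the full centre, keeps the coefficient ring noetherian over a noetherian
  \<open>Z\<close>.\<close>

definition finite_over_center :: "'a set \<Rightarrow> 'a set \<Rightarrow> bool" where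
  "finite_over_center Z T \<longleftrightarrow> (\<exists>E B. finite E \<and> E \<subseteq> T \<and> (\<forall>e\<in>E. \<forall>t\<in>T. e \<otimes> t = t \<otimes> e) \<and>
     finite B \<and> B \<subseteq> T \<and> T \<subseteq> zspan (generate_ring R (Z \<union> E)) B)"

context
  fixes Z w
  assumes Z: "subcring Z R" and w: "w \<in> carrier R" and comm: "\<forall>z\<in>Z. w \<otimes> z = z \<otimes> w"
begin

text \<open>A monic polynomial of degree \<open>m\<close> is written as \<open>w [^] m\<close> plus
  an element of \<open>pspan Z w m\<close>, which keeps the leading coefficient visible although
  degrees are only bounds.\<close>

lemma monic_mult:
  assumes "r \<in> pspan Z w m" "s \<in> pspan Z w n"
  shows "\<exists>t\<in>pspan Z w (m + n). (w [^] m \<oplus> r) \<otimes> (w [^] n \<oplus> s) = w [^] (m + n) \<oplus> t"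
proof -
  note PE = pspanE[OF Z w comm]
  have c: "r \<in> carrier R" "s \<in> carrier R" using assms PE(1) by auto
  have "(\<lambda>u. u \<otimes> w [^] n) ` (\<lambda>i. w [^] i) ` {..<m} \<subseteq> pspan Z w (m + n)"
    using w pspan_pow[OF Z w comm] by (auto simp: nat_pow_mult)
  then have "r \<otimes> w [^] n \<in> pspan Z w (m + n)"
    by (intro zspan_image_mult[OF Z _ _ assms(1)]) (use w in auto)
  then have "w [^] m \<otimes> s \<oplus> (r \<otimes> w [^] n \<oplus> r \<otimes> s) \<in> pspan Z w (m + n)"
    using pspan_shift[OF Z w comm assms(2), of m] pspan_mult[OF Z w comm assms] PE(3) by blast
  moreover have "(w [^] m \<oplus> r) \<otimes> (w [^] n \<oplus> s) = w [^] (m + n) \<oplus> (w [^] m \<otimes> s \<oplus> (r \<otimes> w [^] n \<oplus> r \<otimes> s))"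
    using c w by (simp add: l_distr r_distr nat_pow_mult a_ac)
  ultimately show ?thesis by blast
qed

lemma monic_pow:
  assumes r: "r \<in> pspan Z w n"
  shows "\<exists>t\<in>pspan Z w (n * i). (w [^] n \<oplus> r) [^] i = w [^] (n * i) \<oplus> t"
proof (induction i)
  case 0
  show ?case by (rule bexI[of _ \<zero>]) (use zspan_zero in auto)
next
  case (Suc i)
  then obtain t where t: "t \<in> pspan Z w (n * i)" "(w [^] n \<oplus> r) [^] i = w [^] (n * i) \<oplus> t" by blast
  then show ?case using monic_mult[OF t(1) r] by (simp add: add.commute)
qed

lemma pspan_commutes:
  assumes v: "v \<in> pspan Z w n" and a: "a \<in> carrier R" "a \<otimes> w = w \<otimes> a" "\<And>z. z \<in> Z \<Longrightarrow> a \<otimes> z = z \<otimes> a"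
  shows "a \<otimes> v = v \<otimes> a"
  using v
proof (induction rule: zspan_induct)
  case zero
  then show ?case using a by simp
next
  case (step z s v)
  then obtain i where i: "s = w [^] (i::nat)" by auto
  have c: "z \<in> carrier R" "v \<in> carrier R" "s \<in> carrier R"
    using step(1,3) i w subcringE(1)[OF Z] pspanE(1)[OF Z w comm] by auto
  have as: "a \<otimes> s = s \<otimes> a"
    using commutes_pow[OF w a(1) a(2)[symmetric], of i] i by simp
  have "a \<otimes> (z \<otimes> s) = (a \<otimes> z) \<otimes> s" using c a by (simp add: m_assoc)
  also have "\<dots> = z \<otimes> (a \<otimes> s)" unfolding a(3)[OF step(1)] using c a by (simp add: m_assoc)
  also have "\<dots> = (z \<otimes> s) \<otimes> a" unfolding as using c a by (simp add: m_assoc)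
  finally show ?case using step(4) c a by (simp add: l_distr r_distr)
qed

end

text \<open>The centre of the smaller ring is replaced by the subring of its \<open>p\<close>-th powers, which \<open>ad x\<close>
  kills. Noetherianity then yields, one generator at a time, a monic additive polynomial in \<open>x\<close> that
  commutes with everything.\<close>

lemma finite_over_center_step:
  assumes p: "Factorial_Ring.prime (p::nat)" and char: "[p] \<cdot> \<one> = \<zero>"
    and Z0: "subcring Z0 R" and noeth: "noetherian_ring (R\<lparr>carrier := Z0\<rparr>)"
    and central: "\<And>z a. z \<in> Z0 \<Longrightarrow> a \<in> carrier R \<Longrightarrow> z \<otimes> a = a \<otimes> z"
    and G: "finite G" "G \<subseteq> carrier R" and x: "x \<in> carrier R"
    and adx: "\<And>g. g \<in> G \<Longrightarrow> ad x g \<in> generate_ring R (Z0 \<union> G)"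
    and IH: "finite_over_center Z0 (generate_ring R (Z0 \<union> G))"
  shows "finite_over_center Z0 (generate_ring R (Z0 \<union> insert x G))"
proof -
  define T where "T = generate_ring R (Z0 \<union> G)"
  note Z0E = subcringE[OF Z0]
  have H: "Z0 \<union> G \<subseteq> carrier R" using Z0E(1) G by auto
  have Tc: "T \<subseteq> carrier R" unfolding T_def by (rule generate_ring_incl[OF H])
  note TE = subringE[OF generate_ring_is_subring[OF H], folded T_def]
  have Z0T: "Z0 \<subseteq> T" and GT: "G \<subseteq> T" by (auto simp: T_def intro: generate_ring.incl)
  have adT: "ad x t \<in> T" if "t \<in> T" for t
    unfolding T_def
  proof (rule ad_generate_ring[OF H x _ that[unfolded T_def]])
    fix h assume "h \<in> Z0 \<union> G"
    moreover have "ad x h = \<zero>" if "h \<in> Z0"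
      using central[OF that x] x that Z0E(1) by (simp add: ad_eq_zero_iff subset_eq)
    ultimately show "ad x h \<in> generate_ring R (Z0 \<union> G)" using adx zero_in_generate by auto
  qed
  obtain E B where E': "finite E" "E \<subseteq> T" "\<forall>e\<in>E. \<forall>t\<in>T. e \<otimes> t = t \<otimes> e"
    and B: "finite B" "B \<subseteq> T" "T \<subseteq> zspan (generate_ring R (Z0 \<union> E)) B"
    using IH unfolding finite_over_center_def T_def[symmetric] by (elim exE conjE)
  have E: "finite E" "E \<subseteq> T" "\<And>e t. e \<in> E \<Longrightarrow> t \<in> T \<Longrightarrow> e \<otimes> t = t \<otimes> e"
    using E' by blast+
  have p0: "p > 0" using p by (simp add: prime_gt_0_nat)
  define Ep where "Ep = (\<lambda>e. e [^] p) ` E"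
  have powT: "t [^] (k::nat) \<in> T" if "t \<in> T" for t k
    by (induction k) (use that TE in auto)
  have EpT: "Ep \<subseteq> T" using E(2) powT by (auto simp: Ep_def)
  have Epc: "e \<otimes> t = t \<otimes> e" if "e \<in> Ep" "t \<in> T" for e t
    using that E(2,3) Tc by (auto simp: Ep_def intro!: commutes_pow)
  define Z where "Z = generate_ring R (Z0 \<union> Ep)"
  have ZH: "Z0 \<union> Ep \<subseteq> carrier R" using Z0E(1) EpT Tc by auto
  have finEp: "finite Ep" and EpR: "Ep \<subseteq> carrier R" using E(1) EpT Tc by (auto simp: Ep_def)
  have Epc': "e \<otimes> h = h \<otimes> e" if "e \<in> Ep" "h \<in> Z0 \<union> Ep" for e h
    by (rule Epc[OF that(1)]) (use that(2) EpT Z0T in blast)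
  note Zn = noetherian_generate_finite[OF Z0 noeth finEp EpR Epc', folded Z_def]
  have Z: "subcring Z R" and Znoeth: "noetherian_ring (R\<lparr>carrier := Z\<rparr>)" using Zn by blast+
  have ZT: "Z \<subseteq> T"
    unfolding Z_def T_def
    by (rule generate_ring_min_subring1[OF ZH generate_ring_is_subring[OF H]])
      (use EpT Z0T in \<open>auto simp: T_def\<close>)
  have Zcentral: "a \<otimes> z = z \<otimes> a" if a: "a \<in> carrier R" "\<And>e. e \<in> Ep \<Longrightarrow> a \<otimes> e = e \<otimes> a" and z: "z \<in> Z" for a z
    by (rule generate_ring_commutes[OF ZH a(1) _ z[unfolded Z_def]])
      (use a central[symmetric, OF _ a(1)] in blast)
  have Zc: "t \<otimes> z = z \<otimes> t" if "t \<in> T" "z \<in> Z" for t z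
    by (rule Zcentral) (use that Tc Epc[symmetric, OF _ that(1)] in auto)
  \<comment> \<open>\<open>ad x\<close> maps \<open>T\<close> into itself and the elements of
    \<open>E\<close> commute with \<open>T\<close>; so each \<open>e'\<close> commutes with
    \<open>ad x e'\<close>, and its \<open>p\<close>-th power commutes with
    \<open>x\<close>.\<close>
  have xZ: "x \<otimes> z = z \<otimes> x" if "z \<in> Z" for z
  proof (rule Zcentral[OF x _ that])
    fix e assume "e \<in> Ep"
    then obtain e' where e': "e' \<in> E" "e = e' [^] p" by (auto simp: Ep_def)
    have "e' \<otimes> ad x e' = ad x e' \<otimes> e'" using e' E(2,3) adT by auto
    then show "x \<otimes> e = e \<otimes> x"
      unfolding e'(2) using e' E(2) Tc x by (intro frobenius_commutes[OF p char]) auto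
  qed
  have xZ': "\<forall>z\<in>Z. x \<otimes> z = z \<otimes> x" using xZ by blast
  have Ec: "E \<subseteq> carrier R" using E(2) Tc by auto
  \<comment> \<open>Passing to \<open>p\<close>-th powers costs one more finite layer: the old
    coefficient ring lies in a ring that is finite over \<open>Z\<close>, hence \<open>T\<close> is
    finite over \<open>Z\<close> too.\<close>
  have "\<exists>C. finite C \<and> C \<subseteq> generate_ring R (Z \<union> E) \<and> generate_ring R (Z \<union> E) \<subseteq> zspan Z C"
  proof (rule generate_ring_finite_module[OF Z p0 E(1) Ec])
    show "e [^] p \<in> Z" if "e \<in> E" for e
      unfolding Z_def Ep_def using that by (auto intro: generate_ring.incl)
    show "e \<otimes> h = h \<otimes> e" if "e \<in> E" "h \<in> Z \<union> E" for e h
      using that E(2) ZT by (intro E(3)) auto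
  qed
  then obtain C where C: "finite C" "C \<subseteq> generate_ring R (Z \<union> E)" "generate_ring R (Z \<union> E) \<subseteq> zspan Z C"
    by blast
  have CT: "C \<subseteq> T"
  proof -
    have "generate_ring R (Z \<union> E) \<subseteq> T" unfolding T_def
      by (rule generate_ring_min_subring1[OF _ generate_ring_is_subring[OF H]])
        (use ZT E(2) Tc in \<open>auto simp: T_def\<close>)
    then show ?thesis using C(2) by blast
  qed
  define B1 where "B1 = (\<lambda>(c, b). c \<otimes> b) ` (C \<times> B)"
  have B1: "finite B1" "B1 \<subseteq> T" using C(1) B(1,2) CT TE(6) by (auto simp: B1_def)
  then have B1c: "B1 \<subseteq> carrier R" using Tc by auto
  have ZE: "subcring (generate_ring R (Z0 \<union> E)) R"
    by (rule noetherian_generate_finite[OF Z0 noeth E(1) Ec, THEN conjunct1]) (use E(2,3) Z0T in auto)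
  have "generate_ring R (Z0 \<union> E) \<subseteq> zspan Z C"
    using C(3) generate_ring_mono[of "Z0 \<union> E" "Z \<union> E"] by (auto simp: Z_def intro: generate_ring.incl)
  then have "T \<subseteq> zspan Z B1"
    unfolding B1_def using zspan_trans[OF Z ZE _ _ _, of C B] CT Tc B(2,3) by blast
  moreover have TZ: "zsub Z T" using TE Tc ZT by (intro zsubI[OF Z]) auto
  ultimately have TB1: "T = zspan Z B1" using zspan_minimal[OF Z TZ B1(2)] by blast
  interpret M: module "R\<lparr>carrier := Z\<rparr>" "left_module R" by (rule subcring_module[OF Z])
  have Tnoeth: "noeth_in (R\<lparr>carrier := Z\<rparr>) (left_module R) T"
    unfolding TB1 by (rule M.noeth_in_lin_span[OF Znoeth B1(1)]) (use B1c in simp)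
  note PE = pspanE[OF Z x xZ']
  \<comment> \<open>That \<open>ad y\<close> preserves \<open>T\<close> is part of the invariant
    because the next round applies the noetherianity of \<open>T\<close> to the orbit of a further
    generator. The start is \<open>x\<close> itself, with degree \<open>1\<close> and remainder
    zero.\<close>
  have "\<exists>y n r. n > 0 \<and> r \<in> pspan Z x n \<and> y = x [^] n \<oplus> r \<and> (\<forall>t\<in>T. ad y t \<in> T) \<and> (\<forall>c\<in>Y. ad y c = \<zero>)"
    if "finite Y" "Y \<subseteq> G" for Y
    using that
  proof (induction Y)
    case empty
    show ?case
      by (rule exI[of _ x], rule exI[of _ "1::nat"], rule exI[of _ \<zero>]) (use x adT zspan_zero in auto)
  next
    case (insert b Y)
    then obtain y n r where n: "(n::nat) > 0" and r: "r \<in> pspan Z x n" and y: "y = x [^] n \<oplus> r"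
      and yT: "\<And>t. t \<in> T \<Longrightarrow> ad y t \<in> T" and yY: "\<And>c. c \<in> Y \<Longrightarrow> ad y c = \<zero>" by auto
    have yc: "y \<in> carrier R" using y r x PE(1) by auto
    have bT: "b \<in> T" and bc: "b \<in> carrier R" using insert.prems GT Tc by auto
    have Yc: "Y \<subseteq> carrier R" using insert.prems G(2) by auto
    \<comment> \<open>Only exponents that are powers of \<open>p\<close> are used: for these
      \<open>ad\<close> of the power is an iterate of \<open>ad y\<close>, so the sequence stays in
      \<open>T\<close> and some \<open>v m\<close> depends on its predecessors over
      \<open>Z\<close>.\<close>
    define v where "v i = ad (y [^] (p ^ i)) b" for i
    have stable: "ad (y [^] (p ^ i)) t \<in> T" if "t \<in> T" for i t
      by (rule ad_pow_prime_power_stable[OF p char yc Tc yT that])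
    obtain m where m: "v m \<in> zspan Z (v ` {..<m})"
      using M.noeth_in_sequence[OF Tnoeth TZ, of v] stable[OF bT] by (auto simp: v_def)
    let ?Q = "(\<lambda>i. y [^] (p ^ i)) ` {..<m}"
    have Qc: "?Q \<subseteq> carrier R" using yc by auto
    note QE = zsubD[OF Z zspan_zsub[OF Z Qc]]
    \<comment> \<open>The coefficients in \<open>Z\<close> commute with \<open>b\<close>, so a
      relation among the \<open>v i\<close> lifts to the same combination of the powers
      \<open>y [^] (p ^ i)\<close>.\<close>
    have "\<exists>q\<in>zspan Z ?Q. ad q b = u" if "u \<in> zspan Z (v ` {..<m})" for u
      using that
    proof (induction rule: zspan_induct)
      case zero
      show ?case by (rule bexI[of _ \<zero>]) (use bc QE(2) in \<open>auto simp: ad_eq_zero_iff\<close>)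
    next
      case (step z s u)
      then obtain q i where q: "q \<in> zspan Z ?Q" "ad q b = u" "i < m" "s = v i" by auto
      have zc: "z \<in> carrier R" using step ZT Tc by auto
      have "ad (z \<otimes> y [^] (p ^ i) \<oplus> q) b = z \<otimes> s \<oplus> u"
        using zc yc bc q QE(1) Zc[OF bT step(1)]
        by (auto simp: ad_add_left ad_mult_left v_def subset_eq)
      moreover have "z \<otimes> y [^] (p ^ i) \<oplus> q \<in> zspan Z ?Q"
        using step(1) q by (intro zspan_step) auto
      ultimately show ?case by blast
    qed
    then obtain q where q: "q \<in> zspan Z ?Q" "ad q b = v m" using m by blast
    have qc: "q \<in> carrier R" using q QE(1) by auto
    \<comment> \<open>Stability of \<open>T\<close> under \<open>ad q\<close> keeps the invariant,
      and vanishing on \<open>Y\<close> keeps what the earlier rounds achieved.\<close>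
    have qT: "ad q t \<in> T \<and> (t \<in> Y \<longrightarrow> ad q t = \<zero>)" if t: "t \<in> T" for t
      using q(1)
    proof (induction rule: zspan_induct)
      case zero
      have "ad \<zero> t = \<zero>" using t Tc by (auto simp: ad_eq_zero_iff)
      then show ?case using TE(2) by simp
    next
      case (step z s u)
      then obtain i where i: "s = y [^] (p ^ i)" by auto
      have c: "z \<in> carrier R" "t \<in> carrier R" "u \<in> carrier R" using step ZT Tc t QE(1) by auto
      have eq: "ad (z \<otimes> s \<oplus> u) t = z \<otimes> ad s t \<oplus> ad u t"
        using c yc i Zc[OF t step(1)] by (simp add: ad_add_left ad_mult_left)
      have "ad s t = \<zero>" if "t \<in> Y"
        using yY[OF that] commutes_pow[OF yc c(2), of "p ^ i"] yc c i by (simp add: ad_eq_zero_iff)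
      then show ?case using eq stable[OF t, of i] i step(1,4) ZT TE(6,7) c by auto
    qed
    \<comment> \<open>\<open>ad y' b\<close> is \<open>v m\<close> minus its own expansion by
      earlier terms, hence zero.\<close>
    define y' where "y' = y [^] (p ^ m) \<oplus> \<ominus> q"
    have ad': "ad y' t = ad (y [^] (p ^ m)) t \<oplus> \<ominus> ad q t" if "t \<in> carrier R" for t
      using that yc qc by (simp add: y'_def ad_add_left ad_minus_left)
    have "ad y' t \<in> T" if "t \<in> T" for t
      using ad'[of t] that Tc stable[OF that] qT[OF that] TE(5,7) by auto
    moreover have "ad y' c = \<zero>" if "c \<in> insert b Y" for c
    proof (cases "c = b")
      case True
      then show ?thesis using ad'[OF bc] q yc bc by (simp add: v_def r_neg)
    next
      case False
      then have c: "c \<in> Y" "c \<in> T" "c \<in> carrier R" using that insert.prems GT Yc by auto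
      have "ad (y [^] (p ^ m)) c = \<zero>"
        using yY[OF c(1)] commutes_pow[OF yc c(3), of "p ^ m"] yc c by (simp add: ad_eq_zero_iff)
      then show ?thesis using ad'[OF c(3)] qT[OF c(2)] c(1) by simp
    qed
    moreover have "\<exists>r'\<in>pspan Z x (n * p ^ m). y' = x [^] (n * p ^ m) \<oplus> r'"
    proof -
      obtain t where t: "t \<in> pspan Z x (n * p ^ m)" "y [^] (p ^ m) = x [^] (n * p ^ m) \<oplus> t"
        using monic_pow[OF Z x xZ' r, of "p ^ m"] y by auto
      \<comment> \<open>The exponents in \<open>q\<close> satisfy \<open>p ^ i < p ^ m\<close>, so
        all its terms have degree in \<open>x\<close> below \<open>n * p ^ m\<close>: subtracting
        \<open>q\<close> leaves \<open>y'\<close> monic.\<close>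
      have "?Q \<subseteq> pspan Z x (n * p ^ m)"
      proof clarify
        fix i assume "i < m"
        then have "p ^ i < p ^ m" using prime_gt_1_nat[OF p] by (intro power_strict_increasing) auto
        then have i: "n * p ^ i < n * p ^ m" using n by simp
        obtain t where t: "t \<in> pspan Z x (n * p ^ i)" "y [^] (p ^ i) = x [^] (n * p ^ i) \<oplus> t"
          using monic_pow[OF Z x xZ' r, of "p ^ i"] y by auto
        have "t \<in> pspan Z x (n * p ^ m)" using t(1) pspan_mono[OF Z x xZ', of "n * p ^ i" "n * p ^ m"] i by auto
        then show "y [^] (p ^ i) \<in> pspan Z x (n * p ^ m)"
          unfolding t(2) using pspan_pow[OF Z x xZ' i] by (intro PE(3)) auto
      qed
      then have "q \<in> pspan Z x (n * p ^ m)"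
        using zspan_minimal[OF Z pspan_zsub[OF Z x xZ']] q(1) by blast
      then have "t \<oplus> \<ominus> q \<in> pspan Z x (n * p ^ m)" using t(1) PE(3,5) by blast
      moreover have "y' = x [^] (n * p ^ m) \<oplus> (t \<oplus> \<ominus> q)"
        unfolding y'_def t(2) using subsetD[OF PE(1) t(1)] qc x by (simp add: a_assoc)
      ultimately show ?thesis by blast
    qed
    moreover have "n * p ^ m > 0" using n p0 by simp
    ultimately show ?case by blast
  qed
  from this[OF G(1) subset_refl] obtain y n r where n: "(n::nat) > 0" and r: "r \<in> pspan Z x n"
    and y: "y = x [^] n \<oplus> r" and yG: "\<And>c. c \<in> G \<Longrightarrow> ad y c = \<zero>" by blast
  have rc: "r \<in> carrier R" using r PE(1) by auto
  have yc: "y \<in> carrier R" using y rc x by auto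
  define H' where "H' = Z0 \<union> insert x G"
  define T' where "T' = generate_ring R H'"
  have H'c: "H' \<subseteq> carrier R" using H x by (auto simp: H'_def)
  have T'c: "T' \<subseteq> carrier R" unfolding T'_def by (rule generate_ring_incl[OF H'c])
  note T'E = subringE[OF generate_ring_is_subring[OF H'c], folded T'_def]
  have TT': "T \<subseteq> T'" unfolding T_def T'_def H'_def by (rule generate_ring_mono) auto
  have xT': "x \<in> T'" by (auto simp: T'_def H'_def intro: generate_ring.incl)
  have xkT': "x [^] (k::nat) \<in> T'" for k by (induction k) (use T'E xT' in auto)
  have "zsub Z T'" using T'E T'c ZT TT' by (intro zsubI[OF Z]) auto
  then have "r \<in> T'" using zspan_minimal[OF Z, of T' "(\<lambda>i. x [^] i) ` {..<n}"] r xkT' by auto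
  then have yT': "y \<in> T'" unfolding y using T'E(7) xkT' by blast
  have yx: "y \<otimes> x = x \<otimes> y"
  proof -
    have "x \<otimes> r = r \<otimes> x" by (rule pspan_commutes[OF Z x xZ' r]) (use x xZ in auto)
    moreover have "x \<otimes> x [^] n = x [^] n \<otimes> x" using x nat_pow_Suc2[OF x, of n] by simp
    ultimately show ?thesis unfolding y using x rc by (simp add: l_distr r_distr)
  qed
  have yT'c: "y \<otimes> t = t \<otimes> y" if "t \<in> T'" for t
  proof (rule generate_ring_commutes[OF H'c yc _ that[unfolded T'_def]])
    fix h assume h: "h \<in> H'"
    then consider "h \<in> Z0" | "h = x" | "h \<in> G" by (auto simp: H'_def)
    then show "y \<otimes> h = h \<otimes> y"
    proof cases
      case 1 then show ?thesis using central[OF 1 yc] by simp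
    next
      case 2 then show ?thesis using yx by simp
    next
      case 3 then show ?thesis using yG[OF 3] yc G(2) by (auto simp: ad_eq_zero_iff)
    qed
  qed
  \<comment> \<open>\<open>y\<close> commutes with \<open>x\<close>, being a polynomial in
    \<open>x\<close> over \<open>Z\<close>, and with \<open>G\<close> and \<open>Z0\<close>; so it
    is central in the enlarged ring and joins the \<open>p\<close>-th powers.\<close>
  define E' where "E' = insert y Ep"
  have E'T': "E' \<subseteq> T'" using yT' EpT TT' by (auto simp: E'_def)
  have EpZ: "Ep \<subseteq> Z" by (auto simp: Z_def intro: generate_ring.incl)
  have comm_h: "h \<otimes> z = z \<otimes> h" if "h \<in> H'" "z \<in> Z" for h z
    using that Zc[OF _ that(2)] xZ[OF that(2)] Z0T GT by (auto simp: H'_def)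
  have E'c: "e \<otimes> t = t \<otimes> e" if e: "e \<in> E'" and t: "t \<in> T'" for e t
  proof (cases "e = y")
    case True
    then show ?thesis using yT'c[OF t] by simp
  next
    case False
    then have "e \<in> Z" using e EpZ by (auto simp: E'_def)
    then show ?thesis
      using e t E'T' T'c comm_h[symmetric]
      by (intro generate_ring_commutes[OF H'c _ _ t[unfolded T'_def]]) auto
  qed
  define Z' where "Z' = generate_ring R (Z0 \<union> E')"
  have Z0T': "Z0 \<subseteq> T'" using Z0T TT' by auto
  have finE': "finite E'" using E(1) by (simp add: E'_def Ep_def)
  have E'R: "E' \<subseteq> carrier R" using E'T' T'c by blast
  have E'cc: "e \<otimes> h = h \<otimes> e" if "e \<in> E'" "h \<in> Z0 \<union> E'" for e h
    by (rule E'c[OF that(1)]) (use that(2) E'T' Z0T' in blast)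
  have Z': "subcring Z' R"
    using noetherian_generate_finite[OF Z0 noeth finE' E'R E'cc, folded Z'_def] by blast
  have ZZ': "Z \<subseteq> Z'" unfolding Z_def Z'_def E'_def by (rule generate_ring_mono) auto
  have yZ': "y \<in> Z'" by (auto simp: Z'_def E'_def intro: generate_ring.incl)
  have Z'H: "Z0 \<union> E' \<subseteq> carrier R" using Z0T' E'T' T'c by auto
  have hZ': "h \<otimes> z = z \<otimes> h" if h: "h \<in> H'" and z: "z \<in> Z'" for h z
  proof (rule generate_ring_commutes[OF Z'H _ _ z[unfolded Z'_def]])
    show hc: "h \<in> carrier R" using h H'c by auto
    have hT': "h \<in> T'" using h by (auto simp: T'_def intro: generate_ring.incl)
    show "h \<otimes> k = k \<otimes> h" if "k \<in> Z0 \<union> E'" for k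
      using that central[symmetric, OF _ hc] E'c[symmetric, OF _ hT'] by auto
  qed
  \<comment> \<open>The power \<open>x [^] n\<close> can be traded for \<open>y\<close> and lower
    powers, since \<open>y\<close> is monic of degree \<open>n\<close> and has become a scalar; so
    the exponents below \<open>n\<close> suffice.\<close>
  define B' where "B' = (\<lambda>(b, i). b \<otimes> x [^] i) ` (B1 \<times> {..<n})"
  have B'c: "B' \<subseteq> carrier R" using B1c x by (auto simp: B'_def)
  note WE = zsubD[OF Z' zspan_zsub[OF Z' B'c]]
  have tx: "t \<otimes> x [^] i \<in> zspan Z' B'" if "t \<in> T" "i < n" for t i
  proof (rule zspan_image_mult[OF Z' B1c _ _ B'c])
    show "t \<in> zspan Z' B1"
      using that(1) TB1 lin_span_mono[of B1 B1 "R\<lparr>carrier := Z\<rparr>" "R\<lparr>carrier := Z'\<rparr>" "left_module R"] ZZ' by auto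
    show "(\<lambda>s. s \<otimes> x [^] i) ` B1 \<subseteq> zspan Z' B'"
      using zspan_incl[OF Z' B'c] that(2) by (auto simp: B'_def)
  qed (use x in simp)
  have tr: "t \<otimes> u \<in> zspan Z' B'" if t: "t \<in> T" and u: "u \<in> pspan Z x n" for t u
    using u
  proof (induction rule: zspan_induct)
    case zero
    then show ?case using t Tc WE(2) by auto
  next
    case (step z s u)
    then obtain i where i: "i < n" "s = x [^] i" by auto
    have c: "z \<in> carrier R" "s \<in> carrier R" "u \<in> carrier R" "t \<in> carrier R"
      using step(1,3) i x ZT Tc t PE(1) by auto
    have "t \<otimes> (z \<otimes> s \<oplus> u) = (t \<otimes> z) \<otimes> s \<oplus> t \<otimes> u" using c by (simp add: r_distr m_assoc)
    also have "\<dots> = z \<otimes> (t \<otimes> s) \<oplus> t \<otimes> u" unfolding Zc[OF t step(1)] using c by (simp add: m_assoc)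
    finally show ?case using tx[OF t i(1)] i(2) step(1,4) ZZ' WE(3,4) by auto
  qed
  have txn: "t \<otimes> x [^] n \<in> zspan Z' B'" if t: "t \<in> T" for t
  proof -
    have tc: "t \<in> carrier R" using t Tc by auto
    have "x [^] n = y \<oplus> \<ominus> r" unfolding y using x rc by (simp add: a_assoc r_neg)
    then have "t \<otimes> x [^] n = y \<otimes> (t \<otimes> x [^] (0::nat)) \<oplus> \<ominus> (t \<otimes> r)"
      using tc yc rc yT'c[of t] t TT' by (auto simp: r_distr r_minus)
    then show ?thesis using WE(3,4,5) yZ' tx[OF t n] tr[OF t r] by simp
  qed
  have "T' \<subseteq> zspan Z' B'"
    unfolding T'_def
  proof (rule generate_ring_subset_left[OF H'c WE(1) _ WE(5) WE(3)])
    show "\<one> \<in> zspan Z' B'" using tx[OF TE(3) n] by simp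
    fix h v assume h: "h \<in> H'" and v: "v \<in> zspan Z' B'"
    have hc: "h \<in> carrier R" using h H'c by auto
    show "h \<otimes> v \<in> zspan Z' B'"
    proof (rule zspan_left_closed[OF Z' B'c hc hZ'[OF h] _ v])
      fix s assume "s \<in> B'"
      then obtain b i where bi: "b \<in> B1" "i < n" "s = b \<otimes> x [^] i" by (auto simp: B'_def)
      then have b: "b \<in> T" "b \<in> carrier R" using B1(2) Tc by auto
      show "h \<otimes> s \<in> zspan Z' B'"
      proof (cases "h = x")
        case False
        then have hT: "h \<in> T" using h Z0T GT by (auto simp: H'_def)
        have "h \<otimes> s = (h \<otimes> b) \<otimes> x [^] i" using bi b hc x by (simp add: m_assoc)
        then show ?thesis using tx[OF TE(6)[OF hT b(1)] bi(2)] by simp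
      next
        case True
        \<comment> \<open>Moving \<open>x\<close> to the right of \<open>b\<close> costs
          \<open>ad x b\<close>, which stays in \<open>T\<close>: the second summand keeps the
          exponent \<open>i\<close>, and only the first may reach the exponent
          \<open>n\<close>.\<close>
        have "h \<otimes> s = (b \<otimes> x \<oplus> ad x b) \<otimes> x [^] i"
          using True bi b x ad_eq[OF x b(2)] by (simp add: m_assoc[symmetric])
        also have "\<dots> = b \<otimes> x [^] Suc i \<oplus> ad x b \<otimes> x [^] i"
          using b x nat_pow_Suc2[OF x, of i] by (simp add: l_distr m_assoc del: nat_pow_Suc)
        moreover have "b \<otimes> x [^] Suc i \<in> zspan Z' B'"
          using tx[OF b(1), of "Suc i"] txn[OF b(1)] bi(2) by (cases "Suc i = n") auto
        ultimately show ?thesis using tx[OF adT[OF b(1)] bi(2)] WE(3) by simp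
      qed
    qed
  qed
  moreover have "B' \<subseteq> T'" using B1(2) TT' xkT' T'E(6) by (auto simp: B'_def)
  moreover have "finite B'" using B1(1) by (simp add: B'_def)
  ultimately have W: "T' \<subseteq> zspan Z' B'" "B' \<subseteq> T'" "finite B'" by simp_all
  show ?thesis
    unfolding finite_over_center_def H'_def[symmetric] T'_def[symmetric]
  proof (rule exI[of _ E'], rule exI[of _ B'], intro conjI ballI)
    show "e \<otimes> t = t \<otimes> e" if "e \<in> E'" "t \<in> T'" for e t by (rule E'c[OF that])
  qed (use W finE' E'T' in \<open>simp_all add: Z'_def[symmetric]\<close>)
qed

text \<open>The tower starts with \<open>Z0\<close>, which is spanned over itself by the unit. At
  the top the generated ring is everything, so commuting with it is genuine centrality.\<close>

theorem finite_over_center_tower: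
  assumes p: "Factorial_Ring.prime (p::nat)" and char: "[p] \<cdot> \<one> = \<zero>"
    and Z0: "subcring Z0 R" and noeth: "noetherian_ring (R\<lparr>carrier := Z0\<rparr>)"
    and central: "\<And>z a. z \<in> Z0 \<Longrightarrow> a \<in> carrier R \<Longrightarrow> z \<otimes> a = a \<otimes> z"
    and x: "x ` {1..n} \<subseteq> carrier R"
    and adx: "\<And>k j. k < n \<Longrightarrow> j \<in> {1..k} \<Longrightarrow> ad (x (Suc k)) (x j) \<in> generate_ring R (Z0 \<union> x ` {1..k})"
    and gen: "generate_ring R (Z0 \<union> x ` {1..n}) = carrier R"
  obtains Z B where "subcring Z R" "noetherian_ring (R\<lparr>carrier := Z\<rparr>)"
    "\<And>z a. z \<in> Z \<Longrightarrow> a \<in> carrier R \<Longrightarrow> z \<otimes> a = a \<otimes> z"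
    "finite B" "B \<subseteq> carrier R" "carrier R = zspan Z B"
proof -
  have "finite_over_center Z0 (generate_ring R (Z0 \<union> x ` {1..k}))" if "k \<le> n" for k
    using that
  proof (induction k)
    case 0
    have "generate_ring R Z0 = Z0"
      using generate_ring_min_subring1[OF subcringE(1)[OF Z0] subcring.axioms(1)[OF Z0]]
      by (auto intro: generate_ring.incl)
    moreover have "z \<in> zspan Z0 {\<one>}" if "z \<in> Z0" for z
      using zspan_mult_incl[OF Z0 _ _ that, of "{\<one>}" \<one>] that subcringE(1)[OF Z0] by auto
    ultimately show ?case
      unfolding finite_over_center_def using subcringE(3)[OF Z0]
      by (intro exI[of _ "{}"] exI[of _ "{\<one>}"]) auto
  next
    case (Suc k)
    have eq: "x ` {1..Suc k} = insert (x (Suc k)) (x ` {1..k})" by (simp add: atLeastAtMostSuc_conv)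
    have xc: "x ` {1..k} \<subseteq> carrier R" "x (Suc k) \<in> carrier R" using x Suc.prems by auto
    show ?case unfolding eq
    proof (rule finite_over_center_step[OF p char Z0 noeth central _ xc])
      show "ad (x (Suc k)) g \<in> generate_ring R (Z0 \<union> x ` {1..k})" if "g \<in> x ` {1..k}" for g
        using that adx Suc.prems by auto
    qed (use Suc in auto)
  qed
  from this[OF order_refl] obtain E B where E: "finite E" "E \<subseteq> carrier R" "\<forall>e\<in>E. \<forall>t\<in>carrier R. e \<otimes> t = t \<otimes> e"
    and B: "finite B" "B \<subseteq> carrier R" "carrier R \<subseteq> zspan (generate_ring R (Z0 \<union> E)) B"
    unfolding gen finite_over_center_def by blast
  let ?Z = "generate_ring R (Z0 \<union> E)"
  have ZE: "Z0 \<union> E \<subseteq> carrier R" using subcringE(1)[OF Z0] E(2) by auto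
  have Z: "subcring ?Z R" "noetherian_ring (R\<lparr>carrier := ?Z\<rparr>)"
    using noetherian_generate_finite[OF Z0 noeth E(1,2)] E(3) ZE by blast+
  have "z \<otimes> a = a \<otimes> z" if "z \<in> ?Z" "a \<in> carrier R" for z a
  proof -
    have "a \<otimes> z = z \<otimes> a"
      by (rule generate_ring_commutes[OF ZE that(2) _ that(1)])
        (use central[symmetric, OF _ that(2)] E(3) that(2) in auto)
    then show ?thesis by simp
  qed
  then show ?thesis
    using that[OF Z _ B(1,2)] B(3) zsubD(1)[OF Z(1) zspan_zsub[OF Z(1) B(2)]] by blast
qed

end

section \<open>Bases\<close>

text \<open>Together with \<open>lincomb\<close> this isolates the two ingredients of
  \<open>module_basis\<close>. Coefficients vanish outside \<open>I\<close>, which makes a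
  coefficient family unique as a function on the whole index type.\<close>

definition fin_supp :: "('r, 'm) ring_scheme \<Rightarrow> 'i set \<Rightarrow> ('i \<Rightarrow> 'r) set" where
  "fin_supp R I = {c. range c \<subseteq> carrier R \<and> (\<forall>i. i \<notin> I \<longrightarrow> c i = \<zero>\<^bsub>R\<^esub>) \<and> finite {i. c i \<noteq> \<zero>\<^bsub>R\<^esub>}}"

definition lincomb ::
    "('r, 'm) ring_scheme \<Rightarrow> ('r, 'a, 'n) module_scheme \<Rightarrow> ('i \<Rightarrow> 'a) \<Rightarrow> ('i \<Rightarrow> 'r) \<Rightarrow> 'a" where
  "lincomb R M e c = (\<Oplus>\<^bsub>M\<^esub>i\<in>{i. c i \<noteq> \<zero>\<^bsub>R\<^esub>}. c i \<odot>\<^bsub>M\<^esub> e i)"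

definition lin_indep ::
    "('r, 'm) ring_scheme \<Rightarrow> ('r, 'a, 'n) module_scheme \<Rightarrow> ('i \<Rightarrow> 'a) \<Rightarrow> 'i set \<Rightarrow> bool" where
  "lin_indep R M e I \<longleftrightarrow> (\<forall>c\<in>fin_supp R I. lincomb R M e c = \<zero>\<^bsub>M\<^esub> \<longrightarrow> (\<forall>i. c i = \<zero>\<^bsub>R\<^esub>))"

lemma finsum_hom:
  assumes M: "abelian_monoid M" and N: "abelian_monoid N"
    and h: "h \<in> carrier M \<rightarrow> carrier N" "h \<zero>\<^bsub>M\<^esub> = \<zero>\<^bsub>N\<^esub>"
      "\<And>a b. a \<in> carrier M \<Longrightarrow> b \<in> carrier M \<Longrightarrow> h (a \<oplus>\<^bsub>M\<^esub> b) = h a \<oplus>\<^bsub>N\<^esub> h b"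
    and f: "f \<in> S \<rightarrow> carrier M"
  shows "h (\<Oplus>\<^bsub>M\<^esub>i\<in>S. f i) = (\<Oplus>\<^bsub>N\<^esub>i\<in>S. h (f i))"
proof -
  interpret M: abelian_monoid M by fact
  interpret N: abelian_monoid N by fact
  show ?thesis
    using f
  \<comment> \<open>Over an infinite index set both sums have the default value zero, which
    \<open>h\<close> preserves.\<close>
  proof (induction S rule: infinite_finite_induct)
    case (insert i S)
    then have "h (f i) \<in> carrier N" "(\<lambda>i. h (f i)) \<in> S \<rightarrow> carrier N" using h(1) by auto
    then show ?case using insert h by (simp add: M.finsum_insert N.finsum_insert)
  qed (use h in auto)
qed

lemma module_basis_def':
  "module_basis R M b I \<longleftrightarrow> b \<in> I \<rightarrow> carrier M \<and>
     (\<forall>v\<in>carrier M. \<exists>!c. c \<in> fin_supp R I \<and> v = lincomb R M b c)"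
  by (simp add: module_basis_def fin_supp_def lincomb_def conj_assoc)

context module
begin

lemma lincomb_superset:
  assumes "finite S" "{i. c i \<noteq> \<zero>} \<subseteq> S" "range c \<subseteq> carrier R" "\<And>i. i \<in> S \<Longrightarrow> e i \<in> carrier M"
  shows "lincomb R M e c = (\<Oplus>\<^bsub>M\<^esub>i\<in>S. c i \<odot>\<^bsub>M\<^esub> e i)"
proof -
  have cc: "c i \<in> carrier R" for i using assms(3) by auto
  show ?thesis
    unfolding lincomb_def
    by (rule M.add.finprod_mono_neutral_cong_left) (use assms(1,2) cc assms(4) in auto)
qed

context
  fixes e :: "'i \<Rightarrow> 'c" and I
  assumes e: "\<forall>i\<in>I. e i \<in> carrier M"
begin

lemma supp_sub: "c \<in> fin_supp R I \<Longrightarrow> {i. c i \<noteq> \<zero>} \<subseteq> I"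
  by (auto simp: fin_supp_def)

lemma lincomb_closed: "c \<in> fin_supp R I \<Longrightarrow> lincomb R M e c \<in> carrier M"
  unfolding lincomb_def using e supp_sub by (intro M.finsum_closed) (auto simp: fin_supp_def intro!: smult_closed)

lemma fin_supp_add:
  assumes "c \<in> fin_supp R I" "d \<in> fin_supp R I" shows "(\<lambda>i. c i \<oplus> d i) \<in> fin_supp R I"
proof -
  have "{i. c i \<oplus> d i \<noteq> \<zero>} \<subseteq> {i. c i \<noteq> \<zero>} \<union> {i. d i \<noteq> \<zero>}" by auto
  then have "finite {i. c i \<oplus> d i \<noteq> \<zero>}" using assms by (auto simp: fin_supp_def intro: finite_subset)
  then show ?thesis using assms by (auto simp: fin_supp_def)
qed

lemma fin_supp_smult:
  assumes "r \<in> carrier R" "c \<in> fin_supp R I" shows "(\<lambda>i. r \<otimes> c i) \<in> fin_supp R I"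
proof -
  have "{i. r \<otimes> c i \<noteq> \<zero>} \<subseteq> {i. c i \<noteq> \<zero>}" using assms(1) by auto
  then have "finite {i. r \<otimes> c i \<noteq> \<zero>}" using assms by (auto simp: fin_supp_def intro: finite_subset)
  then show ?thesis using assms by (auto simp: fin_supp_def)
qed

lemma fin_supp_single: "r \<in> carrier R \<Longrightarrow> i \<in> I \<Longrightarrow> (\<lambda>j. if j = i then r else \<zero>) \<in> fin_supp R I"
  by (auto simp: fin_supp_def)

lemma fin_supp_zero: "(\<lambda>j. \<zero>) \<in> fin_supp R I"
  by (auto simp: fin_supp_def)

lemma lincomb_add:
  assumes c: "c \<in> fin_supp R I" "d \<in> fin_supp R I"
  shows "lincomb R M e (\<lambda>i. c i \<oplus> d i) = lincomb R M e c \<oplus>\<^bsub>M\<^esub> lincomb R M e d"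
proof -
  let ?S = "{i. c i \<noteq> \<zero>} \<union> {i. d i \<noteq> \<zero>}"
  have S: "finite ?S" "?S \<subseteq> I" using c by (auto simp: fin_supp_def)
  have cc: "c i \<in> carrier R" "d i \<in> carrier R" for i using c by (auto simp: fin_supp_def)
  have ec: "\<And>i. i \<in> ?S \<Longrightarrow> e i \<in> carrier M" using S e by blast
  have "lincomb R M e (\<lambda>i. c i \<oplus> d i) = (\<Oplus>\<^bsub>M\<^esub>i\<in>?S. (c i \<oplus> d i) \<odot>\<^bsub>M\<^esub> e i)"
    using fin_supp_add[OF c] by (intro lincomb_superset[OF S(1) _ _ ec]) (auto simp: fin_supp_def)
  also have "\<dots> = (\<Oplus>\<^bsub>M\<^esub>i\<in>?S. c i \<odot>\<^bsub>M\<^esub> e i \<oplus>\<^bsub>M\<^esub> d i \<odot>\<^bsub>M\<^esub> e i)"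
    using cc ec by (intro M.add.finprod_cong') (auto simp: smult_l_distr)
  also have "\<dots> = (\<Oplus>\<^bsub>M\<^esub>i\<in>?S. c i \<odot>\<^bsub>M\<^esub> e i) \<oplus>\<^bsub>M\<^esub> (\<Oplus>\<^bsub>M\<^esub>i\<in>?S. d i \<odot>\<^bsub>M\<^esub> e i)"
    using cc ec by (intro M.finsum_addf) auto
  also have "\<dots> = lincomb R M e c \<oplus>\<^bsub>M\<^esub> lincomb R M e d"
    using cc by (subst (1 2) lincomb_superset[OF S(1) _ _ ec]) auto
  finally show ?thesis .
qed

lemma lincomb_smult:
  assumes r: "r \<in> carrier R" and c: "c \<in> fin_supp R I"
  shows "lincomb R M e (\<lambda>i. r \<otimes> c i) = r \<odot>\<^bsub>M\<^esub> lincomb R M e c"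
proof -
  let ?S = "{i. c i \<noteq> \<zero>}"
  have S: "finite ?S" "?S \<subseteq> I" using c by (auto simp: fin_supp_def)
  have cc: "c i \<in> carrier R" for i using c by (auto simp: fin_supp_def)
  have ec: "\<And>i. i \<in> ?S \<Longrightarrow> e i \<in> carrier M" using S e by blast
  have "lincomb R M e (\<lambda>i. r \<otimes> c i) = (\<Oplus>\<^bsub>M\<^esub>i\<in>?S. (r \<otimes> c i) \<odot>\<^bsub>M\<^esub> e i)"
    using r cc by (intro lincomb_superset[OF S(1) _ _ ec]) auto
  also have "\<dots> = (\<Oplus>\<^bsub>M\<^esub>i\<in>?S. r \<odot>\<^bsub>M\<^esub> (c i \<odot>\<^bsub>M\<^esub> e i))"
    using cc ec r by (intro M.add.finprod_cong') (auto simp: smult_assoc1)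
  also have "\<dots> = r \<odot>\<^bsub>M\<^esub> lincomb R M e c"
    unfolding lincomb_def using cc ec r S(1) by (intro finsum_smult_ldistr[symmetric]) auto
  finally show ?thesis .
qed

lemma lincomb_single:
  assumes "r \<in> carrier R" "i \<in> I"
  shows "lincomb R M e (\<lambda>j. if j = i then r else \<zero>) = r \<odot>\<^bsub>M\<^esub> e i"
proof -
  have "lincomb R M e (\<lambda>j. if j = i then r else \<zero>) =
    (\<Oplus>\<^bsub>M\<^esub>j\<in>{i}. (if j = i then r else \<zero>) \<odot>\<^bsub>M\<^esub> e j)"
    using assms e by (intro lincomb_superset) auto
  then show ?thesis using assms e by simp
qed

lemma lincomb_zero: "lincomb R M e (\<lambda>j. \<zero>) = \<zero>\<^bsub>M\<^esub>"
  by (simp add: lincomb_def)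

lemma lin_span_eq_lincomb: "lin_span R M (e ` I) = lincomb R M e ` fin_supp R I"
proof
  show "lin_span R M (e ` I) \<subseteq> lincomb R M e ` fin_supp R I"
  proof
    fix v assume "v \<in> lin_span R M (e ` I)"
    then show "v \<in> lincomb R M e ` fin_supp R I"
    proof induction
      case zero
      show ?case using lincomb_zero fin_supp_zero by (metis imageI)
    next
      case (step r s v)
      then obtain i c where ic: "i \<in> I" "s = e i" "c \<in> fin_supp R I" "v = lincomb R M e c" by auto
      let ?d = "\<lambda>j. if j = i then r else \<zero>"
      have "r \<odot>\<^bsub>M\<^esub> s \<oplus>\<^bsub>M\<^esub> v = lincomb R M e (\<lambda>j. ?d j \<oplus> c j)"
        using lincomb_add[OF fin_supp_single[OF step(1) ic(1)] ic(3)] lincomb_single[OF step(1) ic(1)] ic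
        by simp
      then show ?case using fin_supp_add[OF fin_supp_single[OF step(1) ic(1)] ic(3)] by blast
    qed
  qed
  show "lincomb R M e ` fin_supp R I \<subseteq> lin_span R M (e ` I)"
  proof clarify
    fix c assume c: "c \<in> fin_supp R I"
    have eI: "e ` I \<subseteq> carrier M" using e by auto
    note S = submoduleE[OF lin_span_submodule[OF eI]]
    have "(\<Oplus>\<^bsub>M\<^esub>i\<in>A. c i \<odot>\<^bsub>M\<^esub> e i) \<in> lin_span R M (e ` I)" if "A \<subseteq> I" "finite A" for A
      using that(2,1)
    proof induction
      case empty
      then show ?case by (simp add: lin_span.zero)
    next
      case (insert i A)
      have "c i \<odot>\<^bsub>M\<^esub> e i \<in> lin_span R M (e ` I)" if "i \<in> I" for i
        using that c lin_span_incl[OF eI] by (intro S(4)) (auto simp: fin_supp_def)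
      moreover have "(\<lambda>i. c i \<odot>\<^bsub>M\<^esub> e i) \<in> A \<rightarrow> carrier M" "c i \<odot>\<^bsub>M\<^esub> e i \<in> carrier M"
        using insert.prems c e by (auto simp: fin_supp_def intro!: smult_closed)
      ultimately show ?case using insert S(5) by simp
    qed
    then show "lincomb R M e c \<in> lin_span R M (e ` I)"
      unfolding lincomb_def using c supp_sub by (auto simp: fin_supp_def)
  qed
qed

lemma lin_indep_inj:
  assumes ind: "lin_indep R M e I" and c: "c \<in> fin_supp R I" "d \<in> fin_supp R I"
    and eq: "lincomb R M e c = lincomb R M e d"
  shows "c = d"
proof
  fix i
  let ?d = "\<lambda>i. \<ominus> \<one> \<otimes> d i"
  have d': "?d \<in> fin_supp R I" by (rule fin_supp_smult[OF _ c(2)]) simp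
  have cc: "c i \<in> carrier R" "d i \<in> carrier R" using c by (auto simp: fin_supp_def)
  have "lincomb R M e (\<lambda>i. c i \<oplus> ?d i) = lincomb R M e d \<oplus>\<^bsub>M\<^esub> (\<ominus> \<one>) \<odot>\<^bsub>M\<^esub> lincomb R M e d"
    using lincomb_add[OF c(1) d'] lincomb_smult[OF _ c(2), of "\<ominus> \<one>"] eq by simp
  also have "\<dots> = \<zero>\<^bsub>M\<^esub>" using lincomb_closed[OF c(2)] by (simp add: smult_l_minus M.r_neg)
  finally have "\<forall>i. c i \<oplus> ?d i = \<zero>"
    using ind fin_supp_add[OF c(1) d'] unfolding lin_indep_def by blast
  then show "c i = d i" using cc by (metis R.l_minus R.l_one R.minus_equality R.minus_minus R.one_closed R.add.inv_closed)
qed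

lemma module_basis_iff:
  "module_basis R M e I \<longleftrightarrow> lin_indep R M e I \<and> lin_span R M (e ` I) = carrier M"
proof
  assume b: "module_basis R M e I"
  have ex1: "\<exists>!c. c \<in> fin_supp R I \<and> v = lincomb R M e c" if "v \<in> carrier M" for v
    using b that unfolding module_basis_def' by simp
  have "lin_indep R M e I"
    unfolding lin_indep_def
  proof (intro ballI impI)
    fix c assume c: "c \<in> fin_supp R I" "lincomb R M e c = \<zero>\<^bsub>M\<^esub>"
    then have "c = (\<lambda>_. \<zero>)" using ex1[OF M.zero_closed] fin_supp_zero lincomb_zero by metis
    then show "\<forall>i. c i = \<zero>" by simp
  qed
  moreover have "lin_span R M (e ` I) = carrier M"
    unfolding lin_span_eq_lincomb using ex1 lincomb_closed by blast
  ultimately show "lin_indep R M e I \<and> lin_span R M (e ` I) = carrier M" ..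
next
  assume a: "lin_indep R M e I \<and> lin_span R M (e ` I) = carrier M"
  have "\<exists>!c. c \<in> fin_supp R I \<and> v = lincomb R M e c" if "v \<in> carrier M" for v
  proof -
    have "v \<in> lincomb R M e ` fin_supp R I" using a that unfolding lin_span_eq_lincomb by simp
    then obtain c where c: "v = lincomb R M e c" "c \<in> fin_supp R I" by (rule imageE)
    show ?thesis
    proof (rule ex1I[of _ c])
      fix d assume d: "d \<in> fin_supp R I \<and> v = lincomb R M e d"
      then have "lincomb R M e d = lincomb R M e c" using c(1) by (elim conjE) (erule subst, assumption)
      with conjunct1[OF a] conjunct1[OF d] c(2) show "d = c" by (rule lin_indep_inj)
    next
      show "c \<in> fin_supp R I \<and> v = lincomb R M e c" using c by (intro conjI)
    qed
  qed
  then show "module_basis R M e I"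
    unfolding module_basis_def' using e by auto
qed

text \<open>\<open>free_module\<close> asks for a set of basis vectors, while the bases at hand are
  families indexed by words; injectivity lets coefficients pass from the set to the family.\<close>

lemma module_basis_image:
  assumes b: "module_basis R M e I" and inj: "inj_on e I"
  shows "module_basis R M (\<lambda>v. v) (e ` I)"
proof -
  have ex: "\<exists>c. c \<in> fin_supp R (e ` I) \<and> v = lincomb R M (\<lambda>v. v) c" if "v \<in> carrier M" for v
  proof -
    interpret id: module R M by (rule module_axioms)
    have "v \<in> lin_span R M ((\<lambda>v. v) ` (e ` I))" using b that by (simp add: module_basis_iff)
    then show ?thesis by (subst (asm) module.lin_span_eq_lincomb[OF module_axioms]) (use e in auto)
  qed
  have "c = d" if c: "c \<in> fin_supp R (e ` I)" "d \<in> fin_supp R (e ` I)"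
    and eq: "lincomb R M (\<lambda>v. v) c = lincomb R M (\<lambda>v. v) d" for c d
  proof -
    have pull: "(\<lambda>i. if i \<in> I then c (e i) else \<zero>) \<in> fin_supp R I \<and>
      lincomb R M e (\<lambda>i. if i \<in> I then c (e i) else \<zero>) = lincomb R M (\<lambda>v. v) c"
      if c: "c \<in> fin_supp R (e ` I)" for c
    proof
      let ?c = "\<lambda>i. if i \<in> I then c (e i) else \<zero>"
      have im: "e ` {i. ?c i \<noteq> \<zero>} = {v. c v \<noteq> \<zero>}" using c by (auto simp: fin_supp_def)
      have inj': "inj_on e {i. ?c i \<noteq> \<zero>}" by (rule inj_on_subset[OF inj]) auto
      have "finite {i. ?c i \<noteq> \<zero>}" using im inj' c finite_imageD[of e] by (auto simp: fin_supp_def)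
      then show "?c \<in> fin_supp R I" using c by (auto simp: fin_supp_def)
      have "lincomb R M (\<lambda>v. v) c = (\<Oplus>\<^bsub>M\<^esub>i\<in>{i. ?c i \<noteq> \<zero>}. c (e i) \<odot>\<^bsub>M\<^esub> e i)"
        unfolding lincomb_def im[symmetric]
        by (rule M.finsum_reindex[OF _ inj']) (use c e in \<open>auto simp: fin_supp_def intro!: smult_closed\<close>)
      also have "\<dots> = lincomb R M e ?c"
        unfolding lincomb_def
        by (rule M.add.finprod_cong') (use c e in \<open>auto simp: fin_supp_def intro!: smult_closed\<close>)
      finally show "lincomb R M e ?c = lincomb R M (\<lambda>v. v) c" by simp
    qed
    have "(\<lambda>i. if i \<in> I then c (e i) else \<zero>) = (\<lambda>i. if i \<in> I then d (e i) else \<zero>)"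
      by (rule lin_indep_inj) (use b pull[OF c(1)] pull[OF c(2)] eq in \<open>auto simp: module_basis_iff\<close>)
    then have "c (e i) = d (e i)" if "i \<in> I" for i using that by meson
    then show ?thesis using c by (auto simp: fin_supp_def fun_eq_iff) (metis imageE)
  qed
  then have "\<exists>!c. c \<in> fin_supp R (e ` I) \<and> v = lincomb R M (\<lambda>v. v) c" if "v \<in> carrier M" for v
    using ex[OF that] by blast
  then show ?thesis
    unfolding module_basis_def' using e by auto
qed

lemma module_basis_inj:
  assumes b: "module_basis R M e I" and "\<one> \<noteq> \<zero>" shows "inj_on e I"
proof (rule inj_onI)
  fix i j assume ij: "i \<in> I" "j \<in> I" "e i = e j"
  have "(\<lambda>k. if k = i then \<one> else \<zero>) = (\<lambda>k. if k = j then \<one> else \<zero>)"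
    by (rule lin_indep_inj) (use b ij e fin_supp_single lincomb_single in \<open>auto simp: module_basis_iff\<close>)
  then show "i = j" using assms(2) by (auto dest: fun_cong[of _ _ i] split: if_splits)
qed

end

end

section \<open>Base change\<close>

lemma pair_ring_simps [simp]:
  "carrier (pair_ring B C) = {f. Poly_Mapping.keys f \<subseteq> carrier B \<times> carrier C}"
  "one (pair_ring B C) = frag_of (\<one>\<^bsub>B\<^esub>, \<one>\<^bsub>C\<^esub>)"
  "ring.zero (pair_ring B C) = 0"
  "ring.add (pair_ring B C) = (+)"
  by (simp_all add: pair_ring_def)

lemma frag_extend_fun_diff: "frag_extend (\<lambda>x. f x - g x) c = frag_extend f c - frag_extend g c"
  by (induction c rule: frag_induction[OF subset_UNIV]) (auto simp: frag_extend_diff)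

lemma frag_extend_fun_zero: "frag_extend (\<lambda>x. 0) c = 0"
  by (induction c rule: frag_induction[OF subset_UNIV]) (auto simp: frag_extend_diff)

lemma pair_mult_of [simp]:
  "frag_of p \<otimes>\<^bsub>pair_ring B C\<^esub> frag_of q = frag_of (fst p \<otimes>\<^bsub>B\<^esub> fst q, snd p \<otimes>\<^bsub>C\<^esub> snd q)"
  by (simp add: pair_ring_def)

lemma pair_mult_diff_left: "(f - f') \<otimes>\<^bsub>pair_ring B C\<^esub> g = f \<otimes>\<^bsub>pair_ring B C\<^esub> g - f' \<otimes>\<^bsub>pair_ring B C\<^esub> g"
  by (simp add: pair_ring_def frag_extend_diff)

lemma pair_mult_diff_right: "f \<otimes>\<^bsub>pair_ring B C\<^esub> (g - g') = f \<otimes>\<^bsub>pair_ring B C\<^esub> g - f \<otimes>\<^bsub>pair_ring B C\<^esub> g'"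
  by (simp add: pair_ring_def frag_extend_diff frag_extend_fun_diff)

lemma pair_mult_zero [simp]: "0 \<otimes>\<^bsub>pair_ring B C\<^esub> g = 0" "f \<otimes>\<^bsub>pair_ring B C\<^esub> 0 = 0"
  by (simp_all add: pair_ring_def frag_extend_fun_zero)

lemmas pair_mult_diff = pair_mult_diff_left pair_mult_diff_right

text \<open>Induction over a free abelian group proceeds by differences, and so do the rules for the
  product in \<open>pair_ring\<close>; sums are rewritten accordingly.\<close>

lemma plus_eq_diff: "f + g = f - (0 - g)" for f g :: "'x::ab_group_add"
  by simp

lemma pair_ring_induct [consumes 1, case_names zero of_pair diff]:
  assumes "f \<in> carrier (pair_ring B C)" "P 0"
    "\<And>b c. b \<in> carrier B \<Longrightarrow> c \<in> carrier C \<Longrightarrow> P (frag_of (b, c))"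
    "\<And>f g. P f \<Longrightarrow> P g \<Longrightarrow> P (f - g)"
  shows "P f"
  using assms(1)[unfolded pair_ring_simps mem_Collect_eq]
  by (induction f rule: frag_induction) (use assms(2-4) in auto)

text \<open>The product is additive in both factors, so associativity and the unit laws reduce to
  pairs, where they hold in the product of the two multiplicative monoids.\<close>

lemma pair_ring_ring:
  assumes B: "ring B" and C: "ring C" shows "ring (pair_ring B C)"
proof -
  interpret B: ring B by fact
  interpret C: ring C by fact
  let ?P = "pair_ring B C"
  have of_mem: "frag_of (b, c) \<in> carrier ?P" if "b \<in> carrier B" "c \<in> carrier C" for b c
    using that by simp
  have diff_mem: "f - g \<in> carrier ?P" if "f \<in> carrier ?P" "g \<in> carrier ?P" for f g
    using that keys_diff[of f g] by auto
  have minus_mem: "- f \<in> carrier ?P" if "f \<in> carrier ?P" for f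
    using that by simp
  have add_mem: "f + g \<in> carrier ?P" if "f \<in> carrier ?P" "g \<in> carrier ?P" for f g
    using diff_mem[OF that(1) minus_mem[OF that(2)]] by simp
  have mult_mem: "f \<otimes>\<^bsub>?P\<^esub> g \<in> carrier ?P" if f: "f \<in> carrier ?P" and g: "g \<in> carrier ?P" for f g
    using f
  proof (induction rule: pair_ring_induct)
    case (of_pair b c)
    show ?case
      using g
    proof (induction rule: pair_ring_induct)
      case (diff g g')
      then show ?case by (simp only: pair_mult_diff diff_mem)
    qed (use of_pair in auto)
  next
    case (diff f f')
    then show ?case by (simp only: pair_mult_diff diff_mem)
  qed auto
  have assoc: "f \<otimes>\<^bsub>?P\<^esub> g \<otimes>\<^bsub>?P\<^esub> h = f \<otimes>\<^bsub>?P\<^esub> (g \<otimes>\<^bsub>?P\<^esub> h)"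
    if f: "f \<in> carrier ?P" and g: "g \<in> carrier ?P" and h: "h \<in> carrier ?P" for f g h
    using f
  proof (induction rule: pair_ring_induct)
    case (of_pair b c)
    show ?case
      using g
    proof (induction rule: pair_ring_induct)
      case (of_pair b' c')
      show ?case
        using h
        by (induction rule: pair_ring_induct)
          (use \<open>b \<in> carrier B\<close> \<open>c \<in> carrier C\<close> of_pair in \<open>auto simp: pair_mult_diff B.m_assoc C.m_assoc\<close>)
    qed (auto simp: pair_mult_diff)
  qed (auto simp: pair_mult_diff)
  have one: "\<one>\<^bsub>?P\<^esub> \<otimes>\<^bsub>?P\<^esub> f = f" "f \<otimes>\<^bsub>?P\<^esub> \<one>\<^bsub>?P\<^esub> = f" if "f \<in> carrier ?P" for f
    using that by (induction rule: pair_ring_induct) (auto simp: pair_mult_diff)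
  have distr_l: "(f + g) \<otimes>\<^bsub>?P\<^esub> h = f \<otimes>\<^bsub>?P\<^esub> h + g \<otimes>\<^bsub>?P\<^esub> h" for f g h
    by (simp only: plus_eq_diff pair_mult_diff pair_mult_zero)
  have distr_r: "h \<otimes>\<^bsub>?P\<^esub> (f + g) = h \<otimes>\<^bsub>?P\<^esub> f + h \<otimes>\<^bsub>?P\<^esub> g" for f g h
    by (simp only: plus_eq_diff pair_mult_diff pair_mult_zero)
  show ?thesis
  proof (rule ringI)
    show "abelian_group ?P"
    proof (rule abelian_groupI)
      fix f assume "f \<in> carrier ?P"
      then show "\<exists>g\<in>carrier ?P. g \<oplus>\<^bsub>?P\<^esub> f = \<zero>\<^bsub>?P\<^esub>" using minus_mem by (intro bexI[of _ "- f"]) auto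
    qed (use add_mem in \<open>auto simp: add.assoc add.commute\<close>)
    show "Group.monoid ?P"
      by (rule monoidI) (use mult_mem assoc one in \<open>simp_all del: pair_ring_simps(1)\<close>, simp)
    show "(f \<oplus>\<^bsub>?P\<^esub> g) \<otimes>\<^bsub>?P\<^esub> h = f \<otimes>\<^bsub>?P\<^esub> h \<oplus>\<^bsub>?P\<^esub> g \<otimes>\<^bsub>?P\<^esub> h"
      "h \<otimes>\<^bsub>?P\<^esub> (f \<oplus>\<^bsub>?P\<^esub> g) = h \<otimes>\<^bsub>?P\<^esub> f \<oplus>\<^bsub>?P\<^esub> h \<otimes>\<^bsub>?P\<^esub> g" for f g h
      using distr_l distr_r by simp_all
  qed
qed

lemma pair_ring_minus:
  assumes "ring B" "ring C" "f \<in> carrier (pair_ring B C)"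
  shows "\<ominus>\<^bsub>pair_ring B C\<^esub> f = - f"
proof -
  interpret P: ring "pair_ring B C" by (rule pair_ring_ring[OF assms(1,2)])
  have "- f \<in> carrier (pair_ring B C)" using assms(3) by simp
  then show ?thesis using assms(3) by (intro P.minus_equality) auto
qed

lemma ring_cong:
  assumes "ring R" "carrier S = carrier R" "monoid.mult S = monoid.mult R" "one S = one R"
    "ring.zero S = ring.zero R" "ring.add S = ring.add R"
  shows "ring S"
proof -
  interpret R: ring R by fact
  show ?thesis
  proof (rule ringI)
    show "abelian_group S"
      by (rule abelian_groupI) (auto simp: assms R.add.m_assoc intro: R.l_neg, metis R.a_comm)
    show "Group.monoid S" by (rule monoidI) (auto simp: assms R.m_assoc)
  qed (auto simp: assms R.l_distr R.r_distr)
qed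

section \<open>The tensor product and its universal property\<close>

locale tensor =
  fixes D :: "('r, 'l) ring_scheme" and B :: "('r, 'b, 'm) module_scheme"
    and C :: "('r, 'c, 'n) module_scheme"
  assumes algB: "noncomm_algebra D B" and algC: "noncomm_algebra D C" and crC: "cring C"
begin

interpretation B: ring B using algB by (rule noncomm_algebra.axioms)
interpretation C: cring C by (rule crC)
interpretation BA: noncomm_algebra D B by (rule algB)
interpretation CA: noncomm_algebra D C by (rule algC)

abbreviation "P \<equiv> pair_ring B C"
abbreviation "J \<equiv> tensor_ideal D B C"
abbreviation "T \<equiv> base_change D B C"
abbreviation "pt \<equiv> pure_tensor D B C"

interpretation P: ring P by (rule pair_ring_ring[OF B.ring_axioms C.ring_axioms])

definition "rels =
     {frag_of (b \<oplus>\<^bsub>B\<^esub> b', c) - frag_of (b, c) - frag_of (b', c) | b b' c.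
         b \<in> carrier B \<and> b' \<in> carrier B \<and> c \<in> carrier C} \<union>
      {frag_of (b, c \<oplus>\<^bsub>C\<^esub> c') - frag_of (b, c) - frag_of (b, c') | b c c'.
         b \<in> carrier B \<and> c \<in> carrier C \<and> c' \<in> carrier C} \<union>
      {frag_of (d \<odot>\<^bsub>B\<^esub> b, c) - frag_of (b, d \<odot>\<^bsub>C\<^esub> c) | d b c.
         d \<in> carrier D \<and> b \<in> carrier B \<and> c \<in> carrier C}"

lemma J_eq: "J = Idl\<^bsub>P\<^esub> rels"
  by (simp add: tensor_ideal_def rels_def)

lemma of_mem: "b \<in> carrier B \<Longrightarrow> c \<in> carrier C \<Longrightarrow> frag_of (b, c) \<in> carrier P"
  by simp

lemma diff_mem: "f \<in> carrier P \<Longrightarrow> g \<in> carrier P \<Longrightarrow> f - g \<in> carrier P"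
  using keys_diff[of f g] by auto

lemma rels_closed: "rels \<subseteq> carrier P"
  unfolding rels_def by (auto simp del: pair_ring_simps(1) intro!: diff_mem of_mem)

lemma J_ideal: "ideal J P" and rels_J: "rels \<subseteq> J"
  unfolding J_eq by (rule P.genideal_ideal[OF rels_closed], rule P.genideal_self[OF rels_closed])

interpretation J: ideal J P by (rule J_ideal)

lemma T_simps:
  "carrier T = carrier (P Quot J)" "monoid.mult T = monoid.mult (P Quot J)" "one T = one (P Quot J)"
  "ring.zero T = ring.zero (P Quot J)" "ring.add T = ring.add (P Quot J)"
  "c \<odot>\<^bsub>T\<^esub> t = pt \<one>\<^bsub>B\<^esub> c \<otimes>\<^bsub>T\<^esub> t"
  by (simp_all add: base_change_def Let_def)

lemma ring_T: "ring T"
  by (rule ring_cong[OF J.quotient_is_ring]) (rule T_simps)+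

interpretation T: ring T by (rule ring_T)

definition "proj f = J +>\<^bsub>P\<^esub> f"

lemma proj_hom: "ring_hom_ring P T proj"
proof (rule ring_hom_ringI[OF P.ring_axioms ring_T])
  note h = J.rcos_ring_hom
  show "proj f \<in> carrier T" if "f \<in> carrier P" for f
    using ring_hom_closed[OF h that] by (simp add: T_simps proj_def)
  show "proj (f \<otimes>\<^bsub>P\<^esub> g) = proj f \<otimes>\<^bsub>T\<^esub> proj g" "proj (f \<oplus>\<^bsub>P\<^esub> g) = proj f \<oplus>\<^bsub>T\<^esub> proj g"
    if "f \<in> carrier P" "g \<in> carrier P" for f g
    using ring_hom_mult[OF h that] ring_hom_add[OF h that] by (simp_all add: T_simps proj_def)
  show "proj \<one>\<^bsub>P\<^esub> = \<one>\<^bsub>T\<^esub>" using ring_hom_one[OF h] by (simp only: T_simps proj_def)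
qed

interpretation proj: ring_hom_ring P T proj by (rule proj_hom)

lemma proj_surj: "t \<in> carrier T \<Longrightarrow> \<exists>f\<in>carrier P. t = proj f"
  by (auto simp: T_simps FactRing_def A_RCOSETS_def' proj_def simp del: pair_ring_simps)

lemma proj_J: "f \<in> J \<Longrightarrow> proj f = \<zero>\<^bsub>T\<^esub>"
  using J.a_rcos_const[of f] by (simp add: proj_def T_simps FactRing_def)

lemma pt_proj: "pt b c = proj (frag_of (b, c))"
  by (simp add: pure_tensor_def proj_def)

lemma pt_closed [simp]: "b \<in> carrier B \<Longrightarrow> c \<in> carrier C \<Longrightarrow> pt b c \<in> carrier T"
  unfolding pt_proj by (intro proj.hom_closed of_mem)

lemma proj_diff: "f \<in> carrier P \<Longrightarrow> g \<in> carrier P \<Longrightarrow> proj (f - g) = proj f \<ominus>\<^bsub>T\<^esub> proj g"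
proof -
  assume f: "f \<in> carrier P" and g: "g \<in> carrier P"
  have "f - g = f \<oplus>\<^bsub>P\<^esub> (\<ominus>\<^bsub>P\<^esub> g)" using pair_ring_minus[OF B.ring_axioms C.ring_axioms g] by simp
  then show ?thesis using f g by (simp add: T.minus_eq del: pair_ring_simps)
qed

lemma eq_of_diff:
  assumes "f \<in> carrier P" "g \<in> carrier P" "h \<in> carrier P" "f - g - h \<in> J"
  shows "proj f = proj g \<oplus>\<^bsub>T\<^esub> proj h"
proof -
  have "proj f \<ominus>\<^bsub>T\<^esub> proj g \<ominus>\<^bsub>T\<^esub> proj h = \<zero>\<^bsub>T\<^esub>"
    using proj_J[OF assms(4)] proj_diff[OF diff_mem[OF assms(1,2)] assms(3)] proj_diff[OF assms(1,2)] by simp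
  moreover have c: "proj f \<in> carrier T" "proj g \<in> carrier T" "proj h \<in> carrier T"
    using assms by (simp_all del: pair_ring_simps)
  ultimately have "proj f \<ominus>\<^bsub>T\<^esub> proj g = proj h"
    using T.r_right_minus_eq[of "proj f \<ominus>\<^bsub>T\<^esub> proj g" "proj h"] by simp
  then have "proj h \<oplus>\<^bsub>T\<^esub> proj g = (proj f \<ominus>\<^bsub>T\<^esub> proj g) \<oplus>\<^bsub>T\<^esub> proj g" by simp
  also have "\<dots> = proj f" using c by (simp add: T.minus_eq T.a_assoc T.l_neg)
  finally show ?thesis using c by (simp add: T.a_comm)
qed

lemma pt_add_left:
  assumes "b \<in> carrier B" "b' \<in> carrier B" "c \<in> carrier C"
  shows "pt (b \<oplus>\<^bsub>B\<^esub> b') c = pt b c \<oplus>\<^bsub>T\<^esub> pt b' c"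
proof -
  have "frag_of (b \<oplus>\<^bsub>B\<^esub> b', c) - frag_of (b, c) - frag_of (b', c) \<in> rels" using assms unfolding rels_def by blast
  then show ?thesis unfolding pt_proj using rels_J assms by (intro eq_of_diff) auto
qed

lemma pt_add_right:
  assumes "b \<in> carrier B" "c' \<in> carrier C" "c \<in> carrier C"
  shows "pt b (c \<oplus>\<^bsub>C\<^esub> c') = pt b c \<oplus>\<^bsub>T\<^esub> pt b c'"
proof -
  have "frag_of (b, c \<oplus>\<^bsub>C\<^esub> c') - frag_of (b, c) - frag_of (b, c') \<in> rels" using assms unfolding rels_def by blast
  then show ?thesis unfolding pt_proj using rels_J assms by (intro eq_of_diff) auto
qed

lemma pt_balance:
  assumes "b \<in> carrier B" "d \<in> carrier D" "c \<in> carrier C"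
  shows "pt (d \<odot>\<^bsub>B\<^esub> b) c = pt b (d \<odot>\<^bsub>C\<^esub> c)"
proof -
  have "frag_of (d \<odot>\<^bsub>B\<^esub> b, c) - frag_of (b, d \<odot>\<^bsub>C\<^esub> c) - 0 \<in> J"
  proof -
    have "frag_of (d \<odot>\<^bsub>B\<^esub> b, c) - frag_of (b, d \<odot>\<^bsub>C\<^esub> c) \<in> rels"
      using assms unfolding rels_def by blast
    then show ?thesis using rels_J by auto
  qed
  then have "proj (frag_of (d \<odot>\<^bsub>B\<^esub> b, c)) = proj (frag_of (b, d \<odot>\<^bsub>C\<^esub> c)) \<oplus>\<^bsub>T\<^esub> proj 0"
    by (intro eq_of_diff) (use assms in auto)
  moreover have "proj 0 = \<zero>\<^bsub>T\<^esub>" using proj.hom_zero by simp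
  ultimately show ?thesis unfolding pt_proj using assms proj.hom_closed[OF of_mem, of b "d \<odot>\<^bsub>C\<^esub> c"] by simp
qed

lemma pt_mult:
  assumes "b \<in> carrier B" "b' \<in> carrier B" "c \<in> carrier C" "c' \<in> carrier C"
  shows "pt b c \<otimes>\<^bsub>T\<^esub> pt b' c' = pt (b \<otimes>\<^bsub>B\<^esub> b') (c \<otimes>\<^bsub>C\<^esub> c')"
proof -
  have "proj (frag_of (b, c) \<otimes>\<^bsub>P\<^esub> frag_of (b', c')) = proj (frag_of (b, c)) \<otimes>\<^bsub>T\<^esub> proj (frag_of (b', c'))"
    by (rule proj.hom_mult) (use assms in auto)
  then show ?thesis unfolding pt_proj by simp
qed

lemma pt_one: "pt \<one>\<^bsub>B\<^esub> \<one>\<^bsub>C\<^esub> = \<one>\<^bsub>T\<^esub>"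
  unfolding pt_proj using proj.hom_one by simp

lemma pt_zero: "b \<in> carrier B \<Longrightarrow> pt b \<zero>\<^bsub>C\<^esub> = \<zero>\<^bsub>T\<^esub>"
  using pt_add_right[of b "\<zero>\<^bsub>C\<^esub>" "\<zero>\<^bsub>C\<^esub>"] T.add.r_cancel_one'[of "pt b \<zero>\<^bsub>C\<^esub>" "pt b \<zero>\<^bsub>C\<^esub>"] by auto

lemma pt_minus_left: "b \<in> carrier B \<Longrightarrow> c \<in> carrier C \<Longrightarrow> pt (\<ominus>\<^bsub>B\<^esub> b) c = \<ominus>\<^bsub>T\<^esub> pt b c"
proof -
  assume bc: "b \<in> carrier B" "c \<in> carrier C"
  have z: "pt \<zero>\<^bsub>B\<^esub> c = \<zero>\<^bsub>T\<^esub>"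
    using pt_add_left[of "\<zero>\<^bsub>B\<^esub>" "\<zero>\<^bsub>B\<^esub>" c] T.add.r_cancel_one'[of "pt \<zero>\<^bsub>B\<^esub> c" "pt \<zero>\<^bsub>B\<^esub> c"] bc by auto
  have "pt (\<ominus>\<^bsub>B\<^esub> b) c \<oplus>\<^bsub>T\<^esub> pt b c = \<zero>\<^bsub>T\<^esub>"
    using pt_add_left[of "\<ominus>\<^bsub>B\<^esub> b" b c] bc z by (simp add: B.l_neg)
  then show ?thesis using bc by (metis T.minus_equality pt_closed B.a_inv_closed)
qed

text \<open>Sums of pure tensors suffice, without negatives, because a sign can be absorbed into the
  first factor.\<close>

lemma T_induct [consumes 1, case_names pure add]:
  assumes t: "t \<in> carrier T"
    and pure: "\<And>b c. b \<in> carrier B \<Longrightarrow> c \<in> carrier C \<Longrightarrow> Q (pt b c)"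
    and add: "\<And>s t. s \<in> carrier T \<Longrightarrow> t \<in> carrier T \<Longrightarrow> Q s \<Longrightarrow> Q t \<Longrightarrow> Q (s \<oplus>\<^bsub>T\<^esub> t)"
  shows "Q t"
proof -
  obtain f where f: "f \<in> carrier P" "t = proj f" using proj_surj[OF t] by blast
  \<comment> \<open>The induction rule forms differences and does not record membership; the claim
    is therefore strengthened by membership and by the same property of the negative.\<close>
  have "f \<in> carrier P \<and> Q (proj f) \<and> Q (\<ominus>\<^bsub>T\<^esub> proj f)"
    using f(1)
  proof (induction rule: pair_ring_induct)
    case zero
    have "Q \<zero>\<^bsub>T\<^esub>" using pure[OF B.zero_closed C.zero_closed] pt_zero by simp
    moreover have "proj 0 = \<zero>\<^bsub>T\<^esub>" using proj.hom_zero by simp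
    ultimately show ?case by simp
  next
    case (of_pair b c)
    then show ?case using pure[of b c] pure[of "\<ominus>\<^bsub>B\<^esub> b" c] pt_minus_left[of b c] by (simp add: pt_proj)
  next
    case (diff f g)
    then have fg: "f \<in> carrier P" "g \<in> carrier P" "proj f \<in> carrier T" "proj g \<in> carrier T"
      by (simp_all del: pair_ring_simps)
    have "\<ominus>\<^bsub>T\<^esub> proj (f - g) = \<ominus>\<^bsub>T\<^esub> proj f \<oplus>\<^bsub>T\<^esub> proj g"
      unfolding proj_diff[OF fg(1,2)] using fg(3,4) by (simp add: T.minus_eq T.minus_add)
    then show ?case
      using diff_mem[OF fg(1,2)] diff add[of "proj f" "\<ominus>\<^bsub>T\<^esub> proj g"] add[of "\<ominus>\<^bsub>T\<^esub> proj f" "proj g"] fg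
      by (simp add: proj_diff T.minus_eq del: pair_ring_simps)
  qed
  then show ?thesis using f by simp
qed

lemma inl_hom: "ring_hom_ring B T (\<lambda>b. pt b \<one>\<^bsub>C\<^esub>)"
  by (rule ring_hom_ringI[OF B.ring_axioms ring_T]) (simp_all add: pt_mult pt_add_left pt_one)

lemma inr_hom: "ring_hom_ring C T (\<lambda>c. pt \<one>\<^bsub>B\<^esub> c)"
  by (rule ring_hom_ringI[OF C.ring_axioms ring_T]) (simp_all add: pt_mult pt_add_right pt_one)

text \<open>Here the commutativity of \<open>C\<close> enters; it is what makes the base change an
  algebra over its second factor.\<close>

lemma inr_central:
  assumes c: "c \<in> carrier C" and t: "t \<in> carrier T"
  shows "pt \<one>\<^bsub>B\<^esub> c \<otimes>\<^bsub>T\<^esub> t = t \<otimes>\<^bsub>T\<^esub> pt \<one>\<^bsub>B\<^esub> c"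
  using t
proof (induction rule: T_induct)
  case (pure b c')
  then show ?case using c by (simp add: pt_mult C.m_comm)
next
  case (add s t)
  then show ?case using c by (simp add: T.l_distr T.r_distr)
qed

lemma pt_split: "b \<in> carrier B \<Longrightarrow> c \<in> carrier C \<Longrightarrow> pt \<one>\<^bsub>B\<^esub> c \<otimes>\<^bsub>T\<^esub> pt b \<one>\<^bsub>C\<^esub> = pt b c"
  by (simp add: pt_mult)

lemma noncomm_algebra_T: "noncomm_algebra C T"
proof (intro noncomm_algebra.intro noncomm_algebra_axioms.intro)
  show "ring T" by (rule ring_T)
  show "module C T"
  proof (rule moduleI[OF crC T.abelian_group_axioms])
    note [simp] = T_simps(6) and p1 = pt_closed[OF B.one_closed]
    show "c \<odot>\<^bsub>T\<^esub> s \<in> carrier T" if "c \<in> carrier C" "s \<in> carrier T" for c s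
      using p1[OF that(1)] that(2) by simp
    show "(c \<oplus>\<^bsub>C\<^esub> d) \<odot>\<^bsub>T\<^esub> s = c \<odot>\<^bsub>T\<^esub> s \<oplus>\<^bsub>T\<^esub> d \<odot>\<^bsub>T\<^esub> s"
      if "c \<in> carrier C" "d \<in> carrier C" "s \<in> carrier T" for c d s
      using that p1[OF that(1)] p1[OF that(2)] by (simp add: pt_add_right T.l_distr)
    show "c \<odot>\<^bsub>T\<^esub> (s \<oplus>\<^bsub>T\<^esub> t) = c \<odot>\<^bsub>T\<^esub> s \<oplus>\<^bsub>T\<^esub> c \<odot>\<^bsub>T\<^esub> t"
      if "c \<in> carrier C" "s \<in> carrier T" "t \<in> carrier T" for c s t
      using that p1[OF that(1)] by (simp add: T.r_distr)
    show "(c \<otimes>\<^bsub>C\<^esub> d) \<odot>\<^bsub>T\<^esub> s = c \<odot>\<^bsub>T\<^esub> (d \<odot>\<^bsub>T\<^esub> s)"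
      if "c \<in> carrier C" "d \<in> carrier C" "s \<in> carrier T" for c d s
    proof -
      have "pt \<one>\<^bsub>B\<^esub> (c \<otimes>\<^bsub>C\<^esub> d) = pt \<one>\<^bsub>B\<^esub> c \<otimes>\<^bsub>T\<^esub> pt \<one>\<^bsub>B\<^esub> d" using that by (simp add: pt_mult)
      then show ?thesis using that(3) p1[OF that(1)] p1[OF that(2)] by (simp add: T.m_assoc)
    qed
    show "\<one>\<^bsub>C\<^esub> \<odot>\<^bsub>T\<^esub> s = s" if "s \<in> carrier T" for s using that by (simp add: pt_one)
  qed
next
  fix c s t assume c: "c \<in> carrier C" and s: "s \<in> carrier T" and t: "t \<in> carrier T"
  then show "(c \<odot>\<^bsub>T\<^esub> s) \<otimes>\<^bsub>T\<^esub> t = c \<odot>\<^bsub>T\<^esub> (s \<otimes>\<^bsub>T\<^esub> t)" by (simp add: T_simps(6) T.m_assoc)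
  have "s \<otimes>\<^bsub>T\<^esub> (pt \<one>\<^bsub>B\<^esub> c \<otimes>\<^bsub>T\<^esub> t) = (s \<otimes>\<^bsub>T\<^esub> pt \<one>\<^bsub>B\<^esub> c) \<otimes>\<^bsub>T\<^esub> t" using c s t by (simp add: T.m_assoc)
  also have "\<dots> = pt \<one>\<^bsub>B\<^esub> c \<otimes>\<^bsub>T\<^esub> (s \<otimes>\<^bsub>T\<^esub> t)"
    unfolding inr_central[OF c s, symmetric] using c s t by (simp add: T.m_assoc)
  finally show "s \<otimes>\<^bsub>T\<^esub> (c \<odot>\<^bsub>T\<^esub> t) = c \<odot>\<^bsub>T\<^esub> (s \<otimes>\<^bsub>T\<^esub> t)" by (simp add: T_simps(6))
qed

text \<open>Balancing moves a scalar from \<open>D\<close> across the tensor sign, where it becomes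
  a scalar from \<open>C\<close>; so a spanning set survives base change.\<close>

lemma T_lin_span:
  assumes S: "S \<subseteq> carrier B" "lin_span D B S = carrier B"
  shows "lin_span C T ((\<lambda>b. pt b \<one>\<^bsub>C\<^esub>) ` S) = carrier T"
proof
  interpret A: noncomm_algebra C T by (rule noncomm_algebra_T)
  let ?S = "(\<lambda>b. pt b \<one>\<^bsub>C\<^esub>) ` S"
  have Sc: "?S \<subseteq> carrier T" using S(1) by auto
  show "lin_span C T ?S \<subseteq> carrier T" by (rule A.lin_span_closed[OF Sc])
  note E = A.submoduleE[OF A.lin_span_submodule[OF Sc]]
  have p: "pt b c \<in> lin_span C T ?S" if "b \<in> lin_span D B S" "c \<in> carrier C" for b c
    using that
  proof (induction arbitrary: c)
    case zero
    have "pt \<zero>\<^bsub>B\<^esub> c = \<zero>\<^bsub>T\<^esub>"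
      using pt_minus_left[of "\<zero>\<^bsub>B\<^esub>" c] pt_add_left[of "\<zero>\<^bsub>B\<^esub>" "\<zero>\<^bsub>B\<^esub>" c] zero T.add.r_cancel_one'[of "pt \<zero>\<^bsub>B\<^esub> c" "pt \<zero>\<^bsub>B\<^esub> c"] by auto
    then show ?case by (simp add: lin_span.zero)
  next
    case (step d s b)
    have b: "b \<in> carrier B" "s \<in> carrier B" using step S by auto
    have "pt (d \<odot>\<^bsub>B\<^esub> s \<oplus>\<^bsub>B\<^esub> b) c = pt s (d \<odot>\<^bsub>C\<^esub> c) \<oplus>\<^bsub>T\<^esub> pt b c"
      using b step by (simp add: pt_add_left pt_balance)
    also have "pt s (d \<odot>\<^bsub>C\<^esub> c) = (d \<odot>\<^bsub>C\<^esub> c) \<odot>\<^bsub>T\<^esub> pt s \<one>\<^bsub>C\<^esub>"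
      using b step by (simp add: T_simps(6) pt_split)
    finally show ?case using step lin_span.step[of "d \<odot>\<^bsub>C\<^esub> c" C "pt s \<one>\<^bsub>C\<^esub>" ?S "pt b c" T] by auto
  qed
  show "carrier T \<subseteq> lin_span C T ?S"
  proof
    fix t assume "t \<in> carrier T"
    then show "t \<in> lin_span C T ?S"
      by (induction rule: T_induct) (use p S(2) E(5) in auto)
  qed
qed

text \<open>A pair (b, c) is sent to the multiple of \<open>g b\<close> by \<open>c\<close>. This
  extends additively to the free abelian group; the extension is multiplicative because it is so on
  pairs, and it kills the defining relations, hence the ideal they generate. The hypothesis
  \<open>gD\<close> is compatibility with balancing.\<close>

lemma T_universal:
  assumes A: "noncomm_algebra C A" and g: "g \<in> ring_hom B A"
    and gD: "\<And>d b c. d \<in> carrier D \<Longrightarrow> b \<in> carrier B \<Longrightarrow> c \<in> carrier C \<Longrightarrow>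
      c \<odot>\<^bsub>A\<^esub> g (d \<odot>\<^bsub>B\<^esub> b) = (d \<odot>\<^bsub>C\<^esub> c) \<odot>\<^bsub>A\<^esub> g b"
  obtains h where "ring_hom_ring T A h"
    "\<And>b c. b \<in> carrier B \<Longrightarrow> c \<in> carrier C \<Longrightarrow> h (pt b c) = c \<odot>\<^bsub>A\<^esub> g b"
proof -
  interpret A: ring A using A by (rule noncomm_algebra.axioms)
  interpret AA: noncomm_algebra C A by (rule A)
  let ?S = "carrier B \<times> carrier C"
  have gc: "g b \<in> carrier A" if "b \<in> carrier B" for b using ring_hom_closed[OF g that] .
  have "(\<lambda>(b, c). c \<odot>\<^bsub>A\<^esub> g b) ` ?S \<subseteq> carrier (add_monoid A)" using gc by auto
  then obtain \<psi> where psi: "\<psi> \<in> hom (free_Abelian_group ?S) (add_monoid A)"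
    "\<And>x. x \<in> ?S \<Longrightarrow> \<psi> (frag_of x) = (case x of (b, c) \<Rightarrow> c \<odot>\<^bsub>A\<^esub> g b)"
    using comm_group.free_Abelian_group_universal[OF A.a_comm_group] by blast
  have cF: "carrier (free_Abelian_group ?S) = carrier P" by (simp add: free_Abelian_group_def)
  have psic: "\<psi> f \<in> carrier A" if "f \<in> carrier P" for f
    using hom_in_carrier[OF psi(1), of f] that unfolding cF by simp
  have psiadd: "\<psi> (f + f') = \<psi> f \<oplus>\<^bsub>A\<^esub> \<psi> f'" if "f \<in> carrier P" "f' \<in> carrier P" for f f'
    using hom_mult[OF psi(1), of f f'] that unfolding cF by (simp add: free_Abelian_group_def)
  have psidiff: "\<psi> (f - f') = \<psi> f \<ominus>\<^bsub>A\<^esub> \<psi> f'" if ff: "f \<in> carrier P" "f' \<in> carrier P" for f f'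
  proof -
    have "\<psi> f = \<psi> (f - f') \<oplus>\<^bsub>A\<^esub> \<psi> f'" using psiadd[OF diff_mem[OF ff] ff(2)] by simp
    then show ?thesis using psic[OF diff_mem[OF ff]] psic[OF ff(2)] by (simp add: A.minus_eq A.a_assoc A.r_neg)
  qed
  have psi0: "\<psi> 0 = \<zero>\<^bsub>A\<^esub>" using psidiff[of 0 0] psic[of 0] by (simp add: A.minus_eq A.r_neg)
  have of: "\<psi> (frag_of (b, c)) = c \<odot>\<^bsub>A\<^esub> g b" if "b \<in> carrier B" "c \<in> carrier C" for b c
    using psi(2)[of "(b, c)"] that by simp
  have psimult: "f \<in> carrier P \<and> \<psi> (f \<otimes>\<^bsub>P\<^esub> f') = \<psi> f \<otimes>\<^bsub>A\<^esub> \<psi> f'" if f: "f \<in> carrier P" and f': "f' \<in> carrier P" for f f'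
    using f
  proof (induction rule: pair_ring_induct)
    case zero
    then show ?case using psi0 psic[OF f'] by simp
  next
    case (of_pair b c)
    have "f' \<in> carrier P \<and> \<psi> (frag_of (b, c) \<otimes>\<^bsub>P\<^esub> f') = \<psi> (frag_of (b, c)) \<otimes>\<^bsub>A\<^esub> \<psi> f'"
      using f'
    proof (induction rule: pair_ring_induct)
      case zero
      then show ?case using psi0 psic[OF of_mem[OF of_pair]] by simp
    next
      case (of_pair b' c')
      have "(c \<otimes>\<^bsub>C\<^esub> c') \<odot>\<^bsub>A\<^esub> (g b \<otimes>\<^bsub>A\<^esub> g b') = (c \<odot>\<^bsub>A\<^esub> g b) \<otimes>\<^bsub>A\<^esub> (c' \<odot>\<^bsub>A\<^esub> g b')"
        using of_pair \<open>b \<in> carrier B\<close> \<open>c \<in> carrier C\<close> gc C.m_comm[of c c']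
        by (simp add: AA.smult_mult_left AA.smult_mult_right AA.smult_assoc1)
      then show ?case using of_pair \<open>b \<in> carrier B\<close> \<open>c \<in> carrier C\<close> of ring_hom_mult[OF g] by simp
    next
      case (diff f f')
      then show ?case
        using of_mem[OF of_pair] psic[OF of_mem[OF of_pair]] psic[of f] psic[of f'] diff_mem P.m_closed
        by (simp add: pair_mult_diff psidiff A.minus_eq A.r_distr A.r_minus del: pair_ring_simps)
    qed
    then show ?case using of_mem[OF of_pair] by simp
  next
    case (diff f f2)
    then show ?case
      using f' psic[of f] psic[of f2] psic[OF f'] diff_mem P.m_closed
      by (simp add: pair_mult_diff psidiff A.minus_eq A.l_distr A.l_minus del: pair_ring_simps)
  qed
  have psihom: "ring_hom_ring P A \<psi>"
  proof (rule ring_hom_ringI[OF P.ring_axioms A.ring_axioms])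
    show "\<psi> \<one>\<^bsub>P\<^esub> = \<one>\<^bsub>A\<^esub>" using of[OF B.one_closed C.one_closed] ring_hom_one[OF g] by simp
  qed (use psic psimult psiadd in \<open>simp_all add: pair_ring_simps(4) del: pair_ring_simps(1)\<close>)
  interpret psi: ring_hom_ring P A \<psi> by (rule psihom)
  have "rels \<subseteq> a_kernel P A \<psi>"
  proof
    fix f assume f: "f \<in> rels"
    then have "\<psi> f = \<zero>\<^bsub>A\<^esub>"
      unfolding rels_def
    proof (elim UnE CollectE exE conjE)
      fix b b' c assume f: "f = frag_of (b \<oplus>\<^bsub>B\<^esub> b', c) - frag_of (b, c) - frag_of (b', c)"
        and c: "b \<in> carrier B" "b' \<in> carrier B" "c \<in> carrier C"
      show ?thesis unfolding f using c gc of_mem diff_mem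
        by (simp add: psidiff of ring_hom_add[OF g] AA.smult_r_distr A.minus_eq A.a_ac A.r_neg A.r_neg1 A.r_neg2 del: pair_ring_simps)
    next
      fix b c c' assume f: "f = frag_of (b, c \<oplus>\<^bsub>C\<^esub> c') - frag_of (b, c) - frag_of (b, c')"
        and c: "b \<in> carrier B" "c \<in> carrier C" "c' \<in> carrier C"
      show ?thesis unfolding f using c gc of_mem diff_mem
        by (simp add: psidiff of AA.smult_l_distr A.minus_eq A.a_ac A.r_neg A.r_neg1 A.r_neg2 del: pair_ring_simps)
    next
      fix d b c assume f: "f = frag_of (d \<odot>\<^bsub>B\<^esub> b, c) - frag_of (b, d \<odot>\<^bsub>C\<^esub> c)"
        and c: "d \<in> carrier D" "b \<in> carrier B" "c \<in> carrier C"
      show ?thesis unfolding f using c gc of_mem diff_mem gD[OF c]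
        by (simp add: psidiff of A.minus_eq A.r_neg del: pair_ring_simps)
    qed
    moreover have "f \<in> carrier P" using f rels_closed by blast
    ultimately show "f \<in> a_kernel P A \<psi>" unfolding a_kernel_def' by blast
  qed
  then have Jk: "J \<subseteq> a_kernel P A \<psi>" unfolding J_eq by (rule P.genideal_minimal[OF psi.kernel_is_ideal])
  \<comment> \<open>The additive extension is constant on cosets, so the image of a coset is a
    singleton, from which \<open>the_elem\<close> reads off the value of \<open>h\<close>.\<close>
  have im: "\<psi> ` (proj f) = {\<psi> f}" if f: "f \<in> carrier P" for f
  proof -
    have "\<psi> (j \<oplus>\<^bsub>P\<^esub> f) = \<psi> f" if "j \<in> J" for j
    proof -
      have "j \<in> carrier P" "\<psi> j = \<zero>\<^bsub>A\<^esub>" using that Jk unfolding a_kernel_def' by blast+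
      then show ?thesis using psi.hom_add[of j f] psic[OF f] f by (simp del: pair_ring_simps)
    qed
    moreover have "\<zero>\<^bsub>P\<^esub> \<in> J" by (rule J.zero_closed)
    ultimately show ?thesis unfolding proj_def a_r_coset_def' by auto
  qed
  define h where "h t = the_elem (\<psi> ` t)" for t
  have hp: "h (proj f) = \<psi> f" if "f \<in> carrier P" for f using im[OF that] by (simp add: h_def)
  have "ring_hom_ring T A h"
  proof (rule ring_hom_ringI[OF ring_T A.ring_axioms])
    show "h t \<in> carrier A" if "t \<in> carrier T" for t
      using proj_surj[OF that] hp psic by auto
    show "h (s \<otimes>\<^bsub>T\<^esub> t) = h s \<otimes>\<^bsub>A\<^esub> h t" "h (s \<oplus>\<^bsub>T\<^esub> t) = h s \<oplus>\<^bsub>A\<^esub> h t"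
      if st: "s \<in> carrier T" "t \<in> carrier T" for s t
    proof -
      obtain f f' where f: "f \<in> carrier P" "s = proj f" "f' \<in> carrier P" "t = proj f'"
        using proj_surj[OF st(1)] proj_surj[OF st(2)] by blast
      show "h (s \<otimes>\<^bsub>T\<^esub> t) = h s \<otimes>\<^bsub>A\<^esub> h t"
        using proj.hom_mult[OF f(1,3)] hp[OF f(1)] hp[OF f(3)] hp[OF P.m_closed[OF f(1,3)]] psi.hom_mult[OF f(1,3)] f
        by simp
      show "h (s \<oplus>\<^bsub>T\<^esub> t) = h s \<oplus>\<^bsub>A\<^esub> h t"
        using proj.hom_add[OF f(1,3)] hp[OF f(1)] hp[OF f(3)] hp[OF P.a_closed[OF f(1,3)]] psi.hom_add[OF f(1,3)] f
        by simp
    qed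
    show "h \<one>\<^bsub>T\<^esub> = \<one>\<^bsub>A\<^esub>"
      using proj.hom_one hp[OF P.one_closed] psi.hom_one by simp
  qed
  moreover have "h (pt b c) = c \<odot>\<^bsub>A\<^esub> g b" if "b \<in> carrier B" "c \<in> carrier C" for b c
    unfolding pt_proj using hp[OF of_mem[OF that]] of[OF that] by simp
  ultimately show ?thesis by (rule that)
qed

end

section \<open>Orders\<close>

text \<open>A span refers to \<open>M\<close> only through zero, addition and scalar multiplication,
  not through the carrier. Spans computed in a subalgebra and in the ambient algebra are therefore
  equal as sets.\<close>

lemma lin_span_cong:
  assumes "carrier R = carrier R'" "ring.zero M = ring.zero M'" "ring.add M = ring.add M'" "smult M = smult M'"
  shows "lin_span R M S = lin_span R' M' S"
proof
  show "lin_span R M S \<subseteq> lin_span R' M' S"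
  proof
    fix v assume "v \<in> lin_span R M S"
    then show "v \<in> lin_span R' M' S"
      by induction (use assms lin_span.zero[of M' R' S] lin_span.step[of _ R' _ S _ M'] in auto)
  qed
  show "lin_span R' M' S \<subseteq> lin_span R M S"
  proof
    fix v assume "v \<in> lin_span R' M' S"
    then show "v \<in> lin_span R M S"
      by induction (use assms lin_span.zero[of M R S] lin_span.step[of _ R _ S _ M] in auto)
  qed
qed

lemma scalars_via_cring:
  assumes S: "cring S" shows "cring (scalars_via \<phi> S)"
proof -
  interpret S: cring S by fact
  have "Group.comm_monoid (scalars_via \<phi> S)"
    by (rule comm_monoidI) (auto simp: S.m_assoc intro: S.m_comm)
  moreover have "ring (scalars_via \<phi> S)" by (rule ring_cong[OF S.ring_axioms]) simp_all
  ultimately show ?thesis by (intro cring.intro)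
qed

lemma scalars_via_algebra:
  assumes R: "cring R" and S: "cring S" and h: "\<phi> \<in> ring_hom R S"
  shows "algebra R (scalars_via \<phi> S)" "noncomm_algebra R (scalars_via \<phi> S)"
proof -
  interpret S: cring S by fact
  interpret V: cring "scalars_via \<phi> S" by (rule scalars_via_cring[OF S])
  have m: "module R (scalars_via \<phi> S)" by (rule scalars_via_module[OF R S.ring_axioms h])
  show "algebra R (scalars_via \<phi> S)"
    by (intro algebra.intro m V.cring_axioms algebra_axioms.intro)
      (use ring_hom_closed[OF h] in \<open>auto simp: S.m_assoc\<close>)
  show "noncomm_algebra R (scalars_via \<phi> S)"
    by (intro noncomm_algebra.intro m V.ring_axioms noncomm_algebra_axioms.intro)
      (use ring_hom_closed[OF h] in \<open>auto simp: S.m_ac\<close>)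
qed

lemma noncomm_algebra_restrict_scalars:
  assumes A: "noncomm_algebra K A" and R: "cring R"
    and "carrier R \<subseteq> carrier K" "ring.add R = ring.add K" "monoid.mult R = monoid.mult K" "one R = one K"
  shows "noncomm_algebra R A"
proof -
  interpret A: noncomm_algebra K A by fact
  have "module R A"
    by (rule moduleI[OF R A.M.abelian_group_axioms])
      (use assms in \<open>auto simp: A.smult_l_distr A.smult_r_distr A.smult_assoc1 subset_eq\<close>)
  then show ?thesis
    by (intro noncomm_algebra.intro A.ring_axioms noncomm_algebra_axioms.intro)
      (use assms(3) in \<open>auto simp: A.smult_mult_left A.smult_mult_right\<close>)
qed

lemma noncomm_algebra_sub:
  assumes A: "noncomm_algebra R A" and H: "unital_subalgebra R H A"
  shows "noncomm_algebra R (A\<lparr>carrier := H\<rparr>)"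
proof -
  interpret A: noncomm_algebra R A by fact
  have sub: "subring H A" and sm: "\<And>r b. r \<in> carrier R \<Longrightarrow> b \<in> H \<Longrightarrow> r \<odot>\<^bsub>A\<^esub> b \<in> H"
    using H by (auto simp: unital_subalgebra_def)
  have HA: "\<And>v. v \<in> H \<Longrightarrow> v \<in> carrier A" using subringE(1)[OF sub] by auto
  interpret B: ring "A\<lparr>carrier := H\<rparr>" by (rule A.subring_is_ring[OF sub])
  have "module R (A\<lparr>carrier := H\<rparr>)"
    by (rule moduleI[OF A.R.cring_axioms B.abelian_group_axioms])
      (auto simp: sm HA A.smult_l_distr A.smult_r_distr A.smult_assoc1)
  then show ?thesis
    by (intro noncomm_algebra.intro B.ring_axioms noncomm_algebra_axioms.intro)
      (auto simp: HA A.smult_mult_left A.smult_mult_right)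
qed

lemma subcring_carrier: "cring K \<Longrightarrow> subring D K \<Longrightarrow> cring (K\<lparr>carrier := D\<rparr>)"
  using ring.subcring_iff[of K D] cring.subcringI'[of K D] subringE(1)[of D K] cring.axioms(1)[of K] by blast

text \<open>A combination over \<open>D\<close> is one over \<open>K\<close>; only the sum has to be
  moved from \<open>H\<close> to \<open>A\<close>.\<close>

lemma lin_indep_sub:
  assumes A: "noncomm_algebra K A" and D: "subring D K" and H: "unital_subalgebra (K\<lparr>carrier := D\<rparr>) H A"
    and e: "\<forall>i\<in>I. e i \<in> H" and ind: "lin_indep K A e I"
  shows "lin_indep (K\<lparr>carrier := D\<rparr>) (A\<lparr>carrier := H\<rparr>) e I"
  unfolding lin_indep_def
proof (intro ballI impI)
  interpret A: noncomm_algebra K A by fact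
  have sub: "subring H A" and sm: "\<And>r b. r \<in> D \<Longrightarrow> b \<in> H \<Longrightarrow> r \<odot>\<^bsub>A\<^esub> b \<in> H"
    using H by (auto simp: unital_subalgebra_def)
  interpret B: ring "A\<lparr>carrier := H\<rparr>" by (rule A.subring_is_ring[OF sub])
  fix c assume c: "c \<in> fin_supp (K\<lparr>carrier := D\<rparr>) I"
    and z: "lincomb (K\<lparr>carrier := D\<rparr>) (A\<lparr>carrier := H\<rparr>) e c = \<zero>\<^bsub>A\<lparr>carrier := H\<rparr>\<^esub>"
  have cD: "c i \<in> D" for i using c by (auto simp: fin_supp_def)
  have supp: "{i. c i \<noteq> \<zero>\<^bsub>K\<^esub>} \<subseteq> I" using c by (auto simp: fin_supp_def)
  have "c \<in> fin_supp K I" using c subringE(1)[OF D] by (auto simp: fin_supp_def)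
  moreover have "lincomb (K\<lparr>carrier := D\<rparr>) (A\<lparr>carrier := H\<rparr>) e c = lincomb K A e c"
  proof -
    have "(\<lambda>i. c i \<odot>\<^bsub>A\<^esub> e i) \<in> {i. c i \<noteq> \<zero>\<^bsub>K\<^esub>} \<rightarrow> H" using sm cD e supp by auto
    then show ?thesis
      unfolding lincomb_def
      using finsum_hom[OF B.abelian_monoid_axioms A.M.abelian_monoid_axioms, of "\<lambda>v. v" "\<lambda>i. c i \<odot>\<^bsub>A\<^esub> e i" "{i. c i \<noteq> \<zero>\<^bsub>K\<^esub>}"]
        subringE(1)[OF sub] by (simp add: Pi_def subset_eq)
  qed
  ultimately show "\<forall>i. c i = \<zero>\<^bsub>K\<lparr>carrier := D\<rparr>\<^esub>" using z ind unfolding lin_indep_def by auto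
qed

lemma free_moduleI:
  assumes M: "module R M" and e: "\<forall>i\<in>I. e i \<in> carrier M" and one: "\<one>\<^bsub>R\<^esub> \<noteq> \<zero>\<^bsub>R\<^esub>"
    and ind: "lin_indep R M e I" and span: "lin_span R M (e ` I) = carrier M"
  shows "free_module R M"
proof -
  interpret M: module R M by fact
  have b: "module_basis R M e I" using ind span M.module_basis_iff[OF e] by simp
  show ?thesis
    unfolding free_module_def using M M.module_basis_image[OF e b M.module_basis_inj[OF e b one]] by blast
qed

text \<open>The \<open>K\<close>-basis is also a \<open>D\<close>-basis of its \<open>D\<close>-span
  \<open>H\<close>. The base change is spanned over \<open>K\<close> by the tensors of basis
  elements with the unit, and the natural map carries them to a basis; this gives injectivity and
  surjectivity, so that independence of the tensors is a consequence and not an ingredient. The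
  criterion serves for the order of the algebra and for that of its graded ring.\<close>

lemma is_orderI:
  assumes A: "noncomm_algebra K A" and one: "\<one>\<^bsub>K\<^esub> \<noteq> \<zero>\<^bsub>K\<^esub>" and D: "subring D K"
    and e: "\<forall>i\<in>I. e i \<in> carrier A" and ind: "lin_indep K A e I" and span: "lin_span K A (e ` I) = carrier A"
    and H: "subring H A" "lin_span (K\<lparr>carrier := D\<rparr>) A (e ` I) = H"
  shows "is_order K A D H"
proof -
  interpret A: noncomm_algebra K A by fact
  let ?R = "K\<lparr>carrier := D\<rparr>" and ?B = "A\<lparr>carrier := H\<rparr>" and ?C = "scalars_via (\<lambda>d. d) K"
  have crK: "cring K" by (rule A.R.cring_axioms)
  have crR: "cring ?R" by (rule subcring_carrier[OF crK D])
  have DK: "D \<subseteq> carrier K" by (rule subringE(1)[OF D])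
  have AR: "noncomm_algebra ?R A"
    by (rule noncomm_algebra_restrict_scalars[OF A crR]) (use DK in auto)
  interpret AR: noncomm_algebra ?R A by (rule AR)
  have eA: "e ` I \<subseteq> carrier A" using e by auto
  have Hsub: "unital_subalgebra ?R H A"
    unfolding unital_subalgebra_def using H AR.submoduleE(4)[OF AR.lin_span_submodule[OF eA]] by auto
  have eH: "e i \<in> H" if "i \<in> I" for i using AR.lin_span_incl[OF eA, of "e i"] that H(2) by auto
  have HA: "H \<subseteq> carrier A" by (rule subringE(1)[OF H(1)])
  have B: "noncomm_algebra ?R ?B" by (rule noncomm_algebra_sub[OF AR Hsub])
  have C: "noncomm_algebra ?R ?C"
    by (rule scalars_via_algebra[OF crR crK]) (use DK in \<open>auto intro!: ring_hom_memI\<close>)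
  have CA: "noncomm_algebra ?C A"
    by (rule noncomm_algebra_restrict_scalars[OF A scalars_via_cring[OF crK]]) simp_all
  interpret CA: noncomm_algebra ?C A by (rule CA)
  interpret t: tensor ?R ?B ?C by (intro tensor.intro B C scalars_via_cring crK)
  interpret T: noncomm_algebra ?C t.T by (rule t.noncomm_algebra_T)
  have spanB: "lin_span ?R ?B (e ` I) = H"
    using lin_span_cong[of ?R ?R ?B A "e ` I"] H(2) by simp
  have g: "(\<lambda>b. b) \<in> ring_hom ?B A" using HA by (auto intro!: ring_hom_memI)
  have gD: "c \<odot>\<^bsub>A\<^esub> (d \<odot>\<^bsub>?B\<^esub> b) = (d \<odot>\<^bsub>?C\<^esub> c) \<odot>\<^bsub>A\<^esub> b"
    if "d \<in> carrier ?R" "b \<in> carrier ?B" "c \<in> carrier ?C" for d b c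
  proof -
    have "d \<in> carrier K" "b \<in> carrier A" "c \<in> carrier K" using that DK HA by auto
    then show ?thesis using A.smult_assoc1[of c d b] A.R.m_comm[of c d] by simp
  qed
  obtain h where h: "ring_hom_ring t.T A h"
    "\<And>b c. b \<in> carrier ?B \<Longrightarrow> c \<in> carrier ?C \<Longrightarrow> h (t.pt b c) = c \<odot>\<^bsub>A\<^esub> b"
    using t.T_universal[OF CA g gD] by blast
  interpret h: ring_hom_ring t.T A h by (rule h(1))
  define u where "u i = t.pt (e i) \<one>\<^bsub>?C\<^esub>" for i
  have uT: "\<forall>i\<in>I. u i \<in> carrier t.T" unfolding u_def using eH by (intro ballI t.pt_closed) auto
  have uspan: "lin_span ?C t.T (u ` I) = carrier t.T"
    using t.T_lin_span[of "e ` I"] spanB eH by (auto simp: u_def image_image)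
  have hu: "h (k \<odot>\<^bsub>t.T\<^esub> u i) = k \<odot>\<^bsub>A\<^esub> e i" if "k \<in> carrier K" "i \<in> I" for k i
    using h(2)[of "e i" k] t.pt_split[of "e i" k] eH[OF that(2)] that
    unfolding u_def t.T_simps(6) by simp
  \<comment> \<open>Expand \<open>t\<close> in the spanning tensors, which are not yet known to be
    independent; its image under \<open>h\<close> is the same combination of the basis
    \<open>e\<close>, so all coefficients vanish.\<close>
  have ker: "t = \<zero>\<^bsub>t.T\<^esub>" if t: "t \<in> carrier t.T" and h0: "h t = \<zero>\<^bsub>A\<^esub>" for t
  proof -
    have "t \<in> lincomb ?C t.T u ` fin_supp ?C I"
      using t uspan T.lin_span_eq_lincomb[OF uT] by simp
    then obtain c where c: "t = lincomb ?C t.T u c" "c \<in> fin_supp ?C I" by (rule imageE)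
    then have cK: "c \<in> fin_supp K I" by (simp add: fin_supp_def)
    have S: "c i \<in> carrier K" "c i \<noteq> \<zero>\<^bsub>K\<^esub> \<Longrightarrow> i \<in> I" for i using cK by (auto simp: fin_supp_def)
    have "h t = (\<Oplus>\<^bsub>A\<^esub>i\<in>{i. c i \<noteq> \<zero>\<^bsub>K\<^esub>}. h (c i \<odot>\<^bsub>t.T\<^esub> u i))"
      unfolding c(1) lincomb_def scalars_via_simps
    proof (rule finsum_hom[OF T.M.abelian_monoid_axioms A.M.abelian_monoid_axioms])
      show "(\<lambda>i. c i \<odot>\<^bsub>t.T\<^esub> u i) \<in> {i. c i \<noteq> \<zero>\<^bsub>K\<^esub>} \<rightarrow> carrier t.T"
        using S uT by (intro funcsetI T.smult_closed) auto
    qed auto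
    also have "\<dots> = lincomb K A e c"
      unfolding lincomb_def by (rule A.M.add.finprod_cong') (use S hu e in auto)
    finally have "\<forall>i. c i = \<zero>\<^bsub>K\<^esub>" using h0 ind cK unfolding lin_indep_def by auto
    then show ?thesis unfolding c(1) lincomb_def by simp
  qed
  have inj: "inj_on h (carrier t.T)"
  proof (rule h.trivial_ker_imp_inj)
    show "a_kernel t.T A h = {\<zero>\<^bsub>t.T\<^esub>}"
      unfolding a_kernel_def' using ker h.hom_zero T.M.zero_closed by blast
  qed
  have surj: "h ` carrier t.T = carrier A"
  proof
    show "carrier A \<subseteq> h ` carrier t.T"
    proof
      fix v assume "v \<in> carrier A"
      then have "v \<in> lin_span K A (e ` I)" using span by simp
      then show "v \<in> h ` carrier t.T"
      proof induction
        case zero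
        show ?case by (rule image_eqI[of _ _ "\<zero>\<^bsub>t.T\<^esub>"]) auto
      next
        case (step k s v)
        then obtain i t where it: "i \<in> I" "s = e i" "t \<in> carrier t.T" "v = h t" by auto
        have c: "k \<odot>\<^bsub>t.T\<^esub> u i \<in> carrier t.T" using step(1) it(1) uT by (intro T.smult_closed) auto
        have "k \<odot>\<^bsub>A\<^esub> s \<oplus>\<^bsub>A\<^esub> v = h (k \<odot>\<^bsub>t.T\<^esub> u i \<oplus>\<^bsub>t.T\<^esub> t)"
          using it hu[OF step(1) it(1)] c by simp
        then show ?case using c it(3) by blast
      qed
    qed
  qed auto
  have "h \<in> ring_iso t.T A" unfolding ring_iso_def bij_betw_def using inj surj h.homh by simp
  moreover have "free_module ?R ?B"
  proof (rule free_moduleI)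
    show "module ?R ?B" using B by (rule noncomm_algebra.axioms)
    show "lin_indep ?R ?B e I" by (rule lin_indep_sub[OF A D Hsub _ ind]) (use eH in simp)
    show "lin_span ?R ?B (e ` I) = carrier ?B" using spanB by simp
  qed (use eH one in auto)
  ultimately show ?thesis
    unfolding is_order_def Let_def using D Hsub h(2) by auto
qed

section \<open>Associated graded rings\<close>

locale filtered =
  fixes R :: "('r, 'm) ring_scheme" and A :: "('r, 'a, 'n) module_scheme" and F :: "nat \<Rightarrow> 'a set"
  assumes alg: "noncomm_algebra R A" and filt: "nat_filtration R A F"
begin

interpretation A: ring A using alg by (rule noncomm_algebra.axioms)
interpretation AA: noncomm_algebra R A by (rule alg)

abbreviation "gr \<equiv> assoc_graded A F"
abbreviation "P \<equiv> filt_pred A F"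

lemma F_sub: "submodule (F i) R A" and F_Suc: "F i \<subseteq> F (Suc i)" and one_F: "\<one>\<^bsub>A\<^esub> \<in> F 0"
  and F_mult: "a \<in> F i \<Longrightarrow> b \<in> F j \<Longrightarrow> a \<otimes>\<^bsub>A\<^esub> b \<in> F (i + j)" and F_union: "(\<Union>i. F i) = carrier A"
  using filt unfolding nat_filtration_def by auto

lemmas F_E = AA.submoduleE[OF F_sub] AA.submodule_zero[OF F_sub]

lemma F_mono: "i \<le> j \<Longrightarrow> F i \<subseteq> F j"
  by (rule lift_Suc_mono_le[of F]) (use F_Suc in auto)

lemma P_sub: "submodule (P i) R A"
proof (cases i)
  case 0
  have "submodule {\<zero>\<^bsub>A\<^esub>} R A" by (rule AA.submoduleI) auto
  then show ?thesis using 0 by (simp add: filt_pred_def)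
qed (simp add: filt_pred_def F_sub)

lemmas P_E = AA.submoduleE[OF P_sub] AA.submodule_zero[OF P_sub]

lemma P_F: "P i \<subseteq> F i"
  using F_Suc F_E(7) by (cases i) (auto simp: filt_pred_def)

lemma F_P: "i < j \<Longrightarrow> F i \<subseteq> P j"
  using F_mono by (cases j) (auto simp: filt_pred_def)

lemma P_mult_left: "a \<in> P i \<Longrightarrow> b \<in> F j \<Longrightarrow> a \<otimes>\<^bsub>A\<^esub> b \<in> P (i + j)"
  using F_mult[of a "i - 1" b j] P_E(7)[of j] F_E(1)[of j]
  by (cases i) (auto simp: filt_pred_def split: nat.splits)

lemma P_mult_right: "a \<in> F i \<Longrightarrow> b \<in> P j \<Longrightarrow> a \<otimes>\<^bsub>A\<^esub> b \<in> P (i + j)"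
  using F_mult[of a i b "j - 1"] P_E(7)[of i] F_E(1)[of i]
  by (cases j) (auto simp: filt_pred_def split: nat.splits)

lemma P_abelian: "abelian_subgroup (P i) A"
  using P_sub submodule.axioms(1) by (intro abelian_subgroupI3 additive_subgroup.intro A.abelian_group_axioms) blast

lemma coset_eq_iff:
  assumes "a \<in> carrier A" "b \<in> carrier A"
  shows "P i +>\<^bsub>A\<^esub> a = P i +>\<^bsub>A\<^esub> b \<longleftrightarrow> a \<ominus>\<^bsub>A\<^esub> b \<in> P i"
proof -
  interpret P: abelian_subgroup "P i" A by (rule P_abelian)
  have "P i +>\<^bsub>A\<^esub> a = P i +>\<^bsub>A\<^esub> b \<longleftrightarrow> a \<in> P i +>\<^bsub>A\<^esub> b"
    using P.a_rcos_self[OF assms(1)] A.a_repr_independence[OF _ assms(2) P.a_subgroup, of a] by auto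
  then show ?thesis using P.a_rcos_module[OF assms(2,1)] by (simp add: A.minus_eq)
qed

lemma coset_mem_iff:
  assumes "a \<in> carrier A"
  shows "b \<in> P i +>\<^bsub>A\<^esub> a \<longleftrightarrow> b \<in> carrier A \<and> b \<ominus>\<^bsub>A\<^esub> a \<in> P i"
proof -
  interpret P: abelian_subgroup "P i" A by (rule P_abelian)
  have "P i +>\<^bsub>A\<^esub> a \<subseteq> carrier A" by (rule A.a_r_coset_subset_G[OF P.a_subset assms])
  then show ?thesis using P.a_rcos_module[OF assms, of b] by (auto simp: A.minus_eq)
qed

text \<open>Such a family is a polynomial with coefficients \<open>a i\<close>, and
  \<open>reps\<close> is the Rees ring of the filtration inside the polynomial ring over
  \<open>A\<close>. The map \<open>cls\<close> sends it onto the graded ring.\<close>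

definition "reps = {a. (\<forall>i. a i \<in> F i) \<and> finite {i. a i \<noteq> \<zero>\<^bsub>A\<^esub>}}"

definition "cls a = (\<lambda>i. P i +>\<^bsub>A\<^esub> a i)"

lemma reps_closed: "a \<in> reps \<Longrightarrow> a i \<in> carrier A"
  using F_E(1) by (auto simp: reps_def)

lemma cls_eq_iff: "a \<in> reps \<Longrightarrow> b \<in> reps \<Longrightarrow> cls a = cls b \<longleftrightarrow> (\<forall>i. a i \<ominus>\<^bsub>A\<^esub> b i \<in> P i)"
  unfolding cls_def fun_eq_iff using coset_eq_iff reps_closed by simp

lemma gr_simps:
  "carrier gr = {f. (\<forall>i. f i \<in> (\<lambda>a. P i +>\<^bsub>A\<^esub> a) ` F i) \<and> finite {i. f i \<noteq> P i}}"
  "f \<otimes>\<^bsub>gr\<^esub> g = (\<lambda>n. \<Union>a\<in>{a. \<forall>i. a i \<in> f i}. \<Union>b\<in>{b. \<forall>i. b i \<in> g i}.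
                 P n +>\<^bsub>A\<^esub> (\<Oplus>\<^bsub>A\<^esub>i\<in>{..n}. a i \<otimes>\<^bsub>A\<^esub> b (n - i)))"
  "\<one>\<^bsub>gr\<^esub> = (\<lambda>i. if i = 0 then P 0 +>\<^bsub>A\<^esub> \<one>\<^bsub>A\<^esub> else P i)"
  "\<zero>\<^bsub>gr\<^esub> = P"
  "f \<oplus>\<^bsub>gr\<^esub> g = (\<lambda>i. f i <+>\<^bsub>A\<^esub> g i)"
  "r \<odot>\<^bsub>gr\<^esub> f = (\<lambda>i. \<Union>a\<in>f i. P i +>\<^bsub>A\<^esub> (r \<odot>\<^bsub>A\<^esub> a))"
  by (simp_all add: assoc_graded_def)

lemma coset_zero: "P i +>\<^bsub>A\<^esub> \<zero>\<^bsub>A\<^esub> = P i"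
  using A.a_coset_add_zero[of "P i"] P_E(1) by blast

lemma cls_surj: "carrier gr = cls ` reps"
proof
  show "carrier gr \<subseteq> cls ` reps"
  proof
    fix f assume f: "f \<in> carrier gr"
    then have "\<forall>i. \<exists>a\<in>F i. f i = P i +>\<^bsub>A\<^esub> a" by (auto simp: gr_simps)
    then obtain a where a: "\<And>i. a i \<in> F i" "\<And>i. f i = P i +>\<^bsub>A\<^esub> a i" by metis
    let ?a = "\<lambda>i. if f i = P i then \<zero>\<^bsub>A\<^esub> else a i"
    have "finite {i. f i \<noteq> P i}" using f by (simp add: gr_simps)
    then have "finite {i. ?a i \<noteq> \<zero>\<^bsub>A\<^esub>}" by (rule finite_subset[rotated]) auto
    then have "?a \<in> reps" using a(1) F_E(7) by (simp add: reps_def)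
    moreover have "f = cls ?a"
    proof
      fix i show "f i = cls ?a i" using a(2)[of i] coset_zero[of i] by (cases "f i = P i") (auto simp: cls_def)
    qed
    ultimately show "f \<in> cls ` reps" by blast
  qed
  show "cls ` reps \<subseteq> carrier gr"
  proof clarify
    fix a assume a: "a \<in> reps"
    have "{i. cls a i \<noteq> P i} \<subseteq> {i. a i \<noteq> \<zero>\<^bsub>A\<^esub>}" using coset_zero by (auto simp: cls_def)
    then have "finite {i. cls a i \<noteq> P i}" using a by (auto simp: reps_def intro: finite_subset)
    then show "cls a \<in> carrier gr" using a by (auto simp: gr_simps cls_def reps_def)
  qed
qed

lemma cls_closed: "a \<in> reps \<Longrightarrow> cls a \<in> carrier gr"
  using cls_surj by blast

lemma cls_add: "a \<in> reps \<Longrightarrow> b \<in> reps \<Longrightarrow> cls a \<oplus>\<^bsub>gr\<^esub> cls b = cls (\<lambda>i. a i \<oplus>\<^bsub>A\<^esub> b i)"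
  unfolding gr_simps cls_def using abelian_subgroup.a_rcos_sum[OF P_abelian] reps_closed by simp

lemma cls_zero: "cls (\<lambda>i. \<zero>\<^bsub>A\<^esub>) = \<zero>\<^bsub>gr\<^esub>"
  using coset_zero by (simp add: cls_def gr_simps fun_eq_iff)

lemma cls_one: "cls (\<lambda>i. if i = 0 then \<one>\<^bsub>A\<^esub> else \<zero>\<^bsub>A\<^esub>) = \<one>\<^bsub>gr\<^esub>"
  using coset_zero by (auto simp: cls_def gr_simps fun_eq_iff)

lemma cls_smult:
  assumes r: "r \<in> carrier R" and a: "a \<in> reps"
  shows "r \<odot>\<^bsub>gr\<^esub> cls a = cls (\<lambda>i. r \<odot>\<^bsub>A\<^esub> a i)"
proof
  fix i
  have ai: "a i \<in> carrier A" by (rule reps_closed[OF a])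
  have "P i +>\<^bsub>A\<^esub> (r \<odot>\<^bsub>A\<^esub> b) = P i +>\<^bsub>A\<^esub> (r \<odot>\<^bsub>A\<^esub> a i)" if b: "b \<in> P i +>\<^bsub>A\<^esub> a i" for b
  proof -
    have bc: "b \<in> carrier A" "b \<ominus>\<^bsub>A\<^esub> a i \<in> P i" using b coset_mem_iff[OF ai] by auto
    have "r \<odot>\<^bsub>A\<^esub> b \<ominus>\<^bsub>A\<^esub> r \<odot>\<^bsub>A\<^esub> a i = r \<odot>\<^bsub>A\<^esub> (b \<ominus>\<^bsub>A\<^esub> a i)"
      using r bc ai by (simp add: A.minus_eq AA.smult_r_distr AA.smult_r_minus)
    then show ?thesis using P_E(4)[OF r bc(2)] r bc ai by (subst coset_eq_iff) auto
  qed
  moreover have "a i \<in> P i +>\<^bsub>A\<^esub> a i" using coset_mem_iff[OF ai] ai P_E(7) by (simp add: A.minus_eq A.r_neg)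
  ultimately show "(r \<odot>\<^bsub>gr\<^esub> cls a) i = cls (\<lambda>i. r \<odot>\<^bsub>A\<^esub> a i) i"
    unfolding gr_simps cls_def by blast
qed

text \<open>The product in the graded ring is a union over all representatives of both factors; it
  is a single coset because another choice changes the product in degree \<open>n\<close> only by an
  element of \<open>P n\<close>.\<close>

lemma cls_mult:
  assumes a: "a \<in> reps" and b: "b \<in> reps"
  shows "cls a \<otimes>\<^bsub>gr\<^esub> cls b = cls (\<lambda>n. \<Oplus>\<^bsub>A\<^esub>i\<in>{..n}. a i \<otimes>\<^bsub>A\<^esub> b (n - i))"
proof
  fix n :: nat
  let ?s = "\<lambda>a b. \<Oplus>\<^bsub>A\<^esub>i\<in>{..n}. a i \<otimes>\<^bsub>A\<^esub> b (n - i)"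
  have eq: "P n +>\<^bsub>A\<^esub> ?s a' b' = P n +>\<^bsub>A\<^esub> ?s a b"
    if a': "\<forall>i. a' i \<in> cls a i" and b': "\<forall>i. b' i \<in> cls b i" for a' b'
  proof -
    have ac: "a i \<in> carrier A" "b i \<in> carrier A" for i using reps_closed a b by auto
    have aF: "a i \<in> F i" "b i \<in> F i" for i using a b by (auto simp: reps_def)
    have a'c: "a' i \<in> carrier A" "a' i \<ominus>\<^bsub>A\<^esub> a i \<in> P i" for i
      using a' coset_mem_iff[OF ac(1)] by (auto simp: cls_def)
    have b'c: "b' i \<in> carrier A" "b' i \<ominus>\<^bsub>A\<^esub> b i \<in> P i" for i
      using b' coset_mem_iff[OF ac(2)] by (auto simp: cls_def)
    have a'F: "a' i \<in> F i" for i
    proof -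
      have "(a' i \<ominus>\<^bsub>A\<^esub> a i) \<oplus>\<^bsub>A\<^esub> a i \<in> F i" using F_E(5) a'c(2) P_F aF by blast
      then show ?thesis using a'c ac by (simp add: A.minus_eq A.a_assoc A.l_neg)
    qed
    \<comment> \<open>Change one factor at a time: one error is an element of \<open>F i\<close>
      times one of \<open>P j\<close>, the other an element of \<open>P i\<close> times one of
      \<open>F j\<close>.\<close>
    have tm: "a' i \<otimes>\<^bsub>A\<^esub> b' j \<ominus>\<^bsub>A\<^esub> a i \<otimes>\<^bsub>A\<^esub> b j \<in> P (i + j)" for i j
    proof -
      have "a' i \<otimes>\<^bsub>A\<^esub> b' j \<ominus>\<^bsub>A\<^esub> a i \<otimes>\<^bsub>A\<^esub> b j =
        a' i \<otimes>\<^bsub>A\<^esub> (b' j \<ominus>\<^bsub>A\<^esub> b j) \<oplus>\<^bsub>A\<^esub> (a' i \<ominus>\<^bsub>A\<^esub> a i) \<otimes>\<^bsub>A\<^esub> b j"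
        using a'c b'c ac
        by (simp add: A.minus_eq A.l_distr A.r_distr A.l_minus A.r_minus A.a_assoc A.r_neg1)
      then show ?thesis
        using P_mult_right[OF a'F b'c(2)] P_mult_left[OF a'c(2) aF(2)] P_E(5) by simp
    qed
    have "?s a' b' = (\<Oplus>\<^bsub>A\<^esub>i\<in>{..n}. (a' i \<otimes>\<^bsub>A\<^esub> b' (n - i) \<ominus>\<^bsub>A\<^esub> a i \<otimes>\<^bsub>A\<^esub> b (n - i)) \<oplus>\<^bsub>A\<^esub> a i \<otimes>\<^bsub>A\<^esub> b (n - i))"
      using a'c b'c ac by (intro A.add.finprod_cong') (auto simp: A.minus_eq A.a_assoc A.l_neg)
    also have "\<dots> = (\<Oplus>\<^bsub>A\<^esub>i\<in>{..n}. a' i \<otimes>\<^bsub>A\<^esub> b' (n - i) \<ominus>\<^bsub>A\<^esub> a i \<otimes>\<^bsub>A\<^esub> b (n - i)) \<oplus>\<^bsub>A\<^esub> ?s a b"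
      using a'c b'c ac by (intro A.finsum_addf) auto
    finally have e: "?s a' b' = (\<Oplus>\<^bsub>A\<^esub>i\<in>{..n}. a' i \<otimes>\<^bsub>A\<^esub> b' (n - i) \<ominus>\<^bsub>A\<^esub> a i \<otimes>\<^bsub>A\<^esub> b (n - i)) \<oplus>\<^bsub>A\<^esub> ?s a b" .
    have dP: "(\<Oplus>\<^bsub>A\<^esub>i\<in>S. a' i \<otimes>\<^bsub>A\<^esub> b' (n - i) \<ominus>\<^bsub>A\<^esub> a i \<otimes>\<^bsub>A\<^esub> b (n - i)) \<in> P n"
      if "finite S" "S \<subseteq> {..n}" for S
      using that
    proof induction
      case (insert i S)
      then have "a' i \<otimes>\<^bsub>A\<^esub> b' (n - i) \<ominus>\<^bsub>A\<^esub> a i \<otimes>\<^bsub>A\<^esub> b (n - i) \<in> P n" using tm[of i "n - i"] by auto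
      then show ?case using insert a'c b'c ac P_E(5) by (simp add: Pi_def)
    qed (simp add: P_E(7))
    have c: "?s a' b' \<in> carrier A" "?s a b \<in> carrier A"
      using a'c b'c ac by (auto intro!: A.finsum_closed)
    have "?s a' b' \<ominus>\<^bsub>A\<^esub> ?s a b = (\<Oplus>\<^bsub>A\<^esub>i\<in>{..n}. a' i \<otimes>\<^bsub>A\<^esub> b' (n - i) \<ominus>\<^bsub>A\<^esub> a i \<otimes>\<^bsub>A\<^esub> b (n - i))"
      unfolding e using c(2) a'c b'c ac by (simp add: A.minus_eq A.a_assoc A.r_neg)
    then show ?thesis using dP[of "{..n}"] coset_eq_iff[OF c] by simp
  qed
  have mem: "\<forall>i. c i \<in> cls c i" if "c \<in> reps" for c
    unfolding cls_def using coset_mem_iff[OF reps_closed[OF that]] reps_closed[OF that] P_E(7)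
    by (simp add: A.minus_eq A.r_neg)
  show "(cls a \<otimes>\<^bsub>gr\<^esub> cls b) n = cls (\<lambda>n. \<Oplus>\<^bsub>A\<^esub>i\<in>{..n}. a i \<otimes>\<^bsub>A\<^esub> b (n - i)) n"
    unfolding gr_simps cls_def[of "\<lambda>n. \<Oplus>\<^bsub>A\<^esub>i\<in>{..n}. a i \<otimes>\<^bsub>A\<^esub> b (n - i)"]
    using eq mem[OF a] mem[OF b] by blast
qed

lemma reps_up: "reps \<subseteq> up A"
proof
  fix a assume a: "a \<in> reps"
  then obtain n where "\<And>i. i \<in> {i. a i \<noteq> \<zero>\<^bsub>A\<^esub>} \<Longrightarrow> i \<le> n"
    by (auto simp: reps_def finite_nat_set_iff_bounded_le)
  then have "bound \<zero>\<^bsub>A\<^esub> n a" by (intro bound.intro) (meson leD mem_Collect_eq)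
  then show "a \<in> up A" using reps_closed[OF a] by (intro mem_upI) auto
qed

lemma UP_simps:
  "carrier (UP A) = up A"
  "\<one>\<^bsub>UP A\<^esub> = (\<lambda>i. if i = 0 then \<one>\<^bsub>A\<^esub> else \<zero>\<^bsub>A\<^esub>)"
  "a \<in> up A \<Longrightarrow> coeff (UP A) a i = a i"
  "a \<in> up A \<Longrightarrow> b \<in> up A \<Longrightarrow> a \<oplus>\<^bsub>UP A\<^esub> b = (\<lambda>i. a i \<oplus>\<^bsub>A\<^esub> b i)"
  "a \<in> up A \<Longrightarrow> b \<in> up A \<Longrightarrow> a \<otimes>\<^bsub>UP A\<^esub> b = (\<lambda>n. \<Oplus>\<^bsub>A\<^esub>i\<in>{..n}. a i \<otimes>\<^bsub>A\<^esub> b (n - i))"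
  by (simp_all add: UP_def)

lemma reps_subring: "subring reps (UP A)"
proof -
  interpret U: UP_ring A "UP A" by unfold_locales
  have fin: "finite {i. a i \<noteq> \<zero>\<^bsub>A\<^esub>}" if "a \<in> up A" for a
  proof -
    obtain n where "bound \<zero>\<^bsub>A\<^esub> n a" using A.bound_upD[OF \<open>a \<in> up A\<close>] by blast
    then have "{i. a i \<noteq> \<zero>\<^bsub>A\<^esub>} \<subseteq> {..n}" by (auto dest: bound_below)
    then show ?thesis by (rule finite_subset) simp
  qed
  have repsI: "a \<in> reps" if "a \<in> carrier (UP A)" "\<And>i. a i \<in> F i" for a
    using that fin by (simp add: reps_def UP_simps)
  have UPc: "reps \<subseteq> carrier (UP A)" using reps_up by (simp add: UP_simps)
  show ?thesis
  proof (rule U.P.subringI)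
    show "reps \<subseteq> carrier (UP A)" by (rule UPc)
    show "\<one>\<^bsub>UP A\<^esub> \<in> reps"
    proof (rule repsI)
      show "\<one>\<^bsub>UP A\<^esub> i \<in> F i" for i using one_F F_E(7)[of i] by (simp add: UP_simps)
    qed (rule U.P.one_closed)
    show "\<ominus>\<^bsub>UP A\<^esub> a \<in> reps" if a: "a \<in> reps" for a
    proof (rule repsI)
      show "\<ominus>\<^bsub>UP A\<^esub> a \<in> carrier (UP A)" using a UPc by auto
      then have up: "\<ominus>\<^bsub>UP A\<^esub> a \<in> up A" "a \<in> up A" using a reps_up UP_simps(1) by blast+
      have "coeff (UP A) (\<ominus>\<^bsub>UP A\<^esub> a) i = \<ominus>\<^bsub>A\<^esub> coeff (UP A) a i" for i
        using up(2) UP_simps(1) by (intro U.coeff_a_inv) simp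
      then have "(\<ominus>\<^bsub>UP A\<^esub> a) i = \<ominus>\<^bsub>A\<^esub> a i" for i
        unfolding UP_simps(3)[OF up(1)] UP_simps(3)[OF up(2)] .
      then show "(\<ominus>\<^bsub>UP A\<^esub> a) i \<in> F i" for i
        using a F_E(3)[of "a i" i] by (simp add: reps_def)
    qed
    fix a b assume ab: "a \<in> reps" "b \<in> reps"
    then have up: "a \<in> up A" "b \<in> up A" using reps_up by auto
    have F: "a i \<in> F i" "b i \<in> F i" for i using ab by (auto simp: reps_def)
    show "a \<oplus>\<^bsub>UP A\<^esub> b \<in> reps"

    proof (rule repsI)
      show "(a \<oplus>\<^bsub>UP A\<^esub> b) i \<in> F i" for i using F_E(5)[OF F(1)[of i] F(2)[of i]] up by (simp add: UP_simps)
    qed (use ab UPc in \<open>blast intro: U.P.a_closed\<close>)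
    show "a \<otimes>\<^bsub>UP A\<^esub> b \<in> reps"
    proof (rule repsI)
      show "a \<otimes>\<^bsub>UP A\<^esub> b \<in> carrier (UP A)" using ab UPc by (intro U.P.m_closed) auto
      fix n
      have "(\<Oplus>\<^bsub>A\<^esub>i\<in>S. a i \<otimes>\<^bsub>A\<^esub> b (n - i)) \<in> F n" if "finite S" "S \<subseteq> {..n}" for S
        using that
      proof induction
        case (insert i S)
        then have "a i \<otimes>\<^bsub>A\<^esub> b (n - i) \<in> F n" using F_mult[OF F(1)[of i] F(2)[of "n - i"]] by auto
        then show ?case using insert ab reps_closed F_E(5) by (simp add: Pi_def)
      qed (simp add: F_E(7))
      then show "(a \<otimes>\<^bsub>UP A\<^esub> b) n \<in> F n" using up by (simp add: UP_simps)
    qed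
  qed
qed

lemma cls_hom: "cls \<in> ring_hom (UP A\<lparr>carrier := reps\<rparr>) gr"
proof (rule ring_hom_memI)
  fix a b assume ab: "a \<in> carrier (UP A\<lparr>carrier := reps\<rparr>)" "b \<in> carrier (UP A\<lparr>carrier := reps\<rparr>)"
  then have up: "a \<in> up A" "b \<in> up A" using reps_up by auto
  show "cls (a \<otimes>\<^bsub>UP A\<lparr>carrier := reps\<rparr>\<^esub> b) = cls a \<otimes>\<^bsub>gr\<^esub> cls b"
    using cls_mult[of a b] ab up by (simp add: UP_def)
  show "cls (a \<oplus>\<^bsub>UP A\<lparr>carrier := reps\<rparr>\<^esub> b) = cls a \<oplus>\<^bsub>gr\<^esub> cls b"
    using cls_add[of a b] ab up by (simp add: UP_def)
next
  show "cls \<one>\<^bsub>UP A\<lparr>carrier := reps\<rparr>\<^esub> = \<one>\<^bsub>gr\<^esub>" using cls_one by (simp add: UP_def)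
qed (simp add: cls_closed)

text \<open>Homomorphic images of rings are rings; as an image of the Rees ring, the graded ring
  inherits associativity and distributivity, which would be awkward for operations defined on
  cosets.\<close>

lemma ring_gr: "ring gr"
proof -
  interpret U: UP_ring A "UP A" by unfold_locales
  interpret S: ring "UP A\<lparr>carrier := reps\<rparr>" by (rule U.P.subring_is_ring[OF reps_subring])
  have "ring (gr\<lparr>carrier := carrier gr, ring.zero := \<zero>\<^bsub>gr\<^esub>\<rparr>)"
    using S.ring_hom_imp_img_ring[OF cls_hom] cls_surj cls_zero by (simp add: UP_def)
  then show ?thesis by simp
qed

lemma reps_smult: "r \<in> carrier R \<Longrightarrow> a \<in> reps \<Longrightarrow> (\<lambda>i. r \<odot>\<^bsub>A\<^esub> a i) \<in> reps"
proof -
  assume r: "r \<in> carrier R" and a: "a \<in> reps"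
  have "{i. r \<odot>\<^bsub>A\<^esub> a i \<noteq> \<zero>\<^bsub>A\<^esub>} \<subseteq> {i. a i \<noteq> \<zero>\<^bsub>A\<^esub>}" using r by auto
  then show ?thesis using r a F_E(4) by (auto simp: reps_def intro: finite_subset)
qed

lemma reps_add: "a \<in> reps \<Longrightarrow> b \<in> reps \<Longrightarrow> (\<lambda>i. a i \<oplus>\<^bsub>A\<^esub> b i) \<in> reps"
  using subringE(7)[OF reps_subring, of a b] subsetD[OF reps_up, of a] subsetD[OF reps_up, of b]
  by (simp add: UP_def)

lemma reps_mult: "a \<in> reps \<Longrightarrow> b \<in> reps \<Longrightarrow> (\<lambda>n. \<Oplus>\<^bsub>A\<^esub>i\<in>{..n}. a i \<otimes>\<^bsub>A\<^esub> b (n - i)) \<in> reps"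
  using subringE(6)[OF reps_subring, of a b] subsetD[OF reps_up, of a] subsetD[OF reps_up, of b]
  by (simp add: UP_def)

lemma noncomm_algebra_gr: "noncomm_algebra R gr"
proof -
  interpret G: ring gr by (rule ring_gr)
  have "module R gr"
  proof (rule moduleI[OF AA.R.cring_axioms G.abelian_group_axioms])
    note s = cls_smult cls_add reps_smult reps_add cls_closed
    show "r \<odot>\<^bsub>gr\<^esub> f \<in> carrier gr" if "r \<in> carrier R" "f \<in> carrier gr" for r f
      using that unfolding cls_surj by (auto simp: s)
    show "(r \<oplus>\<^bsub>R\<^esub> r') \<odot>\<^bsub>gr\<^esub> f = r \<odot>\<^bsub>gr\<^esub> f \<oplus>\<^bsub>gr\<^esub> r' \<odot>\<^bsub>gr\<^esub> f"
      if "r \<in> carrier R" "r' \<in> carrier R" "f \<in> carrier gr" for r r' f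
      using that unfolding cls_surj by (auto simp: s AA.smult_l_distr reps_closed)
    show "r \<odot>\<^bsub>gr\<^esub> (f \<oplus>\<^bsub>gr\<^esub> g) = r \<odot>\<^bsub>gr\<^esub> f \<oplus>\<^bsub>gr\<^esub> r \<odot>\<^bsub>gr\<^esub> g"
      if "r \<in> carrier R" "f \<in> carrier gr" "g \<in> carrier gr" for r f g
      using that unfolding cls_surj by (auto simp: s AA.smult_r_distr reps_closed)
    show "(r \<otimes>\<^bsub>R\<^esub> r') \<odot>\<^bsub>gr\<^esub> f = r \<odot>\<^bsub>gr\<^esub> (r' \<odot>\<^bsub>gr\<^esub> f)"
      if "r \<in> carrier R" "r' \<in> carrier R" "f \<in> carrier gr" for r r' f
      using that unfolding cls_surj by (auto simp: s AA.smult_assoc1 reps_closed)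
    show "\<one>\<^bsub>R\<^esub> \<odot>\<^bsub>gr\<^esub> f = f" if "f \<in> carrier gr" for f
      using that unfolding cls_surj by (auto simp: s reps_closed)
  qed
  moreover have "(r \<odot>\<^bsub>gr\<^esub> f) \<otimes>\<^bsub>gr\<^esub> g = r \<odot>\<^bsub>gr\<^esub> (f \<otimes>\<^bsub>gr\<^esub> g)"
    "f \<otimes>\<^bsub>gr\<^esub> (r \<odot>\<^bsub>gr\<^esub> g) = r \<odot>\<^bsub>gr\<^esub> (f \<otimes>\<^bsub>gr\<^esub> g)"
    if rfg: "r \<in> carrier R" "f \<in> carrier gr" "g \<in> carrier gr" for r f g
  proof -
    obtain a b where ab: "a \<in> reps" "f = cls a" "b \<in> reps" "g = cls b"
      using rfg unfolding cls_surj by blast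
    have c: "a i \<in> carrier A" "b i \<in> carrier A" for i using ab reps_closed by auto
    have "(\<Oplus>\<^bsub>A\<^esub>i\<in>{..n}. (r \<odot>\<^bsub>A\<^esub> a i) \<otimes>\<^bsub>A\<^esub> b (n - i)) = r \<odot>\<^bsub>A\<^esub> (\<Oplus>\<^bsub>A\<^esub>i\<in>{..n}. a i \<otimes>\<^bsub>A\<^esub> b (n - i))" for n
      using c rfg(1) by (simp add: AA.smult_mult_left AA.finsum_smult_ldistr)
    then show "(r \<odot>\<^bsub>gr\<^esub> f) \<otimes>\<^bsub>gr\<^esub> g = r \<odot>\<^bsub>gr\<^esub> (f \<otimes>\<^bsub>gr\<^esub> g)"
      using ab rfg(1) by (simp add: cls_smult cls_mult reps_smult reps_mult)
    have "(\<Oplus>\<^bsub>A\<^esub>i\<in>{..n}. a i \<otimes>\<^bsub>A\<^esub> (r \<odot>\<^bsub>A\<^esub> b (n - i))) = r \<odot>\<^bsub>A\<^esub> (\<Oplus>\<^bsub>A\<^esub>i\<in>{..n}. a i \<otimes>\<^bsub>A\<^esub> b (n - i))" for n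
      using c rfg(1) by (simp add: AA.smult_mult_right AA.finsum_smult_ldistr)
    then show "f \<otimes>\<^bsub>gr\<^esub> (r \<odot>\<^bsub>gr\<^esub> g) = r \<odot>\<^bsub>gr\<^esub> (f \<otimes>\<^bsub>gr\<^esub> g)"
      using ab rfg(1) by (simp add: cls_smult cls_mult reps_smult reps_mult)
  qed
  ultimately show ?thesis
    by (intro noncomm_algebra.intro ring_gr noncomm_algebra_axioms.intro)
qed

end

section \<open>Symbols of a basis adapted to the filtration\<close>

context filtered
begin

interpretation A: ring A using alg by (rule noncomm_algebra.axioms)
interpretation AA: noncomm_algebra R A by (rule alg)
interpretation G: ring gr by (rule ring_gr)
interpretation GA: noncomm_algebra R gr by (rule noncomm_algebra_gr)

definition "single i a = (\<lambda>j. if j = i then a else \<zero>\<^bsub>A\<^esub>)"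

lemma single_reps: "a \<in> F i \<Longrightarrow> single i a \<in> reps"
  using F_E(7) by (auto simp: single_def reps_def)

lemma single_mult:
  assumes a: "a \<in> F i" and b: "b \<in> F j"
  shows "cls (single i a) \<otimes>\<^bsub>gr\<^esub> cls (single j b) = cls (single (i + j) (a \<otimes>\<^bsub>A\<^esub> b))"
proof -
  have c: "a \<in> carrier A" "b \<in> carrier A" using a b F_E(1) by auto
  have "(\<Oplus>\<^bsub>A\<^esub>k\<in>{..n}. single i a k \<otimes>\<^bsub>A\<^esub> single j b (n - k)) = single (i + j) (a \<otimes>\<^bsub>A\<^esub> b) n" for n
  proof (cases "i \<le> n")
    case True
    have "(\<Oplus>\<^bsub>A\<^esub>k\<in>{..n}. single i a k \<otimes>\<^bsub>A\<^esub> single j b (n - k)) =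
      (\<Oplus>\<^bsub>A\<^esub>k\<in>{..n}. if k = i then a \<otimes>\<^bsub>A\<^esub> single j b (n - k) else \<zero>\<^bsub>A\<^esub>)"
      using c by (intro A.add.finprod_cong') (auto simp: single_def)
    also have "\<dots> = a \<otimes>\<^bsub>A\<^esub> single j b (n - i)"
      using A.add.finprod_singleton_swap[of i "{..n}" "\<lambda>k. a \<otimes>\<^bsub>A\<^esub> single j b (n - k)"] True c
      by (auto simp: single_def)
    finally show ?thesis using True c by (auto simp: single_def)
  next
    case False
    then have "(\<Oplus>\<^bsub>A\<^esub>k\<in>{..n}. single i a k \<otimes>\<^bsub>A\<^esub> single j b (n - k)) = \<zero>\<^bsub>A\<^esub>"
      using c by (intro A.add.finprod_one_eqI) (auto simp: single_def)
    then show ?thesis using False by (auto simp: single_def)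
  qed
  then show ?thesis using cls_mult[OF single_reps[OF a] single_reps[OF b]] by simp
qed

lemma single_add:
  assumes "a \<in> F i" "b \<in> F i"
  shows "cls (single i (a \<oplus>\<^bsub>A\<^esub> b)) = cls (single i a) \<oplus>\<^bsub>gr\<^esub> cls (single i b)"
proof -
  have "(\<lambda>j. single i a j \<oplus>\<^bsub>A\<^esub> single i b j) = single i (a \<oplus>\<^bsub>A\<^esub> b)"
    by (auto simp: single_def)
  then show ?thesis using cls_add[OF single_reps[OF assms(1)] single_reps[OF assms(2)]] by simp
qed

lemma single_smult:
  assumes "r \<in> carrier R" "a \<in> F i"
  shows "cls (single i (r \<odot>\<^bsub>A\<^esub> a)) = r \<odot>\<^bsub>gr\<^esub> cls (single i a)"
proof -
  have "(\<lambda>j. r \<odot>\<^bsub>A\<^esub> single i a j) = single i (r \<odot>\<^bsub>A\<^esub> a)"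
    using assms(1) by (auto simp: single_def)
  then show ?thesis using cls_smult[OF assms(1) single_reps[OF assms(2)]] by simp
qed

lemma single_zero_iff:
  assumes "a \<in> F i" shows "cls (single i a) = \<zero>\<^bsub>gr\<^esub> \<longleftrightarrow> a \<in> P i"
proof -
  have c: "a \<in> carrier A" using assms F_E(1) by auto
  have z: "(\<lambda>i. \<zero>\<^bsub>A\<^esub>) \<in> reps" using F_E(7) by (simp add: reps_def)
  have "cls (single i a) = \<zero>\<^bsub>gr\<^esub> \<longleftrightarrow> (\<forall>j. single i a j \<ominus>\<^bsub>A\<^esub> \<zero>\<^bsub>A\<^esub> \<in> P j)"
    unfolding cls_zero[symmetric] by (rule cls_eq_iff[OF single_reps[OF assms] z])
  also have "\<dots> \<longleftrightarrow> a \<in> P i" using c P_E(7) by (auto simp: single_def A.minus_eq)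
  finally show ?thesis .
qed

lemma reps_closed_F: "a \<in> reps \<Longrightarrow> a i \<in> F i"
  by (simp add: reps_def)

lemma cls_in_submodule:
  assumes W: "submodule W R gr" and single: "\<And>i. cls (single i (a i)) \<in> W" and a: "a \<in> reps"
  shows "cls a \<in> W"
proof -
  note WE = GA.submoduleE[OF W]
  have "cls (\<lambda>i. if i \<in> S then a i else \<zero>\<^bsub>A\<^esub>) \<in> W" if "finite S" for S
    using that
  proof induction
    case empty
    then show ?case using cls_zero GA.submodule_zero[OF W] by simp
  next
    case (insert i S)
    let ?b = "\<lambda>j. if j \<in> S then a j else \<zero>\<^bsub>A\<^esub>"
    have b: "?b \<in> reps" using a F_E(7) insert(1) by (auto simp: reps_def)
    have "cls (single i (a i)) \<oplus>\<^bsub>gr\<^esub> cls ?b = cls (\<lambda>j. if j \<in> insert i S then a j else \<zero>\<^bsub>A\<^esub>)"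
      unfolding cls_add[OF single_reps[OF reps_closed_F[OF a]] b]
      using insert(2) reps_closed[OF a] by (intro arg_cong[of _ _ cls]) (auto simp: single_def)
    then show ?case using WE(5)[OF single insert(3)] by metis
  qed
  moreover have "finite {i. a i \<noteq> \<zero>\<^bsub>A\<^esub>}" using a by (simp add: reps_def)
  moreover have "(\<lambda>i. if i \<in> {i. a i \<noteq> \<zero>\<^bsub>A\<^esub>} then a i else \<zero>\<^bsub>A\<^esub>) = a" by auto
  ultimately show ?thesis by metis
qed

text \<open>The symbol is taken in the prescribed degree \<open>d w\<close>, so it is zero if
  \<open>e w\<close> already lies in a smaller filtration step; for an independent family over a
  nontrivial ring \<open>gr_indep\<close> excludes this.\<close>

definition symb :: "('i \<Rightarrow> 'a) \<Rightarrow> ('i \<Rightarrow> nat) \<Rightarrow> 'i \<Rightarrow> nat \<Rightarrow> 'a set" where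
  "symb e d w = cls (single (d w) (e w))"

context
  fixes e :: "'i \<Rightarrow> 'a" and I :: "'i set" and d :: "'i \<Rightarrow> nat"
  assumes eA: "\<forall>i\<in>I. e i \<in> carrier A"
    and F_span: "\<And>i. F i = lin_span R A (e ` {w \<in> I. d w \<le> i})"
begin

lemma e_F: "w \<in> I \<Longrightarrow> d w \<le> i \<Longrightarrow> e w \<in> F i"
  unfolding F_span by (rule AA.lin_span_incl) (use eA in auto)

lemma symb_closed: "\<forall>w\<in>I. symb e d w \<in> carrier gr"
  unfolding symb_def using e_F single_reps cls_closed by blast

text \<open>In degree \<open>i\<close> the members of smaller degree vanish, since they lie in
  \<open>P i\<close>; only symbols of degree exactly \<open>i\<close> remain.\<close>

lemma single_in_span:
  assumes "a \<in> F i" shows "cls (single i a) \<in> lin_span R gr (symb e d ` {w \<in> I. d w = i})"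
proof -
  have S: "symb e d ` {w \<in> I. d w = i} \<subseteq> carrier gr" using symb_closed by auto
  note E = GA.submoduleE[OF GA.lin_span_submodule[OF S]]
  have "a \<in> F i \<and> cls (single i a) \<in> lin_span R gr (symb e d ` {w \<in> I. d w = i})"
    using assms unfolding F_span[of i]
  proof induction
    case zero
    have "cls (single i \<zero>\<^bsub>A\<^esub>) = \<zero>\<^bsub>gr\<^esub>" using single_zero_iff[OF F_E(7)] P_E(7) by simp
    then show ?case by (simp add: lin_span.zero)
  next
    case (step r s v)
    then obtain w where w: "w \<in> I" "d w \<le> i" "s = e w" by auto
    then have sF: "s \<in> F i" using e_F by simp
    have vF: "v \<in> F i" using step F_span[of i] by simp
    have "cls (single i s) \<in> lin_span R gr (symb e d ` {w \<in> I. d w = i})"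
    proof (cases "d w = i")
      case True
      then have "cls (single i s) = symb e d w" using w by (simp add: symb_def)
      then show ?thesis using w True GA.lin_span_incl[OF S] by auto
    next
      case False
      then have "s \<in> P i" using w e_F[of w "d w"] F_P[of "d w" i] by auto
      then show ?thesis using single_zero_iff[OF sF] by (simp add: lin_span.zero)
    qed
    then have "cls (single i (r \<odot>\<^bsub>A\<^esub> s \<oplus>\<^bsub>A\<^esub> v)) \<in> lin_span R gr (symb e d ` {w \<in> I. d w = i})"
      using step E(4,5) single_add[OF F_E(4)[OF step(1) sF] vF] single_smult[OF step(1) sF] by simp
    moreover have "r \<odot>\<^bsub>A\<^esub> s \<oplus>\<^bsub>A\<^esub> v \<in> F i" using F_E(4)[OF step(1) sF] vF F_E(5) by blast
    ultimately show ?case by (simp add: F_span[symmetric])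
  qed
  then show ?thesis ..
qed

lemma gr_span: "lin_span R gr (symb e d ` I) = carrier gr"
proof
  have S: "symb e d ` I \<subseteq> carrier gr" using symb_closed by auto
  show "lin_span R gr (symb e d ` I) \<subseteq> carrier gr" by (rule GA.lin_span_closed[OF S])
  show "carrier gr \<subseteq> lin_span R gr (symb e d ` I)"
  proof
    fix f assume "f \<in> carrier gr"
    then obtain a where a: "a \<in> reps" "f = cls a" using cls_surj by blast
    have "cls (single i (a i)) \<in> lin_span R gr (symb e d ` I)" for i
      using single_in_span[OF reps_closed_F[OF a(1)], of i]
        lin_span_mono[of "symb e d ` {w \<in> I. d w = i}" "symb e d ` I" R R gr] by auto
    then show "f \<in> lin_span R gr (symb e d ` I)"
      unfolding a(2) by (rule cls_in_submodule[OF GA.lin_span_submodule[OF S] _ a(1)])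
  qed
qed

lemma graded_component_span: "graded_component gr i = lin_span R gr (symb e d ` {w \<in> I. d w = i})"
proof
  have S: "symb e d ` {w \<in> I. d w = i} \<subseteq> carrier gr" using symb_closed by auto
  show "graded_component gr i \<subseteq> lin_span R gr (symb e d ` {w \<in> I. d w = i})"
  proof
    fix f assume f: "f \<in> graded_component gr i"
    then obtain a where a: "a \<in> reps" "f = cls a" unfolding graded_component_def using cls_surj by blast
    have "cls a j = cls (single i (a i)) j" for j
    proof (cases "j = i")
      case True
      then show ?thesis by (simp add: cls_def single_def)
    next
      case False
      then have "cls a j = P j" using f a by (simp add: graded_component_def gr_simps)
      then show ?thesis using False coset_zero by (simp add: cls_def single_def)
    qed
    then have "f = cls (single i (a i))" unfolding a(2) by (rule ext)
    then show "f \<in> lin_span R gr (symb e d ` {w \<in> I. d w = i})"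
      using single_in_span[OF reps_closed_F[OF a(1)], of i] by simp
  qed
  have "\<exists>a\<in>F i. f = cls (single i a)" if "f \<in> lin_span R gr (symb e d ` {w \<in> I. d w = i})" for f
    using that
  proof induction
    case zero
    show ?case using single_zero_iff[OF F_E(7)] P_E(7) F_E(7) by metis
  next
    case (step r s v)
    then obtain w a where w: "w \<in> I" "d w = i" "s = symb e d w" "a \<in> F i" "v = cls (single i a)" by auto
    have eF: "e w \<in> F i" using e_F w by simp
    have s: "s = cls (single i (e w))" using w by (simp add: symb_def)
    have "r \<odot>\<^bsub>gr\<^esub> s \<oplus>\<^bsub>gr\<^esub> v = cls (single i (r \<odot>\<^bsub>A\<^esub> e w \<oplus>\<^bsub>A\<^esub> a))"
      using single_add[OF F_E(4)[OF step(1) eF] w(4)] single_smult[OF step(1) eF] s w(5) by simp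
    then show ?case using F_E(5)[OF F_E(4)[OF step(1) eF] w(4)] by blast
  qed
  then show "lin_span R gr (symb e d ` {w \<in> I. d w = i}) \<subseteq> graded_component gr i"
    unfolding graded_component_def
    using cls_closed[OF single_reps] coset_zero by (fastforce simp: gr_simps(4) cls_def single_def)
qed

lemma graded_component_fin_gen:
  assumes "finite {w \<in> I. d w = i}" shows "fin_gen_submodule (graded_component gr i) R gr"
proof -
  have S: "symb e d ` {w \<in> I. d w = i} \<subseteq> carrier gr" using symb_closed by auto
  show ?thesis
    unfolding fin_gen_submodule_def graded_component_span
    using GA.lin_span_submodule[OF S] GA.lin_span_eq_hull[OF S] GA.lin_span_incl[OF S] assms
    by (intro conjI exI[of _ "symb e d ` {w \<in> I. d w = i}"]) auto
qed

lemma P_span: "P i = lin_span R A (e ` {w \<in> I. d w < i})"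
proof (cases i)
  case 0
  have "lin_span R A {} = {\<zero>\<^bsub>A\<^esub>}" by (auto elim: lin_span.cases intro: lin_span.zero)
  then show ?thesis using 0 by (simp add: filt_pred_def)
qed (simp add: filt_pred_def F_span less_Suc_eq_le)

text \<open>Read in degree \<open>i\<close>, a vanishing combination of symbols says that the degree
  \<open>i\<close> part of the same combination of the \<open>e w\<close> lies in
  \<open>P i\<close>, so it can be rewritten with members of degree below \<open>i\<close>.
  Independence makes the two expansions equal, although their supports are disjoint; so both are
  zero.\<close>

lemma gr_indep:
  assumes ind: "lin_indep R A e I" shows "lin_indep R gr (symb e d) I"
  unfolding lin_indep_def
proof (intro ballI impI allI)
  fix c w0
  assume c: "c \<in> fin_supp R I" and z: "lincomb R gr (symb e d) c = \<zero>\<^bsub>gr\<^esub>"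
  have cc: "c w \<in> carrier R" "c w \<noteq> \<zero>\<^bsub>R\<^esub> \<Longrightarrow> w \<in> I" for w using c by (auto simp: fin_supp_def)
  let ?v = "\<lambda>S i. \<Oplus>\<^bsub>A\<^esub>w\<in>{w \<in> S. d w = i}. c w \<odot>\<^bsub>A\<^esub> e w"
  have sum: "?v S \<in> reps \<and> (\<Oplus>\<^bsub>gr\<^esub>w\<in>S. c w \<odot>\<^bsub>gr\<^esub> symb e d w) = cls (?v S)" if "finite S" "S \<subseteq> I" for S
    using that
  proof induction
    case empty
    then show ?case using cls_zero F_E(7) by (simp add: reps_def)
  next
    case (insert w S)
    have w: "w \<in> I" "e w \<in> F (d w)" "e w \<in> carrier A" using insert.prems e_F eA by auto
    have ce: "c w \<odot>\<^bsub>A\<^esub> e w \<in> F (d w)" using F_E(4)[OF cc(1) w(2)] .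
    have cec: "c w \<odot>\<^bsub>A\<^esub> e w \<in> carrier A" using cc(1) w(3) by simp
    have IH: "?v S \<in> reps" "(\<Oplus>\<^bsub>gr\<^esub>w\<in>S. c w \<odot>\<^bsub>gr\<^esub> symb e d w) = cls (?v S)" using insert by auto
    have SA: "v \<in> S \<Longrightarrow> c v \<odot>\<^bsub>A\<^esub> e v \<in> carrier A" for v using insert.prems eA cc(1) by auto
    have v: "?v (insert w S) = (\<lambda>i. single (d w) (c w \<odot>\<^bsub>A\<^esub> e w) i \<oplus>\<^bsub>A\<^esub> ?v S i)"
    proof
      fix i
      show "?v (insert w S) i = single (d w) (c w \<odot>\<^bsub>A\<^esub> e w) i \<oplus>\<^bsub>A\<^esub> ?v S i"
      proof (cases "d w = i")
        case True
        then have "{v \<in> insert w S. d v = i} = insert w {v \<in> S. d v = i}" by auto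
        then show ?thesis using True insert.hyps SA cec by (simp add: single_def Pi_def)
      next
        case False
        then have "{v \<in> insert w S. d v = i} = {v \<in> S. d v = i}" by auto
        moreover have "?v S i \<in> carrier A" using SA by (intro A.finsum_closed) auto
        ultimately show ?thesis using False by (simp add: single_def)
      qed
    qed
    have "(\<Oplus>\<^bsub>gr\<^esub>w\<in>insert w S. c w \<odot>\<^bsub>gr\<^esub> symb e d w) = c w \<odot>\<^bsub>gr\<^esub> symb e d w \<oplus>\<^bsub>gr\<^esub> cls (?v S)"
      using insert.hyps insert.prems IH symb_closed cc(1) by (simp add: Pi_def subset_eq)
    also have "c w \<odot>\<^bsub>gr\<^esub> symb e d w = cls (single (d w) (c w \<odot>\<^bsub>A\<^esub> e w))"
      using single_smult[OF cc(1) w(2)] by (simp add: symb_def)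
    also have "\<dots> \<oplus>\<^bsub>gr\<^esub> cls (?v S) = cls (?v (insert w S))"
      unfolding v by (rule cls_add[OF single_reps[OF ce] IH(1)])
    finally show ?case using reps_add[OF single_reps[OF ce] IH(1)] unfolding v by simp
  qed
  let ?S = "{w. c w \<noteq> \<zero>\<^bsub>R\<^esub>}"
  have S: "finite ?S" "?S \<subseteq> I" using c by (auto simp: fin_supp_def)
  have v: "?v ?S \<in> reps" "cls (?v ?S) = \<zero>\<^bsub>gr\<^esub>" using sum[OF S] z unfolding lincomb_def by auto
  define i where "i = d w0"
  let ?c = "\<lambda>w. if d w = i then c w else \<zero>\<^bsub>R\<^esub>"
  have supp_c: "{w. ?c w \<noteq> \<zero>\<^bsub>R\<^esub>} = {w \<in> ?S. d w = i}" by auto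
  have c': "?c \<in> fin_supp R I" using c supp_c by (auto simp: fin_supp_def)
  have "cls (?v ?S) i = P i" using v(2) by (simp add: gr_simps)
  then have "P i +>\<^bsub>A\<^esub> ?v ?S i = P i +>\<^bsub>A\<^esub> \<zero>\<^bsub>A\<^esub>" using coset_zero by (simp add: cls_def)
  then have "?v ?S i \<ominus>\<^bsub>A\<^esub> \<zero>\<^bsub>A\<^esub> \<in> P i" using coset_eq_iff[OF reps_closed[OF v(1)]] by simp
  then have "?v ?S i \<in> P i" using reps_closed[OF v(1), of i] by (simp add: A.minus_eq)
  moreover have "?v ?S i = lincomb R A e ?c"
    unfolding lincomb_def supp_c using S eA cc by (intro A.add.finprod_cong') auto
  ultimately have "lincomb R A e ?c \<in> lin_span R A (e ` {w \<in> I. d w < i})" using P_span by simp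
  then have "lincomb R A e ?c \<in> lincomb R A e ` fin_supp R {w \<in> I. d w < i}"
    by (subst (asm) AA.lin_span_eq_lincomb) (use eA in auto)
  then obtain c'' where c'': "lincomb R A e ?c = lincomb R A e c''" "c'' \<in> fin_supp R {w \<in> I. d w < i}"
    by (rule imageE)
  then have "c'' \<in> fin_supp R I" by (auto simp: fin_supp_def)
  then have eq: "?c = c''" by (rule AA.lin_indep_inj[OF eA ind c' _ c''(1)])
  have "c w0 = ?c w0" by (simp add: i_def)
  also have "\<dots> = c'' w0" by (rule fun_cong[OF eq])
  also have "\<dots> = \<zero>\<^bsub>R\<^esub>" using c''(2) by (auto simp: fin_supp_def i_def)
  finally show "c w0 = \<zero>\<^bsub>R\<^esub>" .
qed

end

end

lemma lin_span_image:
  assumes h0: "h \<zero>\<^bsub>M\<^esub> = \<zero>\<^bsub>N\<^esub>"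
    and h: "\<And>r s v. r \<in> carrier R \<Longrightarrow> s \<in> S \<Longrightarrow> v \<in> lin_span R M S \<Longrightarrow>
      h (r \<odot>\<^bsub>M\<^esub> s \<oplus>\<^bsub>M\<^esub> v) = r \<odot>\<^bsub>N\<^esub> h s \<oplus>\<^bsub>N\<^esub> h v"
  shows "h ` lin_span R M S = lin_span R N (h ` S)"
proof
  show "h ` lin_span R M S \<subseteq> lin_span R N (h ` S)"
  proof clarify
    fix v assume "v \<in> lin_span R M S"
    then show "h v \<in> lin_span R N (h ` S)"
      by induction (auto simp: h0 h intro: lin_span.intros)
  qed
  show "lin_span R N (h ` S) \<subseteq> h ` lin_span R M S"
  proof
    fix u assume "u \<in> lin_span R N (h ` S)"
    then show "u \<in> h ` lin_span R M S"
    proof induction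
      case zero
      show ?case using h0 lin_span.zero by (metis imageI)
    next
      case (step r s u)
      then obtain s' v where sv: "s' \<in> S" "s = h s'" "v \<in> lin_span R M S" "u = h v" by auto
      then have "r \<odot>\<^bsub>N\<^esub> s \<oplus>\<^bsub>N\<^esub> u = h (r \<odot>\<^bsub>M\<^esub> s' \<oplus>\<^bsub>M\<^esub> v)"
        using h[OF step(1) sv(1,3)] by simp
      then show ?case using lin_span.step[OF step(1) sv(1,3)] by blast
    qed
  qed
qed

section \<open>The induced filtration on a subalgebra over a subring\<close>

locale filtered_sub =
  fixes K :: "('k, 'm) ring_scheme" and A :: "('k, 'a, 'n) module_scheme" and F :: "nat \<Rightarrow> 'a set"
    and D :: "'k set" and H :: "'a set"
  assumes filtA: "filtered K A F"
    and D: "subring D K" and H: "unital_subalgebra (K\<lparr>carrier := D\<rparr>) H A"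
begin

abbreviation "R \<equiv> K\<lparr>carrier := D\<rparr>"
abbreviation "B \<equiv> A\<lparr>carrier := H\<rparr>"
abbreviation "FD \<equiv> \<lambda>i. F i \<inter> H"
abbreviation "incl \<equiv> graded_incl A F"

interpretation fA: filtered K A F by (rule filtA)
interpretation A: noncomm_algebra K A by (rule fA.alg)

lemma DK: "D \<subseteq> carrier K" by (rule subringE(1)[OF D])

lemma subH: "subring H A" using H by (simp add: unital_subalgebra_def)

lemmas HE = subringE[OF subH]

lemma algB: "noncomm_algebra R B"
  using noncomm_algebra_restrict_scalars[OF fA.alg subcring_carrier[OF A.R.cring_axioms D]] DK H
  by (intro noncomm_algebra_sub) auto

interpretation B: noncomm_algebra R B by (rule algB)

lemma smult_H: "d \<in> D \<Longrightarrow> b \<in> H \<Longrightarrow> d \<odot>\<^bsub>A\<^esub> b \<in> H"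
  using H by (simp add: unital_subalgebra_def)

lemma minus_H: "b \<in> H \<Longrightarrow> \<ominus>\<^bsub>B\<^esub> b = \<ominus>\<^bsub>A\<^esub> b"
  using HE by (intro B.M.minus_equality) (auto simp: A.M.l_neg subset_eq)

lemma filtB: "filtered R B FD"
proof (rule filtered.intro[OF algB])
  have "submodule (FD i) R B" for i
  proof (rule B.submoduleI)
    show "\<ominus>\<^bsub>B\<^esub> a \<in> FD i" if "a \<in> FD i" for a
      using that fA.F_E(3)[of a i] HE(5)[of a] minus_H[of a] by simp
    show "d \<odot>\<^bsub>B\<^esub> a \<in> FD i" if "d \<in> carrier R" "a \<in> FD i" for d a
      using that fA.F_E(4)[of d a i] smult_H[of d a] DK by auto
  qed (use fA.F_E(5,7) HE(2,7) in auto)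
  then show "nat_filtration R B FD"
    unfolding nat_filtration_def using fA.F_Suc fA.one_F fA.F_mult fA.F_union HE by auto
qed

interpretation fB: filtered R B FD by (rule filtB)
interpretation GA: ring fA.gr by (rule fA.ring_gr)
interpretation GB: ring fB.gr by (rule fB.ring_gr)

lemma P_H: "fB.P i = fA.P i \<inter> H"
  using HE(2) by (cases i) (auto simp: filt_pred_def)

lemma reps_H: "fB.reps = {a \<in> fA.reps. \<forall>i. a i \<in> H}"
  by (auto simp: fA.reps_def fB.reps_def)

text \<open>All members of a small coset lie in the same larger coset, so the union that defines
  \<open>graded_incl\<close> collapses, and on representatives the map is the identity.\<close>

lemma incl_cls:
  assumes a: "a \<in> fB.reps" shows "incl (fB.cls a) = fA.cls a"
proof (rule ext)
  fix i
  have aH: "a i \<in> H" and ac: "a i \<in> carrier A" using a reps_H HE(1) by auto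
  have "fA.P i +>\<^bsub>A\<^esub> b = fA.P i +>\<^bsub>A\<^esub> a i" if "b \<in> fB.P i +>\<^bsub>B\<^esub> a i" for b
  proof -
    have b: "b \<in> H" "b \<ominus>\<^bsub>B\<^esub> a i \<in> fA.P i"
      using that fB.coset_mem_iff[of "a i"] aH P_H by auto
    then have "b \<ominus>\<^bsub>A\<^esub> a i \<in> fA.P i" using minus_H[OF aH] by (simp add: a_minus_def)
    then show ?thesis using fA.coset_eq_iff[of b "a i"] b HE(1) ac by auto
  qed
  moreover have "a i \<in> fB.P i +>\<^bsub>B\<^esub> a i"
    using fB.coset_mem_iff[of "a i"] aH fB.P_E(7) by (simp add: a_minus_def minus_H[OF aH] A.M.r_neg ac)
  ultimately show "incl (fB.cls a) i = fA.cls a i"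
    unfolding graded_incl_def fA.cls_def fB.cls_def by blast
qed

lemma finsum_B: "f \<in> S \<rightarrow> H \<Longrightarrow> (\<Oplus>\<^bsub>B\<^esub>i\<in>S. f i) = (\<Oplus>\<^bsub>A\<^esub>i\<in>S. f i)"
  using finsum_hom[OF B.M.abelian_monoid_axioms A.M.abelian_monoid_axioms, of "\<lambda>v. v" f S] HE(1)
  by (simp add: Pi_def subset_eq)

lemma incl_hom: "ring_hom_ring fB.gr fA.gr incl"
proof (rule ring_hom_ringI[OF fB.ring_gr fA.ring_gr])
  show "incl f \<in> carrier fA.gr" if "f \<in> carrier fB.gr" for f
    using that fA.cls_closed incl_cls reps_H unfolding fB.cls_surj by auto
  show "incl (f \<otimes>\<^bsub>fB.gr\<^esub> g) = incl f \<otimes>\<^bsub>fA.gr\<^esub> incl g" "incl (f \<oplus>\<^bsub>fB.gr\<^esub> g) = incl f \<oplus>\<^bsub>fA.gr\<^esub> incl g"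
    if fg: "f \<in> carrier fB.gr" "g \<in> carrier fB.gr" for f g
  proof -
    obtain a b where ab: "a \<in> fB.reps" "f = fB.cls a" "b \<in> fB.reps" "g = fB.cls b"
      using fg unfolding fB.cls_surj by blast
    then have ab': "a \<in> fA.reps" "b \<in> fA.reps" "\<And>i. a i \<in> H" "\<And>i. b i \<in> H" by (auto simp: reps_H)
    have "(\<Oplus>\<^bsub>B\<^esub>i\<in>{..n}. a i \<otimes>\<^bsub>B\<^esub> b (n - i)) = (\<Oplus>\<^bsub>A\<^esub>i\<in>{..n}. a i \<otimes>\<^bsub>A\<^esub> b (n - i))" for n
      using finsum_B[of "\<lambda>i. a i \<otimes>\<^bsub>A\<^esub> b (n - i)" "{..n}"] ab' HE(6) by auto
    then show "incl (f \<otimes>\<^bsub>fB.gr\<^esub> g) = incl f \<otimes>\<^bsub>fA.gr\<^esub> incl g"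
      using fB.cls_mult[OF ab(1,3)] fA.cls_mult[OF ab'(1,2)] fB.reps_mult[OF ab(1,3)] ab(2,4)
        incl_cls[OF ab(1)] incl_cls[OF ab(3)] incl_cls by simp
    show "incl (f \<oplus>\<^bsub>fB.gr\<^esub> g) = incl f \<oplus>\<^bsub>fA.gr\<^esub> incl g"
      using fB.cls_add[OF ab(1,3)] fA.cls_add[OF ab'(1,2)] fB.reps_add[OF ab(1,3)] ab(2,4)
        incl_cls[OF ab(1)] incl_cls[OF ab(3)] incl_cls by simp
  qed
  let ?o = "\<lambda>i::nat. if i = 0 then \<one>\<^bsub>A\<^esub> else \<zero>\<^bsub>A\<^esub>"
  have "?o \<in> fB.reps" using fB.one_F fB.F_E(7) by (auto simp: fB.reps_def)
  then have "incl (fB.cls ?o) = fA.cls ?o" by (rule incl_cls)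
  then show "incl \<one>\<^bsub>fB.gr\<^esub> = \<one>\<^bsub>fA.gr\<^esub>" using fB.cls_one fA.cls_one by (simp cong: if_cong)
qed

lemma incl_smult:
  assumes d: "d \<in> D" and f: "f \<in> carrier fB.gr"
  shows "incl (d \<odot>\<^bsub>fB.gr\<^esub> f) = d \<odot>\<^bsub>fA.gr\<^esub> incl f"
proof -
  obtain a where a: "a \<in> fB.reps" "f = fB.cls a" using f unfolding fB.cls_surj by blast
  then have "a \<in> fA.reps" by (simp add: reps_H)
  then show ?thesis
    using a d DK fB.cls_smult[of d a] fA.cls_smult[of d a] fB.reps_smult[of d a] incl_cls by auto
qed

lemma incl_subring: "subring (incl ` carrier fB.gr) fA.gr"
proof -
  interpret h: ring_hom_ring fB.gr fA.gr incl by (rule incl_hom)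
  show ?thesis by (rule GA.ring_incl_imp_subring[OF _ h.img_is_ring]) auto
qed

lemma incl_symb:
  assumes "e w \<in> F (d w)" "e w \<in> H"
  shows "incl (fB.symb e d w) = fA.symb e d w"
  using incl_cls[OF fB.single_reps[of "e w" "d w"]] assms
  by (simp add: fA.symb_def fB.symb_def fA.single_def fB.single_def cong: if_cong)

end

section \<open>Ordered monomials\<close>

text \<open>A nondecreasing word is an ordered monomial whose exponents are the multiplicities;
  comparing arbitrary products of generators with ordered monomials becomes a matter of
  sorting.\<close>

definition sorted_words :: "nat set \<Rightarrow> nat list set" where
  "sorted_words J = {w. sorted w \<and> set w \<subseteq> J}"

text \<open>One element of a span uses finitely many coefficients. The conclusion is given for every
  larger set \<open>D\<close>, so that finitely many relations can later share one subring.\<close>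

lemma coeff_subring:
  assumes "v \<in> lin_span K A S"
  shows "\<exists>C. finite C \<and> C \<subseteq> carrier K \<and> (\<forall>D. C \<subseteq> D \<longrightarrow> v \<in> lin_span (K\<lparr>carrier := D\<rparr>) A S)"
  using assms
proof induction
  case zero
  show ?case by (rule exI[of _ "{}"]) (auto intro: lin_span.zero)
next
  case (step r s v)
  then obtain C where "finite C" "C \<subseteq> carrier K" "\<forall>D. C \<subseteq> D \<longrightarrow> v \<in> lin_span (K\<lparr>carrier := D\<rparr>) A S" by blast
  then show ?case using step by (intro exI[of _ "insert r C"]) (auto intro: lin_span.step)
qed

text \<open>The base ring stays arbitrary because the same words are used over the field, over its
  subring \<open>D\<close> and over finite fields.\<close>

locale word_algebra =
  fixes R :: "('r, 'm) ring_scheme" and A :: "('r, 'a, 'n) module_scheme"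
    and x :: "nat \<Rightarrow> 'a" and d :: "nat \<Rightarrow> nat" and J :: "nat set"
  assumes alg: "noncomm_algebra R A" and x: "x ` J \<subseteq> carrier A"
begin

interpretation A: ring A using alg by (rule noncomm_algebra.axioms)
interpretation AA: noncomm_algebra R A by (rule alg)

abbreviation "e \<equiv> word_eval A x"
abbreviation "wdeg w \<equiv> sum_list (map d w)"
abbreviation "W \<equiv> word_filtration R A x d J"
abbreviation "H \<equiv> adjoin R A (x ` J)"

lemma e_closed [simp]: "set w \<subseteq> J \<Longrightarrow> e w \<in> carrier A"
  using x by (intro A.word_eval_closed) auto

lemma W_span: "W i = lin_span R A (e ` {w. set w \<subseteq> J \<and> wdeg w \<le> i})"
proof -
  have eq: "{e w | w. set w \<subseteq> J \<and> wdeg w \<le> i} = e ` {w. set w \<subseteq> J \<and> wdeg w \<le> i}" by auto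
  have "e ` {w. set w \<subseteq> J \<and> wdeg w \<le> i} \<subseteq> carrier A" by auto
  then show ?thesis unfolding word_filtration_def eq by (rule AA.lin_span_eq_hull)
qed

lemma words_closed: "e ` {w. set w \<subseteq> J \<and> Q w} \<subseteq> carrier A"
  by auto

lemma W_sub: "submodule (W i) R A"
  unfolding W_span by (rule AA.lin_span_submodule[OF words_closed])

lemmas W_E = AA.submoduleE[OF W_sub] AA.submodule_zero[OF W_sub]

lemma W_mono: "i \<le> j \<Longrightarrow> W i \<subseteq> W j"
  unfolding W_span by (rule lin_span_mono) auto

lemma e_W: "set w \<subseteq> J \<Longrightarrow> wdeg w \<le> i \<Longrightarrow> e w \<in> W i"
  unfolding W_span by (rule AA.lin_span_incl[OF words_closed]) auto

lemma W_mult: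
  assumes a: "a \<in> W i" and b: "b \<in> W j" shows "a \<otimes>\<^bsub>A\<^esub> b \<in> W (i + j)"
proof -
  have wb: "e w \<otimes>\<^bsub>A\<^esub> b \<in> W (i + j)" if w: "set w \<subseteq> J" "wdeg w \<le> i" for w
    using b unfolding W_span[of j]
  proof induction
    case zero
    then show ?case using w W_E(7) by simp
  next
    case (step r s v)
    then obtain w' where w': "set w' \<subseteq> J" "wdeg w' \<le> j" "s = e w'" by auto
    have vc: "v \<in> carrier A" using step(3) W_span[of j] W_E(1) by auto
    have "x ` set w \<subseteq> carrier A" "x ` set w' \<subseteq> carrier A" using w w' x by auto
    then have "e w \<otimes>\<^bsub>A\<^esub> s = e (w @ w')" unfolding w'(3) by (rule A.word_eval_append[symmetric])
    then have "e w \<otimes>\<^bsub>A\<^esub> s \<in> W (i + j)" using w w' by (auto intro!: e_W)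
    moreover have "e w \<otimes>\<^bsub>A\<^esub> (r \<odot>\<^bsub>A\<^esub> s \<oplus>\<^bsub>A\<^esub> v) = r \<odot>\<^bsub>A\<^esub> (e w \<otimes>\<^bsub>A\<^esub> s) \<oplus>\<^bsub>A\<^esub> e w \<otimes>\<^bsub>A\<^esub> v"
      using step(1) w w' vc by (simp add: A.r_distr AA.smult_mult_right)
    ultimately show ?case using step(1,4) W_E(4,5) by simp
  qed
  have bc: "b \<in> carrier A" using b W_E(1) by auto
  show ?thesis
    using a unfolding W_span[of i]
  proof induction
    case zero
    then show ?case using bc W_E(7) by simp
  next
    case (step r s v)
    then obtain w where w: "set w \<subseteq> J" "wdeg w \<le> i" "s = e w" by auto
    have vc: "v \<in> carrier A" using step(3) W_span[of i] W_E(1) by auto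
    have "(r \<odot>\<^bsub>A\<^esub> s \<oplus>\<^bsub>A\<^esub> v) \<otimes>\<^bsub>A\<^esub> b = r \<odot>\<^bsub>A\<^esub> (s \<otimes>\<^bsub>A\<^esub> b) \<oplus>\<^bsub>A\<^esub> v \<otimes>\<^bsub>A\<^esub> b"
      using step(1) w vc bc by (simp add: A.l_distr AA.smult_mult_left)
    then show ?case using step(1,4) wb[OF w(1,2)] w(3) W_E(4,5) by simp
  qed
qed

lemma one_W: "\<one>\<^bsub>A\<^esub> \<in> W 0"
  using e_W[of "[]" 0] by simp

lemma W_union_subalgebra: "unital_subalgebra R (\<Union>i. W i) A"
  unfolding unital_subalgebra_def
proof (intro conjI ballI)
  show "subring (\<Union>i. W i) A"
  proof (rule A.subringI)
    show "(\<Union>i. W i) \<subseteq> carrier A" using W_E(1) by auto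
    show "\<one>\<^bsub>A\<^esub> \<in> (\<Union>i. W i)" using one_W by auto
    show "\<ominus>\<^bsub>A\<^esub> a \<in> (\<Union>i. W i)" if "a \<in> (\<Union>i. W i)" for a using that W_E(3) by blast
    fix a b assume "a \<in> (\<Union>i. W i)" "b \<in> (\<Union>i. W i)"
    then obtain i j where ij: "a \<in> W i" "b \<in> W j" by auto
    then show "a \<otimes>\<^bsub>A\<^esub> b \<in> (\<Union>i. W i)" using W_mult by blast
    have "a \<in> W (i + j)" "b \<in> W (i + j)" using ij W_mono[of i "i + j"] W_mono[of j "i + j"] by auto
    then show "a \<oplus>\<^bsub>A\<^esub> b \<in> (\<Union>i. W i)" using W_E(5) by blast
  qed
  show "r \<odot>\<^bsub>A\<^esub> b \<in> (\<Union>i. W i)" if "r \<in> carrier R" "b \<in> (\<Union>i. W i)" for r b using that W_E(4) by blast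
qed

lemma subalgebra_words:
  assumes B: "unital_subalgebra R B A" "x ` J \<subseteq> B" and w: "set w \<subseteq> J" shows "e w \<in> B"
  using w
proof (induction w)
  case (Cons j w)
  then show ?case using B subringE(6)[of B A "x j" "e w"] by (auto simp: unital_subalgebra_def)
qed (use B subringE(3) in \<open>auto simp: unital_subalgebra_def\<close>)

lemma subalgebra_submodule: "unital_subalgebra R B A \<Longrightarrow> submodule B R A"
  using subringE[of B A] by (intro AA.submoduleI) (auto simp: unital_subalgebra_def)

lemma W_union: "(\<Union>i. W i) = H"
  unfolding adjoin_def
proof (rule hull_unique[symmetric])
  show "x ` J \<subseteq> (\<Union>i. W i)"
  proof clarify
    fix j assume "j \<in> J"
    then have "e [j] \<in> W (d j)" "x j \<in> carrier A" using x e_W[of "[j]" "d j"] by auto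
    moreover from this have "e [j] = x j" by simp
    ultimately have "x j \<in> W (d j)" by simp
    then show "x j \<in> (\<Union>i. W i)" by auto
  qed
  show "unital_subalgebra R (\<Union>i. W i) A" by (rule W_union_subalgebra)
  show "(\<Union>i. W i) \<subseteq> B" if B: "x ` J \<subseteq> B" "unital_subalgebra R B A" for B
  proof clarify
    fix v i assume v: "v \<in> W i"
    have "e ` {w. set w \<subseteq> J \<and> wdeg w \<le> i} \<subseteq> B" using subalgebra_words[OF B(2,1)] by auto
    then have "W i \<subseteq> B" unfolding W_span by (rule AA.lin_span_minimal[OF subalgebra_submodule[OF B(2)]])
    then show "v \<in> B" using v by blast
  qed
qed

lemma H_subalgebra: "unital_subalgebra R H A"
  using W_union_subalgebra W_union by simp

lemma e_H: "set w \<subseteq> J \<Longrightarrow> e w \<in> H"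
  using e_W W_union by blast

lemma W_filtration: "H = carrier A \<Longrightarrow> nat_filtration R A W"
  unfolding nat_filtration_def using W_sub W_mono one_W W_mult W_union by auto

text \<open>The preceding filtration step, with value zero at \<open>0\<close>; the errors made by
  sorting live here.\<close>

definition "Wlt i = lin_span R A (e ` {w. set w \<subseteq> J \<and> wdeg w < i})"

lemma Wlt_Suc: "Wlt (Suc i) = W i"
  unfolding Wlt_def W_span by (simp add: less_Suc_eq_le)

lemma Wlt_0: "Wlt 0 = {\<zero>\<^bsub>A\<^esub>}"
  unfolding Wlt_def by (auto elim: lin_span.cases intro: lin_span.zero)

lemma Wlt_sub: "submodule (Wlt i) R A"
  unfolding Wlt_def by (rule AA.lin_span_submodule[OF words_closed])

lemmas Wlt_E = AA.submoduleE[OF Wlt_sub] AA.submodule_zero[OF Wlt_sub]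

lemma Wlt_mult_right: "a \<in> W i \<Longrightarrow> b \<in> Wlt j \<Longrightarrow> a \<otimes>\<^bsub>A\<^esub> b \<in> Wlt (i + j)"
  using W_mult[of a i b "j - 1"] W_E(1)[of i] Wlt_0 Wlt_Suc Wlt_E(7)[of i] by (cases j) auto

lemma Wlt_mult_left: "a \<in> Wlt i \<Longrightarrow> b \<in> W j \<Longrightarrow> a \<otimes>\<^bsub>A\<^esub> b \<in> Wlt (i + j)"
  using W_mult[of a "i - 1" b j] W_E(1)[of j] Wlt_0 Wlt_Suc Wlt_E(7)[of j] by (cases i) auto

lemma deg_insort: "wdeg (insort a w) = d a + wdeg w"
  by (induction w) auto

lemma deg_sort: "wdeg (sort w) = wdeg w"
  by (induction w) (auto simp: deg_insort)

context
  assumes swap: "\<And>j k. j \<in> J \<Longrightarrow> k \<in> J \<Longrightarrow> x k \<otimes>\<^bsub>A\<^esub> x j \<ominus>\<^bsub>A\<^esub> x j \<otimes>\<^bsub>A\<^esub> x k \<in> Wlt (d k + d j)"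
begin

text \<open>Insertion sort on the word: each exchange of neighbours costs a commutator, which by
  \<open>swap\<close> has smaller degree than the product it corrects.\<close>

lemma insort_mod:
  assumes a: "a \<in> J" and "set w \<subseteq> J"
  shows "x a \<otimes>\<^bsub>A\<^esub> e w \<ominus>\<^bsub>A\<^esub> e (insort a w) \<in> Wlt (d a + wdeg w)"
  using assms(2)
proof (induction w)
  case Nil
  have "x a \<in> carrier A" using x a by auto
  then show ?case using Wlt_E(7) by (simp add: A.minus_eq A.r_neg)
next
  case (Cons y w)
  have c: "x a \<in> carrier A" "x y \<in> carrier A" "e w \<in> carrier A" "e (insort a w) \<in> carrier A"
    using a Cons.prems x e_closed[of w] e_closed[of "insort a w"] by (auto simp: set_insort_key)
  show ?case
  proof (cases "a \<le> y")
    case True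
    then show ?thesis using c Wlt_E(7) by (simp add: A.minus_eq A.r_neg)
  next
    case False
    let ?s = "x a \<otimes>\<^bsub>A\<^esub> x y \<ominus>\<^bsub>A\<^esub> x y \<otimes>\<^bsub>A\<^esub> x a" and ?i = "x a \<otimes>\<^bsub>A\<^esub> e w \<ominus>\<^bsub>A\<^esub> e (insort a w)"
    have "?s \<otimes>\<^bsub>A\<^esub> e w \<in> Wlt ((d a + d y) + wdeg w)"
      by (rule Wlt_mult_left[OF swap e_W]) (use a Cons.prems in auto)
    moreover have "x y \<otimes>\<^bsub>A\<^esub> ?i \<in> Wlt (d y + (d a + wdeg w))"
    proof (rule Wlt_mult_right)
      show "x y \<in> W (d y)" using e_W[of "[y]" "d y"] Cons.prems c by simp
    qed (use Cons in auto)
    moreover have "d y + (d a + wdeg w) = d a + wdeg (y # w)" "(d a + d y) + wdeg w = d a + wdeg (y # w)" by auto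
    ultimately have "?s \<otimes>\<^bsub>A\<^esub> e w \<oplus>\<^bsub>A\<^esub> x y \<otimes>\<^bsub>A\<^esub> ?i \<in> Wlt (d a + wdeg (y # w))"
      using Wlt_E(5) by metis
    \<comment> \<open>Exchange \<open>a\<close> with the first letter \<open>y\<close>, then insert
      it into the rest: the errors are the commutator times the rest, and \<open>x y\<close> times
      the error of the shorter insertion.\<close>
    moreover have "x a \<otimes>\<^bsub>A\<^esub> e (y # w) \<ominus>\<^bsub>A\<^esub> e (insort a (y # w)) = ?s \<otimes>\<^bsub>A\<^esub> e w \<oplus>\<^bsub>A\<^esub> x y \<otimes>\<^bsub>A\<^esub> ?i"
      using False c
      by (simp add: A.minus_eq A.l_distr A.r_distr A.l_minus A.r_minus A.m_assoc A.a_assoc A.r_neg1)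
    ultimately show ?thesis by simp
  qed
qed

lemma sort_mod:
  assumes "set w \<subseteq> J" shows "e w \<ominus>\<^bsub>A\<^esub> e (sort w) \<in> Wlt (wdeg w)"
  using assms
proof (induction w)
  case Nil
  then show ?case using Wlt_E(7) by (simp add: A.minus_eq A.r_neg)
next
  case (Cons a w)
  have c: "x a \<in> carrier A" "e w \<in> carrier A" "e (sort w) \<in> carrier A" "e (insort a (sort w)) \<in> carrier A"
    using Cons.prems x e_closed[of w] e_closed[of "sort w"] e_closed[of "insort a (sort w)"]
    by (auto simp: set_insort_key)
  have "x a \<otimes>\<^bsub>A\<^esub> (e w \<ominus>\<^bsub>A\<^esub> e (sort w)) \<in> Wlt (d a + wdeg w)"
  proof (rule Wlt_mult_right)
    show "x a \<in> W (d a)" using e_W[of "[a]" "d a"] Cons.prems c by simp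
  qed (use Cons in auto)
  moreover have "x a \<otimes>\<^bsub>A\<^esub> e (sort w) \<ominus>\<^bsub>A\<^esub> e (insort a (sort w)) \<in> Wlt (d a + wdeg w)"
    using insort_mod[of a "sort w"] Cons.prems by (simp add: deg_sort)
  ultimately have "x a \<otimes>\<^bsub>A\<^esub> (e w \<ominus>\<^bsub>A\<^esub> e (sort w)) \<oplus>\<^bsub>A\<^esub> (x a \<otimes>\<^bsub>A\<^esub> e (sort w) \<ominus>\<^bsub>A\<^esub> e (insort a (sort w))) \<in> Wlt (d a + wdeg w)"
    using Wlt_E(5) by blast
  moreover have "e (a # w) \<ominus>\<^bsub>A\<^esub> e (sort (a # w)) =
    x a \<otimes>\<^bsub>A\<^esub> (e w \<ominus>\<^bsub>A\<^esub> e (sort w)) \<oplus>\<^bsub>A\<^esub> (x a \<otimes>\<^bsub>A\<^esub> e (sort w) \<ominus>\<^bsub>A\<^esub> e (insort a (sort w)))"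
    using c by (simp add: A.minus_eq A.r_distr A.r_minus A.a_assoc A.r_neg1)
  ultimately show ?case by simp
qed

text \<open>Strong induction on the degree: a word differs from its sorted form by an element of
  smaller degree, to which the induction hypothesis applies. In degree zero there is no room for an
  error.\<close>

lemma W_sorted: "W i = lin_span R A (e ` {w \<in> sorted_words J. wdeg w \<le> i})"
proof (induction i rule: less_induct)
  case (less i)
  let ?S = "\<lambda>i. lin_span R A (e ` {w \<in> sorted_words J. wdeg w \<le> i})"
  have c: "e ` {w \<in> sorted_words J. wdeg w \<le> i} \<subseteq> carrier A" for i by (auto simp: sorted_words_def)
  note S = AA.submoduleE[OF AA.lin_span_submodule[OF c]] AA.submodule_zero[OF AA.lin_span_submodule[OF c]]
  show ?case
  proof
    show "?S i \<subseteq> W i" unfolding W_span by (rule lin_span_mono) (auto simp: sorted_words_def)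
    have "e w \<in> ?S i" if w: "set w \<subseteq> J" "wdeg w \<le> i" for w
    proof -
      have wc: "e w \<in> carrier A" "e (sort w) \<in> carrier A" using w by simp_all
      have s: "e (sort w) \<in> ?S i"
        by (rule AA.lin_span_incl[OF c]) (use w in \<open>auto simp: sorted_words_def deg_sort\<close>)
      have "e w \<ominus>\<^bsub>A\<^esub> e (sort w) \<in> ?S i"
      proof (cases "wdeg w")
        case 0
        have "e w \<ominus>\<^bsub>A\<^esub> e (sort w) = \<zero>\<^bsub>A\<^esub>"
          using sort_mod[OF w(1)] unfolding 0 Wlt_0 by simp
        then show ?thesis using S(7) by simp
      next
        case (Suc k)
        then have "e w \<ominus>\<^bsub>A\<^esub> e (sort w) \<in> ?S k"
          using sort_mod[OF w(1)] less[of k] w(2) unfolding Suc Wlt_Suc by simp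
        moreover have "e ` {w \<in> sorted_words J. wdeg w \<le> k} \<subseteq> e ` {w \<in> sorted_words J. wdeg w \<le> i}"
          using Suc w(2) by (intro image_mono) auto
        ultimately show ?thesis using lin_span_mono[OF _ order_refl] by blast
      qed
      then have "(e w \<ominus>\<^bsub>A\<^esub> e (sort w)) \<oplus>\<^bsub>A\<^esub> e (sort w) \<in> ?S i" using s S(5) by blast
      then show ?thesis using wc by (simp add: A.minus_eq A.a_assoc A.l_neg)
    qed
    then show "W i \<subseteq> ?S i"
      unfolding W_span by (intro AA.lin_span_minimal[OF AA.lin_span_submodule[OF c]]) auto
  qed
qed

lemma H_sorted: "H = lin_span R A (e ` sorted_words J)"
proof
  show "H \<subseteq> lin_span R A (e ` sorted_words J)"
  proof
    fix v assume "v \<in> H"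
    then obtain i where "v \<in> W i" unfolding W_union[symmetric] by auto
    then show "v \<in> lin_span R A (e ` sorted_words J)"
      unfolding W_sorted using lin_span_mono[of "e ` {w \<in> sorted_words J. wdeg w \<le> i}" "e ` sorted_words J" R R A] by auto
  qed
  show "lin_span R A (e ` sorted_words J) \<subseteq> H"
    by (rule AA.lin_span_minimal[OF subalgebra_submodule[OF H_subalgebra]])
      (auto simp: sorted_words_def intro: e_H)
qed

end

end

text \<open>Degrees of at least one bound the length of a word by its degree; through this the lower
  bound in \<open>ore_degrees\<close> yields local finiteness.\<close>

lemma finite_words_bounded:
  assumes "finite J" "\<And>j. j \<in> J \<Longrightarrow> d j \<ge> (1::nat)"
  shows "finite {w. set w \<subseteq> J \<and> sum_list (map d w) \<le> i}"
proof -
  have "length w \<le> sum_list (map d w)" if "set w \<subseteq> J" for w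
    using that by (induction w) (use assms(2) in \<open>fastforce+\<close>)
  then have "{w. set w \<subseteq> J \<and> sum_list (map d w) \<le> i} \<subseteq> {w. set w \<subseteq> J \<and> length w \<le> i}" by force
  then show ?thesis by (rule finite_subset) (rule finite_lists_length_le[OF assms(1)])
qed

section \<open>Iterated Ore extensions\<close>

lemma (in ring) word_eval_replicate:
  "x j \<in> carrier R \<Longrightarrow> word_eval R x (replicate i j) = x j [^] i"
proof (induction i)
  case (Suc i)
  then show ?case using nat_pow_Suc2[of "x j" i] by (simp del: nat_pow_Suc)
qed simp

text \<open>The largest letter stands at the end, so that an ordered monomial is a left coefficient
  times a power of the newest generator, in accordance with the basis of an Ore extension as a left
  module.\<close>

lemma sorted_words_Suc:
  "sorted_words {1..Suc k} = (\<lambda>(v, i). v @ replicate i (Suc k)) ` (sorted_words {1..k} \<times> UNIV)"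
proof
  show "(\<lambda>(v, i). v @ replicate i (Suc k)) ` (sorted_words {1..k} \<times> UNIV) \<subseteq> sorted_words {1..Suc k}"
    by (fastforce simp: sorted_words_def sorted_append)
  show "sorted_words {1..Suc k} \<subseteq> (\<lambda>(v, i). v @ replicate i (Suc k)) ` (sorted_words {1..k} \<times> UNIV)"
  proof
    fix w assume "w \<in> sorted_words {1..Suc k}"
    then show "w \<in> (\<lambda>(v, i). v @ replicate i (Suc k)) ` (sorted_words {1..k} \<times> UNIV)"
    proof (induction w)
      case Nil
      show ?case by (rule image_eqI[of _ _ "([], 0)"]) (auto simp: sorted_words_def)
    next
      case (Cons a w)
      then have "w \<in> sorted_words {1..Suc k}" by (auto simp: sorted_words_def)
      then obtain v i where vi: "v \<in> sorted_words {1..k}" "w = v @ replicate i (Suc k)" using Cons.IH by auto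
      show ?case
      proof (cases "a = Suc k")
        case True
        have "b = Suc k" if "b \<in> set w" for b
          using that Cons.prems True by (intro antisym) (auto simp: sorted_words_def)
        then have "w = replicate (length w) (Suc k)" by (simp add: replicate_length_same)
        then have "a # w = [] @ replicate (Suc (length w)) (Suc k)" using True by simp
        moreover have "[] \<in> sorted_words {1..k}" by (simp add: sorted_words_def)
        ultimately show ?thesis by (intro image_eqI[of _ _ "([], Suc (length w))"]) auto
      next
        case False
        then have "a # v \<in> sorted_words {1..k}" using Cons.prems vi by (auto simp: sorted_words_def)
        then show ?thesis using vi by (intro image_eqI[of _ _ "(a # v, i)"]) auto
      qed
    qed
  qed
qed

lemma sorted_words_append_inj:
  assumes "v \<in> sorted_words {1..k}" "v' \<in> sorted_words {1..k}"
    and "v @ replicate i (Suc k) = v' @ replicate j (Suc k)"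
  shows "v = v' \<and> i = j"
proof -
  have f: "filter (\<lambda>a. a \<le> k) (v @ replicate i (Suc k)) = v" if "v \<in> sorted_words {1..k}" for v i
    using that by (auto simp: sorted_words_def filter_id_conv)
  have "v = v'" using f[OF assms(1), of i] f[OF assms(2), of j] assms(3) by simp
  then show ?thesis using assms(3) by auto
qed

lemma iterated_ore_closed:
  assumes "iterated_ore K A n x \<delta>" shows "x ` {1..n} \<subseteq> carrier A"
proof clarify
  fix k assume "k \<in> {1..n}"
  then have "ore_extension K A (adjoin K A (x ` {1..<k})) (adjoin K A (x ` {1..k})) (x k) (\<delta> k)"
    using assms by (auto simp: iterated_ore_def)
  then have "subring (adjoin K A (x ` {1..k})) A" "x k \<in> adjoin K A (x ` {1..k})"
    by (simp_all add: ore_extension_def unital_subalgebra_def)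
  then show "x k \<in> carrier A" using subringE(1) by blast
qed

text \<open>Grouping the summands by the exponent of the newest generator turns the combination into
  a polynomial with left coefficients in the smaller ring. Freeness on the powers kills these
  coefficients, and the induction hypothesis then kills their own scalar coefficients.\<close>

lemma ore_indep_step:
  assumes alg: "noncomm_algebra K A" and x: "x ` {1..Suc k} \<subseteq> carrier A"
    and ore: "ore_extension K A (adjoin K A (x ` {1..k})) (adjoin K A (x ` {1..Suc k})) (x (Suc k)) \<delta>"
    and IH: "lin_indep K A (word_eval A x) (sorted_words {1..k})"
  shows "lin_indep K A (word_eval A x) (sorted_words {1..Suc k})"
  unfolding lin_indep_def
proof (intro ballI impI allI)
  interpret A: ring A using alg by (rule noncomm_algebra.axioms)
  interpret AA: noncomm_algebra K A by (rule alg)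
  let ?e = "word_eval A x" and ?y = "x (Suc k)" and ?I = "sorted_words {1..k}"
  let ?R = "adjoin K A (x ` {1..k})" and ?S = "adjoin K A (x ` {1..Suc k})"
  let ?RR = "A\<lparr>carrier := ?R\<rparr>" and ?SS = "left_module (A\<lparr>carrier := ?S\<rparr>)"
  have xk: "x ` {1..k} \<subseteq> carrier A" using x by auto
  have ec: "\<forall>w\<in>?I. ?e w \<in> carrier A"
    using xk by (auto simp: sorted_words_def intro!: A.word_eval_closed)
  have yc: "?y \<in> carrier A" using x by auto
  have R: "unital_subalgebra K ?R A" and S: "unital_subalgebra K ?S A" and RS: "?R \<subseteq> ?S" and yS: "?y \<in> ?S"
    and basis: "module_basis ?RR ?SS (\<lambda>i::nat. ?y [^]\<^bsub>A\<^esub> i) UNIV"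
    using ore by (auto simp: ore_extension_def)
  have RA: "?R \<subseteq> carrier A" and SA: "?S \<subseteq> carrier A"
    using R S subringE(1) by (auto simp: unital_subalgebra_def)
  \<comment> \<open>Only membership in the generated subalgebra is at stake, so all degrees are set
    to zero.\<close>
  interpret wk: word_algebra K A x "\<lambda>_. 0" "{1..k}" by (intro word_algebra.intro alg xk)
  fix c w0 assume c: "c \<in> fin_supp K (sorted_words {1..Suc k})" and z: "lincomb K A ?e c = \<zero>\<^bsub>A\<^esub>"
  have cK: "c w \<in> carrier K" for w using c by (auto simp: fin_supp_def)
  have supp: "{w. c w \<noteq> \<zero>\<^bsub>K\<^esub>} \<subseteq> sorted_words {1..Suc k}" "finite {w. c w \<noteq> \<zero>\<^bsub>K\<^esub>}"
    using c by (auto simp: fin_supp_def)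
  define ci where "ci i v = (if v \<in> ?I then c (v @ replicate i (Suc k)) else \<zero>\<^bsub>K\<^esub>)" for i v
  have suppi: "{v. ci i v \<noteq> \<zero>\<^bsub>K\<^esub>} = {v \<in> ?I. c (v @ replicate i (Suc k)) \<noteq> \<zero>\<^bsub>K\<^esub>}" for i
    by (auto simp: ci_def)
  have inj: "inj_on (\<lambda>v. v @ replicate i (Suc k)) B" for i B by (auto simp: inj_on_def)
  have ci: "ci i \<in> fin_supp K ?I" for i
  proof -
    have "(\<lambda>v. v @ replicate i (Suc k)) ` {v. ci i v \<noteq> \<zero>\<^bsub>K\<^esub>} \<subseteq> {w. c w \<noteq> \<zero>\<^bsub>K\<^esub>}"
      unfolding suppi by auto
    then have "finite {v. ci i v \<noteq> \<zero>\<^bsub>K\<^esub>}"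
      using finite_imageD[OF finite_subset[OF _ supp(2)] inj] by blast
    then show ?thesis using cK by (auto simp: fin_supp_def ci_def)
  qed
  define r where "r i = lincomb K A ?e (ci i)" for i
  have rR: "r i \<in> ?R" for i
  proof -
    have "r i \<in> lin_span K A (?e ` ?I)"
      unfolding r_def AA.lin_span_eq_lincomb[OF ec] using ci by blast
    moreover have "lin_span K A (?e ` ?I) \<subseteq> ?R"
      by (rule AA.lin_span_minimal[OF wk.subalgebra_submodule[OF wk.H_subalgebra]])
        (auto simp: sorted_words_def simp del: One_nat_def intro: wk.e_H)
    ultimately show ?thesis by blast
  qed
  \<comment> \<open>The exponents of the newest generator that occur in the support of
    \<open>c\<close>; they are finitely many, since an exponent is at most the length of its
    word.\<close>
  define N where "N = (\<Union>w\<in>{w. c w \<noteq> \<zero>\<^bsub>K\<^esub>}. {i. \<exists>v\<in>?I. w = v @ replicate i (Suc k)})"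
  have Nfin: "finite N"
    unfolding N_def
  proof (intro finite_UN_I supp(2))
    fix w show "finite {i. \<exists>v\<in>?I. w = v @ replicate i (Suc k)}"
      by (rule finite_subset[of _ "{..length w}"]) auto
  qed
  have rN: "r i = \<zero>\<^bsub>A\<^esub>" if "i \<notin> N" for i
  proof -
    have "ci i = (\<lambda>_. \<zero>\<^bsub>K\<^esub>)"
    proof
      fix v show "ci i v = \<zero>\<^bsub>K\<^esub>" using that unfolding N_def ci_def by auto
    qed
    then show ?thesis by (simp add: r_def lincomb_def)
  qed
  let ?g = "\<lambda>w. c w \<odot>\<^bsub>A\<^esub> ?e w"
  let ?Si = "\<lambda>i. (\<lambda>v. v @ replicate i (Suc k)) ` {v. ci i v \<noteq> \<zero>\<^bsub>K\<^esub>}"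
  have gc: "?g w \<in> carrier A" if "w \<in> sorted_words {1..Suc k}" for w
    using that x cK by (auto simp: sorted_words_def intro!: AA.smult_closed A.word_eval_closed)
  have SiI: "?Si i \<subseteq> sorted_words {1..Suc k}" for i
    unfolding sorted_words_Suc suppi by auto
  have fin_i: "finite {v. ci i v \<noteq> \<zero>\<^bsub>K\<^esub>}" for i using ci by (simp add: fin_supp_def)
  have "{w. c w \<noteq> \<zero>\<^bsub>K\<^esub>} = (\<Union>i\<in>N. ?Si i)"
  proof
    show "{w. c w \<noteq> \<zero>\<^bsub>K\<^esub>} \<subseteq> (\<Union>i\<in>N. ?Si i)"
    proof
      fix w assume w: "w \<in> {w. c w \<noteq> \<zero>\<^bsub>K\<^esub>}"
      then have "w \<in> sorted_words {1..Suc k}" using supp(1) by blast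
      then obtain v i where vi: "v \<in> ?I" "w = v @ replicate i (Suc k)" unfolding sorted_words_Suc by auto
      have "i \<in> N" unfolding N_def using w vi by blast
      moreover have "w \<in> ?Si i" unfolding suppi using w vi by blast
      ultimately show "w \<in> (\<Union>i\<in>N. ?Si i)" by blast
    qed
  qed (auto simp: suppi)
  then have "lincomb K A ?e c = finsum A ?g (\<Union>i\<in>N. ?Si i)" by (simp add: lincomb_def)
  also have "\<dots> = (\<Oplus>\<^bsub>A\<^esub>i\<in>N. finsum A ?g (?Si i))"
  proof (rule A.add.finprod_UN_disjoint[OF Nfin])
    show "finite (?Si i)" for i using fin_i by simp
    show "pairwise (\<lambda>i j. disjnt (?Si i) (?Si j)) N"
    proof (rule pairwiseI)
      fix i j :: nat assume "i \<noteq> j"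
      then show "disjnt (?Si i) (?Si j)"
        unfolding disjnt_iff suppi using sorted_words_append_inj by blast
    qed
    show "?g w \<in> carrier A" if "w \<in> ?Si i" for i w using gc SiI that by blast
  qed
  also have "\<dots> = (\<Oplus>\<^bsub>A\<^esub>i\<in>N. r i \<otimes>\<^bsub>A\<^esub> ?y [^]\<^bsub>A\<^esub> i)"
  proof (rule A.add.finprod_cong')
    show "(\<lambda>i. r i \<otimes>\<^bsub>A\<^esub> ?y [^]\<^bsub>A\<^esub> i) \<in> N \<rightarrow> carrier A" using rR RA yc by auto
    fix i
    have "finsum A ?g (?Si i) = (\<Oplus>\<^bsub>A\<^esub>v\<in>{v. ci i v \<noteq> \<zero>\<^bsub>K\<^esub>}. ?g (v @ replicate i (Suc k)))"
      by (rule A.finsum_reindex[OF _ inj]) (use gc SiI in blast)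
    also have "\<dots> = (\<Oplus>\<^bsub>A\<^esub>v\<in>{v. ci i v \<noteq> \<zero>\<^bsub>K\<^esub>}. (ci i v \<odot>\<^bsub>A\<^esub> ?e v) \<otimes>\<^bsub>A\<^esub> ?y [^]\<^bsub>A\<^esub> i)"
    proof (rule A.add.finprod_cong')
      fix v assume v: "v \<in> {v. ci i v \<noteq> \<zero>\<^bsub>K\<^esub>}"
      then have vI: "v \<in> ?I" by (simp add: suppi)
      have vx: "x ` set v \<subseteq> carrier A" using vI xk by (auto simp: sorted_words_def)
      have "x ` set (replicate i (Suc k)) \<subseteq> carrier A" using yc by auto
      then have "?e (v @ replicate i (Suc k)) = ?e v \<otimes>\<^bsub>A\<^esub> ?y [^]\<^bsub>A\<^esub> i"
        using A.word_eval_append[OF vx] A.word_eval_replicate[of x "Suc k" i] yc by simp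
      then show "?g (v @ replicate i (Suc k)) = (ci i v \<odot>\<^bsub>A\<^esub> ?e v) \<otimes>\<^bsub>A\<^esub> ?y [^]\<^bsub>A\<^esub> i"
        using vI ec yc cK by (simp add: ci_def AA.smult_mult_left)
    qed (use ec yc cK in \<open>auto simp: suppi ci_def\<close>)
    also have "\<dots> = r i \<otimes>\<^bsub>A\<^esub> ?y [^]\<^bsub>A\<^esub> i"
      unfolding r_def lincomb_def
      by (rule A.finsum_ldistr[symmetric]) (use fin_i ec yc cK in \<open>auto simp: suppi ci_def\<close>)
    finally show "finsum A ?g (?Si i) = r i \<otimes>\<^bsub>A\<^esub> ?y [^]\<^bsub>A\<^esub> i" .
  qed simp
  finally have sum0: "(\<Oplus>\<^bsub>A\<^esub>i\<in>N. r i \<otimes>\<^bsub>A\<^esub> ?y [^]\<^bsub>A\<^esub> i) = \<zero>\<^bsub>A\<^esub>" using z by simp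
  have rsub: "{i. r i \<noteq> \<zero>\<^bsub>A\<^esub>} \<subseteq> N" using rN by blast
  have powS: "?y [^]\<^bsub>A\<^esub> i \<in> ?S" for i :: nat
    using S yS subringE(3,6)[of ?S A] by (induction i) (auto simp: unital_subalgebra_def)
  \<comment> \<open>The basis property concerns sums formed in the subring \<open>?S\<close>; these
    agree with the sums in \<open>A\<close> treated so far.\<close>
  have sumS: "lincomb ?RR ?SS (\<lambda>i::nat. ?y [^]\<^bsub>A\<^esub> i) r = \<zero>\<^bsub>A\<^esub>"
  proof -
    interpret Sr: ring "A\<lparr>carrier := ?S\<rparr>" by (rule A.subring_is_ring) (use S in \<open>simp add: unital_subalgebra_def\<close>)
    interpret SV: ring ?SS by (rule ring_cong[OF Sr.ring_axioms]) simp_all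
    have prod: "r i \<otimes>\<^bsub>A\<^esub> ?y [^]\<^bsub>A\<^esub> i \<in> ?S" for i
      using S rR[of i] RS powS[of i] subringE(6)[of ?S A] by (auto simp: unital_subalgebra_def)
    have "lincomb ?RR ?SS (\<lambda>i::nat. ?y [^]\<^bsub>A\<^esub> i) r = (\<Oplus>\<^bsub>?SS\<^esub>i\<in>{i. r i \<noteq> \<zero>\<^bsub>A\<^esub>}. r i \<otimes>\<^bsub>A\<^esub> ?y [^]\<^bsub>A\<^esub> i)"
      by (simp add: lincomb_def)
    also have "\<dots> = (\<Oplus>\<^bsub>A\<^esub>i\<in>{i. r i \<noteq> \<zero>\<^bsub>A\<^esub>}. r i \<otimes>\<^bsub>A\<^esub> ?y [^]\<^bsub>A\<^esub> i)"
      by (rule finsum_hom[OF SV.abelian_monoid_axioms A.abelian_monoid_axioms, of "\<lambda>v. v"])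
        (use prod SA in auto)
    also have "\<dots> = (\<Oplus>\<^bsub>A\<^esub>i\<in>N. r i \<otimes>\<^bsub>A\<^esub> ?y [^]\<^bsub>A\<^esub> i)"
      by (rule A.add.finprod_mono_neutral_cong_left[OF Nfin rsub]) (use prod SA yc in auto)
    finally show ?thesis using sum0 by simp
  qed
  have zR: "\<zero>\<^bsub>A\<^esub> \<in> ?R" using R subringE(2) by (auto simp: unital_subalgebra_def)
  have "\<zero>\<^bsub>A\<^esub> \<in> carrier ?SS" using zR RS by auto
  then have ex1: "\<exists>!f. f \<in> fin_supp ?RR (UNIV :: nat set) \<and> \<zero>\<^bsub>A\<^esub> = lincomb ?RR ?SS (\<lambda>i::nat. ?y [^]\<^bsub>A\<^esub> i) f"
    using basis unfolding module_basis_def' by blast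
  have rfin: "r \<in> fin_supp ?RR UNIV"
    using rR finite_subset[OF rsub Nfin] by (auto simp: fin_supp_def)
  have zfin: "(\<lambda>_::nat. \<zero>\<^bsub>A\<^esub>) \<in> fin_supp ?RR UNIV" using zR by (auto simp: fin_supp_def)
  have "lincomb ?RR ?SS (\<lambda>i::nat. ?y [^]\<^bsub>A\<^esub> i) (\<lambda>_::nat. \<zero>\<^bsub>A\<^esub>) = \<zero>\<^bsub>A\<^esub>"
    using subsetD[OF RS zR] by (simp add: lincomb_def finsum_def finprod_def foldD_empty del: One_nat_def)
  then have r0: "r = (\<lambda>_. \<zero>\<^bsub>A\<^esub>)" using ex1 rfin zfin sumS by (metis (mono_tags, lifting))
  show "c w0 = \<zero>\<^bsub>K\<^esub>"
  proof (cases "w0 \<in> sorted_words {1..Suc k}")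
    case True
    then obtain v i where vi: "v \<in> ?I" "w0 = v @ replicate i (Suc k)" unfolding sorted_words_Suc by auto
    have "lincomb K A ?e (ci i) = \<zero>\<^bsub>A\<^esub>" using fun_cong[OF r0, of i] by (simp add: r_def)
    then have "ci i v = \<zero>\<^bsub>K\<^esub>" using IH ci[of i] unfolding lin_indep_def by blast
    then show ?thesis using vi by (simp add: ci_def)
  next
    case False
    then show ?thesis using c by (auto simp: fin_supp_def)
  qed
qed

lemma iterated_ore_indep:
  assumes ore: "iterated_ore K A n x \<delta>" and "k \<le> n"
  shows "lin_indep K A (word_eval A x) (sorted_words {1..k})"
  using assms(2)
proof (induction k)
  case 0
  interpret A: noncomm_algebra K A using ore by (simp add: iterated_ore_def)
  have e0: "sorted_words {1..0::nat} = {[]}" by (auto simp: sorted_words_def)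
  show ?case
    unfolding lin_indep_def e0
  proof (intro ballI impI allI)
    fix c w assume c: "c \<in> fin_supp K {[]}" and z: "lincomb K A (word_eval A x) c = \<zero>\<^bsub>A\<^esub>"
    have cK: "range c \<subseteq> carrier K" using c by (auto simp: fin_supp_def)
    have "lincomb K A (word_eval A x) c = (\<Oplus>\<^bsub>A\<^esub>i\<in>{[]}. c i \<odot>\<^bsub>A\<^esub> word_eval A x i)"
      by (rule A.lincomb_superset) (use c cK in \<open>auto simp: fin_supp_def\<close>)
    also have "\<dots> = c [] \<odot>\<^bsub>A\<^esub> \<one>\<^bsub>A\<^esub>" using cK by (simp add: image_subset_iff)
    finally have eq: "c [] \<odot>\<^bsub>A\<^esub> \<one>\<^bsub>A\<^esub> = \<zero>\<^bsub>K\<^esub> \<odot>\<^bsub>A\<^esub> \<one>\<^bsub>A\<^esub>" using z by simp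
    \<comment> \<open>Without generators, independence means that a multiple of the unit vanishes
      only for the scalar zero, that is, that the base field embeds.\<close>
    have inj: "inj_on (\<lambda>c. c \<odot>\<^bsub>A\<^esub> \<one>\<^bsub>A\<^esub>) (carrier K)" using ore by (simp add: iterated_ore_def)
    have "c [] = \<zero>\<^bsub>K\<^esub>" by (rule inj_onD[OF inj eq]) (use cK in auto)
    then show "c w = \<zero>\<^bsub>K\<^esub>" using c by (cases "w = []") (auto simp: fin_supp_def)
  qed
next
  case (Suc k)
  have "{1..<Suc k} = {1..k}" by auto
  then have "ore_extension K A (adjoin K A (x ` {1..k})) (adjoin K A (x ` {1..Suc k})) (x (Suc k)) (\<delta> (Suc k))"
    using ore Suc.prems unfolding iterated_ore_def by (metis Suc_le_mono atLeastAtMost_iff le0 One_nat_def)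
  moreover have "x ` {1..Suc k} \<subseteq> carrier A" using iterated_ore_closed[OF ore] Suc.prems by auto
  ultimately show ?case using ore Suc by (intro ore_indep_step) (auto simp: iterated_ore_def)
qed

text \<open>Stated for an arbitrary index set \<open>J'\<close>: applied to the indices of the
  earlier generators, it places the image of a commutator in the subring generated so far.\<close>

lemma (in tensor) T_generate_mem:
  assumes y: "y ` J' \<subseteq> carrier B" and L: "\<And>w. w \<in> L \<Longrightarrow> set w \<subseteq> J'"
    and v: "v \<in> lin_span D B (word_eval B y ` L)" and c: "c \<in> carrier C"
  shows "pt v c \<in> generate_ring T ((\<lambda>c. pt \<one>\<^bsub>B\<^esub> c) ` carrier C \<union> (\<lambda>j. pt (y j) \<one>\<^bsub>C\<^esub>) ` J')"
    (is "_ \<in> ?G")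
proof -
  interpret B: ring B using algB by (rule noncomm_algebra.axioms)
  interpret C: cring C by (rule crC)
  interpret BA: noncomm_algebra D B by (rule algB)
  interpret CA: noncomm_algebra D C by (rule algC)
  interpret T: ring T by (rule ring_T)
  interpret l: ring_hom_ring B T "\<lambda>b. pt b \<one>\<^bsub>C\<^esub>" by (rule inl_hom)
  have w: "pt (word_eval B y w) \<one>\<^bsub>C\<^esub> \<in> ?G" if "set w \<subseteq> J'" for w
    using that
  proof (induction w)
    case Nil
    then show ?case by (simp add: pt_one generate_ring.one)
  next
    case (Cons j w)
    have "y j \<in> carrier B" "word_eval B y w \<in> carrier B"
      using Cons.prems y by (auto intro!: B.word_eval_closed)
    moreover have "pt (y j) \<one>\<^bsub>C\<^esub> \<in> ?G" using Cons.prems by (intro generate_ring.incl) auto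
    ultimately show ?case using Cons by (auto intro: generate_ring.eng_mult)
  qed
  have wB: "word_eval B y w \<in> carrier B" if "w \<in> L" for w
    using L[OF that] y by (intro B.word_eval_closed) auto
  have sub: "lin_span D B (word_eval B y ` L) \<subseteq> carrier B"
    by (rule BA.lin_span_closed) (use wB in auto)
  have cG: "pt \<one>\<^bsub>B\<^esub> c \<in> ?G" if "c \<in> carrier C" for c
    using that by (intro generate_ring.incl) auto
  have "pt v \<one>\<^bsub>C\<^esub> \<in> ?G"
    using v
  proof induction
    case zero
    have "pt \<zero>\<^bsub>B\<^esub> \<one>\<^bsub>C\<^esub> = \<zero>\<^bsub>T\<^esub>" by simp
    then show ?case by (simp add: T.zero_in_generate)
  next
    case (step r s v)
    then obtain u where u: "u \<in> L" "s = word_eval B y u" by auto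
    have sc: "s \<in> carrier B" "v \<in> carrier B" using u wB step(3) sub by auto
    have rc: "r \<odot>\<^bsub>C\<^esub> \<one>\<^bsub>C\<^esub> \<in> carrier C" using step(1) by simp
    have "pt (r \<odot>\<^bsub>B\<^esub> s \<oplus>\<^bsub>B\<^esub> v) \<one>\<^bsub>C\<^esub> = pt (r \<odot>\<^bsub>B\<^esub> s) \<one>\<^bsub>C\<^esub> \<oplus>\<^bsub>T\<^esub> pt v \<one>\<^bsub>C\<^esub>"
      using sc step(1) by simp
    also have "pt (r \<odot>\<^bsub>B\<^esub> s) \<one>\<^bsub>C\<^esub> = pt \<one>\<^bsub>B\<^esub> (r \<odot>\<^bsub>C\<^esub> \<one>\<^bsub>C\<^esub>) \<otimes>\<^bsub>T\<^esub> pt s \<one>\<^bsub>C\<^esub>"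
      unfolding pt_balance[OF sc(1) step(1) C.one_closed] pt_split[OF sc(1) rc] ..
    finally show ?case
      using cG[OF rc] w[OF L[OF u(1)]] u(2) step(4) by (auto intro: generate_ring.eng_add generate_ring.eng_mult)
  qed
  moreover have "pt v c = pt \<one>\<^bsub>B\<^esub> c \<otimes>\<^bsub>T\<^esub> pt v \<one>\<^bsub>C\<^esub>"
    using pt_split[of v c] v sub c by auto
  ultimately show ?thesis using cG[OF c] by (auto intro: generate_ring.eng_mult)
qed

lemma (in tensor) T_generated:
  assumes y: "y ` J' \<subseteq> carrier B" and L: "\<And>w. w \<in> L \<Longrightarrow> set w \<subseteq> J'"
    and span: "lin_span D B (word_eval B y ` L) = carrier B"
  shows "generate_ring T ((\<lambda>c. pt \<one>\<^bsub>B\<^esub> c) ` carrier C \<union> (\<lambda>j. pt (y j) \<one>\<^bsub>C\<^esub>) ` J') = carrier T"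
    (is "?G = _")
proof
  interpret B: ring B using algB by (rule noncomm_algebra.axioms)
  interpret C: cring C by (rule crC)
  interpret T: ring T by (rule ring_T)
  show "?G \<subseteq> carrier T" by (rule T.generate_ring_incl) (use y in auto)
  show "carrier T \<subseteq> ?G"
  proof
    fix t assume "t \<in> carrier T"
    then show "t \<in> ?G"
    proof (induction rule: T_induct)
      case (pure b c)
      then show ?case using T_generate_mem[OF y L] span by simp
    next
      case (add s t)
      then show ?case by (intro generate_ring.eng_add)
    qed
  qed
qed

section \<open>Finite rings and their characteristic\<close>

lemma (in ring_hom_ring) hom_add_pow:
  "a \<in> carrier R \<Longrightarrow> h ([(k::nat)] \<cdot>\<^bsub>R\<^esub> a) = [k] \<cdot>\<^bsub>S\<^esub> h a"
proof (induction k)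
  case (Suc k)
  then show ?case by (simp add: R.add.nat_pow_Suc S.add.nat_pow_Suc)
qed simp

text \<open>The order of the additive group annihilates the unit. In a domain one of two factors of
  an annihilating number annihilates already, and splitting off prime factors descends to a
  prime.\<close>

lemma (in domain) finite_prime_char:
  assumes "finite (carrier R)"
  obtains p :: nat where "Factorial_Ring.prime p" "[p] \<cdot> \<one> = \<zero>"
proof -
  have "\<exists>p::nat. Factorial_Ring.prime p \<and> [p] \<cdot> \<one> = \<zero>" if "m > 0" "[m] \<cdot> \<one> = \<zero>" for m :: nat
    using that
  proof (induction m rule: less_induct)
    case (less m)
    have "m \<noteq> 1" using less.prems(2) by auto
    then obtain p where p: "Factorial_Ring.prime p" "p dvd m" by (rule prime_factor_nat[THEN exE]) blast
    then obtain k where k: "m = p * k" by auto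
    have "[p] \<cdot> \<one> \<otimes> [k] \<cdot> \<one> = [m] \<cdot> \<one>"
      unfolding k by (simp add: add_pow_ldistr add.nat_pow_pow mult.commute)
    then have "[p] \<cdot> \<one> = \<zero> \<or> [k] \<cdot> \<one> = \<zero>" using less.prems(2) by (intro integral) auto
    then show ?case
    proof
      assume "[k] \<cdot> \<one> = \<zero>"
      moreover have "k < m" "k > 0" using less.prems(1) p(1) k prime_gt_1_nat[OF p(1)] by auto
      ultimately show ?thesis using less.IH by blast
    qed (use p in blast)
  qed
  moreover have "[order (add_monoid R)] \<cdot> \<one> = \<zero>" using add.pow_order_eq_1[of \<one>] by simp
  moreover have "order (add_monoid R) > 0" using assms by (simp add: order_def card_gt_0_iff) auto
  ultimately show ?thesis using that by blast
qed

lemma (in ring) finite_noetherian: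
  assumes "finite (carrier R)" shows "noetherian_ring R"
proof (intro noetherian_ring.intro noetherian_ring_axioms.intro ring_axioms)
  fix I assume I: "ideal I R"
  have sub: "I \<subseteq> carrier R" by (rule additive_subgroup.a_subset[OF ideal.axioms(1)[OF I]])
  have "I = Idl I" using genideal_self[OF sub] genideal_minimal[OF I subset_refl] by blast
  then show "\<exists>A\<subseteq>carrier R. finite A \<and> I = Idl A" using sub assms finite_subset by blast
qed

section \<open>Degrees of the generators and commutation relations\<close>

lemma ore_degrees_stable: "j \<le> m \<Longrightarrow> m \<le> n \<Longrightarrow> ore_degrees K A x \<delta> n j = ore_degrees K A x \<delta> m j"
  by (induction n) (auto simp: le_Suc_eq)

lemma ore_degrees_ge_1: "j \<in> {1..n} \<Longrightarrow> ore_degrees K A x \<delta> n j \<ge> 1"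
proof (induction n)
  case (Suc n)
  then show ?case by (cases "j = Suc n") (auto intro!: Max_ge)
qed simp

text \<open>The degree of \<open>x k\<close> is a maximum that takes in exactly these derivatives,
  computed in the filtration of the previous stage. Later generators do not change the degrees of
  earlier ones, so the bound persists for the final degrees.\<close>

lemma ore_relation:
  assumes ore: "iterated_ore K A n x \<delta>" and k: "k \<in> {1..n}" and j: "j \<in> {1..<k}"
  shows "\<exists>u\<in>lin_span K A (word_eval A x ` {w. set w \<subseteq> {1..<k} \<and> sum_list (map (ore_degrees K A x \<delta> n) w) \<le> ore_degrees K A x \<delta> n k}).
    x k \<otimes>\<^bsub>A\<^esub> x j = x j \<otimes>\<^bsub>A\<^esub> x k \<oplus>\<^bsub>A\<^esub> u"
proof -
  have alg: "noncomm_algebra K A" using ore by (simp add: iterated_ore_def)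
  obtain m where m: "k = Suc m" "m < n" using k by (cases k) auto
  have km: "{1..<k} = {1..m}" using m by auto
  let ?d' = "ore_degrees K A x \<delta> m" and ?d = "ore_degrees K A x \<delta> n"
  have xm: "x ` {1..m} \<subseteq> carrier A" using iterated_ore_closed[OF ore] m by fastforce
  interpret w: word_algebra K A x ?d' "{1..m}" by (intro word_algebra.intro alg xm)
  have oe: "ore_extension K A (adjoin K A (x ` {1..<k})) (adjoin K A (x ` {1..k})) (x k) (\<delta> k)"
    using ore k unfolding iterated_ore_def by blast
  have xj: "x j \<in> adjoin K A (x ` {1..<k})" using j unfolding adjoin_def by (intro hull_inc) auto
  have der: "derivation K (A\<lparr>carrier := adjoin K A (x ` {1..<k})\<rparr>) (\<delta> k)"
    and rel: "x k \<otimes>\<^bsub>A\<^esub> x j = x j \<otimes>\<^bsub>A\<^esub> x k \<oplus>\<^bsub>A\<^esub> \<delta> k (x j)"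
    using oe xj unfolding ore_extension_def by blast+
  have "\<delta> k (x j) \<in> adjoin K A (x ` {1..<k})" using der xj unfolding derivation_def by auto
  then have "\<delta> k (x j) \<in> (\<Union>i. w.W i)" unfolding km w.W_union .
  \<comment> \<open>The derivative lies in some filtration step, so the least index in
    \<open>filtration_degree\<close> is attained.\<close>
  then have least: "\<delta> k (x j) \<in> w.W (filtration_degree w.W (\<delta> k (x j)))"
    unfolding filtration_degree_def by (elim UN_E) (rule LeastI)
  have "filtration_degree w.W (\<delta> k (x j)) \<le> ore_degrees K A x \<delta> (Suc m) (Suc m)"
    unfolding m(1) ore_degrees.simps fun_upd_same using j m by (intro Max_ge) auto
  also have "\<dots> = ?d k" using ore_degrees_stable[of "Suc m" "Suc m" n K A x \<delta>] m by simp
  finally have "\<delta> k (x j) \<in> w.W (?d k)" using least w.W_mono by blast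
  moreover have "w.W (?d k) \<subseteq> lin_span K A (word_eval A x ` {w. set w \<subseteq> {1..<k} \<and> sum_list (map ?d w) \<le> ?d k})"
    unfolding w.W_span
  proof (rule lin_span_mono[OF image_mono order_refl], clarify)
    fix v assume v: "set v \<subseteq> {1..m}" "sum_list (map ?d' v) \<le> ?d k"
    have eq: "map ?d' v = map ?d v"
      using v(1) ore_degrees_stable[of _ m n K A x \<delta>] m(2) by (intro map_cong) auto
    have "sum_list (map ?d v) \<le> ?d k" using v(2) by (simp only: eq)
    then show "set v \<subseteq> {1..<k} \<and> sum_list (map ?d v) \<le> ?d k" using v(1) km by simp
  qed
  ultimately show ?thesis using rel by blast
qed

text \<open>The correction has degree at most \<open>d k\<close>, and \<open>d j \<ge> 1\<close>
  puts this strictly below \<open>d k + d j\<close>. When the roles of the two indices are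
  exchanged, the commutator only changes its sign.\<close>

lemma (in word_algebra) swap_of_relation:
  assumes d: "\<And>j. j \<in> J \<Longrightarrow> d j \<ge> 1"
    and rel: "\<And>j k. j \<in> J \<Longrightarrow> k \<in> J \<Longrightarrow> j < k \<Longrightarrow> \<exists>u\<in>W (d k). x k \<otimes>\<^bsub>A\<^esub> x j = x j \<otimes>\<^bsub>A\<^esub> x k \<oplus>\<^bsub>A\<^esub> u"
    and jk: "j \<in> J" "k \<in> J"
  shows "x k \<otimes>\<^bsub>A\<^esub> x j \<ominus>\<^bsub>A\<^esub> x j \<otimes>\<^bsub>A\<^esub> x k \<in> Wlt (d k + d j)"
proof -
  interpret A: ring A using alg by (rule noncomm_algebra.axioms)
  have lt: "x k \<otimes>\<^bsub>A\<^esub> x j \<ominus>\<^bsub>A\<^esub> x j \<otimes>\<^bsub>A\<^esub> x k \<in> Wlt (d k + d j)"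
    if jk: "j \<in> J" "k \<in> J" and "j < k" for j k
  proof -
    obtain u where u: "u \<in> W (d k)" "x k \<otimes>\<^bsub>A\<^esub> x j = x j \<otimes>\<^bsub>A\<^esub> x k \<oplus>\<^bsub>A\<^esub> u" using rel[OF jk \<open>j < k\<close>] by blast
    have c: "x j \<in> carrier A" "x k \<in> carrier A" "u \<in> carrier A" using jk x u(1) W_E(1) by auto
    have "x k \<otimes>\<^bsub>A\<^esub> x j \<ominus>\<^bsub>A\<^esub> x j \<otimes>\<^bsub>A\<^esub> x k = u"
      unfolding u(2) using c A.a_comm[of "x j \<otimes>\<^bsub>A\<^esub> x k" u] by (simp add: A.minus_eq A.a_assoc A.r_neg)
    moreover have "W (d k) \<subseteq> Wlt (d k + d j)"
      using W_mono[of "d k" "d k + d j - 1"] Wlt_Suc[of "d k + d j - 1"] d[OF jk(1)] by simp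
    ultimately show ?thesis using u(1) by auto
  qed
  have c: "x j \<in> carrier A" "x k \<in> carrier A" using jk x by auto
  consider "j < k" | "j = k" | "k < j" by linarith
  then show ?thesis
  proof cases
    case 1
    then show ?thesis using lt jk by blast
  next
    case 2
    then show ?thesis using c Wlt_E(7) by (simp add: A.minus_eq A.r_neg)
  next
    case 3
    have "x k \<otimes>\<^bsub>A\<^esub> x j \<ominus>\<^bsub>A\<^esub> x j \<otimes>\<^bsub>A\<^esub> x k = \<ominus>\<^bsub>A\<^esub> (x j \<otimes>\<^bsub>A\<^esub> x k \<ominus>\<^bsub>A\<^esub> x k \<otimes>\<^bsub>A\<^esub> x j)"
      using c by (simp add: A.minus_eq A.minus_add A.a_comm)
    then show ?thesis using Wlt_E(3)[OF lt[OF jk(2,1) 3]] by (simp add: add.commute)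
  qed
qed

section \<open>Congeniality\<close>

text \<open>The derivations have disappeared: what remains is the independence of the ordered
  monomials and commutation relations with coefficients in \<open>D\<close>. The corrections involve
  earlier generators only, on which the tower over a finite field depends.\<close>

locale ore_order =
  fixes K :: "('k, 'm) ring_scheme" and A :: "('k, 'a, 'n) module_scheme"
    and n :: nat and x :: "nat \<Rightarrow> 'a" and d :: "nat \<Rightarrow> nat" and D :: "'k set"
  assumes field: "field K" and alg: "noncomm_algebra K A" and xA: "x ` {1..n} \<subseteq> carrier A"
    and gen: "adjoin K A (x ` {1..n}) = carrier A"
    and indep: "lin_indep K A (word_eval A x) (sorted_words {1..n})"
    and d: "\<And>j. j \<in> {1..n} \<Longrightarrow> d j \<ge> 1"
    and D: "subring D K"
    and rel: "\<And>k j. k \<in> {1..n} \<Longrightarrow> j \<in> {1..<k} \<Longrightarrow>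
      \<exists>u\<in>lin_span (K\<lparr>carrier := D\<rparr>) A (word_eval A x ` {w. set w \<subseteq> {1..<k} \<and> sum_list (map d w) \<le> d k}).
        x k \<otimes>\<^bsub>A\<^esub> x j = x j \<otimes>\<^bsub>A\<^esub> x k \<oplus>\<^bsub>A\<^esub> u"
begin

abbreviation "R \<equiv> K\<lparr>carrier := D\<rparr>"

lemma algR: "noncomm_algebra R A"
  using noncomm_algebra_restrict_scalars[OF alg subcring_carrier] field D subringE(1)[OF D]
  by (auto simp: field_def domain_def)

sublocale wK: word_algebra K A x d "{1..n}"
  by (intro word_algebra.intro alg xA)

sublocale wR: word_algebra R A x d "{1..n}"
  by (intro word_algebra.intro algR xA)

interpretation K: field K by (rule field)
interpretation A: ring A using alg by (rule noncomm_algebra.axioms)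
interpretation AK: noncomm_algebra K A by (rule alg)
interpretation AR: noncomm_algebra R A by (rule algR)

abbreviation "e \<equiv> word_eval A x"
abbreviation "I \<equiv> sorted_words {1..n}"
abbreviation "H \<equiv> adjoin R A (x ` {1..n})"
abbreviation "B \<equiv> A\<lparr>carrier := H\<rparr>"
abbreviation "F \<equiv> word_filtration K A x d {1..n}"
abbreviation "wdeg w \<equiv> sum_list (map d w)"

lemma DK: "D \<subseteq> carrier K" by (rule subringE(1)[OF D])

lemma relR:
  assumes "j \<in> {1..n}" "k \<in> {1..n}" "j < k"
  shows "\<exists>u\<in>wR.W (d k). x k \<otimes>\<^bsub>A\<^esub> x j = x j \<otimes>\<^bsub>A\<^esub> x k \<oplus>\<^bsub>A\<^esub> u"
proof -
  have "j \<in> {1..<k}" using assms by auto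
  then obtain u where u: "u \<in> lin_span R A (e ` {w. set w \<subseteq> {1..<k} \<and> wdeg w \<le> d k})"
    "x k \<otimes>\<^bsub>A\<^esub> x j = x j \<otimes>\<^bsub>A\<^esub> x k \<oplus>\<^bsub>A\<^esub> u" using rel[OF assms(2)] by blast
  have "lin_span R A (e ` {w. set w \<subseteq> {1..<k} \<and> wdeg w \<le> d k}) \<subseteq> wR.W (d k)"
    unfolding wR.W_span using assms(2) by (intro lin_span_mono image_mono order_refl) auto
  then show ?thesis using u by blast
qed

lemma WR_WK: "wR.W i \<subseteq> wK.W i"
  unfolding wR.W_span wK.W_span using DK by (intro lin_span_mono) auto

lemma swapR: "j \<in> {1..n} \<Longrightarrow> k \<in> {1..n} \<Longrightarrow> x k \<otimes>\<^bsub>A\<^esub> x j \<ominus>\<^bsub>A\<^esub> x j \<otimes>\<^bsub>A\<^esub> x k \<in> wR.Wlt (d k + d j)"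
  by (rule wR.swap_of_relation[OF d relR])

lemma swapK: "j \<in> {1..n} \<Longrightarrow> k \<in> {1..n} \<Longrightarrow> x k \<otimes>\<^bsub>A\<^esub> x j \<ominus>\<^bsub>A\<^esub> x j \<otimes>\<^bsub>A\<^esub> x k \<in> wK.Wlt (d k + d j)"
proof (rule wK.swap_of_relation[OF d])
  show "\<exists>u\<in>wK.W (d k). x k \<otimes>\<^bsub>A\<^esub> x j = x j \<otimes>\<^bsub>A\<^esub> x k \<oplus>\<^bsub>A\<^esub> u"
    if "j \<in> {1..n}" "k \<in> {1..n}" "j < k" for j k
    using relR[OF that] WR_WK by blast
qed

lemma F_sorted: "F i = lin_span K A (e ` {w \<in> I. wdeg w \<le> i})"
  by (rule wK.W_sorted[OF swapK])

lemma A_sorted: "lin_span K A (e ` I) = carrier A"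
  using wK.H_sorted[OF swapK] gen by simp

lemma WR_sorted: "wR.W i = lin_span R A (e ` {w \<in> I. wdeg w \<le> i})"
  by (rule wR.W_sorted[OF swapR])

lemma H_sorted: "lin_span R A (e ` I) = H"
  using wR.H_sorted[OF swapR] by simp

lemma subH: "subring H A" using wR.H_subalgebra by (simp add: unital_subalgebra_def)

lemma eA: "\<forall>w\<in>I. e w \<in> carrier A" by (auto simp: sorted_words_def simp del: One_nat_def)

lemma eH: "w \<in> I \<Longrightarrow> e w \<in> H" by (auto simp: sorted_words_def simp del: One_nat_def intro: wR.e_H)

lemma one_neq_zero: "\<one>\<^bsub>K\<^esub> \<noteq> \<zero>\<^bsub>K\<^esub>" by (rule K.one_not_zero)

lemma orderA: "is_order K A D H"
  by (rule is_orderI[OF alg one_neq_zero D eA indep A_sorted subH H_sorted])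

text \<open>An element of the intersection has an expansion over \<open>K\<close> by monomials of
  degree at most \<open>i\<close>, and one with coefficients in \<open>D\<close>. Independence over
  \<open>K\<close> identifies them, so a single expansion has both properties.\<close>

lemma F_H: "F i \<inter> H = wR.W i"
proof
  show "wR.W i \<subseteq> F i \<inter> H" using WR_WK wR.W_union by blast
  show "F i \<inter> H \<subseteq> wR.W i"
  proof
    fix v assume v: "v \<in> F i \<inter> H"
    let ?Ii = "{w \<in> I. wdeg w \<le> i}"
    have eI: "\<forall>w\<in>?Ii. e w \<in> carrier A" using eA by auto
    have "v \<in> lincomb K A e ` fin_supp K ?Ii"
      using v F_sorted[of i] AK.lin_span_eq_lincomb[OF eI] by simp
    then obtain c where c: "v = lincomb K A e c" "c \<in> fin_supp K ?Ii" by (rule imageE)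
    have "v \<in> lincomb R A e ` fin_supp R I"
      using v H_sorted AR.lin_span_eq_lincomb[OF eA] by simp
    then obtain c' where c': "v = lincomb R A e c'" "c' \<in> fin_supp R I" by (rule imageE)
    have "lincomb R A e c' = lincomb K A e c'" by (simp add: lincomb_def)
    then have eq: "lincomb K A e c = lincomb K A e c'" using c(1) c'(1) by simp
    have "c \<in> fin_supp K I" using c(2) by (auto simp: fin_supp_def)
    moreover have "c' \<in> fin_supp K I" using c'(2) DK by (auto simp: fin_supp_def)
    ultimately have cc: "c = c'" by (rule AK.lin_indep_inj[OF eA indep _ _ eq])
    have "c' \<in> fin_supp R ?Ii" using c(2) c'(2) unfolding cc by (auto simp: fin_supp_def)
    then have "v \<in> lin_span R A (e ` ?Ii)"
      unfolding c'(1) AR.lin_span_eq_lincomb[OF eI] by (rule imageI)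
    then show "v \<in> wR.W i" using WR_sorted by simp
  qed
qed

sublocale fA: filtered K A F
  by (rule filtered.intro[OF alg wK.W_filtration[OF gen]])

sublocale fs: filtered_sub K A F D H
  by (rule filtered_sub.intro[OF fA.filtered_axioms D wR.H_subalgebra])

sublocale fB: filtered R B "\<lambda>i. F i \<inter> H"
  by (rule fs.filtB)

lemma lin_span_B: "lin_span R B S = lin_span R A S"
  by (rule lin_span_cong) simp_all

lemma FD_sorted: "F i \<inter> H = lin_span R B (e ` {w \<in> I. wdeg w \<le> i})"
  unfolding F_H WR_sorted lin_span_B ..

lemma eB: "\<forall>w\<in>I. e w \<in> carrier B" using eH by simp

lemma finite_I: "finite {w \<in> I. wdeg w \<le> i}"
  by (rule finite_subset[OF _ finite_words_bounded[of "{1..n}" d i]])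
    (use d in \<open>auto simp: sorted_words_def\<close>)

lemma loc_finite_A: "loc_finite_filtered K A F"
  unfolding loc_finite_filtered_def
proof (intro conjI allI alg fA.filt)
  fix i
  have S: "e ` {w \<in> I. wdeg w \<le> i} \<subseteq> carrier A" using eA by auto
  show "fin_gen_submodule (F i) K A"
    unfolding fin_gen_submodule_def F_sorted
    using AK.lin_span_submodule[OF S] AK.lin_span_eq_hull[OF S] AK.lin_span_incl[OF S] finite_I
    by (intro conjI exI[of _ "e ` {w \<in> I. wdeg w \<le> i}"]) auto
qed

lemma loc_finite_B: "loc_finite_filtered R B (\<lambda>i. F i \<inter> H)"
  unfolding loc_finite_filtered_def
proof (intro conjI allI fB.alg fB.filt)
  fix i
  interpret BR: noncomm_algebra R B by (rule fB.alg)
  have S: "e ` {w \<in> I. wdeg w \<le> i} \<subseteq> carrier B" using eB by auto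
  show "fin_gen_submodule (F i \<inter> H) R B"
    unfolding fin_gen_submodule_def FD_sorted
    using BR.lin_span_submodule[OF S] BR.lin_span_eq_hull[OF S] BR.lin_span_incl[OF S] finite_I
    by (intro conjI exI[of _ "e ` {w \<in> I. wdeg w \<le> i}"]) auto
qed

abbreviation "symA \<equiv> fA.symb e wdeg"
abbreviation "symB \<equiv> fB.symb e wdeg"

lemma grB_span: "lin_span R fB.gr (symB ` I) = carrier fB.gr"
  by (rule fB.gr_span[OF eB FD_sorted])

text \<open>This is \<open>is_orderI\<close> for the symbols: those of the small graded ring are
  sent to those of the large one, so the image of the small ring is the \<open>D\<close>-span of the
  latter.\<close>

lemma order_gr: "is_order K fA.gr D (graded_incl A F ` carrier fB.gr)"
proof (rule is_orderI[OF fA.noncomm_algebra_gr one_neq_zero D])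
  interpret h: ring_hom_ring fB.gr fA.gr "graded_incl A F" by (rule fs.incl_hom)
  interpret GB: noncomm_algebra R fB.gr by (rule fB.noncomm_algebra_gr)
  show "\<forall>w\<in>I. symA w \<in> carrier fA.gr" by (rule fA.symb_closed[OF eA F_sorted])
  show "lin_indep K fA.gr symA I" by (rule fA.gr_indep[OF eA F_sorted indep])
  show "lin_span K fA.gr (symA ` I) = carrier fA.gr" by (rule fA.gr_span[OF eA F_sorted])
  show "subring (graded_incl A F ` carrier fB.gr) fA.gr" by (rule fs.incl_subring)
  have sc: "symB w \<in> carrier fB.gr" if "w \<in> I" for w
    using fB.symb_closed[OF eB FD_sorted] that by blast
  have "symA w = graded_incl A F (symB w)" if "w \<in> I" for w
    using fs.incl_symb[of e w wdeg] fA.e_F[OF eA F_sorted that, of "wdeg w"] eH[OF that] by simp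
  then have im: "symA ` I = graded_incl A F ` (symB ` I)" by (simp add: image_image)
  have "graded_incl A F ` lin_span R fB.gr (symB ` I) = lin_span R fA.gr (graded_incl A F ` (symB ` I))"
  proof (rule lin_span_image)
    show "graded_incl A F \<zero>\<^bsub>fB.gr\<^esub> = \<zero>\<^bsub>fA.gr\<^esub>" by (rule h.hom_zero)
    fix r s v assume r: "r \<in> carrier R" and s: "s \<in> symB ` I" and v: "v \<in> lin_span R fB.gr (symB ` I)"
    have c: "s \<in> carrier fB.gr" "v \<in> carrier fB.gr" using s v sc grB_span by auto
    then show "graded_incl A F (r \<odot>\<^bsub>fB.gr\<^esub> s \<oplus>\<^bsub>fB.gr\<^esub> v) =
      r \<odot>\<^bsub>fA.gr\<^esub> graded_incl A F s \<oplus>\<^bsub>fA.gr\<^esub> graded_incl A F v"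
      using h.hom_add[OF GB.smult_closed[OF r c(1)] c(2)] fs.incl_smult[of r s] r by simp
  qed
  then show "lin_span R fA.gr (symA ` I) = graded_incl A F ` carrier fB.gr"
    unfolding grB_span im by simp
qed

lemma graded_components: "fin_gen_submodule (graded_component fB.gr i) R fB.gr"
proof (rule fB.graded_component_fin_gen[OF eB FD_sorted])
  show "finite {w \<in> I. wdeg w = i}"
    by (rule finite_subset[OF _ finite_I[of i]]) auto
qed

lemma symB_words: "set w \<subseteq> {1..n} \<Longrightarrow> word_eval fB.gr (\<lambda>j. symB [j]) w = symB w"
proof (induction w)
  case Nil
  have "fB.single 0 \<one>\<^bsub>A\<^esub> = (\<lambda>i. if i = 0 then \<one>\<^bsub>B\<^esub> else \<zero>\<^bsub>B\<^esub>)"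
    unfolding fB.single_def by (simp cong: if_cong)
  then have "fB.cls (fB.single 0 \<one>\<^bsub>A\<^esub>) = \<one>\<^bsub>fB.gr\<^esub>"
    by (rule trans[OF arg_cong[of _ _ fB.cls] fB.cls_one])
  then show ?case by (simp add: fB.symb_def del: One_nat_def)
next
  case (Cons j w)
  have F: "e v \<in> F (wdeg v) \<inter> H" if "set v \<subseteq> {1..n}" for v
    using wR.e_W[OF that, of "wdeg v"] unfolding F_H by simp
  have xj: "x j \<in> carrier A" using Cons.prems xA by auto
  have "symB [j] \<otimes>\<^bsub>fB.gr\<^esub> symB w = symB (j # w)"
    using fB.single_mult[of "e [j]" "wdeg [j]" "e w" "wdeg w"] F[of "[j]"] F[of w] Cons.prems xj
    by (simp add: fB.symb_def del: One_nat_def)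
  then show ?case using Cons by (simp del: One_nat_def)
qed

text \<open>The commutator lies one filtration step below the product, so both orders of
  multiplication have the same class in degree \<open>d k + d j\<close>.\<close>

lemma symB_comm:
  assumes "j \<in> {1..n}" "k \<in> {1..n}"
  shows "symB [k] \<otimes>\<^bsub>fB.gr\<^esub> symB [j] = symB [j] \<otimes>\<^bsub>fB.gr\<^esub> symB [k]"
proof -
  have xc: "x j \<in> carrier A" "x k \<in> carrier A" using assms xA by auto
  have F: "x i \<in> F (d i) \<inter> H" if "i \<in> {1..n}" for i
  proof -
    have "x i \<in> carrier A" using that xA by blast
    then show ?thesis using wR.e_W[of "[i]" "d i"] that unfolding F_H by (simp del: One_nat_def)
  qed
  have m: "symB [i] \<otimes>\<^bsub>fB.gr\<^esub> symB [l] = fB.cls (fB.single (d i + d l) (x i \<otimes>\<^bsub>A\<^esub> x l))"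
    if "i \<in> {1..n}" "l \<in> {1..n}" for i l
  proof -
    have "x i \<in> carrier A" "x l \<in> carrier A" using that xA by blast+
    then show ?thesis using fB.single_mult[OF F[OF that(1)] F[OF that(2)]]
      by (simp add: fB.symb_def del: One_nat_def)
  qed
  have FF: "x i \<otimes>\<^bsub>A\<^esub> x l \<in> F (d i + d l) \<inter> H" if "i \<in> {1..n}" "l \<in> {1..n}" for i l
    using fB.F_mult[OF F[OF that(1)] F[OF that(2)]] by simp
  have r: "fB.single (d k + d j) (x k \<otimes>\<^bsub>A\<^esub> x j) \<in> fB.reps" "fB.single (d k + d j) (x j \<otimes>\<^bsub>A\<^esub> x k) \<in> fB.reps"
    using FF[OF assms(2,1)] FF[OF assms] by (auto intro!: fB.single_reps simp: add.commute simp del: One_nat_def)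
  have "x k \<otimes>\<^bsub>A\<^esub> x j \<ominus>\<^bsub>A\<^esub> x j \<otimes>\<^bsub>A\<^esub> x k \<in> fB.P (d k + d j)"
  proof -
    \<comment> \<open>\<open>filt_pred\<close> gives the preceding step only at a successor;
      positivity of the degrees exhibits one.\<close>
    have dp: "d k + d j = Suc (d k + d j - 1)" using d[OF assms(1)] by simp
    have "x k \<otimes>\<^bsub>A\<^esub> x j \<ominus>\<^bsub>A\<^esub> x j \<otimes>\<^bsub>A\<^esub> x k \<in> wR.W (d k + d j - 1)"
      using swapR[OF assms] dp wR.Wlt_Suc[of "d k + d j - 1"] by simp
    moreover have "fB.P (Suc i) = wR.W i" for i using F_H by (simp add: filt_pred_def del: One_nat_def)
    ultimately show ?thesis by (subst dp) (simp del: One_nat_def)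
  qed
  moreover have "x k \<otimes>\<^bsub>A\<^esub> x j \<ominus>\<^bsub>B\<^esub> x j \<otimes>\<^bsub>A\<^esub> x k = x k \<otimes>\<^bsub>A\<^esub> x j \<ominus>\<^bsub>A\<^esub> x j \<otimes>\<^bsub>A\<^esub> x k"
    using fs.minus_H[of "x j \<otimes>\<^bsub>A\<^esub> x k"] FF[OF assms] by (simp add: a_minus_def)
  moreover have "\<zero>\<^bsub>A\<^esub> \<ominus>\<^bsub>B\<^esub> \<zero>\<^bsub>A\<^esub> = \<zero>\<^bsub>A\<^esub>"
    using fs.minus_H[OF subringE(2)[OF subH]] by (simp add: a_minus_def)
  ultimately have "fB.cls (fB.single (d k + d j) (x k \<otimes>\<^bsub>A\<^esub> x j)) = fB.cls (fB.single (d k + d j) (x j \<otimes>\<^bsub>A\<^esub> x k))"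
    unfolding fB.cls_eq_iff[OF r] unfolding fB.single_def using fB.P_E(7) by (simp del: One_nat_def)
  then show ?thesis using m[OF assms(2,1)] m[OF assms] by (simp add: add.commute)
qed

text \<open>The symbol of a word is the product of the symbols of its letters. Hence the module
  basis of symbols consists of words in the symbols of the generators, and these become ring
  generators, over the image of \<open>C\<close>, of every base change.\<close>

lemma strongly_noetherian_gr: "strongly_noetherian U R fB.gr"
  unfolding strongly_noetherian_def
proof (intro allI impI, elim conjE)
  fix C :: "('k, 'c) module"
  assume C: "algebra R C" "noetherian_ring C"
  interpret C: algebra R C by (rule C(1))
  have crC: "cring C" by (rule C.M_cring)
  have algC: "noncomm_algebra R C"
  proof (intro noncomm_algebra.intro noncomm_algebra_axioms.intro C.module)
    show "ring C" using crC by (rule cring.axioms)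
    show "(a \<odot>\<^bsub>C\<^esub> u) \<otimes>\<^bsub>C\<^esub> v = a \<odot>\<^bsub>C\<^esub> (u \<otimes>\<^bsub>C\<^esub> v)" if "a \<in> carrier R" "u \<in> carrier C" "v \<in> carrier C" for a u v
      by (rule C.smult_assoc2[OF that])
    show "u \<otimes>\<^bsub>C\<^esub> (a \<odot>\<^bsub>C\<^esub> v) = a \<odot>\<^bsub>C\<^esub> (u \<otimes>\<^bsub>C\<^esub> v)" if "a \<in> carrier R" "u \<in> carrier C" "v \<in> carrier C" for a u v
      using C.smult_assoc2[OF that(1,3,2)] cring.cring_simprules(14)[OF crC that(2)]
        cring.cring_simprules(14)[OF crC that(2,3)] C.smult_closed[OF that(1,3)] by simp
  qed
  interpret t: tensor R fB.gr C by (intro tensor.intro fB.noncomm_algebra_gr algC crC)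
  interpret T: ring t.T by (rule t.ring_T)
  interpret G: ring fB.gr by (rule fB.ring_gr)
  let ?y = "\<lambda>j. symB [j]"
  have yG: "?y ` {1..n} \<subseteq> carrier fB.gr"
    using fB.symb_closed[OF eB FD_sorted] by (auto simp: sorted_words_def)
  have words: "word_eval fB.gr ?y ` I = symB ` I"
    using symB_words by (auto simp: sorted_words_def simp del: One_nat_def intro!: image_cong)
  let ?Z0 = "(\<lambda>c. t.pt \<one>\<^bsub>fB.gr\<^esub> c) ` carrier C" and ?E = "(\<lambda>j. t.pt (?y j) \<one>\<^bsub>C\<^esub>) ` {1..n}"
  have gen: "generate_ring t.T (?Z0 \<union> ?E) = carrier t.T"
    by (rule t.T_generated[OF yG, of I]) (use words grB_span in \<open>auto simp: sorted_words_def simp del: One_nat_def\<close>)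
  note Z0 = T.noetherian_image[OF t.inr_hom C(2) crC]
  have Ec: "?E \<subseteq> carrier t.T"
  proof (rule image_subsetI)
    fix j assume "j \<in> {1..n}"
    then have "?y j \<in> carrier fB.gr" using yG by blast
    then show "t.pt (?y j) \<one>\<^bsub>C\<^esub> \<in> carrier t.T"
      using cring.cring_simprules(6)[OF crC] by (rule t.pt_closed)
  qed
  have comm: "u \<otimes>\<^bsub>t.T\<^esub> v = v \<otimes>\<^bsub>t.T\<^esub> u" if u: "u \<in> ?E" and v: "v \<in> ?Z0 \<union> ?E" for u v
    using v
  proof
    assume "v \<in> ?Z0"
    then show ?thesis using t.inr_central[OF _ subsetD[OF Ec u]] by auto
  next
    assume "v \<in> ?E"
    then obtain j k where jk: "j \<in> {1..n}" "k \<in> {1..n}" "u = t.pt (?y j) \<one>\<^bsub>C\<^esub>" "v = t.pt (?y k) \<one>\<^bsub>C\<^esub>"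
      using u by blast
    then have "?y j \<in> carrier fB.gr" "?y k \<in> carrier fB.gr" using yG by blast+
    then show ?thesis unfolding jk(3,4) using symB_comm[OF jk(1,2)] cring.cring_simprules(6)[OF crC] by (simp add: t.pt_mult del: One_nat_def)
  qed
  have Z: "subcring (carrier t.T) t.T" "noetherian_ring (t.T\<lparr>carrier := carrier t.T\<rparr>)"
    using T.noetherian_generate_finite[OF Z0 _ Ec comm] unfolding gen by auto
  \<comment> \<open>A commutative ring is spanned over itself by the unit; so the criterion for
    rings finite over a centre converts noetherianity for ideals into the one-sided notion.\<close>
  have "v \<in> T.zspan (carrier t.T) {\<one>\<^bsub>t.T\<^esub>}" if "v \<in> carrier t.T" for v
  proof -
    have "v \<otimes>\<^bsub>t.T\<^esub> \<one>\<^bsub>t.T\<^esub> \<in> T.zspan (carrier t.T) {\<one>\<^bsub>t.T\<^esub>}"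
      using T.zspan_mult_incl[OF Z(1) _ _ that, of "{\<one>\<^bsub>t.T\<^esub>}" "\<one>\<^bsub>t.T\<^esub>"]
      by (simp del: One_nat_def)
    then show ?thesis unfolding T.r_one[OF that] .
  qed
  then show "noetherian t.T"
    using T.zsubD(1)[OF Z(1) T.zspan_zsub[OF Z(1), of "{\<one>\<^bsub>t.T\<^esub>}"]] T.one_closed
    by (intro T.noetherian_finite_over_center[OF Z, of "{\<one>\<^bsub>t.T\<^esub>}"] subcringE(8)[OF Z(1)]) auto
qed

declare One_nat_def [simp del]

text \<open>The finite field enters through a homomorphism \<open>\<phi>\<close> from
  \<open>D\<close>, later the quotient map. What the tower theorem uses of the fibre is its list of
  generators and the location of their commutators, and both can be read off in the tensor
  product.\<close>

lemma finite_field_fibre: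
  assumes Q: "field Q" "finite (carrier Q)" and h: "\<phi> \<in> ring_hom R Q"
  defines "T \<equiv> base_change R B (scalars_via \<phi> Q)"
  shows "affine_algebra Q T \<and> noetherian T \<and> PI_algebra Q T"
proof -
  interpret Q: field Q by (rule Q(1))
  let ?C = "scalars_via \<phi> Q"
  have crQ: "cring Q" by (rule Q.cring_axioms)
  have algC: "noncomm_algebra R ?C" by (rule scalars_via_algebra[OF AR.R.cring_axioms crQ h])
  have crC: "cring ?C" by (rule scalars_via_cring[OF crQ])
  interpret C: cring ?C by (rule crC)
  interpret t: tensor R B ?C by (intro tensor.intro fB.alg algC crC)
  interpret T: ring t.T by (rule t.ring_T)
  have algT: "noncomm_algebra Q t.T"
    by (rule noncomm_algebra_restrict_scalars[OF t.noncomm_algebra_T crQ]) simp_all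
  interpret TQ: noncomm_algebra Q t.T by (rule algT)
  have xB: "x ` {1..n} \<subseteq> carrier B" using wR.e_H[of "[_]"] xA by fastforce
  have eB': "word_eval B x w = e w" for w by (induction w) auto
  have eBf: "word_eval B x = e" by (rule ext) (rule eB')
  define y where "y j = t.pt (x j) \<one>\<^bsub>Q\<^esub>" for j
  let ?Z0 = "(\<lambda>c. t.pt \<one>\<^bsub>B\<^esub> c) ` carrier ?C"
  have yT: "y ` {1..n} \<subseteq> carrier t.T" using xB by (auto simp: y_def)
  have gen: "generate_ring t.T (?Z0 \<union> y ` {1..n}) = carrier t.T"
    using t.T_generated[OF xB, of I] H_sorted unfolding eBf lin_span_B y_def
    by (simp add: sorted_words_def)
  have mem: "t.pt v \<one>\<^bsub>Q\<^esub> \<in> generate_ring t.T (?Z0 \<union> y ` J')"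
    if "J' \<subseteq> {1..n}" "v \<in> lin_span R A (e ` L)" "\<And>w. w \<in> L \<Longrightarrow> set w \<subseteq> J'" for J' v L
  proof -
    have "x ` J' \<subseteq> carrier B" using that(1) xB by blast
    then show ?thesis
      using t.T_generate_mem[of x J' L v "\<one>\<^bsub>Q\<^esub>"] that unfolding eBf lin_span_B y_def by simp
  qed
  \<comment> \<open>The bottom of the tower is the image of the finite field.\<close>
  have "noetherian_ring ?C" by (rule C.finite_noetherian) (simp add: Q(2))
  note Z0 = T.noetherian_image[OF t.inr_hom this crC]
  obtain p where p: "Factorial_Ring.prime (p::nat)" "[p] \<cdot>\<^bsub>Q\<^esub> \<one>\<^bsub>Q\<^esub> = \<zero>\<^bsub>Q\<^esub>"
    using Q.finite_prime_char[OF Q(2)] by blast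
  have char: "[p] \<cdot>\<^bsub>t.T\<^esub> \<one>\<^bsub>t.T\<^esub> = \<zero>\<^bsub>t.T\<^esub>"
  proof -
    interpret r: ring_hom_ring ?C t.T "\<lambda>c. t.pt \<one>\<^bsub>B\<^esub> c" by (rule t.inr_hom)
    have "[p] \<cdot>\<^bsub>?C\<^esub> \<one>\<^bsub>?C\<^esub> = \<zero>\<^bsub>?C\<^esub>" using p(2) by (simp add: add_pow_def nat_pow_def)
    then show ?thesis using r.hom_add_pow[OF C.one_closed, of p] r.hom_zero r.hom_one by simp
  qed
  \<comment> \<open>The relation survives base change because its coefficients lie in
    \<open>D\<close>: the correction \<open>u\<close> is a \<open>D\<close>-combination of words in
    the earlier generators, so its image lies in the subring they generate over the image of the
    field.\<close>
  have adx: "T.ad (y (Suc k)) (y j) \<in> generate_ring t.T (?Z0 \<union> y ` {1..k})"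
    if k: "k < n" and j: "j \<in> {1..k}" for k j
  proof -
    have "Suc k \<in> {1..n}" "j \<in> {1..<Suc k}" using k j by auto
    then obtain u where u: "u \<in> lin_span R A (e ` {w. set w \<subseteq> {1..<Suc k} \<and> wdeg w \<le> d (Suc k)})"
      "x (Suc k) \<otimes>\<^bsub>A\<^esub> x j = x j \<otimes>\<^bsub>A\<^esub> x (Suc k) \<oplus>\<^bsub>A\<^esub> u" using rel by blast
    have kk: "{1..<Suc k} = {1..k}" by auto
    have "lin_span R A (e ` {w. set w \<subseteq> {1..<Suc k} \<and> wdeg w \<le> d (Suc k)}) \<subseteq> wR.W (d (Suc k))"
      unfolding wR.W_span using k by (intro lin_span_mono image_mono order_refl) auto
    then have "u \<in> H" using u(1) F_H by blast
    then have uH: "u \<in> carrier B" by simp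
    have xc: "x (Suc k) \<in> carrier B" "x j \<in> carrier B" using xB k j by auto
    have yc: "y (Suc k) \<in> carrier t.T" "y j \<in> carrier t.T" using yT k j by auto
    have oneC: "\<one>\<^bsub>Q\<^esub> \<in> carrier ?C" by simp
    have xx: "x j \<otimes>\<^bsub>B\<^esub> x (Suc k) \<in> carrier B" using xc subringE(6)[OF subH] by simp
    have "y (Suc k) \<otimes>\<^bsub>t.T\<^esub> y j = t.pt (x j \<otimes>\<^bsub>B\<^esub> x (Suc k) \<oplus>\<^bsub>B\<^esub> u) \<one>\<^bsub>Q\<^esub>"
      unfolding y_def using xc u(2) by (simp add: t.pt_mult)
    also have "\<dots> = y j \<otimes>\<^bsub>t.T\<^esub> y (Suc k) \<oplus>\<^bsub>t.T\<^esub> t.pt u \<one>\<^bsub>Q\<^esub>"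
      unfolding y_def t.pt_add_left[OF xx uH oneC] using xc by (simp add: t.pt_mult)
    finally have "T.ad (y (Suc k)) (y j) = t.pt u \<one>\<^bsub>Q\<^esub>"
      by (rule T.ad_eqI[OF yc t.pt_closed[OF uH oneC]])
    moreover have "t.pt u \<one>\<^bsub>Q\<^esub> \<in> generate_ring t.T (?Z0 \<union> y ` {1..k})"
      by (rule mem[OF _ u(1)]) (use k kk in auto)
    ultimately show ?thesis by (simp only:)
  qed
  have central: "z \<otimes>\<^bsub>t.T\<^esub> a = a \<otimes>\<^bsub>t.T\<^esub> z" if z: "z \<in> ?Z0" and a: "a \<in> carrier t.T" for z a
      proof -
    obtain c where c: "z = t.pt \<one>\<^bsub>B\<^esub> c" "c \<in> carrier ?C" using z by (rule imageE)
    show ?thesis unfolding c(1) by (rule t.inr_central[OF c(2) a])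
  qed
  obtain Z B' where Z: "subcring Z t.T" "noetherian_ring (t.T\<lparr>carrier := Z\<rparr>)"
    "\<And>z a. z \<in> Z \<Longrightarrow> a \<in> carrier t.T \<Longrightarrow> z \<otimes>\<^bsub>t.T\<^esub> a = a \<otimes>\<^bsub>t.T\<^esub> z"
    "finite B'" "B' \<subseteq> carrier t.T" "carrier t.T = T.zspan Z B'"
  proof (rule T.finite_over_center_tower[OF p(1) char Z0 central yT adx gen])
    fix Z B'
    assume "subcring Z t.T" "noetherian_ring (t.T\<lparr>carrier := Z\<rparr>)"
      "\<And>z a. z \<in> Z \<Longrightarrow> a \<in> carrier t.T \<Longrightarrow> z \<otimes>\<^bsub>t.T\<^esub> a = a \<otimes>\<^bsub>t.T\<^esub> z"
      "finite B'" "B' \<subseteq> carrier t.T" "carrier t.T = T.zspan Z B'"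
    then show thesis by (rule that)
  qed
  have "noetherian t.T" by (rule T.noetherian_finite_over_center[OF Z])
  moreover have "PI_algebra Q t.T"
    by (rule PI_finite_over_center[OF algT Q.one_not_zero Z(1,3-6)])
  moreover have "affine_algebra Q t.T"
    unfolding affine_algebra_def
  proof (intro conjI algT exI[of _ "y ` {1..n}"])
    interpret wT: word_algebra Q t.T y "\<lambda>_. 0" "{1..n}" by (intro word_algebra.intro algT yT)
    show "adjoin Q t.T (y ` {1..n}) = carrier t.T"
    proof
      show "wT.H \<subseteq> carrier t.T" using wT.H_subalgebra subringE(1) by (auto simp: unital_subalgebra_def)
      have sub: "subring wT.H t.T" using wT.H_subalgebra by (simp add: unital_subalgebra_def)
      \<comment> \<open>The image of the field consists of scalar multiples of the unit, so it
        belongs to every subalgebra over the field.\<close>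
      have "z \<in> wT.H" if z: "z \<in> ?Z0" for z
      proof -
        obtain c where c: "c \<in> carrier Q" "z = t.pt \<one>\<^bsub>B\<^esub> c" using z by auto
        then have "z = c \<odot>\<^bsub>t.T\<^esub> \<one>\<^bsub>t.T\<^esub>" using t.pt_closed[of "\<one>\<^bsub>B\<^esub>" c] subringE(3)[OF subH] by (simp add: t.T_simps(6))
        then show ?thesis using wT.H_subalgebra subringE(3)[OF sub] c(1) by (auto simp: unital_subalgebra_def)
      qed
      then have "?Z0 \<subseteq> wT.H" by (rule subsetI)
      moreover have "y ` {1..n} \<subseteq> wT.H" unfolding adjoin_def by (rule hull_subset)
      ultimately have yH: "?Z0 \<union> y ` {1..n} \<subseteq> wT.H" by (rule Un_least)
      have "?Z0 \<union> y ` {1..n} \<subseteq> carrier t.T"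
        using yT t.pt_closed[of "\<one>\<^bsub>B\<^esub>"] subringE(3)[OF subH] by auto
      then have "generate_ring t.T (?Z0 \<union> y ` {1..n}) \<subseteq> wT.H"
        by (rule T.generate_ring_min_subring1[OF _ sub yH])
      then show "carrier t.T \<subseteq> wT.H" by (simp only: gen)
    qed
  qed (use yT in auto)
  ultimately show ?thesis unfolding T_def by (intro conjI)
qed

end

theorem theorem12:
  fixes K :: "'k ring" and A :: "('k, 'a) module"
    and n :: nat and x :: "nat \<Rightarrow> 'a" and \<delta> :: "nat \<Rightarrow> 'a \<Rightarrow> 'a"
  assumes "algebraically_closed K"
    and "\<And>m::nat. m > 0 \<Longrightarrow> [m] \<cdot>\<^bsub>K\<^esub> \<one>\<^bsub>K\<^esub> \<noteq> \<zero>\<^bsub>K\<^esub>"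
    and "n \<ge> 1"
    and "iterated_ore K A n x \<delta>"
  shows "congenial TYPE('c) K A (ore_filtration K A n x \<delta>)"
proof -
  interpret K: algebraically_closed K by fact
  note ore = assms(4)
  let ?d = "ore_degrees K A x \<delta> n" and ?e = "word_eval A x"
  let ?L = "\<lambda>k. ?e ` {w. set w \<subseteq> {1..<k} \<and> sum_list (map ?d w) \<le> ?d k}"
  have alg: "noncomm_algebra K A" using ore by (simp add: iterated_ore_def)
  \<comment> \<open>\<open>E\<close> contains the coefficients of one relation. Validity is demanded
    over every set containing \<open>E\<close>, so that the union over all pairs of indices serves
    all relations at once.\<close>
  define P where "P k j E \<longleftrightarrow> finite E \<and> E \<subseteq> carrier K \<and> (\<forall>D. E \<subseteq> D \<longrightarrow>
      (\<exists>u\<in>lin_span (K\<lparr>carrier := D\<rparr>) A (?L k). x k \<otimes>\<^bsub>A\<^esub> x j = x j \<otimes>\<^bsub>A\<^esub> x k \<oplus>\<^bsub>A\<^esub> u))" for k j E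
  define C where "C k j = (SOME E. P k j E)" for k j
  have C: "P k j (C k j)" if kj: "k \<in> {1..n}" "j \<in> {1..<k}" for k j
  proof -
    obtain u where u: "u \<in> lin_span K A (?L k)" "x k \<otimes>\<^bsub>A\<^esub> x j = x j \<otimes>\<^bsub>A\<^esub> x k \<oplus>\<^bsub>A\<^esub> u"
      using ore_relation[OF ore kj] by (rule bexE)
    obtain E where "finite E" "E \<subseteq> carrier K"
      "\<forall>D. E \<subseteq> D \<longrightarrow> u \<in> lin_span (K\<lparr>carrier := D\<rparr>) A (?L k)"
      using coeff_subring[OF u(1)] by (elim exE conjE)
    then have "P k j E" unfolding P_def using u(2) by (intro conjI allI impI bexI[of _ u]) simp_all
    then show ?thesis unfolding C_def by (rule someI)
  qed
  define S where "S = (\<Union>k\<in>{1..n}. \<Union>j\<in>{1..<k}. C k j)"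
  have finC: "finite (C k j)" and subC: "C k j \<subseteq> carrier K" if "k \<in> {1..n}" "j \<in> {1..<k}" for k j
    using C[OF that] conjunct1[of "finite (C k j)"] conjunct1[of "C k j \<subseteq> carrier K"]
    unfolding P_def by simp_all
  have S: "finite S" unfolding S_def by (intro finite_UN_I finite_atLeastAtMost finite_atLeastLessThan finC)
  have SK: "S \<subseteq> carrier K" unfolding S_def by (intro UN_least subC)
  \<comment> \<open>Generated by finitely many coefficients, hence affine over the integers, and
    large enough for every commutation relation.\<close>
  define D where "D = generate_ring K S"
  have D: "subring D K" unfolding D_def by (rule K.generate_ring_is_subring[OF SK])
  interpret O: ore_order K A n x ?d D
  proof (rule ore_order.intro)
    show "field K" by (rule K.field_axioms)
    show "noncomm_algebra K A" by (rule alg)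
    show "x ` {1..n} \<subseteq> carrier A" by (rule iterated_ore_closed[OF ore])
    show "adjoin K A (x ` {1..n}) = carrier A" using ore by (simp add: iterated_ore_def)
    show "lin_indep K A ?e (sorted_words {1..n})" by (rule iterated_ore_indep[OF ore order_refl])
    show "1 \<le> ?d j" if "j \<in> {1..n}" for j by (rule ore_degrees_ge_1[OF that])
    show "subring D K" by (rule D)
    fix k j assume kj: "k \<in> {1..n}" "j \<in> {1..<k}"
    have "C k j \<subseteq> D" using kj generate_ring.incl[of _ S K] unfolding D_def S_def by blast
    then show "\<exists>u\<in>lin_span (K\<lparr>carrier := D\<rparr>) A (?L k). x k \<otimes>\<^bsub>A\<^esub> x j = x j \<otimes>\<^bsub>A\<^esub> x k \<oplus>\<^bsub>A\<^esub> u"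
      using C[OF kj] unfolding P_def by (elim conjE allE impE)
  qed
  have D_affine: "int_affine_subring D K" unfolding int_affine_subring_def using D S SK D_def by blast
  show ?thesis
    unfolding congenial_def Let_def ore_filtration_def
  proof (rule conjI[OF O.loc_finite_A], rule exI[of _ D], rule exI[of _ O.H],
      intro conjI allI impI D_affine O.orderA O.loc_finite_B O.order_gr O.strongly_noetherian_gr
        O.graded_components; elim conjE)
    fix I
    let ?Q = "O.R Quot I" and ?T = "base_change O.R O.B (scalars_via (\<lambda>d. I +>\<^bsub>O.R\<^esub> d) (O.R Quot I))"
    assume I: "ideal I O.R" "field ?Q" "finite (carrier ?Q)"
    \<comment> \<open>The homomorphism required for the fibre is the quotient map of
      \<open>D\<close> modulo \<open>I\<close>.\<close>
    have "affine_algebra ?Q ?T \<and> noetherian ?T \<and> PI_algebra ?Q ?T"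
      by (rule O.finite_field_fibre[OF I(2,3) ideal.rcos_ring_hom[OF I(1)]])
    then show "affine_algebra ?Q ?T" "noetherian ?T" "PI_algebra ?Q ?T" by blast+
  qed
qed

end
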